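(* Let $-\infty\le a<b\le\infty$ and let $f$ be a continuous real function on $(a,b)$ that is analytically continued to $\mathbb{C}^+$. Then the following conditions are equivalent: (i) $f$ is operator monotone on $(a,b)$; (ii) $\mathrm{Im}\, f(X)\ge0$ for every $X\in B(\mathcal{H})$ such that $\mathrm{Im}\, X>0$; (iii) $\mathrm{Im}\, f(A+iB)\ge0$ for every $n\in\mathbb{N}$, every $A\in\mathbb{M}_n^{sa}(a,b)$ and every $B\in\mathbb{M}_n^{sa}$ with $B>0$; (iv) $\mathrm{Im}\, f(z)\ge0$ for every $z\in\mathbb{C}$ with $\mathrm{Im}\, z>0$. Moreover, if $f$ is a non-constant operator monotone function on $(a,b)$, then $\mathrm{Im}\, f(X)>0$ for every $X\in B(\mathcal{H})$ with $\mathrm{Im}\, X>0$.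
   Context: $\mathcal{H}$ is a separable infinite-dimensional complex Hilbert space, $B(\mathcal{H})$ the bounded linear operators on it; $\mathbb{M}_n^{sa}$ the $n\times n$ Hermitian matrices, $\mathbb{M}_n^{sa}(a,b)$ those with all eigenvalues in $(a,b)$. For an operator $Y$, $\mathrm{Re}\,Y=(Y+Y^* )/2$, $\mathrm{Im}\,Y=(Y-Y^* )/(2i)$. For self-adjoint $Y$, $Y\ge0$ means positive semidefinite, and $Y>0$ means positive and invertible. A real function $f$ on $(a,b)$ is operator monotone if $A\le B$ implies $f(A)\le f(B)$ for all self-adjoint $A,B\in B(\mathcal{H})$ with spectra in $(a,b)$. "$f$ is analytically continued to $\mathbb{C}^+$" means: with $\mathbb{C}^+=\{z:\mathrm{Im}\,z>0\}$, there is a continuous function on $\mathbb{C}^+\cup(a,b)$, again denoted $f$, analytic in $\mathbb{C}^+$ and equal to the given $f$ on $(a,b)$. By the reflection principle, setting $f(\bar z)=\overline{f(z)}$, $f$ extends to an analytic function on $(\mathbb{C}\setminus\mathbb{R})\cup(a,b)$. For an operator or matrix $X$ with $\sigma(X)\subset(\mathbb{C}\setminus\mathbb{R})\cup(a,b)$, $f(X)=\frac1{2\pi i}\int_\Gamma f(\zeta)(\zeta I-X)^{-1}d\zeta$ is the analytic (holomorphic) functional calculus, $\Gamma$ being a piecewise smooth closed curve (possibly with several components) in $(\mathbb{C}\setminus\mathbb{R})\cup(a,b)$ surrounding $\sigma(X)$. If $\mathrm{Im}\,X>0$ then $\sigma(X)\subset\mathbb{C}^+$, so $f(X)$ is defined.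 *)

theory Defs
  imports
    "HOL-Analysis.Analysis"
    "HOL-Complex_Analysis.Complex_Analysis"
    "HOL-Computational_Algebra.Polynomial"
    "Jordan_Normal_Form.Schur_Decomposition"
    "Jordan_Normal_Form.Gauss_Jordan_Elimination"
    "Jordan_Normal_Form.Spectral_Radius"
begin

section \<open>Complex Hilbert spaces\<close>

text \<open>The inner product is linear in its first argument. The axiom \<open>cinner_self\<close> says that it is
  positive definite and induces the norm; completeness comes from the superclass.\<close>

class chilbert_space = banach +
  fixes scaleC :: "complex \<Rightarrow> 'a \<Rightarrow> 'a"
    and cinner :: "'a \<Rightarrow> 'a \<Rightarrow> complex"
  assumes scaleC_add_right: "scaleC c (x + y) = scaleC c x + scaleC c y"
    and scaleC_add_left: "scaleC (c + d) x = scaleC c x + scaleC d x"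
    and scaleC_scaleC: "scaleC c (scaleC d x) = scaleC (c * d) x"
    and scaleC_one: "scaleC 1 x = x"
    and scaleC_of_real: "scaleC (complex_of_real r) x = r *\<^sub>R x"
    and cinner_add_left: "cinner (x + y) z = cinner x z + cinner y z"
    and cinner_scaleC_left: "cinner (scaleC c x) y = c * cinner x y"
    and cinner_commute: "cinner x y = cnj (cinner y x)"
    and cinner_self: "cinner x x = complex_of_real ((norm x)\<^sup>2)"

global_interpretation complex_vector: vector_space "scaleC :: complex \<Rightarrow> 'a \<Rightarrow> 'a::chilbert_space"
  by unfold_locales
    (simp_all add: scaleC_add_right scaleC_add_left scaleC_scaleC scaleC_one)

lemma norm_scaleC: "norm (scaleC c x) = cmod c * norm (x::'a::chilbert_space)"
proof -
  have "complex_of_real ((norm (scaleC c x))\<^sup>2) = cinner (scaleC c x) (scaleC c x)"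
    by (simp only: cinner_self)
  also have "\<dots> = c * cnj c * cinner x x"
    by (metis cinner_commute cinner_scaleC_left complex_cnj_mult mult.assoc)
  also have "\<dots> = complex_of_real ((cmod c * norm x)\<^sup>2)"
    by (simp add: cinner_self complex_norm_square[symmetric] power_mult_distrib)
  finally have "(norm (scaleC c x))\<^sup>2 = (cmod c * norm x)\<^sup>2"
    by (simp only: of_real_eq_iff)
  then show ?thesis
    by (simp add: power2_eq_iff_nonneg)
qed

lemma bounded_linear_scaleC: "bounded_linear (scaleC c :: 'a \<Rightarrow> 'a::chilbert_space)"
proof (rule bounded_linear_intro)
  show "scaleC c (r *\<^sub>R x) = r *\<^sub>R scaleC c x" for r and x :: 'a
    by (simp add: scaleC_of_real[symmetric] scaleC_scaleC mult.commute)
  show "norm (scaleC c x) \<le> norm x * cmod c" for x :: 'a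
    by (simp add: norm_scaleC mult.commute)
qed (rule scaleC_add_right)

definition separable_infinite_dim :: "'a::chilbert_space itself \<Rightarrow> bool" where
  "separable_infinite_dim TYPE('a) \<longleftrightarrow>
     separable_space (euclidean :: 'a topology) \<and>
     \<not> (\<exists>S. finite S \<and> complex_vector.span S = (UNIV :: 'a set))"


section \<open>Bounded operators\<close>

text \<open>The type \<^typ>\<open>'a \<Rightarrow>\<^sub>L 'a\<close> consists of the bounded real-linear operators, with the operator
  norm; the bounded complex-linear ones form the following subset.\<close>

definition bounded_ops :: "('a::chilbert_space \<Rightarrow>\<^sub>L 'a) set" where
  "bounded_ops = {X. \<forall>c x. blinfun_apply X (scaleC c x) = scaleC c (blinfun_apply X x)}"

lift_definition op_scaleC :: "complex \<Rightarrow> ('a::chilbert_space \<Rightarrow>\<^sub>L 'a) \<Rightarrow> ('a \<Rightarrow>\<^sub>L 'a)"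
  is "\<lambda>c X x. scaleC c (X x)"
  by (rule bounded_linear_compose[OF bounded_linear_scaleC])

definition op_adjoint :: "('a::chilbert_space \<Rightarrow>\<^sub>L 'a) \<Rightarrow> ('a \<Rightarrow>\<^sub>L 'a)" where
  "op_adjoint X = (THE Y. Y \<in> bounded_ops \<and>
     (\<forall>x y. cinner (blinfun_apply X x) y = cinner x (blinfun_apply Y y)))"

definition op_selfadjoint :: "('a::chilbert_space \<Rightarrow>\<^sub>L 'a) \<Rightarrow> bool" where
  "op_selfadjoint X \<longleftrightarrow> X \<in> bounded_ops \<and> op_adjoint X = X"

definition op_Im :: "('a::chilbert_space \<Rightarrow>\<^sub>L 'a) \<Rightarrow> ('a \<Rightarrow>\<^sub>L 'a)" where
  "op_Im X = op_scaleC (1 / (2 * \<i>)) (X - op_adjoint X)"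

definition op_inverse_of :: "('a::chilbert_space \<Rightarrow>\<^sub>L 'a) \<Rightarrow> ('a \<Rightarrow>\<^sub>L 'a) \<Rightarrow> bool" where
  "op_inverse_of X Y \<longleftrightarrow>
     Y \<in> bounded_ops \<and> X o\<^sub>L Y = id_blinfun \<and> Y o\<^sub>L X = id_blinfun"

definition op_invertible :: "('a::chilbert_space \<Rightarrow>\<^sub>L 'a) \<Rightarrow> bool" where
  "op_invertible X \<longleftrightarrow> (\<exists>Y. op_inverse_of X Y)"

definition op_inverse :: "('a::chilbert_space \<Rightarrow>\<^sub>L 'a) \<Rightarrow> ('a \<Rightarrow>\<^sub>L 'a)" where
  "op_inverse X = (THE Y. op_inverse_of X Y)"

definition op_psd :: "('a::chilbert_space \<Rightarrow>\<^sub>L 'a) \<Rightarrow> bool" where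
  "op_psd X \<longleftrightarrow> op_selfadjoint X \<and> (\<forall>x. 0 \<le> Re (cinner (blinfun_apply X x) x))"

definition op_pos :: "('a::chilbert_space \<Rightarrow>\<^sub>L 'a) \<Rightarrow> bool" where
  "op_pos X \<longleftrightarrow> op_psd X \<and> op_invertible X"

definition op_spectrum :: "('a::chilbert_space \<Rightarrow>\<^sub>L 'a) \<Rightarrow> complex set" where
  "op_spectrum X = {z. \<not> op_invertible (op_scaleC z id_blinfun - X)}"


section \<open>Continuous functional calculus and operator monotonicity\<close>

definition op_poly :: "real poly \<Rightarrow> ('a::chilbert_space \<Rightarrow>\<^sub>L 'a) \<Rightarrow> ('a \<Rightarrow>\<^sub>L 'a)" where
  "op_poly p A = (\<Sum>i\<le>degree p. coeff p i *\<^sub>R (((\<lambda>Y. A o\<^sub>L Y) ^^ i) id_blinfun))"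

text \<open>For self-adjoint \<open>A\<close> and \<open>f\<close> continuous on the spectrum of \<open>A\<close>, \<open>f(A)\<close> is the operator-norm
  limit of \<open>p\<^sub>k(A)\<close> for any real polynomials \<open>p\<^sub>k\<close> converging to \<open>f\<close> uniformly on the spectrum.\<close>

definition cont_calc :: "(real \<Rightarrow> real) \<Rightarrow> ('a::chilbert_space \<Rightarrow>\<^sub>L 'a) \<Rightarrow> ('a \<Rightarrow>\<^sub>L 'a)" where
  "cont_calc f A = (THE Y. \<forall>p :: nat \<Rightarrow> real poly.
     uniform_limit {x. complex_of_real x \<in> op_spectrum A} (\<lambda>k. poly (p k)) f sequentially \<longrightarrow>
     (\<lambda>k. op_poly (p k) A) \<longlonglongrightarrow> Y)"

text \<open>Since \<open>f(A)\<close> is given by the continuous calculus, this is meaningful only for \<open>f\<close>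
  continuous on \<open>S\<close>.\<close>

definition op_monotone_on :: "'a::chilbert_space itself \<Rightarrow> real set \<Rightarrow> (real \<Rightarrow> real) \<Rightarrow> bool" where
  "op_monotone_on TYPE('a) S f \<longleftrightarrow>
     (\<forall>A B :: 'a \<Rightarrow>\<^sub>L 'a.
        op_selfadjoint A \<and> op_spectrum A \<subseteq> complex_of_real ` S \<and>
        op_selfadjoint B \<and> op_spectrum B \<subseteq> complex_of_real ` S \<and>
        op_psd (B - A) \<longrightarrow>
        op_psd (cont_calc f B - cont_calc f A))"


section \<open>Holomorphic functional calculus\<close>

definition upper_half_plane :: "complex set" where
  "upper_half_plane = {z. 0 < Im z}"

definition slit_domain :: "real set \<Rightarrow> complex set" where
  "slit_domain S = (UNIV - \<real>) \<union> complex_of_real ` S"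

text \<open>Extension to the lower half-plane by \<open>f(cnj z) = cnj (f z)\<close>.\<close>

definition reflect_ext :: "(complex \<Rightarrow> complex) \<Rightarrow> complex \<Rightarrow> complex" where
  "reflect_ext F z = (if 0 \<le> Im z then F z else cnj (F (cnj z)))"

text \<open>A cycle is given by the list of its closed components; it surrounds \<open>K\<close> inside \<open>D\<close> if its
  total winding number is 1 about every point of \<open>K\<close> and 0 about every point outside \<open>D\<close>.\<close>

definition surrounding_cycle ::
  "complex set \<Rightarrow> complex set \<Rightarrow> (real \<Rightarrow> complex) list \<Rightarrow> bool" where
  "surrounding_cycle D K \<Gamma> \<longleftrightarrow>
     (\<forall>\<gamma>\<in>set \<Gamma>. valid_path \<gamma> \<and> pathfinish \<gamma> = pathstart \<gamma> \<and> path_image \<gamma> \<subseteq> D - K) \<and>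
     (\<forall>z\<in>K. (\<Sum>\<gamma>\<leftarrow>\<Gamma>. winding_number \<gamma> z) = 1) \<and>
     (\<forall>z. z \<notin> D \<longrightarrow> (\<Sum>\<gamma>\<leftarrow>\<Gamma>. winding_number \<gamma> z) = 0)"

text \<open>The library's contour integral is restricted to complex-valued integrands; this is the same
  formula for operator-valued ones, the integral being taken in the operator norm.\<close>

definition op_contour_integral ::
  "(real \<Rightarrow> complex) \<Rightarrow> (complex \<Rightarrow> 'a::chilbert_space \<Rightarrow>\<^sub>L 'a) \<Rightarrow> ('a \<Rightarrow>\<^sub>L 'a)" where
  "op_contour_integral \<gamma> G =
     integral {0..1} (\<lambda>t. op_scaleC (vector_derivative \<gamma> (at t within {0..1})) (G (\<gamma> t)))"

text \<open>For \<open>f\<close> holomorphic on \<open>D\<close> and spectrum inside \<open>D\<close>, the operators and matrices defined below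
  do not depend on the chosen cycle, by Cauchy's theorem.\<close>

definition op_hol_calc ::
  "complex set \<Rightarrow> (complex \<Rightarrow> complex) \<Rightarrow> ('a::chilbert_space \<Rightarrow>\<^sub>L 'a) \<Rightarrow> ('a \<Rightarrow>\<^sub>L 'a)" where
  "op_hol_calc D f X =
     (let \<Gamma> = (SOME \<Gamma>. surrounding_cycle D (op_spectrum X) \<Gamma>) in
      op_scaleC (1 / (2 * of_real pi * \<i>))
        (\<Sum>\<gamma>\<leftarrow>\<Gamma>. op_contour_integral \<gamma>
           (\<lambda>\<zeta>. op_scaleC (f \<zeta>) (op_inverse (op_scaleC \<zeta> id_blinfun - X)))))"

definition mat_hol_calc ::
  "complex set \<Rightarrow> (complex \<Rightarrow> complex) \<Rightarrow> complex Matrix.mat \<Rightarrow> complex Matrix.mat" where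
  "mat_hol_calc D f X =
     (let n = dim_row X; \<Gamma> = (SOME \<Gamma>. surrounding_cycle D (spectrum X) \<Gamma>) in
      Matrix.mat n n (\<lambda>(i, j). 1 / (2 * of_real pi * \<i>) *
        (\<Sum>\<gamma>\<leftarrow>\<Gamma>. contour_integral \<gamma>
           (\<lambda>\<zeta>. f \<zeta> * (the (mat_inverse (\<zeta> \<cdot>\<^sub>m 1\<^sub>m n - X)) $$ (i, j))))))"


section \<open>Hermitian matrices\<close>

definition herm_mats :: "nat \<Rightarrow> complex Matrix.mat set" where
  "herm_mats n = {A \<in> carrier_mat n n. mat_adjoint A = A}"

definition herm_mats_in :: "nat \<Rightarrow> real set \<Rightarrow> complex Matrix.mat set" where
  "herm_mats_in n S = {A \<in> herm_mats n. spectrum A \<subseteq> complex_of_real ` S}"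

definition mat_Im :: "complex Matrix.mat \<Rightarrow> complex Matrix.mat" where
  "mat_Im X = (1 / (2 * \<i>)) \<cdot>\<^sub>m (X - mat_adjoint X)"

definition mat_psd :: "complex Matrix.mat \<Rightarrow> bool" where
  "mat_psd A \<longleftrightarrow> A \<in> herm_mats (dim_row A) \<and>
     (\<forall>v\<in>carrier_vec (dim_row A). 0 \<le> Re ((A *\<^sub>v v) \<bullet>c v))"

definition mat_pos :: "complex Matrix.mat \<Rightarrow> bool" where
  "mat_pos A \<longleftrightarrow> mat_psd A \<and> invertible_mat A"

end

theory Submission
  imports Defs
begin

text \<open>An operator with \<open>Im X \<ge> \<delta> > 0\<close> satisfies \<open>\<parallel>X - iR\<parallel> < R\<close> for all large \<open>R\<close>, and a self-adjoint
  operator with \<open>m \<le> A \<le> M\<close> satisfies \<open>\<parallel>A - (m + M)/2\<parallel> \<le> (M - m)/2\<close>. In both cases the spectrum lies in a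
  disc inside the slit domain, and the holomorphic calculus is a power series in the operator; that
  the cycle does not matter follows from the resolvent identity and Liouville's theorem. On such a
  disc the Poisson formula bounds \<open>Im f(X)\<close> from below by an average of the values of \<open>Im f\<close> with a
  positive operator kernel, which gives (iv) \<open>\<Longrightarrow>\<close> (ii), the strict version and, after embedding matrices into
  the Hilbert space, (iii); differentiating along a segment gives (iv) \<open>\<Longrightarrow>\<close> (i). Scalar operators give
  (ii) \<open>\<Longrightarrow>\<close> (iv).

  Conversely, (i) or (iii), applied to rank-one perturbations of diagonal operators, shows that the
  Loewner matrices \<open>(f x\<^sub>i - f x\<^sub>j) / (x\<^sub>i - x\<^sub>j)\<close> at nodes close to a point \<open>c\<close> are positive semidefinite. The map
  \<open>u \<mapsto> c + 2 r u / (1 + u\<^sup>2)\<close> from the unit disc into the slit domain turns them into a positive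
  semidefinite kernel on a real interval around \<open>0\<close>. Evaluation at a point of the disc is a limit of
  combinations of evaluations at real nodes tending to \<open>0\<close>, so that the kernel is positive
  semidefinite on the disc, and its diagonal at non-real points is (iv).\<close>


section \<open>Operators on a complex Hilbert space\<close>

text \<open>Both holomorphic calculi fix an arbitrary surrounding cycle by \<open>SOME\<close>, so
  no value is accessible before independence of the cycle is known. Afterwards one operator may be
  expanded in any disc of the domain whose radius exceeds its distance from the centre, so that
  estimates from a disc in the upper half-plane apply to the Taylor series at a real point. A matrix
  is extended by one of its own eigenvalues on the complement, so that the spectrum, and with it the
  chosen cycle, stays the same.

  Towards (iv) the continuation is already given, and only positivity has to travel from the reals
  into the half-plane. The map \<open>2 u / (1 + u^2)\<close> serves this by two properties: it
  commutes with conjugation, so that the kernel at \<open>(u, cnj u)\<close> is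
  \<open>Im F(z)\<close> up to a positive factor, and its difference quotient contains
  \<open>1 - u v\<close>, so that the Loewner kernel turns into
  \<open>slope G u v / (1 - u v)\<close>, a double power series on the whole disc. In a weighted sup
  norm of coefficient sequences, evaluation at any point of the disc is then a limit of evaluations
  at real nodes near 0.\<close>

lemma cinner_add_right: "cinner (x::'a::chilbert_space) (y + z) = cinner x y + cinner x z"
  by (metis cinner_add_left cinner_commute complex_cnj_add)

lemma cinner_scaleC_right: "cinner (x::'a::chilbert_space) (scaleC c y) = cnj c * cinner x y"
  by (metis cinner_commute cinner_scaleC_left complex_cnj_mult)

lemma cinner_scaleR_left: "cinner (r *\<^sub>R x) (y::'a::chilbert_space) = of_real r * cinner x y"
  by (metis cinner_scaleC_left scaleC_of_real)

lemma cinner_scaleR_right: "cinner x (r *\<^sub>R (y::'a::chilbert_space)) = of_real r * cinner x y"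
  by (metis cinner_scaleC_right complex_cnj_complex_of_real scaleC_of_real)

lemma cinner_zero [simp]: "cinner 0 (y::'a::chilbert_space) = 0" "cinner (y::'a::chilbert_space) 0 = 0"
  using cinner_scaleR_left[of 0 0 y] cinner_scaleR_right[of y 0 0] by auto

lemma cinner_minus: "cinner (- x) (y::'a::chilbert_space) = - cinner x y"
  "cinner x (- y) = - cinner x (y::'a::chilbert_space)"
  using cinner_scaleR_left[of "-1" x y] cinner_scaleR_right[of x "-1" y] by auto

lemma cinner_diff: "cinner (x - z) (y::'a::chilbert_space) = cinner x y - cinner z y"
  "cinner x (y - w) = cinner x y - cinner x (w::'a::chilbert_space)"
  by (metis cinner_add_left cinner_minus(1) diff_conv_add_uminus,
      metis cinner_add_right cinner_minus(2) diff_conv_add_uminus)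

lemmas cinner_simps = cinner_add_left cinner_add_right cinner_scaleC_left cinner_scaleC_right
  cinner_scaleR_left cinner_scaleR_right cinner_minus cinner_diff

lemma cinner_sum_left: "cinner (\<Sum>i\<in>I. f i) (y::'a::chilbert_space) = (\<Sum>i\<in>I. cinner (f i) y)"
  by (induction I rule: infinite_finite_induct) (auto simp: cinner_simps)

lemma cinner_sum_right: "cinner (y::'a::chilbert_space) (\<Sum>i\<in>I. f i) = (\<Sum>i\<in>I. cinner y (f i))"
  by (induction I rule: infinite_finite_induct) (auto simp: cinner_simps)

lemma Re_cinner_commute: "Re (cinner x (y::'a::chilbert_space)) = Re (cinner y x)"
  using cinner_commute[of x y] by simp

lemma norm_add_square:
  "(norm (x + y :: 'a::chilbert_space))\<^sup>2 = (norm x)\<^sup>2 + 2 * Re (cinner x y) + (norm y)\<^sup>2"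
proof -
  have "(norm (x+y))\<^sup>2 = Re (cinner (x+y) (x+y))" by (simp only: cinner_self Re_complex_of_real)
  also have "\<dots> = (norm x)\<^sup>2 + 2 * Re (cinner x y) + (norm y)\<^sup>2"
    unfolding cinner_add_left cinner_add_right
    by (simp add: cinner_self Re_cinner_commute[of y x] flip: of_real_power)
  finally show ?thesis .
qed

lemma norm_diff_square:
  "(norm (x - y :: 'a::chilbert_space))\<^sup>2 = (norm x)\<^sup>2 - 2 * Re (cinner x y) + (norm y)\<^sup>2"
  using norm_add_square[of x "-y"] by (simp add: cinner_simps)

lemma cinner_Cauchy_Schwarz: "cmod (cinner x y) \<le> norm x * norm (y::'a::chilbert_space)"
proof (cases "y = 0")
  case False
  define c where "c = cinner x y / of_real ((norm y)\<^sup>2)"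
  have ny: "norm y > 0" using False by simp
  have "0 \<le> (norm (x - scaleC c y))\<^sup>2" by simp
  also have "\<dots> = (norm x)\<^sup>2 - 2 * Re (cnj c * cinner x y) + (cmod c * norm y)\<^sup>2"
    by (simp add: norm_diff_square cinner_simps norm_scaleC)
  also have "cnj c * cinner x y = of_real ((cmod (cinner x y))\<^sup>2 / (norm y)\<^sup>2)"
    by (simp add: c_def complex_norm_square mult.commute flip: of_real_power)
  also have "(cmod c * norm y)\<^sup>2 = (cmod (cinner x y))\<^sup>2 / (norm y)\<^sup>2"
    using ny by (simp add: c_def norm_divide power_mult_distrib power_divide norm_power) (simp add: field_simps eval_nat_numeral)
  finally have "(cmod (cinner x y))\<^sup>2 / (norm y)\<^sup>2 \<le> (norm x)\<^sup>2" by simp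
  then have "(cmod (cinner x y))\<^sup>2 \<le> (norm x * norm y)\<^sup>2"
    using ny by (simp add: field_simps power_mult_distrib)
  then show ?thesis by (rule power2_le_imp_le) simp
qed simp

lemma bounded_linear_cinner_left: "bounded_linear (\<lambda>x::'a::chilbert_space. cinner x y)"
  by (rule bounded_linear_intro[where K="norm y"])
     (auto simp: cinner_simps scaleR_conv_of_real cinner_Cauchy_Schwarz)

lemma cinner_eqI: "(\<And>y. cinner x y = cinner x' y) \<Longrightarrow> x = (x'::'a::chilbert_space)"
proof -
  assume "\<And>y. cinner x y = cinner x' y"
  then have "cinner (x - x') (x - x') = 0" by (simp add: cinner_simps)
  then show ?thesis by (simp add: cinner_self)
qed

lemma scaleC_zero [simp]: "scaleC 0 (x::'a::chilbert_space) = 0" "scaleC c 0 = (0::'a::chilbert_space)"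
  by (simp_all)

lemma bounded_bilinear_scaleC: "bounded_bilinear (scaleC :: complex \<Rightarrow> 'a \<Rightarrow> 'a::chilbert_space)"
proof
  show "scaleC (r *\<^sub>R a) b = r *\<^sub>R scaleC a b" for r a and b :: 'a
    by (simp add: scaleC_scaleC scaleR_conv_of_real flip: scaleC_of_real)
  show "scaleC a (r *\<^sub>R b) = r *\<^sub>R scaleC a b" for r a and b :: 'a
    by (simp add: scaleC_scaleC scaleR_conv_of_real mult.commute flip: scaleC_of_real)
  show "\<exists>K. \<forall>a (b::'a). norm (scaleC a b) \<le> norm a * norm b * K"
    by (rule exI[of _ 1]) (simp add: norm_scaleC)
qed (simp_all add: scaleC_add_left scaleC_add_right)

text \<open>If \<open>\<phi>\<close> is the inner product with \<open>w\<close>, then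
  \<open>J y = |y - w|^2 - |w|^2\<close>, so the representing vector is found as the minimiser of
  \<open>J\<close>; the parallelogram law makes a minimising sequence Cauchy and completeness gives
  the limit.\<close>

theorem riesz_representation:
  fixes \<phi> :: "'a::chilbert_space \<Rightarrow> complex"
  assumes bl: "bounded_linear \<phi>" and sc: "\<And>c x. \<phi> (scaleC c x) = c * \<phi> x"
  shows "\<exists>y. \<forall>x. \<phi> x = cinner x y"
proof -
  interpret bounded_linear \<phi> by fact
  define J where "J y = (norm y)\<^sup>2 - 2 * Re (\<phi> y)" for y
  obtain K where K: "\<And>x. cmod (\<phi> x) \<le> norm x * K" "K > 0" using pos_bounded by blast
  have Jlow: "- (K^2) \<le> J y" for y
  proof -
    have "Re (\<phi> y) \<le> norm y * K" using K(1)[of y] complex_Re_le_cmod[of "\<phi> y"] by linarith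
    moreover have "0 \<le> (norm y - K)^2" by simp
    ultimately show ?thesis unfolding J_def by (simp add: power2_diff)
  qed
  define m where "m = Inf (range J)"
  have bdd: "bdd_below (range J)" using Jlow by (auto intro!: bdd_belowI)
  have mle: "m \<le> J y" for y unfolding m_def by (rule cInf_lower[OF _ bdd]) simp
  have "\<exists>y. J y < m + 1 / real (Suc n)" for n
    using cInf_lessD[of "range J" "m + 1 / real (Suc n)"] unfolding m_def[symmetric] by auto
  then obtain y where y: "\<And>n. J (y n) < m + 1 / real (Suc n)" by metis
  \<comment> \<open>The parallelogram law; the linear part of \<open>J\<close> cancels because
    \<open>\<phi>\<close> is additive.\<close>
  have par: "(norm (u - v))\<^sup>2 = 2 * (J u + J v - 2 * J ((1/2) *\<^sub>R (u + v)))" for u v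
    using norm_add_square[of u v] norm_diff_square[of u v]
    by (simp add: J_def scaleR add power_divide) (simp add: field_simps)
  have cau: "(norm (y k - y l))\<^sup>2 \<le> 2 * (1 / real (Suc k) + 1 / real (Suc l))" for k l
    using par[of "y k" "y l"] y[of k] y[of l] mle[of "(1/2) *\<^sub>R (y k + y l)"] by argo
  have "Cauchy y"
  proof (rule metric_CauchyI)
    fix e :: real assume e: "e > 0"
    obtain N where N: "inverse (real (Suc N)) < e^2 / 4" using reals_Archimedean[of "e^2/4"] e by auto
    have "dist (y k) (y l) < e" if "k \<ge> N" "l \<ge> N" for k l
    proof -
      have "1 / real (Suc k) \<le> 1 / real (Suc N)" "1 / real (Suc l) \<le> 1 / real (Suc N)"
        using that by (auto intro!: divide_left_mono)
      then have "(norm (y k - y l))\<^sup>2 < e^2"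
        using cau[of k l] N by (simp add: inverse_eq_divide)
      then show ?thesis using e by (simp add: dist_norm power2_less_imp_less)
    qed
    then show "\<exists>M. \<forall>m\<ge>M. \<forall>n\<ge>M. dist (y m) (y n) < e" by blast
  qed
  then obtain w where w: "y \<longlonglongrightarrow> w" using Cauchy_convergent_iff convergent_def by blast
  have "(\<lambda>n. J (y n)) \<longlonglongrightarrow> J w" unfolding J_def by (intro tendsto_intros w tendsto)
  moreover have "(\<lambda>n. m + 1 / real (Suc n)) \<longlonglongrightarrow> m + 0"
    by (intro tendsto_intros) (use LIMSEQ_inverse_real_of_nat in \<open>simp add: inverse_eq_divide\<close>)
  ultimately have "J w \<le> m + 0" by (rule LIMSEQ_le) (use y less_imp_le in blast)
  with mle have Jmin: "J w \<le> J u" for u by (metis add.right_neutral order_trans)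
  have re: "Re (cinner x w) = Re (\<phi> x)" for x
  proof -
    define q where "q = Re (cinner x w) - Re (\<phi> x)"
    have quad: "0 \<le> t^2 * (norm x)^2 + 2 * t * q" for t
      using Jmin[of "w + t *\<^sub>R x"] norm_add_square[of w "t *\<^sub>R x"]
      by (simp add: J_def q_def scaleR add cinner_simps Re_cinner_commute[of w x] power_mult_distrib algebra_simps)
    have "q = 0"
    proof (rule ccontr)
      assume q0: "q \<noteq> 0"
      \<comment> \<open>At \<open>t = -q/n\<close> the quadratic of \<open>quad\<close> is negative
        unless \<open>q = 0\<close>; adding 1 keeps the denominator positive when
        \<open>x = 0\<close>.\<close>
      define n where "n = (norm x)^2 + 1"
      have n: "n > 0" unfolding n_def by (simp add: add_nonneg_pos)
      have "0 \<le> (q/n)^2 * (norm x)^2 - 2 * (q/n) * q" using quad[of "-q/n"] by simp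
      also have "\<dots> = (q^2/n) * ((norm x)^2 / n - 2)"
        using n by (simp add: field_simps eval_nat_numeral)
      also have "\<dots> < 0"
      proof (rule mult_pos_neg)
        show "0 < q^2/n" using q0 n by simp
        show "(norm x)^2 / n - 2 < 0" using n by (simp add: n_def field_simps add_pos_nonneg)
      qed
      finally show False by simp
    qed
    then show ?thesis by (simp add: q_def)
  qed
  \<comment> \<open>Testing with \<open>i x\<close> gives the imaginary parts, by complex
    linearity.\<close>
  have "\<phi> x = cinner x w" for x
    using re[of x] re[of "scaleC \<i> x"] by (simp add: complex_eq_iff cinner_simps sc)
  then show ?thesis by blast
qed

section \<open>Complex-linear bounded operators, adjoints and imaginary parts\<close>

lemmas blinfun_simps = blinfun.bilinear_simps op_scaleC.rep_eq id_blinfun.rep_eq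
  blinfun_apply_blinfun_compose

lemma bounded_opsD: "X \<in> bounded_ops \<Longrightarrow> blinfun_apply X (scaleC c x) = scaleC c (blinfun_apply X x)"
  by (simp add: bounded_ops_def)

lemma scaleR_scaleC: "r *\<^sub>R scaleC c x = scaleC c (r *\<^sub>R (x::'a::chilbert_space))"
  by (simp add: scaleC_scaleC mult.commute flip: scaleC_of_real)

lemma scaleC_diff_right: "scaleC c (x - y) = scaleC c x - scaleC c (y::'a::chilbert_space)"
  by (metis add_diff_cancel_right' diff_add_cancel scaleC_add_right)

lemma bounded_ops_intros [intro, simp]:
  "id_blinfun \<in> bounded_ops" "0 \<in> bounded_ops"
  "X \<in> bounded_ops \<Longrightarrow> Y \<in> bounded_ops \<Longrightarrow> X + Y \<in> bounded_ops"
  "X \<in> bounded_ops \<Longrightarrow> Y \<in> bounded_ops \<Longrightarrow> X - Y \<in> bounded_ops"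
  "X \<in> bounded_ops \<Longrightarrow> Y \<in> bounded_ops \<Longrightarrow> X o\<^sub>L Y \<in> bounded_ops"
  "X \<in> bounded_ops \<Longrightarrow> op_scaleC c X \<in> bounded_ops"
  "X \<in> bounded_ops \<Longrightarrow> r *\<^sub>R X \<in> bounded_ops"
  by (auto simp: bounded_ops_def blinfun_simps scaleC_add_right scaleC_diff_right scaleC_scaleC
      mult.commute scaleR_scaleC)

lemma bounded_ops_sum [intro, simp]:
  "(\<And>i. i \<in> I \<Longrightarrow> X i \<in> bounded_ops) \<Longrightarrow> (\<Sum>i\<in>I. X i) \<in> bounded_ops"
  by (induction I rule: infinite_finite_induct) auto

lemma bounded_ops_limit:
  assumes "\<And>n. X n \<in> bounded_ops" "X \<longlonglongrightarrow> Y"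
  shows "Y \<in> bounded_ops"
proof -
  have ap: "(\<lambda>n. blinfun_apply (X n) x) \<longlonglongrightarrow> blinfun_apply Y x" for x
    using assms(2) by (intro tendsto_intros)
  have "blinfun_apply Y (scaleC c x) = scaleC c (blinfun_apply Y x)" for c x
  proof (rule LIMSEQ_unique[OF ap])
    show "(\<lambda>n. blinfun_apply (X n) (scaleC c x)) \<longlonglongrightarrow> scaleC c (blinfun_apply Y x)"
      unfolding bounded_opsD[OF assms(1)]
      by (rule bounded_linear.tendsto[OF bounded_linear_scaleC ap])
  qed
  then show ?thesis by (simp add: bounded_ops_def)
qed

lemma norm_op_scaleC: "norm (op_scaleC c X) \<le> cmod c * norm X"
  by (rule norm_blinfun_bound)
     (auto simp: blinfun_simps norm_scaleC mult.assoc intro!: mult_left_mono norm_blinfun)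

lemma bounded_bilinear_op_scaleC:
  "bounded_bilinear (op_scaleC :: complex \<Rightarrow> ('a::chilbert_space \<Rightarrow>\<^sub>L 'a) \<Rightarrow> _)"
proof
  show "\<exists>K. \<forall>a (b::'a \<Rightarrow>\<^sub>L 'a). norm (op_scaleC a b) \<le> norm a * norm b * K"
    by (rule exI[of _ 1]) (simp add: norm_op_scaleC)
  interpret bounded_bilinear "scaleC :: complex \<Rightarrow> 'a \<Rightarrow> 'a" by (rule bounded_bilinear_scaleC)
  show "op_scaleC (a + a') b = op_scaleC a b + op_scaleC a' b" for a a' and b :: "'a \<Rightarrow>\<^sub>L 'a"
    by (rule blinfun_eqI) (simp add: blinfun_simps add_left)
  show "op_scaleC a (b + b') = op_scaleC a b + op_scaleC a b'" for a and b b' :: "'a \<Rightarrow>\<^sub>L 'a"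
    by (rule blinfun_eqI) (simp add: blinfun_simps add_right)
  show "op_scaleC (r *\<^sub>R a) b = r *\<^sub>R op_scaleC a b" for r a and b :: "'a \<Rightarrow>\<^sub>L 'a"
    by (rule blinfun_eqI) (simp add: blinfun_simps scaleR_left)
  show "op_scaleC a (r *\<^sub>R b) = r *\<^sub>R op_scaleC a b" for r a and b :: "'a \<Rightarrow>\<^sub>L 'a"
    by (rule blinfun_eqI) (simp add: blinfun_simps scaleR_right)
qed

text \<open>Riesz representation for each \<open>y\<close> separately; boundedness of the resulting
  map follows from \<open>|Y x|^2 = <x, X (Y x)>\<close> after cancelling one factor.\<close>

lemma op_adjoint_ex:
  assumes X: "X \<in> bounded_ops"
  shows "\<exists>Y\<in>bounded_ops. \<forall>x y. cinner (blinfun_apply X x) y = cinner x (blinfun_apply Y y)"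
proof -
  have "\<exists>w. \<forall>x. cinner (blinfun_apply X x) y = cinner x w" for y
  proof (rule riesz_representation)
    show "bounded_linear (\<lambda>x. cinner (blinfun_apply X x) y)"
      by (rule bounded_linear_compose[OF bounded_linear_cinner_left blinfun.bounded_linear_right])
  qed (simp add: bounded_opsD[OF X] cinner_simps)
  then obtain Y where Y: "\<And>x y. cinner (blinfun_apply X x) y = cinner x (Y y)" by metis
  have Y': "cinner (Y y) x = cinner y (blinfun_apply X x)" for x y
    by (metis Y cinner_commute)
  have bl: "bounded_linear Y"
  proof (rule bounded_linear_intro[where K="norm X"])
    show "Y (x + y) = Y x + Y y" for x y by (rule cinner_eqI) (simp add: Y' cinner_simps)
    show "Y (r *\<^sub>R x) = r *\<^sub>R Y x" for r x by (rule cinner_eqI) (simp add: Y' cinner_simps)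
    show "norm (Y x) \<le> norm x * norm X" for x
    proof (cases "Y x = 0")
      case False
      have "norm (Y x) * norm (Y x) = cmod (cinner (Y x) (Y x))"
        by (simp add: cinner_self power2_eq_square norm_mult)
      also have "\<dots> = cmod (cinner x (blinfun_apply X (Y x)))" by (simp add: Y')
      also have "\<dots> \<le> norm x * (norm X * norm (Y x))"
        by (rule order_trans[OF cinner_Cauchy_Schwarz]) (intro mult_left_mono norm_blinfun norm_ge_zero)
      finally have "norm (Y x) * norm (Y x) \<le> (norm x * norm X) * norm (Y x)" by (simp add: mult.assoc)
      then show ?thesis using False by (simp add: mult_le_cancel_right)
    qed simp
  qed
  have app: "blinfun_apply (Blinfun Y) = Y" by (rule bounded_linear_Blinfun_apply[OF bl])
  have "Y (scaleC c x) = scaleC c (Y x)" for c x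
    by (rule cinner_eqI) (simp add: Y' cinner_simps)
  then have "Blinfun Y \<in> bounded_ops" by (simp add: bounded_ops_def app)
  then show ?thesis using Y app by (intro bexI[of _ "Blinfun Y"]) auto
qed

lemma op_adjoint_unique:
  assumes "\<And>x y. cinner (blinfun_apply X x) y = cinner x (blinfun_apply Y y)"
    "\<And>x y. cinner (blinfun_apply X x) y = cinner x (blinfun_apply Z y)"
  shows "Y = Z"
proof (rule blinfun_eqI, rule cinner_eqI)
  fix x y
  show "cinner (blinfun_apply Y x) y = cinner (blinfun_apply Z x) y"
    unfolding cinner_commute[of _ y] assms[symmetric] by (rule refl)
qed

lemma op_adjoint_eqI:
  assumes "Y \<in> bounded_ops" "\<And>x y. cinner (blinfun_apply X x) y = cinner x (blinfun_apply Y y)"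
  shows "op_adjoint X = Y"
  unfolding op_adjoint_def using assms op_adjoint_unique[of X _ Y] by (intro the_equality) auto

lemma op_adjoint:
  assumes "X \<in> bounded_ops"
  shows "op_adjoint X \<in> bounded_ops"
    "cinner (blinfun_apply X x) y = cinner x (blinfun_apply (op_adjoint X) y)"
proof -
  obtain Y where "Y \<in> bounded_ops" "\<And>x y. cinner (blinfun_apply X x) y = cinner x (blinfun_apply Y y)"
    using op_adjoint_ex[OF assms] by blast
  then show "op_adjoint X \<in> bounded_ops"
    "cinner (blinfun_apply X x) y = cinner x (blinfun_apply (op_adjoint X) y)"
    using op_adjoint_eqI[of Y X] by auto
qed

lemma op_selfadjointI:
  assumes "X \<in> bounded_ops" "\<And>x y. cinner (blinfun_apply X x) y = cinner x (blinfun_apply X y)"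
  shows "op_selfadjoint X"
  using op_adjoint_eqI[OF assms] assms(1) by (simp add: op_selfadjoint_def)

lemma op_selfadjointD:
  assumes "op_selfadjoint X"
  shows "X \<in> bounded_ops" "cinner (blinfun_apply X x) y = cinner x (blinfun_apply X y)"
  using op_adjoint(2)[of X x y] assms by (auto simp: op_selfadjoint_def)

text \<open>Polarisation over the complex field: the form at \<open>x + y\<close> compares the
  imaginary parts of the off-diagonal values, and \<open>i x\<close> in place of \<open>x\<close>
  compares the real parts. Self-adjointness of sums, shifts and series is later read off from this
  criterion.\<close>

lemma op_selfadjoint_iff:
  "op_selfadjoint X \<longleftrightarrow> X \<in> bounded_ops \<and> (\<forall>x. Im (cinner (blinfun_apply X x) x) = 0)"
proof
  assume "op_selfadjoint X"
  then show "X \<in> bounded_ops \<and> (\<forall>x. Im (cinner (blinfun_apply X x) x) = 0)"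
    using op_selfadjointD[of X] cinner_commute
    by (metis Reals_cnj_iff complex_is_Real_iff)
next
  assume a: "X \<in> bounded_ops \<and> (\<forall>x. Im (cinner (blinfun_apply X x) x) = 0)"
  then have im: "Im (cinner (blinfun_apply X x) x) = 0" for x by blast
  have s: "Im (cinner (blinfun_apply X x) y) = - Im (cinner (blinfun_apply X y) x)" for x y
    using im[of "x + y"] im[of x] im[of y] by (simp add: blinfun_simps cinner_simps)
  have r: "Re (cinner (blinfun_apply X x) y) = Re (cinner (blinfun_apply X y) x)" for x y
    using s[of "scaleC \<i> x" y] by (simp add: cinner_simps bounded_opsD a)
  have "cinner (blinfun_apply X x) y = cnj (cinner (blinfun_apply X y) x)" for x y
    by (rule complex_eqI) (simp_all only: complex_cnj s[of x y] r[of x y] cnj.sel)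
  then have "cinner (blinfun_apply X x) y = cinner x (blinfun_apply X y)" for x y
    by (rule trans[OF _ cinner_commute[symmetric]])
  then show "op_selfadjoint X" using a by (intro op_selfadjointI) auto
qed

lemma op_Im:
  assumes X: "X \<in> bounded_ops"
  shows "op_Im X \<in> bounded_ops" "op_selfadjoint (op_Im X)"
    "cinner (blinfun_apply (op_Im X) x) x = of_real (Im (cinner (blinfun_apply X x) x))"
proof -
  have 1: "cinner (blinfun_apply (op_Im X) x) x = of_real (Im (cinner (blinfun_apply X x) x))" for x
  proof -
    have "cinner (blinfun_apply (op_adjoint X) x) x = cnj (cinner (blinfun_apply X x) x)"
      unfolding cinner_commute[of _ x] op_adjoint(2)[OF X, symmetric] by (rule refl)
    then show ?thesis
      by (simp add: op_Im_def blinfun_simps cinner_simps complex_eq_iff)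
  qed
  show 2: "op_Im X \<in> bounded_ops" using op_adjoint[OF X] X by (auto simp: op_Im_def)
  show "op_selfadjoint (op_Im X)" using 1 2 by (simp add: op_selfadjoint_iff)
  show "cinner (blinfun_apply (op_Im X) x) x = of_real (Im (cinner (blinfun_apply X x) x))" by (rule 1)
qed

lemma op_psd_op_Im_iff:
  "X \<in> bounded_ops \<Longrightarrow> op_psd (op_Im X) \<longleftrightarrow> (\<forall>x. 0 \<le> Im (cinner (blinfun_apply X x) x))"
  using op_Im[of X] by (simp add: op_psd_def)

section \<open>Powers, inverses and the Neumann series\<close>

definition op_pow :: "('a::real_normed_vector \<Rightarrow>\<^sub>L 'a) \<Rightarrow> nat \<Rightarrow> ('a \<Rightarrow>\<^sub>L 'a)" where
  "op_pow T m = ((\<lambda>Y. T o\<^sub>L Y) ^^ m) id_blinfun"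

lemma op_pow_0 [simp]: "op_pow T 0 = id_blinfun" by (simp add: op_pow_def)

lemma op_pow_Suc: "op_pow T (Suc m) = T o\<^sub>L op_pow T m" by (simp add: op_pow_def)

lemma op_pow_apply: "blinfun_apply (op_pow T m) x = (blinfun_apply T ^^ m) x"
  by (induction m) (auto simp: op_pow_Suc blinfun_simps)

lemma op_pow_Suc_apply: "blinfun_apply (op_pow T (Suc m)) x = blinfun_apply (op_pow T m) (blinfun_apply T x)"
  "blinfun_apply (op_pow T (Suc m)) x = blinfun_apply T (blinfun_apply (op_pow T m) x)"
  by (simp_all add: op_pow_apply funpow_swap1)

lemma norm_op_pow: "norm (op_pow T m) \<le> norm T ^ m"
proof (induction m)
  case (Suc m)
  have "norm (op_pow T (Suc m)) \<le> norm T * norm (op_pow T m)"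
    unfolding op_pow_Suc by (rule norm_blinfun_compose)
  also have "\<dots> \<le> norm T * norm T ^ m" by (rule mult_left_mono[OF Suc]) simp
  finally show ?case by simp
qed (simp add: norm_blinfun_id_le)

lemma op_pow_bounded_ops [intro, simp]: "T \<in> bounded_ops \<Longrightarrow> op_pow T m \<in> bounded_ops"
  by (induction m) (auto simp: op_pow_Suc)

lemma op_pow_selfadjoint:
  assumes "op_selfadjoint T"
  shows "cinner (blinfun_apply (op_pow T m) x) y = cinner x (blinfun_apply (op_pow T m) y)"
proof (induction m arbitrary: x y)
  case (Suc m)
  have "cinner (blinfun_apply (op_pow T (Suc m)) x) y = cinner (blinfun_apply T x) (blinfun_apply (op_pow T m) y)"
    by (simp only: op_pow_Suc_apply(1) Suc)
  also have "\<dots> = cinner x (blinfun_apply (op_pow T (Suc m)) y)"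
    by (simp only: op_pow_Suc_apply(2) op_selfadjointD(2)[OF assms])
  finally show ?case .
qed simp

lemma op_inverse_of_unique:
  assumes "op_inverse_of X Y" "op_inverse_of X Z" shows "Y = Z"
proof -
  have "blinfun_apply Y x = blinfun_apply Z x" for x
  proof -
    have "blinfun_apply X (blinfun_apply Z x) = x"
      using assms(2) by (metis op_inverse_of_def blinfun_apply_blinfun_compose id_blinfun.rep_eq)
    moreover have "blinfun_apply Y (blinfun_apply X (blinfun_apply Z x)) = blinfun_apply Z x"
      using assms(1) by (metis op_inverse_of_def blinfun_apply_blinfun_compose id_blinfun.rep_eq)
    ultimately show ?thesis by simp
  qed
  then show ?thesis by (rule blinfun_eqI)
qed

lemma op_inverse_eqI: "op_inverse_of X Y \<Longrightarrow> op_inverse X = Y"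
  unfolding op_inverse_def using op_inverse_of_unique by blast

lemma op_inverse_of_op_inverse: "op_invertible X \<Longrightarrow> op_inverse_of X (op_inverse X)"
  using op_inverse_eqI by (auto simp: op_invertible_def)

lemma op_inverse_ofI:
  assumes "Y \<in> bounded_ops" "\<And>x. blinfun_apply X (blinfun_apply Y x) = x"
    "\<And>x. blinfun_apply Y (blinfun_apply X x) = x"
  shows "op_inverse_of X Y"
  using assms by (auto simp: op_inverse_of_def blinfun_simps intro!: blinfun_eqI)

lemma op_inverse_ofD:
  assumes "op_inverse_of X Y"
  shows "Y \<in> bounded_ops" "blinfun_apply X (blinfun_apply Y x) = x"
    "blinfun_apply Y (blinfun_apply X x) = x"
proof -
  have i: "Y \<in> bounded_ops" "X o\<^sub>L Y = id_blinfun" "Y o\<^sub>L X = id_blinfun"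
    using assms by (auto simp: op_inverse_of_def)
  show "Y \<in> bounded_ops" by (rule i)
  show "blinfun_apply X (blinfun_apply Y x) = x"
    unfolding blinfun_apply_blinfun_compose[symmetric] i by simp
  show "blinfun_apply Y (blinfun_apply X x) = x"
    unfolding blinfun_apply_blinfun_compose[symmetric] i by simp
qed

lemma op_invertible_compose:
  assumes "op_invertible X" "op_invertible Y"
  shows "op_invertible (X o\<^sub>L Y)"
proof -
  have "op_inverse_of (X o\<^sub>L Y) (op_inverse Y o\<^sub>L op_inverse X)"
    using op_inverse_ofD[OF op_inverse_of_op_inverse[OF assms(1)]]
      op_inverse_ofD[OF op_inverse_of_op_inverse[OF assms(2)]]
    by (intro op_inverse_ofI) (simp_all add: blinfun_apply_blinfun_compose)
  then show ?thesis by (auto simp: op_invertible_def)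
qed

abbreviation op_const :: "complex \<Rightarrow> ('a::chilbert_space \<Rightarrow>\<^sub>L 'a)" where
  "op_const z \<equiv> op_scaleC z id_blinfun"

text \<open>Multiplying a partial sum by \<open>z - X\<close> telescopes to
  \<open>1 - X^n / z^n\<close>, whose last term tends to 0 at every vector. The series itself is
  part of the conclusion because resolvents on circles are integrated term by term.\<close>

theorem neumann_series:
  assumes X: "X \<in> bounded_ops" and z: "norm X < cmod z"
  obtains S where "(\<lambda>m. op_scaleC (1 / z ^ Suc m) (op_pow X m)) sums S"
    "op_inverse_of (op_const z - X) S"
proof -
  let ?t = "\<lambda>m. op_scaleC (1 / z ^ Suc m) (op_pow X m)"
  have z0: "z \<noteq> 0" using z by auto
  let ?q = "norm X / cmod z"
  have q: "?q < 1" "?q \<ge> 0" using z by (auto simp: divide_less_eq)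
  have bd: "norm (?t m) \<le> ?q ^ m / cmod z" for m
  proof -
    have "norm (?t m) \<le> cmod (1 / z ^ Suc m) * norm X ^ m"
      by (rule order_trans[OF norm_op_scaleC]) (intro mult_left_mono norm_op_pow norm_ge_zero)
    also have "\<dots> = ?q ^ m / cmod z" by (simp add: norm_divide norm_power norm_mult power_divide)
    finally show ?thesis .
  qed
  have "summable (\<lambda>m. ?q ^ m / cmod z)" by (intro summable_divide summable_geometric) (use q in auto)
  then have "summable ?t" by (rule summable_comparison_test'[where N = 0]) (rule bd)
  then obtain S where S: "?t sums S" by (auto simp: summable_def)
  have "S \<in> bounded_ops"
    using S unfolding sums_def by (rule bounded_ops_limit[rotated]) (use X in auto)
  moreover have part: "blinfun_apply (op_const z - X) (blinfun_apply (\<Sum>m<n. ?t m) x) = x - scaleC (1/z^n) (blinfun_apply (op_pow X n) x)"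
     "blinfun_apply (\<Sum>m<n. ?t m) (blinfun_apply (op_const z - X) x) = x - scaleC (1/z^n) (blinfun_apply (op_pow X n) x)" for n x
  proof (induction n arbitrary: x)
    case (Suc n)
    { case 1 show ?case using Suc(1)[of x] z0
      by (simp add: blinfun_simps scaleC_scaleC bounded_opsD[OF X] op_pow_Suc_apply(2) scaleC_diff_right) }
    { case 2 show ?case using Suc(2)[of x] z0
      by (simp add: blinfun_simps scaleC_scaleC bounded_opsD[OF op_pow_bounded_ops[OF X]] op_pow_Suc_apply(1) scaleC_diff_right)
        (simp add: algebra_simps) }
  qed (simp_all add: scaleC_one)
  have lim0: "(\<lambda>n. x - scaleC (1/z^n) (blinfun_apply (op_pow X n) x)) \<longlonglongrightarrow> x - 0" for x
  proof (intro tendsto_intros)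
    show "(\<lambda>n. scaleC (1/z^n) (blinfun_apply (op_pow X n) x)) \<longlonglongrightarrow> 0"
    proof (rule Lim_null_comparison)
      show "\<forall>\<^sub>F n in sequentially. norm (scaleC (1/z^n) (blinfun_apply (op_pow X n) x)) \<le> ?q ^ n * norm x"
      proof (intro always_eventually allI)
        fix n
        have "norm (blinfun_apply (op_pow X n) x) \<le> norm X ^ n * norm x"
          by (rule order_trans[OF norm_blinfun]) (intro mult_right_mono norm_op_pow norm_ge_zero)
        then show "norm (scaleC (1/z^n) (blinfun_apply (op_pow X n) x)) \<le> ?q ^ n * norm x"
          by (simp add: norm_scaleC norm_divide norm_power power_divide divide_right_mono)
      qed
      show "(\<lambda>n. ?q ^ n * norm x) \<longlonglongrightarrow> 0"
        by (rule tendsto_mult_left_zero, rule LIMSEQ_realpow_zero) (use q in auto)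
    qed
  qed
  have ap: "(\<lambda>n. blinfun_apply (\<Sum>m<n. ?t m) x) \<longlonglongrightarrow> blinfun_apply S x" for x
    using S unfolding sums_def by (intro tendsto_intros)
  have "blinfun_apply (op_const z - X) (blinfun_apply S x) = x" for x
  proof (rule LIMSEQ_unique)
    show "(\<lambda>n. blinfun_apply (op_const z - X) (blinfun_apply (\<Sum>m<n. ?t m) x))
      \<longlonglongrightarrow> blinfun_apply (op_const z - X) (blinfun_apply S x)"
      by (rule bounded_linear.tendsto[OF blinfun.bounded_linear_right ap])
    show "(\<lambda>n. blinfun_apply (op_const z - X) (blinfun_apply (\<Sum>m<n. ?t m) x)) \<longlonglongrightarrow> x"
      using lim0[of x] unfolding part by simp
  qed
  moreover have "blinfun_apply S (blinfun_apply (op_const z - X) x) = x" for x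
    by (rule LIMSEQ_unique[OF ap]) (use lim0[of x] in \<open>simp only: part diff_zero\<close>)
  ultimately have "op_inverse_of (op_const z - X) S" by (rule op_inverse_ofI)
  with S show ?thesis using that by blast
qed

section \<open>Resolvents and spectra\<close>

definition rsv :: "('a::chilbert_space \<Rightarrow>\<^sub>L 'a) \<Rightarrow> complex \<Rightarrow> ('a \<Rightarrow>\<^sub>L 'a)" where
  "rsv X z = op_inverse (op_const z - X)"

lemma rsv:
  assumes "z \<notin> op_spectrum X"
  shows "rsv X z \<in> bounded_ops"
    "blinfun_apply (op_const z - X) (blinfun_apply (rsv X z) x) = x"
    "blinfun_apply (rsv X z) (blinfun_apply (op_const z - X) x) = x"
    "blinfun_apply X (blinfun_apply (rsv X z) x) = scaleC z (blinfun_apply (rsv X z) x) - x"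
proof -
  have i: "op_inverse_of (op_const z - X) (rsv X z)"
    using assms op_inverse_of_op_inverse by (auto simp: op_spectrum_def rsv_def)
  note d = op_inverse_ofD[OF i]
  show "rsv X z \<in> bounded_ops" "blinfun_apply (rsv X z) (blinfun_apply (op_const z - X) x) = x"
    by (fact d)+
  show 2: "blinfun_apply (op_const z - X) (blinfun_apply (rsv X z) x) = x" by (fact d)
  then show "blinfun_apply X (blinfun_apply (rsv X z) x) = scaleC z (blinfun_apply (rsv X z) x) - x"
    by (simp add: blinfun_simps algebra_simps)
qed

lemma rsv_eqI: "op_inverse_of (op_const z - X) S \<Longrightarrow> rsv X z = S"
  by (simp add: rsv_def op_inverse_eqI)

lemma op_const_diff: "op_const (z - c) = op_const z - op_const c"
  by (rule bounded_bilinear.diff_left[OF bounded_bilinear_op_scaleC])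

lemma op_const_0 [simp]: "op_const 0 = 0"
  by (rule bounded_bilinear.zero_left[OF bounded_bilinear_op_scaleC])

lemma op_spectrum_bound:
  assumes "X \<in> bounded_ops" "norm (X - op_const c) < cmod (z - c)"
  shows "z \<notin> op_spectrum X"
proof -
  obtain S where "op_inverse_of (op_const (z - c) - (X - op_const c)) S"
    using neumann_series[of "X - op_const c" "z - c"] assms by auto
  then have "op_invertible (op_const (z - c) - (X - op_const c))" by (auto simp: op_invertible_def)
  then show ?thesis by (simp add: op_spectrum_def op_const_diff)
qed

lemma op_spectrum_subset_cball:
  assumes "X \<in> bounded_ops" shows "op_spectrum X \<subseteq> cball c (norm (X - op_const c))"
  using op_spectrum_bound[OF assms, of c] by (force simp: dist_norm norm_minus_commute not_less)

lemma resolvent_identity: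
  assumes z: "z \<notin> op_spectrum X" and w: "w \<notin> op_spectrum X"
  shows "rsv X z - rsv X w = op_scaleC (w - z) (rsv X z o\<^sub>L rsv X w)"
proof (rule blinfun_eqI)
  fix x
  define u where "u = blinfun_apply (rsv X w) x"
  have "x = blinfun_apply (op_const w - X) u" by (simp add: u_def rsv[OF w])
  also have "\<dots> = blinfun_apply (op_const z - X) u + scaleC (w - z) u"
    by (simp add: blinfun_simps complex_vector.scale_left_diff_distrib)
  finally have "blinfun_apply (rsv X z) x = u + scaleC (w - z) (blinfun_apply (rsv X z) u)"
    using rsv[OF z] by (metis blinfun.add_right bounded_opsD)
  then show "blinfun_apply (rsv X z - rsv X w) x = blinfun_apply (op_scaleC (w - z) (rsv X z o\<^sub>L rsv X w)) x"
    by (simp add: blinfun_simps u_def)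
qed

text \<open>With \<open>R\<close> the resolvent, \<open>w - X = (z - X) (1 - (z - w) R(z))\<close>,
  and the hypothesis puts the second factor in the range of the Neumann series at 1.\<close>

lemma op_spectrum_perturb:
  assumes X: "X \<in> bounded_ops" and z: "z \<notin> op_spectrum X" and w: "cmod (w - z) * norm (rsv X z) < 1"
  shows "w \<notin> op_spectrum X"
proof -
  define Y where "Y = op_scaleC (z - w) (rsv X z)"
  have Y: "Y \<in> bounded_ops" using rsv[OF z] by (auto simp: Y_def)
  have "norm Y < cmod 1"
    using norm_op_scaleC[of "z - w" "rsv X z"] w by (simp add: Y_def norm_minus_commute)
  then obtain S where "op_inverse_of (op_const 1 - Y) S" using neumann_series[OF Y] by blast
  then have "op_invertible (op_const 1 - Y)" by (auto simp: op_invertible_def)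
  then have "op_invertible ((op_const z - X) o\<^sub>L (op_const 1 - Y))"
    using z by (intro op_invertible_compose) (auto simp: op_spectrum_def)
  also have "(op_const z - X) o\<^sub>L (op_const 1 - Y) = op_const w - X"
  proof (rule blinfun_eqI)
    fix x
    have zX: "op_const z - X \<in> bounded_ops" using X by simp
    have Yx: "blinfun_apply (op_const 1 - Y) x = x - scaleC (z - w) (blinfun_apply (rsv X z) x)"
      by (simp add: blinfun_simps Y_def scaleC_one)
    have "blinfun_apply ((op_const z - X) o\<^sub>L (op_const 1 - Y)) x
       = blinfun_apply (op_const z - X) x - scaleC (z - w) x"
      by (simp only: blinfun_apply_blinfun_compose Yx blinfun.diff_right bounded_opsD[OF zX] rsv(2)[OF z])
    also have "\<dots> = blinfun_apply (op_const w - X) x"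
      by (simp add: blinfun_simps complex_vector.scale_left_diff_distrib)
    finally show "blinfun_apply ((op_const z - X) o\<^sub>L (op_const 1 - Y)) x = blinfun_apply (op_const w - X) x" .
  qed
  finally show ?thesis by (simp add: op_spectrum_def)
qed

lemma open_resolvent_set: assumes X: "X \<in> bounded_ops" shows "open (- op_spectrum X)"
  unfolding open_contains_ball
proof
  fix z assume z: "z \<in> - op_spectrum X"
  have "ball z (1 / (norm (rsv X z) + 1)) \<subseteq> - op_spectrum X"
  proof
    fix w assume "w \<in> ball z (1 / (norm (rsv X z) + 1))"
    then have "cmod (w - z) < 1 / (norm (rsv X z) + 1)" by (simp add: dist_norm norm_minus_commute)
    then have "cmod (w - z) * (norm (rsv X z) + 1) < 1" by (simp add: field_simps add_pos_nonneg)
    moreover have "cmod (w - z) * norm (rsv X z) \<le> cmod (w - z) * (norm (rsv X z) + 1)"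
      by (intro mult_left_mono) auto
    ultimately show "w \<in> - op_spectrum X" using op_spectrum_perturb[OF X] z by auto
  qed
  then show "\<exists>e>0. ball z e \<subseteq> - op_spectrum X"
    by (intro exI[of _ "1 / (norm (rsv X z) + 1)"]) (auto simp: add_nonneg_pos)
qed

lemma compact_op_spectrum: assumes X: "X \<in> bounded_ops" shows "compact (op_spectrum X)"
  using open_resolvent_set[OF X] op_spectrum_subset_cball[OF X, of 0]
  by (auto simp: compact_eq_bounded_closed closed_def intro: bounded_subset[OF bounded_cball])

lemma isCont_rsv:
  assumes X: "X \<in> bounded_ops" and z: "z \<notin> op_spectrum X"
  shows "isCont (rsv X) z"
proof -
  let ?N = "norm (rsv X z)"
  have ev: "\<forall>\<^sub>F w in at z. w \<notin> op_spectrum X \<and> cmod (w - z) * ?N < 1/2"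
  proof (rule eventually_conj)
    show "\<forall>\<^sub>F w in at z. w \<notin> op_spectrum X"
      using eventually_at_in_open'[OF open_resolvent_set[OF X], of z] z by simp
    have "((\<lambda>w. cmod (w - z) * ?N) \<longlongrightarrow> cmod (z - z) * ?N) (at z)" by (intro tendsto_intros)
    then show "\<forall>\<^sub>F w in at z. cmod (w - z) * ?N < 1/2" by (rule order_tendstoD) simp
  qed
  have "(rsv X \<longlongrightarrow> rsv X z) (at z)"
  proof (rule LIM_zero_cancel, rule Lim_null_comparison)
    show "\<forall>\<^sub>F w in at z. norm (rsv X w - rsv X z) \<le> cmod (w - z) * (2 * ?N * ?N)"
      using ev
    proof eventually_elim
      case (elim w)
      have "norm (rsv X w - rsv X z) \<le> cmod (z - w) * norm (rsv X w o\<^sub>L rsv X z)"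
        using resolvent_identity[of w X z] elim z norm_op_scaleC by metis
      also have "\<dots> \<le> cmod (z - w) * (norm (rsv X w) * ?N)"
        by (intro mult_left_mono norm_blinfun_compose norm_ge_zero)
      finally have 1: "norm (rsv X w - rsv X z) \<le> cmod (w - z) * ?N * norm (rsv X w)"
        by (simp add: norm_minus_commute mult_ac)
      \<comment> \<open>The estimate \<open>1\<close> still contains the unknown
        \<open>norm (rsv X w)\<close>; half of it is absorbed on the left, which bounds it by
        \<open>2 * ?N\<close> near \<open>z\<close>.\<close>
      have "cmod (w - z) * ?N * norm (rsv X w) \<le> 1/2 * norm (rsv X w)"
        using elim by (intro mult_right_mono) auto
      with 1 have "norm (rsv X w) \<le> 2 * ?N"
        using norm_triangle_ineq2[of "rsv X w" "rsv X z"] by linarith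
      then have "cmod (w - z) * ?N * norm (rsv X w) \<le> cmod (w - z) * ?N * (2 * ?N)"
        by (intro mult_left_mono) auto
      with 1 show ?case by (simp add: mult_ac)
    qed
    have "((\<lambda>w. cmod (w - z) * (2 * ?N * ?N)) \<longlongrightarrow> cmod (z - z) * (2 * ?N * ?N)) (at z)" by (intro tendsto_intros)
    then show "((\<lambda>w. cmod (w - z) * (2 * ?N * ?N)) \<longlongrightarrow> 0) (at z)" by simp
  qed
  then show ?thesis by (simp add: isCont_def)
qed

lemma continuous_on_rsv: "X \<in> bounded_ops \<Longrightarrow> continuous_on (- op_spectrum X) (rsv X)"
  using isCont_rsv by (auto intro!: continuous_at_imp_continuous_on)

text \<open>Stated for a general complex-linear functional instead of a matrix coefficient, since
  independence of the cycle applies it to \<open>T \<mapsto> <E T x, y>\<close> with a fixed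
  operator \<open>E\<close>. The difference quotient is supplied by the resolvent identity.\<close>

lemma holomorphic_rsv:
  fixes l :: "('a::chilbert_space \<Rightarrow>\<^sub>L 'a) \<Rightarrow> complex"
  assumes X: "X \<in> bounded_ops" and l: "bounded_linear l" and sc: "\<And>c T. l (op_scaleC c T) = c * l T"
  shows "(\<lambda>z. l (rsv X z)) holomorphic_on - op_spectrum X"
proof (rule holomorphic_onI)
  interpret bounded_linear l by fact
  fix z assume z: "z \<in> - op_spectrum X"
  have "((\<lambda>w. (l (rsv X w) - l (rsv X z)) / (w - z)) \<longlongrightarrow> - l (rsv X z o\<^sub>L rsv X z)) (at z)"
  proof (rule Lim_transform_within_open[OF _ open_resolvent_set[OF X] z])
    have "((\<lambda>w. rsv X w) \<longlongrightarrow> rsv X z) (at z)" using isCont_rsv[OF X] z by (simp add: isCont_def)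
    then show "((\<lambda>w. - l (rsv X w o\<^sub>L rsv X z)) \<longlongrightarrow> - l (rsv X z o\<^sub>L rsv X z)) (at z)"
      by (intro tendsto_intros tendsto bounded_bilinear.tendsto[OF bounded_bilinear_blinfun_compose])
    fix w assume w: "w \<in> - op_spectrum X" "w \<noteq> z"
    have "l (rsv X w) - l (rsv X z) = l (rsv X w - rsv X z)" by (simp add: diff)
    also have "\<dots> = (z - w) * l (rsv X w o\<^sub>L rsv X z)"
      using resolvent_identity[of w X z] w z by (simp add: sc)
    finally show "- l (rsv X w o\<^sub>L rsv X z) = (l (rsv X w) - l (rsv X z)) / (w - z)"
      using w by (simp add: field_simps)
  qed
  then have "((\<lambda>z. l (rsv X z)) has_field_derivative (- l (rsv X z o\<^sub>L rsv X z))) (at z)"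
    by (simp add: has_field_derivative_iff)
  then show "(\<lambda>z. l (rsv X z)) field_differentiable at z within - op_spectrum X"
    using field_differentiable_at_within field_differentiable_def by blast
qed

lemma norm_rsv_le:
  assumes X: "X \<in> bounded_ops" and z: "norm X < cmod z"
  shows "norm (rsv X z) \<le> 1 / (cmod z - norm X)"
proof (rule norm_blinfun_bound)
  have zs: "z \<notin> op_spectrum X" using op_spectrum_bound[OF X, of 0 z] z by simp
  fix x
  define u where "u = blinfun_apply (rsv X z) x"
  have "cmod z * norm u = norm (blinfun_apply X u + x)"
    using rsv(4)[OF zs, of x] by (simp add: u_def norm_scaleC[symmetric])
  also have "\<dots> \<le> norm X * norm u + norm x"
    using norm_triangle_ineq[of "blinfun_apply X u" x] norm_blinfun[of X u] by linarith
  finally show "norm (blinfun_apply (rsv X z) x) \<le> 1 / (cmod z - norm X) * norm x"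
    using z by (simp add: u_def[symmetric] field_simps)
qed (use z in simp)

section \<open>Operators with coercive imaginary part\<close>

lemma coercive_disc:
  assumes X: "X \<in> bounded_ops" and d: "d > 0" and co: "\<And>x. d * (norm x)\<^sup>2 \<le> Im (cinner (blinfun_apply X x) x)"
  obtains R where "R > 0" "norm (X - op_const (\<i> * of_real R)) < R"
proof -
  \<comment> \<open>\<open>|(X - iR) x|^2 = |X x|^2 - 2 R Im <X x, x> + R^2 |x|^2\<close>, so the
    aim is \<open>2 R d > |X|^2\<close>; this choice gives \<open>R d = |X|^2 + d\<close>.\<close>
  define R where "R = (norm X)^2 / d + 1"
  have R: "R > 0" using d by (simp add: R_def add_nonneg_pos)
  define q where "q = (norm X)^2 - 2 * R * d + R^2"
  have "R * d = (norm X)^2 + d" using d by (simp add: R_def field_simps)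
  then have q: "q < R^2" using d zero_le_power2[of "norm X"] unfolding q_def by linarith
  have n: "(norm (blinfun_apply (X - op_const (\<i> * of_real R)) x))^2 \<le> q * (norm x)^2" for x
  proof -
    have "(norm (blinfun_apply (X - op_const (\<i> * of_real R)) x))^2
        = (norm (blinfun_apply X x))^2 - 2 * R * Im (cinner (blinfun_apply X x) x) + R^2 * (norm x)^2"
      using R by (simp add: blinfun_simps norm_diff_square cinner_simps norm_scaleC norm_mult power_mult_distrib)
    also have "\<dots> \<le> (norm X * norm x)^2 - 2 * R * (d * (norm x)^2) + R^2 * (norm x)^2"
      using R co[of x] by (intro add_right_mono diff_mono power_mono norm_blinfun mult_left_mono) auto
    also have "\<dots> = q * (norm x)^2" by (simp add: q_def algebra_simps power_mult_distrib)
    finally show ?thesis .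
  qed
  \<comment> \<open>By \<open>n\<close>, \<open>q\<close> can be negative only on the zero space;
    the maximum keeps the square root meaningful there as well.\<close>
  define p where "p = max q 0"
  have p: "p \<ge> 0" "p < R^2" using q R by (auto simp: p_def)
  have "norm (X - op_const (\<i> * of_real R)) \<le> sqrt p"
  proof (rule norm_blinfun_bound)
    fix x
    have "(norm (blinfun_apply (X - op_const (\<i> * of_real R)) x))^2 \<le> p * (norm x)^2"
      by (rule order_trans[OF n]) (auto simp: p_def intro: mult_right_mono)
    also have "\<dots> = (sqrt p * norm x)^2" using p by (simp add: power_mult_distrib)
    finally show "norm (blinfun_apply (X - op_const (\<i> * of_real R)) x) \<le> sqrt p * norm x"
      by (rule power2_le_imp_le) (use p in simp)
  qed (use p in simp)
  also have "\<dots> < R" using p R by (simp add: real_less_lsqrt)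
  finally show ?thesis using that R by blast
qed

text \<open>The disc of \<open>coercive_disc\<close> has centre \<open>z = iR\<close> and radius
  \<open>|z|\<close>, so the Neumann series inverts \<open>X = z - (z - X)\<close>.\<close>

lemma coercive_invertible:
  assumes X: "X \<in> bounded_ops" and d: "d > 0" and co: "\<And>x. d * (norm x)\<^sup>2 \<le> Im (cinner (blinfun_apply X x) x)"
  shows "op_invertible X"
proof -
  obtain R where R: "R > 0" "norm (X - op_const (\<i> * of_real R)) < R" using coercive_disc[OF assms] by blast
  define z where "z = \<i> * of_real R"
  have "norm (op_const z - X) < cmod z" using R by (simp add: norm_minus_commute z_def norm_mult)
  then obtain S where "op_inverse_of (op_const z - (op_const z - X)) S"
    using neumann_series[of "op_const z - X"] X by (metis bounded_ops_intros(1,4,6))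
  then show ?thesis by (auto simp: op_invertible_def)
qed

text \<open>Positivity at \<open>x - t B x\<close> yields \<open>t |B x|^2 \<le> <B x, x>\<close> as
  soon as \<open>t |B| \<le> 1\<close>, and the inverse bounds \<open>|x|\<close> by a multiple of
  \<open>|B x|\<close>.\<close>

lemma op_psd_invertible_bound:
  assumes B: "op_psd B" and inv: "op_invertible B"
  obtains d where "d > 0" "\<And>x. d * (norm x)\<^sup>2 \<le> Re (cinner (blinfun_apply B x) x)"
proof -
  have sa: "op_selfadjoint B" and pos: "\<And>x. 0 \<le> Re (cinner (blinfun_apply B x) x)"
    using B by (auto simp: op_psd_def)
  obtain S where S: "op_inverse_of B S" using inv by (auto simp: op_invertible_def)
  define t where "t = 1 / (norm B + 1)"
  have t: "t > 0" "t * norm B \<le> 1" by (auto simp: t_def add_nonneg_pos divide_le_eq add_pos_nonneg)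
  define d where "d = t / (norm S + 1)^2"
  have "d > 0" using t by (auto simp: d_def add_nonneg_pos intro!: divide_pos_pos zero_less_power)
  moreover have "d * (norm x)\<^sup>2 \<le> Re (cinner (blinfun_apply B x) x)" for x
  proof -
    define y where "y = blinfun_apply B x"
    have "0 \<le> Re (cinner (blinfun_apply B (x - t *\<^sub>R y)) (x - t *\<^sub>R y))" by (rule pos)
    also have "\<dots> = Re (cinner y x) - 2 * t * (norm y)^2 + t^2 * Re (cinner (blinfun_apply B y) y)"
      by (simp add: blinfun_simps cinner_simps y_def[symmetric] op_selfadjointD(2)[OF sa, of y x] cinner_self
          algebra_simps power2_eq_square flip: of_real_power)
    also have "Re (cinner (blinfun_apply B y) y) \<le> norm B * (norm y)^2"
    proof -
      have "Re (cinner (blinfun_apply B y) y) \<le> norm (blinfun_apply B y) * norm y"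
        using cinner_Cauchy_Schwarz complex_Re_le_cmod order_trans by blast
      also have "\<dots> \<le> norm B * norm y * norm y" by (intro mult_right_mono norm_blinfun norm_ge_zero)
      finally show ?thesis by (simp add: power2_eq_square mult.assoc)
    qed
    also have "t^2 * (norm B * (norm y)^2) \<le> t * (norm y)^2"
      using mult_right_mono[OF t(2), of "t * (norm y)^2"] t(1) by (simp add: power2_eq_square mult_ac)
    finally have 1: "t * (norm y)^2 \<le> Re (cinner y x)" using t by (simp add: algebra_simps)
    have "norm x \<le> norm S * norm y" using norm_blinfun[of S y] by (simp add: y_def op_inverse_ofD(3)[OF S])
    also have "\<dots> \<le> (norm S + 1) * norm y" by (intro mult_right_mono) auto
    finally have "(norm x)^2 \<le> ((norm S + 1) * norm y)^2" by (intro power_mono) auto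
    then have "d * (norm x)^2 \<le> d * ((norm S + 1) * norm y)^2" using \<open>d > 0\<close> by (intro mult_left_mono) auto
    also have "\<dots> = t * (norm y)^2"
    proof -
      have "norm S + 1 \<noteq> 0" using norm_ge_zero[of S] by linarith
      then show ?thesis by (simp add: d_def power_mult_distrib)
    qed
    finally show ?thesis using 1 by (simp add: y_def)
  qed
  ultimately show ?thesis using that by blast
qed

text \<open>Replaces positivity with invertibility by coercivity of the form, the shape in which the
  hypothesis enters \<open>coercive_disc\<close> and in which the strict conclusion leaves the
  Poisson bound. Backwards, \<open>i Im X\<close> is coercive, hence invertible.\<close>

lemma op_pos_op_Im_iff:
  assumes X: "X \<in> bounded_ops"
  shows "op_pos (op_Im X) \<longleftrightarrow> (\<exists>d>0. \<forall>x. d * (norm x)\<^sup>2 \<le> Im (cinner (blinfun_apply X x) x))"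
proof
  assume "op_pos (op_Im X)"
  then show "\<exists>d>0. \<forall>x. d * (norm x)\<^sup>2 \<le> Im (cinner (blinfun_apply X x) x)"
    unfolding op_pos_def using op_psd_invertible_bound[of "op_Im X"] op_Im(3)[OF X] by (metis Re_complex_of_real)
next
  assume "\<exists>d>0. \<forall>x. d * (norm x)\<^sup>2 \<le> Im (cinner (blinfun_apply X x) x)"
  then obtain d where d: "d > 0" "\<And>x. d * (norm x)\<^sup>2 \<le> Im (cinner (blinfun_apply X x) x)" by blast
  have "op_psd (op_Im X)"
    unfolding op_psd_op_Im_iff[OF X]
  proof
    show "0 \<le> Im (cinner (blinfun_apply X x) x)" for x
      using d(2)[of x] d(1) by (meson order_trans mult_nonneg_nonneg less_imp_le zero_le_power2)
  qed
  moreover have "op_invertible (op_scaleC \<i> (op_Im X))"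
    by (rule coercive_invertible[OF _ d(1)]) (use d op_Im[OF X] in \<open>auto simp: blinfun_simps cinner_simps\<close>)
  then obtain S where S: "op_inverse_of (op_scaleC \<i> (op_Im X)) S" by (auto simp: op_invertible_def)
  have "op_inverse_of (op_Im X) (op_scaleC \<i> S)"
    using op_inverse_ofD[OF S] op_Im(1)[OF X]
    by (intro op_inverse_ofI) (auto simp: blinfun_simps bounded_opsD)
  then have "op_invertible (op_Im X)" by (auto simp: op_invertible_def)
  ultimately show "op_pos (op_Im X)" by (simp add: op_pos_def)
qed

text \<open>The imaginary part of \<open><(z - A) x, x>\<close> is \<open>Im z |x|^2\<close>, so off
  the real axis \<open>z - A\<close> or its negative is coercive.\<close>

lemma op_selfadjoint_spectrum_real:
  assumes A: "op_selfadjoint A" shows "op_spectrum A \<subseteq> \<real>"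
proof
  fix z assume z: "z \<in> op_spectrum A"
  have AB: "A \<in> bounded_ops" using A by (simp add: op_selfadjoint_def)
  have im: "Im (cinner (blinfun_apply (op_const z - A) x) x) = Im z * (norm x)^2" for x
    using A[unfolded op_selfadjoint_iff] by (simp add: blinfun_simps cinner_simps cinner_self flip: of_real_power)
  show "z \<in> \<real>"
  proof (rule ccontr)
    assume "z \<notin> \<real>"
    then have "Im z \<noteq> 0" by (simp add: complex_is_Real_iff)
    then have "Im z > 0 \<or> Im z < 0" by auto
    then have "op_invertible (op_const z - A)"
    proof
      assume "Im z > 0"
      then show ?thesis by (rule coercive_invertible[rotated]) (use AB im in auto)
    next
      assume "Im z < 0"
      then have "op_invertible (op_scaleC (-1) (op_const z - A))"
      proof (intro coercive_invertible[of _ "- Im z"])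
        fix x show "- Im z * (norm x)\<^sup>2 \<le> Im (cinner (blinfun_apply (op_scaleC (- 1) (op_const z - A)) x) x)"
          using im[of x] unfolding op_scaleC.rep_eq cinner_scaleC_left by simp
      qed (use AB in auto)
      then obtain S where S: "op_inverse_of (op_scaleC (-1) (op_const z - A)) S" by (auto simp: op_invertible_def)
      have "op_inverse_of (op_const z - A) (op_scaleC (-1) S)"
        using op_inverse_ofD[OF S] AB
        by (intro op_inverse_ofI) (auto simp: blinfun_simps bounded_opsD)
      then show ?thesis by (auto simp: op_invertible_def)
    qed
    then show False using z by (simp add: op_spectrum_def)
  qed
qed

section \<open>Power series in an operator\<close>

text \<open>Complex coefficients are allowed so that a polynomial splits into linear factors;
  \<open>op_poly\<close> is the case of real ones.\<close>

definition op_cpoly :: "complex poly \<Rightarrow> ('a::chilbert_space \<Rightarrow>\<^sub>L 'a) \<Rightarrow> ('a \<Rightarrow>\<^sub>L 'a)" where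
  "op_cpoly p A = (\<Sum>i\<le>degree p. op_scaleC (coeff p i) (op_pow A i))"

lemma op_cpoly_eq_sum:
  assumes "degree p \<le> n" shows "op_cpoly p A = (\<Sum>i\<le>n. op_scaleC (coeff p i) (op_pow A i))"
  unfolding op_cpoly_def
  by (rule sum.mono_neutral_left)
     (use assms in \<open>auto simp: coeff_eq_0 bounded_bilinear.zero_left[OF bounded_bilinear_op_scaleC]\<close>)

lemma op_scaleC_of_real: "op_scaleC (of_real r) X = r *\<^sub>R X"
  by (rule blinfun_eqI) (simp add: blinfun_simps scaleC_of_real)

lemma op_poly_eq_op_cpoly: "op_poly p A = op_cpoly (map_poly of_real p) A"
  by (simp add: op_poly_def op_cpoly_def degree_map_poly coeff_map_poly op_scaleC_of_real op_pow_def)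

lemma op_cpoly_diff: "op_cpoly (p - q) A = op_cpoly p A - op_cpoly q A"
proof -
  let ?n = "max (degree p) (degree q)"
  have "op_cpoly (p - q) A = (\<Sum>i\<le>?n. op_scaleC (coeff (p - q) i) (op_pow A i))"
    by (rule op_cpoly_eq_sum) (rule degree_diff_le_max)
  also have "\<dots> = (\<Sum>i\<le>?n. op_scaleC (coeff p i) (op_pow A i)) - (\<Sum>i\<le>?n. op_scaleC (coeff q i) (op_pow A i))"
    by (simp add: bounded_bilinear.diff_left[OF bounded_bilinear_op_scaleC] sum_subtractf)
  also have "\<dots> = op_cpoly p A - op_cpoly q A"
    by (simp add: op_cpoly_eq_sum[of p ?n] op_cpoly_eq_sum[of q ?n])
  finally show ?thesis .
qed

lemma op_poly_diff: "op_poly (p - q) A = op_poly p A - op_poly q A"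
proof -
  have "map_poly of_real (p - q) = map_poly of_real p - (map_poly of_real q :: complex poly)"
    by (rule poly_eqI) (simp add: coeff_map_poly)
  then show ?thesis by (simp add: op_poly_eq_op_cpoly op_cpoly_diff)
qed

lemma op_cpoly_const: "op_cpoly [:c:] A = op_const c"
  by (simp add: op_cpoly_def)

lemma op_cpoly_linear_mult:
  assumes A: "A \<in> bounded_ops"
  shows "op_cpoly ([:- z, 1:] * q) A = (A - op_const z) o\<^sub>L op_cpoly q A"
proof (rule blinfun_eqI)
  fix x
  let ?n = "degree q"
  have d: "degree ([:- z, 1:] * q) \<le> Suc ?n" using degree_mult_le[of "[:-z,1:]" q] by simp
  have "blinfun_apply (op_cpoly ([:- z, 1:] * q) A) x
      = (\<Sum>i\<le>Suc ?n. scaleC (coeff (pCons 0 q) i) (blinfun_apply (op_pow A i) x)) -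
        (\<Sum>i\<le>Suc ?n. scaleC z (scaleC (coeff q i) (blinfun_apply (op_pow A i) x)))"
    unfolding op_cpoly_eq_sum[OF d]
    by (simp add: blinfun_simps blinfun.sum_left complex_vector.scale_left_diff_distrib sum_subtractf
        scaleC_scaleC del: sum.atMost_Suc)
  also have "(\<Sum>i\<le>Suc ?n. scaleC (coeff (pCons 0 q) i) (blinfun_apply (op_pow A i) x)) =
     (\<Sum>i\<le>?n. scaleC (coeff q i) (blinfun_apply A (blinfun_apply (op_pow A i) x)))"
    by (simp add: sum.atMost_Suc_shift op_pow_Suc_apply(2) del: sum.atMost_Suc)
  also have "\<dots> = blinfun_apply A (blinfun_apply (op_cpoly q A) x)"
    by (simp add: op_cpoly_def blinfun.sum_left blinfun.sum_right blinfun_simps bounded_opsD[OF A])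
  also have "(\<Sum>i\<le>Suc ?n. scaleC z (scaleC (coeff q i) (blinfun_apply (op_pow A i) x))) =
     scaleC z (blinfun_apply (op_cpoly q A) x)"
    by (simp add: op_cpoly_def blinfun.sum_left blinfun_simps coeff_eq_0 complex_vector.scale_sum_right)
  finally show "blinfun_apply (op_cpoly ([:- z, 1:] * q) A) x = blinfun_apply ((A - op_const z) o\<^sub>L op_cpoly q A) x"
    by (simp add: blinfun_simps)
qed

lemma op_invertible_scaleC:
  assumes "c \<noteq> 0" "op_invertible X" "X \<in> bounded_ops" shows "op_invertible (op_scaleC c X)"
proof -
  obtain S where S: "op_inverse_of X S" using assms by (auto simp: op_invertible_def)
  have "op_inverse_of (op_scaleC c X) (op_scaleC (1/c) S)"
    using op_inverse_ofD[OF S] assms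
    by (intro op_inverse_ofI) (auto simp: blinfun_simps bounded_opsD scaleC_scaleC scaleC_one)
  then show ?thesis by (auto simp: op_invertible_def)
qed

text \<open>One half of the spectral mapping theorem: every root of \<open>p\<close> lies off the
  spectrum, so \<open>p(A)\<close> is a product of invertible linear factors.\<close>

lemma op_cpoly_invertible:
  assumes A: "A \<in> bounded_ops" and "p \<noteq> 0" "\<And>z. z \<in> op_spectrum A \<Longrightarrow> poly p z \<noteq> 0"
  shows "op_invertible (op_cpoly p A)"
  using assms(2,3)
proof (induction "degree p" arbitrary: p)
  case 0
  then obtain c where c: "p = [:c:]" "c \<noteq> 0" by (metis degree_eq_zeroE pCons_0_0)
  have "op_invertible (id_blinfun :: 'a \<Rightarrow>\<^sub>L 'a)"
    unfolding op_invertible_def by (rule exI[of _ id_blinfun]) (rule op_inverse_ofI, auto)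
  then show ?case using c by (auto simp: op_cpoly_const intro: op_invertible_scaleC)
next
  case (Suc n)
  then have "\<not> constant (poly p)" by (simp add: constant_degree)
  then obtain z where z: "poly p z = 0" using fundamental_theorem_of_algebra by blast
  then obtain q where q: "p = [:- z, 1:] * q" by (auto simp: poly_eq_0_iff_dvd)
  have q0: "q \<noteq> 0" using Suc.prems q by auto
  then have "n = degree q" using Suc.hyps(2) q degree_mult_eq[of "[:-z,1:]" q] by simp
  then have 1: "op_invertible (op_cpoly q A)" using q0 Suc.prems q by (intro Suc.hyps(1)) auto
  have "z \<notin> op_spectrum A" using Suc.prems z by auto
  then have "op_invertible (op_scaleC (-1) (op_const z - A))"
    using A by (intro op_invertible_scaleC) (auto simp: op_spectrum_def)
  also have "op_scaleC (-1) (op_const z - A) = A - op_const z"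
    by (rule blinfun_eqI) (simp add: blinfun_simps)
  finally show ?case using 1 unfolding q op_cpoly_linear_mult[OF A] by (rule op_invertible_compose)
qed

text \<open>If neither \<open>N = |T|\<close> nor \<open>-N\<close> were in the spectrum,
  \<open>T^2 - N^2\<close> would be bounded below by \<open>1/K\<close>. But self-adjointness gives
  \<open>|(T^2 - N^2) x|^2 \<le> N^2 (N^2 |x|^2 - |T x|^2)\<close>, which then keeps
  \<open>|T x|\<close> uniformly below \<open>N |x|\<close>.\<close>

lemma op_selfadjoint_norm_in_spectrum:
  assumes T: "op_selfadjoint T" and nt: "\<exists>x::'a::chilbert_space. x \<noteq> 0"
  shows "of_real (norm T) \<in> op_spectrum (T :: 'a \<Rightarrow>\<^sub>L 'a) \<or> of_real (- norm T) \<in> op_spectrum T"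
proof (rule ccontr)
  assume neg: "\<not> ?thesis"
  let ?N = "norm T"
  have TB: "T \<in> bounded_ops" using T by (simp add: op_selfadjoint_def)
  let ?R = "rsv T (of_real ?N)" and ?S = "rsv T (of_real (- ?N))"
  define K where "K = norm ?S * norm ?R"
  \<comment> \<open>\<open>T^2 - N^2 = (- N - T) (N - T)\<close>, and each factor is bounded below
    through its inverse.\<close>
  have low: "norm x \<le> K * norm (blinfun_apply T (blinfun_apply T x) - (?N)^2 *\<^sub>R x)" for x
  proof -
    define y where "y = blinfun_apply (op_const (of_real ?N) - T) x"
    have "blinfun_apply (op_const (of_real (- ?N)) - T) y = blinfun_apply T (blinfun_apply T x) - (?N)^2 *\<^sub>R x"
      unfolding y_def blinfun_simps scaleC_of_real by (simp add: blinfun_simps scaleC_of_real power2_eq_square algebra_simps)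
    then have "norm y \<le> norm ?S * norm (blinfun_apply T (blinfun_apply T x) - (?N)^2 *\<^sub>R x)"
      using rsv(3)[of "of_real (- ?N)" T y] neg norm_blinfun by metis
    moreover have "norm x \<le> norm ?R * norm y"
      using rsv(3)[of "of_real ?N" T x] neg norm_blinfun unfolding y_def by metis
    ultimately show ?thesis unfolding K_def
      by (smt (verit) mult.assoc mult.commute mult_left_mono norm_ge_zero)
  qed
  obtain x0 :: 'a where x0: "x0 \<noteq> 0" using nt by blast
  have K: "K > 0"
  proof (rule ccontr)
    assume "\<not> K > 0"
    then have "norm x0 \<le> 0" using low[of x0] by (smt (verit) mult_nonpos_nonneg norm_ge_zero)
    then show False using x0 by simp
  qed
  have sq: "(norm x)^2 \<le> K^2 * (?N^2 * (?N^2 * (norm x)^2 - (norm (blinfun_apply T x))^2))" for x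
  proof -
    let ?y = "blinfun_apply T (blinfun_apply T x)"
    have "(norm (?y - (?N)^2 *\<^sub>R x))^2 = (norm ?y)^2 - 2 * ?N^2 * (norm (blinfun_apply T x))^2 + ?N^4 * (norm x)^2"
      by (simp add: norm_diff_square cinner_simps op_selfadjointD(2)[OF T, of "blinfun_apply T x" x] cinner_self power_mult_distrib
        flip: of_real_power)
    also have "(norm ?y)^2 \<le> (?N * norm (blinfun_apply T x))^2" by (intro power_mono norm_blinfun norm_ge_zero)
    finally have "(norm (?y - (?N)^2 *\<^sub>R x))^2 \<le> ?N^2 * (?N^2 * (norm x)^2 - (norm (blinfun_apply T x))^2)"
      by (simp add: power_mult_distrib algebra_simps eval_nat_numeral)
    then have "K^2 * (norm (?y - (?N)^2 *\<^sub>R x))^2 \<le> K^2 * (?N^2 * (?N^2 * (norm x)^2 - (norm (blinfun_apply T x))^2))"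
      by (intro mult_left_mono) auto
    moreover have "(norm x)^2 \<le> (K * norm (?y - (?N)^2 *\<^sub>R x))^2" by (intro power_mono low) auto
    ultimately show ?thesis by (simp add: power_mult_distrib)
  qed
  have N: "?N > 0" using sq[of x0] x0 by (cases "T = 0") auto
  \<comment> \<open>The factor that \<open>sq\<close> leaves for \<open>|T x|^2\<close> against
    \<open>|x|^2\<close>, cut off at 0 for the square root; it is strictly below
    \<open>?N^2\<close>.\<close>
  define c where "c = max 0 (?N^2 - 1 / (K^2 * ?N^2))"
  have "(norm (blinfun_apply T x))^2 \<le> c * (norm x)^2" for x
  proof -
    have "(norm x)^2 / (K^2 * ?N^2) \<le> ?N^2 * (norm x)^2 - (norm (blinfun_apply T x))^2"
      using sq[of x] K N by (simp add: divide_le_eq mult_ac)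
    then have "(norm (blinfun_apply T x))^2 \<le> (?N^2 - 1 / (K^2 * ?N^2)) * (norm x)^2"
      by (simp add: algebra_simps)
    also have "\<dots> \<le> c * (norm x)^2" by (intro mult_right_mono) (auto simp: c_def)
    finally show ?thesis .
  qed
  then have "norm (blinfun_apply T x) \<le> sqrt c * norm x" for x
    by (metis real_sqrt_le_iff real_sqrt_mult real_sqrt_abs abs_norm_cancel)
  then have "?N \<le> sqrt c" by (intro norm_blinfun_bound) (auto simp: c_def)
  then have "?N^2 \<le> c" by (metis c_def max.cobounded1 norm_ge_zero power_mono real_sqrt_pow2)
  moreover have "c < ?N^2" using K N by (auto simp: c_def)
  ultimately show False by simp
qed

section \<open>Norm bound for polynomials and the continuous calculus\<close>

lemma op_poly_selfadjoint:
  assumes "op_selfadjoint A" shows "op_selfadjoint (op_poly q A)"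
proof (rule op_selfadjointI)
  show "op_poly q A \<in> bounded_ops" using assms by (auto simp: op_poly_eq_op_cpoly op_cpoly_def op_selfadjoint_def)
  show "cinner (blinfun_apply (op_poly q A) x) y = cinner x (blinfun_apply (op_poly q A) y)" for x y
    unfolding op_poly_def op_pow_def[symmetric]
    by (simp add: blinfun.sum_left blinfun_simps cinner_sum_left cinner_sum_right cinner_simps op_pow_selfadjoint[OF assms])
qed

text \<open>The norm of \<open>q(A)\<close> is up to sign a point \<open>l\<close> of its spectrum.
  If it exceeded \<open>M\<close>, then \<open>q - l\<close> would have no zero on the spectrum of
  \<open>A\<close> and \<open>q(A) - l\<close> would be invertible.\<close>

lemma norm_op_poly_le:
  assumes A: "op_selfadjoint A" and M: "M \<ge> 0"
    and q: "\<And>x. complex_of_real x \<in> op_spectrum A \<Longrightarrow> \<bar>poly q x\<bar> \<le> M"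
  shows "norm (op_poly q (A :: 'a::chilbert_space \<Rightarrow>\<^sub>L 'a)) \<le> M"
proof (cases "\<exists>x::'a. x \<noteq> 0")
  case False
  then have "op_poly q A = 0" by (intro blinfun_eqI) (metis)
  then show ?thesis using M by simp
next
  case True
  have AB: "A \<in> bounded_ops" using A by (simp add: op_selfadjoint_def)
  show ?thesis
  proof (rule ccontr)
    assume "\<not> ?thesis"
    then have gt: "norm (op_poly q A) > M" by simp
    obtain l where l: "\<bar>l\<bar> > M" "complex_of_real l \<in> op_spectrum (op_poly q A)"
    proof -
      from op_selfadjoint_norm_in_spectrum[OF op_poly_selfadjoint[OF A] True, of q] show thesis
        by (elim disjE; intro that[of "norm (op_poly q A)"] that[of "- norm (op_poly q A)"]) (use gt in auto)
    qed
    define p where "p = map_poly complex_of_real q - [:of_real l:]"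
    have pz: "poly p z \<noteq> 0" if z: "z \<in> op_spectrum A" for z
    proof -
      obtain x where x: "z = of_real x" using op_selfadjoint_spectrum_real[OF A] z by (auto elim: Reals_cases)
      have "poly p z = of_real (poly q x - l)" by (simp add: p_def x)
      moreover have "poly q x \<noteq> l" using q[of x] z x l by auto
      ultimately show ?thesis by (metis eq_iff_diff_eq_0 of_real_eq_0_iff)
    qed
    have "op_spectrum A \<noteq> {}" using op_selfadjoint_norm_in_spectrum[OF A True] by auto
    then have "p \<noteq> 0" using pz by auto
    then have "op_invertible (op_cpoly p A)" by (rule op_cpoly_invertible[OF AB]) (rule pz)
    also have "op_cpoly p A = op_poly q A - op_const (of_real l)"
      by (simp add: p_def op_cpoly_diff op_cpoly_const op_poly_eq_op_cpoly)
    finally have "op_invertible (op_scaleC (-1) (op_poly q A - op_const (of_real l)))"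
      using op_poly_selfadjoint[OF A] by (intro op_invertible_scaleC) (auto simp: op_selfadjoint_def)
    also have "op_scaleC (-1) (op_poly q A - op_const (of_real l)) = op_const (of_real l) - op_poly q A"
      by (rule blinfun_eqI) (simp add: blinfun_simps)
    finally show False using l by (simp add: op_spectrum_def)
  qed
qed

text \<open>A single approximating sequence settles the definite description: the norm bound applied
  to differences carries its limit over to every other sequence, and its existence keeps the
  quantifier over sequences from being vacuous, which gives uniqueness.\<close>

lemma cont_calc_eqI:
  assumes A: "op_selfadjoint A"
    and u: "uniform_limit {x. complex_of_real x \<in> op_spectrum A} (\<lambda>k. poly (p k)) f sequentially"
    and Y: "(\<lambda>k. op_poly (p k) A) \<longlonglongrightarrow> Y"
  shows "cont_calc f A = Y"
  unfolding cont_calc_def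
proof (rule the_equality)
  let ?S = "{x. complex_of_real x \<in> op_spectrum A}"
  show "\<forall>p. uniform_limit ?S (\<lambda>k. poly (p k)) f sequentially \<longrightarrow> (\<lambda>k. op_poly (p k) A) \<longlonglongrightarrow> Y"
  proof (intro allI impI)
    fix p' assume u': "uniform_limit ?S (\<lambda>k. poly (p' k :: real poly)) f sequentially"
    have "(\<lambda>k. op_poly (p' k) A - op_poly (p k) A) \<longlonglongrightarrow> 0"
    proof (rule tendstoI)
      fix e :: real assume e: "e > 0"
      have "\<forall>\<^sub>F k in sequentially. \<forall>x\<in>?S. dist (poly (p k) x) (f x) < e/4"
        "\<forall>\<^sub>F k in sequentially. \<forall>x\<in>?S. dist (poly (p' k) x) (f x) < e/4"
        by (rule uniform_limitD[OF u], use e in simp, rule uniform_limitD[OF u'], use e in simp)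
      then show "\<forall>\<^sub>F k in sequentially. dist (op_poly (p' k) A - op_poly (p k) A) 0 < e"
      proof eventually_elim
        case (elim k)
        have "norm (op_poly (p' k - p k) A) \<le> e/2"
        proof (rule norm_op_poly_le[OF A])
          fix x assume "complex_of_real x \<in> op_spectrum A"
          with elim have "dist (poly (p k) x) (f x) < e/4" "dist (poly (p' k) x) (f x) < e/4" by auto
          then show "\<bar>poly (p' k - p k) x\<bar> \<le> e/2" unfolding dist_real_def poly_diff by linarith
        qed (use e in simp)
        then show ?case using e by (simp add: op_poly_diff)
      qed
    qed
    from tendsto_add[OF this Y] show "(\<lambda>k. op_poly (p' k) A) \<longlonglongrightarrow> Y" by simp
  qed
  then show "Y' = Y" if "\<forall>p. uniform_limit ?S (\<lambda>k. poly (p k)) f sequentially \<longrightarrow> (\<lambda>k. op_poly (p k) A) \<longlonglongrightarrow> Y'" for Y'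
    using that u LIMSEQ_unique by blast
qed

section \<open>Convergent power series and their agreement with the continuous calculus\<close>

definition op_ps :: "(nat \<Rightarrow> complex) \<Rightarrow> ('a::chilbert_space \<Rightarrow>\<^sub>L 'a) \<Rightarrow> ('a \<Rightarrow>\<^sub>L 'a)" where
  "op_ps a T = (\<Sum>m. op_scaleC (a m) (op_pow T m))"

lemma op_ps_sums:
  assumes "summable (\<lambda>m. cmod (a m) * r ^ m)" "norm T \<le> r"
  shows "(\<lambda>m. op_scaleC (a m) (op_pow T m)) sums op_ps a T"
proof -
  have "norm (op_scaleC (a m) (op_pow T m)) \<le> cmod (a m) * r ^ m" for m
  proof -
    have "norm (op_scaleC (a m) (op_pow T m)) \<le> cmod (a m) * norm (op_pow T m)" by (rule norm_op_scaleC)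
    also have "\<dots> \<le> cmod (a m) * r ^ m"
      by (intro mult_left_mono order_trans[OF norm_op_pow] power_mono assms norm_ge_zero)
    finally show ?thesis .
  qed
  then have "summable (\<lambda>m. op_scaleC (a m) (op_pow T m))"
    by (intro summable_comparison_test'[OF assms(1), where N = 0]) auto
  then show ?thesis unfolding op_ps_def by (rule summable_sums)
qed

lemma op_ps_cinner_sums:
  assumes "summable (\<lambda>m. cmod (a m) * r ^ m)" "norm T \<le> r"
  shows "(\<lambda>m. a m * cinner (blinfun_apply (op_pow T m) x) y) sums cinner (blinfun_apply (op_ps a T) x) y"
proof -
  have "bounded_linear (\<lambda>T. cinner (blinfun_apply T x) y)"
    by (rule bounded_linear_compose[OF bounded_linear_cinner_left blinfun.bounded_linear_left])
  from bounded_linear.sums[OF this op_ps_sums[OF assms]] show ?thesis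
    by (simp add: blinfun_simps cinner_simps)
qed

lemma op_ps_bounded_ops:
  assumes "summable (\<lambda>m. cmod (a m) * r ^ m)" "norm T \<le> r" "T \<in> bounded_ops"
  shows "op_ps a T \<in> bounded_ops"
  using op_ps_sums[OF assms(1,2)] unfolding sums_def
  by (rule bounded_ops_limit[rotated]) (use assms in auto)

lemma op_poly_linear_power:
  assumes A: "A \<in> bounded_ops"
  shows "op_poly ([:- c, 1:] ^ m) A = op_pow (A - op_const (of_real c)) m"
proof -
  have lin: "map_poly complex_of_real ([:- c, 1:] * q) = [:- of_real c, 1:] * map_poly of_real q" for q
    by (rule poly_eqI) (simp add: coeff_map_poly coeff_pCons split: nat.split)
  have one: "map_poly complex_of_real 1 = [:1:]" by (rule poly_eqI) (simp add: coeff_map_poly coeff_pCons split: nat.split)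
  show ?thesis unfolding op_poly_eq_op_cpoly
    by (induction m)
      (simp_all only: one power_0 op_cpoly_const power_Suc lin op_cpoly_linear_mult[OF A] op_pow_0 op_pow_Suc,
       auto intro!: blinfun_eqI simp: blinfun_simps scaleC_one)
qed

lemma op_poly_add: "op_poly (p + q) A = op_poly p A + op_poly q A"
  using op_poly_diff[of "p + q" q A] by (simp add: algebra_simps)

lemma op_poly_smult: "op_poly (Polynomial.smult c p) A = c *\<^sub>R op_poly p A"
  by (cases "c = 0") (simp_all add: op_poly_def scaleR_sum_right)

text \<open>The partial sums are themselves polynomials, and the spectrum lies within
  \<open>r\<close> of \<open>c\<close>, so by the M-test they form an admissible approximating
  sequence.\<close>

lemma cont_calc_power_series:
  fixes a :: "nat \<Rightarrow> real"
  assumes A: "op_selfadjoint A"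
    and s: "summable (\<lambda>m. \<bar>a m\<bar> * r ^ m)" and n: "norm (A - op_const (of_real c)) \<le> r"
    and f: "\<And>x. \<bar>x - c\<bar> \<le> r \<Longrightarrow> (\<lambda>m. a m * (x - c) ^ m) sums f x"
  shows "cont_calc f A = op_ps (\<lambda>m. of_real (a m)) (A - op_const (of_real c))"
proof (rule cont_calc_eqI[OF A])
  have AB: "A \<in> bounded_ops" using A by (simp add: op_selfadjoint_def)
  define p where "p k = (\<Sum>m<k. Polynomial.smult (a m) ([:- c, 1:] ^ m))" for k
  let ?S = "{x. complex_of_real x \<in> op_spectrum A}"
  have S: "\<bar>x - c\<bar> \<le> r" if "x \<in> ?S" for x
  proof -
    have "complex_of_real x \<in> cball (of_real c) (norm (A - op_const (of_real c)))"
      using op_spectrum_subset_cball[OF AB] that by blast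
    then have "cmod (of_real (x - c)) \<le> r" using n by (simp add: dist_norm norm_minus_commute)
    then show ?thesis by (simp only: norm_of_real)
  qed
  have "uniform_limit ?S (\<lambda>k x. \<Sum>m<k. a m * (x - c) ^ m) (\<lambda>x. \<Sum>m. a m * (x - c) ^ m) sequentially"
    by (rule Weierstrass_m_test[OF _ s]) (auto simp: abs_mult power_abs intro!: mult_left_mono power_mono S)
  then show "uniform_limit ?S (\<lambda>k. poly (p k)) f sequentially"
  proof (rule uniform_limit_cong'[THEN iffD1, rotated -1])
    show "(\<Sum>m<k. a m * (x - c) ^ m) = poly (p k) x" for k x
      by (simp add: p_def poly_sum)
    show "(\<Sum>m. a m * (x - c) ^ m) = f x" if "x \<in> ?S" for x using f[OF S[OF that]] by (simp add: sums_iff)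
  qed
  have sum: "op_poly (p k) A = (\<Sum>m<k. a m *\<^sub>R op_pow (A - op_const (of_real c)) m)" for k
    unfolding p_def
    by (induction k) (simp_all add: op_poly_add op_poly_smult op_poly_linear_power[OF AB], simp add: op_poly_def)
  show "(\<lambda>k. op_poly (p k) A) \<longlonglongrightarrow> op_ps (\<lambda>m. of_real (a m)) (A - op_const (of_real c))"
    using op_ps_sums[of "\<lambda>m. of_real (a m)" r "A - op_const (of_real c)"] s n
    by (simp add: sum sums_def op_scaleC_of_real)
qed

section \<open>Contour integrals of the resolvent\<close>

text \<open>Norm continuity makes the operator-valued integrals along segments exist; the matrix
  coefficients give access to the scalar Cauchy theory, and operators are compared through them by
  \<open>op_eqI\<close>.\<close>

definition weakly_holomorphic_on :: "(complex \<Rightarrow> 'a::chilbert_space \<Rightarrow>\<^sub>L 'a) \<Rightarrow> complex set \<Rightarrow> bool" where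
  "weakly_holomorphic_on G S \<longleftrightarrow> continuous_on S G \<and>
     (\<forall>x y. (\<lambda>z. cinner (blinfun_apply (G z) x) y) holomorphic_on S)"

lemma bounded_linear_matrix_coeff: "bounded_linear (\<lambda>T. cinner (blinfun_apply T x) y)"
  by (rule bounded_linear_compose[OF bounded_linear_cinner_left blinfun.bounded_linear_left])

lemma op_eqI: "(\<And>x y. cinner (blinfun_apply S x) y = cinner (blinfun_apply T x) y) \<Longrightarrow> S = T"
  by (intro blinfun_eqI cinner_eqI)

definition op_segment_integral :: "(complex \<Rightarrow> 'a::chilbert_space \<Rightarrow>\<^sub>L 'a) \<Rightarrow> complex \<Rightarrow> complex \<Rightarrow> ('a \<Rightarrow>\<^sub>L 'a)" where
  "op_segment_integral G u v = integral {0..1} (\<lambda>t. op_scaleC (v - u) (G (linepath u v t)))"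

lemma segment_integrand_continuous:
  assumes "continuous_on S G" "closed_segment u v \<subseteq> S"
  shows "continuous_on {0..1} (\<lambda>t. op_scaleC (v - u) (G (linepath u v t)))"
proof -
  have "continuous_on {0..1} (\<lambda>t. G (linepath u v t))"
    by (rule continuous_on_compose2[OF assms(1)]) (use assms(2) in \<open>auto intro: continuous_on_linepath simp: linepath_in_path subset_iff\<close>)
  then show ?thesis
    by (intro bounded_bilinear.continuous_on[OF bounded_bilinear_op_scaleC] continuous_on_const)
qed

lemma op_segment_integral_cinner:
  assumes "continuous_on S G" "closed_segment u v \<subseteq> S"
  shows "((\<lambda>z. cinner (blinfun_apply (G z) x) y) has_contour_integral
     cinner (blinfun_apply (op_segment_integral G u v) x) y) (linepath u v)"
proof -
  have "((\<lambda>t. op_scaleC (v - u) (G (linepath u v t))) has_integral op_segment_integral G u v) {0..1}"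
    unfolding op_segment_integral_def
    by (intro integrable_integral integrable_continuous_interval segment_integrand_continuous[OF assms])
  from has_integral_linear[OF this bounded_linear_matrix_coeff[of x y]]
  have "((\<lambda>t. (v - u) * cinner (blinfun_apply (G (linepath u v t)) x) y) has_integral
      cinner (blinfun_apply (op_segment_integral G u v) x) y) {0..1}"
    by (simp add: o_def blinfun_simps cinner_simps)
  then show ?thesis
    unfolding has_contour_integral_def
    by (rule has_integral_eq[rotated]) (simp add: vector_derivative_linepath_within mult.commute)
qed

text \<open>Path independence of the segment integrals is tested on matrix coefficients, where
  scalar primitives exist; differentiability of \<open>P\<close> in operator norm then follows from
  continuity of \<open>G\<close>.\<close>

lemma weakly_holomorphic_local_primitive:
  assumes G: "weakly_holomorphic_on G (ball z0 r)"
  obtains P where "\<And>z. z \<in> ball z0 r \<Longrightarrow> (P has_derivative (\<lambda>h. op_scaleC h (G z))) (at z)"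
proof -
  let ?B = "ball z0 r"
  have cG: "continuous_on ?B G" using G by (simp add: weakly_holomorphic_on_def)
  define P where "P = op_segment_integral G z0"
  have seg: "closed_segment u v \<subseteq> ?B" if "u \<in> ?B" "v \<in> ?B" for u v
    using that by (simp add: closed_segment_subset)
  have diff: "P v - P u = op_segment_integral G u v" if u: "u \<in> ?B" and v: "v \<in> ?B" for u v
  proof (rule op_eqI)
    fix x y
    have z0: "z0 \<in> ?B" using u by (metis le_less_trans mem_ball zero_le_dist centre_in_ball)
    have hol: "(\<lambda>z. cinner (blinfun_apply (G z) x) y) holomorphic_on ?B"
      using G by (simp add: weakly_holomorphic_on_def)
    obtain p where p: "\<And>z. z \<in> ?B \<Longrightarrow> (p has_field_derivative cinner (blinfun_apply (G z) x) y) (at z within ?B)"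
      by (rule holomorphic_convex_primitive'[OF convex_ball open_ball hol]) blast
    have "cinner (blinfun_apply (op_segment_integral G s t) x) y = p t - p s" if st: "s \<in> ?B" "t \<in> ?B" for s t
    proof (rule has_contour_integral_unique[OF op_segment_integral_cinner[OF cG seg[OF st]]])
      show "((\<lambda>z. cinner (blinfun_apply (G z) x) y) has_contour_integral p t - p s) (linepath s t)"
        using contour_integral_primitive[OF p, of "linepath s t"] seg[OF st] by simp
    qed
    then show "cinner (blinfun_apply (P v - P u) x) y = cinner (blinfun_apply (op_segment_integral G u v) x) y"
      using u v z0 by (simp add: P_def blinfun_simps cinner_simps)
  qed
  have "(P has_derivative (\<lambda>h. op_scaleC h (G z))) (at z)" if z: "z \<in> ?B" for z
    unfolding has_derivative_at_alt
  proof (intro conjI allI impI)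
    show "bounded_linear (\<lambda>h. op_scaleC h (G z))"
      by (rule bounded_bilinear.bounded_linear_left[OF bounded_bilinear_op_scaleC])
    fix e :: real assume e: "e > 0"
    have "isCont G z" using cG z by (simp add: continuous_on_eq_continuous_at)
    then obtain d where d: "d > 0" "\<And>w. dist w z < d \<Longrightarrow> dist (G w) (G z) < e"
      using e unfolding continuous_at_eps_delta by blast
    obtain d' where d': "d' > 0" "ball z d' \<subseteq> ?B" using z openE[OF open_ball] by blast
    have "norm (P w - P z - op_scaleC (w - z) (G z)) \<le> e * norm (w - z)" if w: "norm (w - z) < min d d'" for w
    proof -
      have wB: "w \<in> ?B" using w by (intro subsetD[OF d'(2)]) (simp add: dist_norm norm_minus_commute)
      have cont: "continuous_on {0..1} (\<lambda>t. op_scaleC (w - z) (G (linepath z w t)))"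
        by (rule segment_integrand_continuous[OF cG seg[OF z wB]])
      have "P w - P z - op_scaleC (w - z) (G z) =
          integral {0..1} (\<lambda>t. op_scaleC (w - z) (G (linepath z w t)) - op_scaleC (w - z) (G z))"
        by (subst integral_diff) (auto intro: integrable_continuous_interval cont simp: diff[OF z wB] op_segment_integral_def)
      also have "norm \<dots> \<le> e * norm (w - z) * (1 - 0)"
      proof (rule integral_bound)
        fix t :: real assume t: "t \<in> {0..1}"
        have "norm (linepath z w t - z) \<le> norm (w - z)"
        proof -
          have "linepath z w t - z = t *\<^sub>R (w - z)" by (simp add: linepath_def algebra_simps scaleR_conv_of_real)
          then show ?thesis using t by (simp add: mult_left_le_one_le)
        qed
        then have "dist (G (linepath z w t)) (G z) < e" using w by (intro d) (simp add: dist_norm)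
        then have "norm (w - z) * norm (G (linepath z w t) - G z) \<le> norm (w - z) * e"
          by (intro mult_left_mono) (auto simp: dist_norm)
        then show "norm (op_scaleC (w - z) (G (linepath z w t)) - op_scaleC (w - z) (G z)) \<le> e * norm (w - z)"
          using norm_op_scaleC[of "w - z" "G (linepath z w t) - G z"]
          by (simp add: bounded_bilinear.diff_right[OF bounded_bilinear_op_scaleC] mult.commute)
      qed (auto intro!: continuous_intros cont)
      finally show ?thesis by simp
    qed
    then show "\<exists>d>0. \<forall>y. norm (y - z) < d \<longrightarrow> norm (P y - P z - op_scaleC (y - z) (G z)) \<le> e * norm (y - z)"
      using d(1) d'(1) by (intro exI[of _ "min d d'"]) auto
  qed
  then show ?thesis using that by blast
qed

text \<open>A valid path may have an unbounded derivative, so that continuity of the integrand along the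
  path does not suffice for integrability; the local primitives are needed.\<close>

lemma op_contour_integrable:
  assumes G: "weakly_holomorphic_on G S" and S: "open S" and g: "valid_path g" "path_image g \<subseteq> S"
  shows "(\<lambda>t. op_scaleC (vector_derivative g (at t within {0..1})) (G (g t))) integrable_on {0..1}"
proof -
  let ?f = "\<lambda>t. op_scaleC (vector_derivative g (at t within {0..1})) (G (g t))"
  obtain N where N: "finite N" "g C1_differentiable_on ({0..1} - N)" and cont: "continuous_on {0..1} g"
    using g(1) by (auto simp: valid_path_def piecewise_C1_differentiable_on_def)
  have "?f integrable_on cbox 0 1"
  proof (rule integrable_on_little_subintervals, rule ballI)
    fix t0 :: real assume t0: "t0 \<in> cbox 0 1"
    then have "g t0 \<in> S" using g(2) by (auto simp: path_image_def)
    then obtain r where r: "r > 0" "ball (g t0) r \<subseteq> S" using S by (meson openE)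
    have "weakly_holomorphic_on G (ball (g t0) r)"
      using G r by (auto simp: weakly_holomorphic_on_def intro: continuous_on_subset holomorphic_on_subset)
    then obtain P where P: "\<And>z. z \<in> ball (g t0) r \<Longrightarrow> (P has_derivative (\<lambda>h. op_scaleC h (G z))) (at z)"
      using weakly_holomorphic_local_primitive by blast
    obtain d where d: "d > 0" "\<And>t. t \<in> {0..1} \<Longrightarrow> dist t t0 < d \<Longrightarrow> dist (g t) (g t0) < r"
      using cont t0 r unfolding continuous_on_iff by (metis cbox_interval)
    have "?f integrable_on cbox u v" if uv: "t0 \<in> cbox u v" "cbox u v \<subseteq> ball t0 d" "cbox u v \<subseteq> cbox 0 1" for u v
    proof -
      have le: "u \<le> v" using uv(1) by auto
      have in_ball: "g t \<in> ball (g t0) r" if "t \<in> {u..v}" for t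
        using d(2)[of t] that uv(2,3) by (auto simp: dist_commute subset_iff)
      have sub: "{u..v} \<subseteq> {0..1}" using uv(3) by simp
      \<comment> \<open>The gauge integral integrates any derivative, bounded or not, and by
        continuity of \<open>P \<circ> g\<close> it tolerates the finite exceptional set
        \<open>N\<close>.\<close>
      have "(?f has_integral (P \<circ> g) v - (P \<circ> g) u) {u..v}"
      proof (rule fundamental_theorem_of_calculus_interior_strong[OF N(1) le])
        fix t assume t: "t \<in> {u<..<v} - N"
        then have t': "t \<in> {u..v}" "t \<in> {0..1} - N" "0 \<le> t" "t \<le> 1" using sub by auto
        have gd: "(g has_vector_derivative vector_derivative g (at t)) (at t)"
          using N(2) t'(2) by (auto simp: C1_differentiable_on_eq vector_derivative_works)
        have w: "vector_derivative g (at t within {0..1}) = vector_derivative g (at t)"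
          by (rule vector_derivative_at_within_ivl[OF gd]) (use t' in auto)
        have "(P \<circ> g has_derivative (\<lambda>h. op_scaleC (h *\<^sub>R vector_derivative g (at t)) (G (g t)))) (at t)"
          using diff_chain_at[OF gd[unfolded has_vector_derivative_def] P[OF in_ball[OF t'(1)]]]
          by (simp add: o_def)
        then show "(P \<circ> g has_vector_derivative ?f t) (at t)"
          unfolding has_vector_derivative_def w
          by (simp add: bounded_bilinear.scaleR_left[OF bounded_bilinear_op_scaleC])
      next
        have "continuous_on (ball (g t0) r) P"
          using P has_derivative_continuous by (blast intro: continuous_at_imp_continuous_on)
        then show "continuous_on {u..v} (P \<circ> g)"
          using in_ball sub cont
          by (intro continuous_on_compose continuous_on_subset[OF cont]) (auto intro: continuous_on_subset)
      qed
      then show ?thesis by (auto simp: integrable_on_def)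
    qed
    then show "\<exists>d>0. \<forall>u v. t0 \<in> cbox u v \<and> cbox u v \<subseteq> ball t0 d \<and> cbox u v \<subseteq> cbox 0 1 \<longrightarrow> ?f integrable_on cbox u v"
      using d(1) by blast
  qed
  then show ?thesis by simp
qed

lemma op_contour_integral_cinner:
  assumes "weakly_holomorphic_on G S" "open S" "valid_path g" "path_image g \<subseteq> S"
  shows "cinner (blinfun_apply (op_contour_integral g G) x) y =
    contour_integral g (\<lambda>z. cinner (blinfun_apply (G z) x) y)"
proof -
  have "((\<lambda>t. op_scaleC (vector_derivative g (at t within {0..1})) (G (g t))) has_integral op_contour_integral g G) {0..1}"
    unfolding op_contour_integral_def by (rule integrable_integral[OF op_contour_integrable[OF assms]])
  from has_integral_linear[OF this bounded_linear_matrix_coeff[of x y]]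
  have "((\<lambda>z. cinner (blinfun_apply (G z) x) y) has_contour_integral
      cinner (blinfun_apply (op_contour_integral g G) x) y) g"
    by (simp add: has_contour_integral_def o_def blinfun_simps cinner_simps mult.commute)
  then show ?thesis by (simp add: contour_integral_unique)
qed

lemma weakly_holomorphic_rsv:
  assumes X: "X \<in> bounded_ops" and f: "f holomorphic_on D"
  shows "weakly_holomorphic_on (\<lambda>z. op_scaleC (f z) (rsv X z)) (D - op_spectrum X)"
  unfolding weakly_holomorphic_on_def
proof (intro conjI allI)
  have fK: "f holomorphic_on (D - op_spectrum X)" using f by (rule holomorphic_on_subset) auto
  show "continuous_on (D - op_spectrum X) (\<lambda>z. op_scaleC (f z) (rsv X z))"
    by (intro bounded_bilinear.continuous_on[OF bounded_bilinear_op_scaleC] holomorphic_on_imp_continuous_on fK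
        continuous_on_subset[OF continuous_on_rsv[OF X]]) auto
  have h: "(\<lambda>z. cinner (blinfun_apply (rsv X z) x) y) holomorphic_on (D - op_spectrum X)" for x y
    by (rule holomorphic_on_subset[OF holomorphic_rsv[OF X bounded_linear_matrix_coeff]])
       (auto simp: blinfun_simps cinner_simps)
  show "(\<lambda>z. cinner (blinfun_apply (op_scaleC (f z) (rsv X z)) x) y) holomorphic_on (D - op_spectrum X)" for x y
    unfolding blinfun_simps cinner_simps by (intro holomorphic_on_mult fK h)
qed

definition op_cycle_integral ::
  "(complex \<Rightarrow> complex) \<Rightarrow> ('a::chilbert_space \<Rightarrow>\<^sub>L 'a) \<Rightarrow> (real \<Rightarrow> complex) list \<Rightarrow> ('a \<Rightarrow>\<^sub>L 'a)" where
  "op_cycle_integral f X \<Gamma> = (\<Sum>\<gamma>\<leftarrow>\<Gamma>. op_contour_integral \<gamma> (\<lambda>\<zeta>. op_scaleC (f \<zeta>) (rsv X \<zeta>)))"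

lemma op_hol_calc_eq_cycle_integral:
  "op_hol_calc D f X = op_scaleC (1 / (2 * of_real pi * \<i>))
     (op_cycle_integral f X (SOME \<Gamma>. surrounding_cycle D (op_spectrum X) \<Gamma>))"
  by (simp add: op_hol_calc_def op_cycle_integral_def rsv_def Let_def)

context
  fixes X :: "'a::chilbert_space \<Rightarrow>\<^sub>L 'a" and D f
  assumes X: "X \<in> bounded_ops" and D: "open D" "starlike D" and f: "f holomorphic_on D"
    and K: "op_spectrum X \<subseteq> D"
begin

lemma open_DK: "open (D - op_spectrum X)"
  using D(1) compact_op_spectrum[OF X] by (intro open_Diff compact_imp_closed)

lemma hol_integrand: "(\<lambda>z. f z * cinner (blinfun_apply (rsv X z) x) y) holomorphic_on (D - op_spectrum X)"
  using weakly_holomorphic_rsv[OF X f] by (simp add: weakly_holomorphic_on_def blinfun_simps cinner_simps)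

lemma op_cycle_integral_cinner:
  assumes "surrounding_cycle D (op_spectrum X) \<Gamma>"
  shows "cinner (blinfun_apply (op_cycle_integral f X \<Gamma>) x) y =
    (\<Sum>\<gamma>\<leftarrow>\<Gamma>. contour_integral \<gamma> (\<lambda>z. f z * cinner (blinfun_apply (rsv X z) x) y))"
proof -
  have "\<forall>\<gamma>\<in>set \<Gamma>. valid_path \<gamma> \<and> path_image \<gamma> \<subseteq> D - op_spectrum X"
    using assms by (simp add: surrounding_cycle_def)
  then show ?thesis
    unfolding op_cycle_integral_def
    by (induction \<Gamma>) (auto simp: blinfun_simps cinner_simps
        op_contour_integral_cinner[OF weakly_holomorphic_rsv[OF X f] open_DK])
qed

text \<open>The integral is formed in the space of real-linear operators, so complex linearity has
  to be recovered: on the cycle the resolvent is complex-linear, and scalars pass through the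
  contour integrals of its matrix coefficients.\<close>

lemma op_cycle_integral_bounded_ops:
  assumes "surrounding_cycle D (op_spectrum X) \<Gamma>"
  shows "op_cycle_integral f X \<Gamma> \<in> bounded_ops"
proof -
  have p: "valid_path \<gamma> \<and> path_image \<gamma> \<subseteq> D - op_spectrum X" if "\<gamma> \<in> set \<Gamma>" for \<gamma>
    using assms that by (simp add: surrounding_cycle_def)
  have scale: "contour_integral \<gamma> (\<lambda>z. f z * cinner (blinfun_apply (rsv X z) (scaleC c x)) y)
      = c * contour_integral \<gamma> (\<lambda>z. f z * cinner (blinfun_apply (rsv X z) x) y)" if g: "\<gamma> \<in> set \<Gamma>" for \<gamma> c x y
  proof -
    have "contour_integral \<gamma> (\<lambda>z. f z * cinner (blinfun_apply (rsv X z) (scaleC c x)) y)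
      = contour_integral \<gamma> (\<lambda>z. c * (f z * cinner (blinfun_apply (rsv X z) x) y))"
    proof (rule contour_integral_eq)
      fix z assume "z \<in> path_image \<gamma>"
      then have "z \<notin> op_spectrum X" using p[OF g] by auto
      then show "f z * cinner (blinfun_apply (rsv X z) (scaleC c x)) y = c * (f z * cinner (blinfun_apply (rsv X z) x) y)"
        by (simp add: bounded_opsD[OF rsv(1)] cinner_simps)
    qed
    also have "\<dots> = c * contour_integral \<gamma> (\<lambda>z. f z * cinner (blinfun_apply (rsv X z) x) y)"
      using p[OF g] by (intro contour_integral_lmul contour_integrable_holomorphic_simple[OF hol_integrand open_DK]) auto
    finally show ?thesis .
  qed
  have "cinner (blinfun_apply (op_cycle_integral f X \<Gamma>) (scaleC c x)) y
      = c * cinner (blinfun_apply (op_cycle_integral f X \<Gamma>) x) y" for c x y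
    unfolding op_cycle_integral_cinner[OF assms] sum_list_const_mult[symmetric]
    by (rule arg_cong[where f = sum_list], rule map_cong[OF refl scale])
  then have "blinfun_apply (op_cycle_integral f X \<Gamma>) (scaleC c x) = scaleC c (blinfun_apply (op_cycle_integral f X \<Gamma>) x)" for c x
    by (intro cinner_eqI) (simp only: cinner_scaleC_left)
  then show ?thesis unfolding bounded_ops_def by blast
qed

end

section \<open>Independence of the cycle\<close>

text \<open>The path is polynomial because differentiation under the integral asks for a bound on
  its derivative, which a valid path need not have.\<close>

lemma cauchy_transform_holomorphic:
  assumes q: "polynomial_function q" and S: "open S" "path_image q \<subseteq> S" and g: "g holomorphic_on S"
  shows "(\<lambda>z. contour_integral q (\<lambda>w. g w / (w - z))) holomorphic_on - path_image q"
proof -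
  have vq: "valid_path q" by (rule valid_path_polynomial_function[OF q])
  obtain q' where q': "polynomial_function q'" "\<And>t. (q has_vector_derivative q' t) (at t)"
    using has_vector_derivative_polynomial_function[OF q] by blast
  have "compact (q' ` {0..1})"
    using q'(1) by (intro compact_continuous_image continuous_on_polymonial_function) auto
  then obtain B where "\<And>t. t \<in> {0..1} \<Longrightarrow> norm (q' t) \<le> B"
    by (meson compact_imp_bounded bounded_iff imageI)
  then have B: "\<And>t. t \<in> {0..1} \<Longrightarrow> norm (vector_derivative q (at t)) \<le> B"
    by (simp add: vector_derivative_at[OF q'(2)])
  have int: "((\<lambda>u. g u / (u - w) ^ 1) has_contour_integral contour_integral q (\<lambda>u. g u / (u - w))) q"
    if w: "w \<in> UNIV - path_image q" for w
  proof -
    have "(\<lambda>u. g u / (u - w)) holomorphic_on S - {w}"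
      by (intro holomorphic_intros holomorphic_on_subset[OF g]) auto
    then have "(\<lambda>u. g u / (u - w)) contour_integrable_on q"
      using S w by (intro contour_integrable_holomorphic_simple[OF _ open_delete[OF S(1)] vq]) auto
    then show ?thesis by (simp add: has_contour_integral_integral)
  qed
  have cont: "continuous_on (path_image q) g"
    using g S by (meson continuous_on_subset holomorphic_on_imp_continuous_on)
  show ?thesis
  proof (rule holomorphic_onI)
    fix z assume "z \<in> - path_image q"
    then have "((\<lambda>z. contour_integral q (\<lambda>w. g w / (w - z))) has_field_derivative
        (of_nat 1 * contour_integral q (\<lambda>u. g u / (u - z) ^ Suc 1))) (at z)"
      by (intro Cauchy_next_derivative(2)[OF cont B int _ open_UNIV vq]) auto
    then show "(\<lambda>z. contour_integral q (\<lambda>w. g w / (w - z))) field_differentiable at z within - path_image q"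
      using field_differentiable_at_within field_differentiable_def by blast
  qed
qed

text \<open>Loops uniformly close to \<open>g\<close> have the same integrals of holomorphic
  functions, and polynomial ones come arbitrarily close.\<close>

lemma polynomial_loop_approx:
  assumes S: "open S" and g: "valid_path g" "pathfinish g = pathstart g" "path_image g \<subseteq> S"
  obtains q where "polynomial_function q" "pathfinish q = pathstart q" "path_image q \<subseteq> S"
    "\<And>h. h holomorphic_on S \<Longrightarrow> contour_integral q h = contour_integral g h"
proof -
  have pg: "path g" by (rule valid_path_imp_path[OF g(1)])
  from contour_integral_nearby_loops[OF S pg g(3)] obtain d where d: "d > 0"
      and near: "\<forall>g1 h. valid_path g1 \<and> valid_path h \<and>
        (\<forall>t\<in>{0..1}. cmod (g1 t - g t) < d \<and> cmod (h t - g t) < d) \<and>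
        pathfinish g1 = pathstart g1 \<and> pathfinish h = pathstart h \<longrightarrow>
        path_image g1 \<subseteq> S \<and> path_image h \<subseteq> S \<and>
        (\<forall>f. f holomorphic_on S \<longrightarrow> contour_integral h f = contour_integral g1 f)"
    by (elim exE conjE)
  obtain q where q: "polynomial_function q" "pathstart q = pathstart g" "pathfinish q = pathfinish g"
      "\<And>t. t \<in> {0..1} \<Longrightarrow> norm (q t - g t) < d"
    using path_approx_polynomial_function[OF pg d] by blast
  have "pathfinish q = pathstart q" using q g by simp
  moreover have "path_image g \<subseteq> S \<and> path_image q \<subseteq> S \<and>
      (\<forall>f. f holomorphic_on S \<longrightarrow> contour_integral q f = contour_integral g f)"
    using near[rule_format, of g q] by (simp add: q g d valid_path_polynomial_function)
  ultimately show ?thesis using that[OF q(1)] by blast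
qed

lemma continuous_on_sum_list:
  fixes g :: "'b \<Rightarrow> 'c::topological_space \<Rightarrow> 'd::topological_monoid_add"
  shows "(\<And>b. b \<in> set L \<Longrightarrow> continuous_on A (g b)) \<Longrightarrow> continuous_on A (\<lambda>z. \<Sum>b\<leftarrow>L. g b z)"
  by (induction L) (auto intro!: continuous_intros)

lemma holomorphic_on_sum_list:
  "(\<And>b. b \<in> set L \<Longrightarrow> g b holomorphic_on A) \<Longrightarrow> (\<lambda>z. \<Sum>b\<leftarrow>L. g b z) holomorphic_on A"
  by (induction L) (auto intro!: holomorphic_intros)

lemma sum_list_Ints: "(\<And>b. b \<in> set L \<Longrightarrow> g b \<in> \<int>) \<Longrightarrow> (\<Sum>b\<leftarrow>L. g b) \<in> \<int>"
  by (induction L) auto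

context
  fixes X :: "'a::chilbert_space \<Rightarrow>\<^sub>L 'a" and D f
  assumes X: "X \<in> bounded_ops" and D: "open D" "starlike D" and f: "f holomorphic_on D"
    and K: "op_spectrum X \<subseteq> D"
begin

text \<open>By the resolvent identity the Cauchy transform of \<open>f R x\<close> along the cycle is
  \<open>(2 \<pi> i f(z) - E) R(z) x\<close> near the spectrum, and it has no singularity there.\<close>

lemma cycle_integral_local_extension:
  assumes G: "surrounding_cycle D (op_spectrum X) \<Gamma>"
  obtains V where "open V" "op_spectrum X \<subseteq> V"
    "\<And>x y. \<exists>h. h holomorphic_on V \<and> (\<forall>z\<in>V - op_spectrum X.
        h z = 2 * of_real pi * \<i> * f z * cinner (blinfun_apply (rsv X z) x) y -
          cinner (blinfun_apply (op_cycle_integral f X \<Gamma>) (blinfun_apply (rsv X z) x)) y)"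
proof -
  let ?K = "op_spectrum X"
  note DK = open_DK[OF X D f K]
  note hol = hol_integrand[OF X D f K]
  have G': "valid_path \<gamma>" "pathfinish \<gamma> = pathstart \<gamma>" "path_image \<gamma> \<subseteq> D - ?K" if "\<gamma> \<in> set \<Gamma>" for \<gamma>
    using G that by (auto simp: surrounding_cycle_def)
  have "\<forall>\<gamma>\<in>set \<Gamma>. \<exists>q. polynomial_function q \<and> pathfinish q = pathstart q \<and> path_image q \<subseteq> D - ?K \<and>
      (\<forall>h. h holomorphic_on (D - ?K) \<longrightarrow> contour_integral q h = contour_integral \<gamma> h)"
  proof
    fix \<gamma> assume "\<gamma> \<in> set \<Gamma>"
    from polynomial_loop_approx[OF DK G'[OF this]] show "\<exists>q. polynomial_function q \<and> pathfinish q = pathstart q \<and> path_image q \<subseteq> D - ?K \<and>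
      (\<forall>h. h holomorphic_on (D - ?K) \<longrightarrow> contour_integral q h = contour_integral \<gamma> h)"
      by metis
  qed
  from bchoice[OF this] obtain q where q': "\<forall>\<gamma>\<in>set \<Gamma>. polynomial_function (q \<gamma>) \<and>
      pathfinish (q \<gamma>) = pathstart (q \<gamma>) \<and> path_image (q \<gamma>) \<subseteq> D - ?K \<and>
      (\<forall>h. h holomorphic_on (D - ?K) \<longrightarrow> contour_integral (q \<gamma>) h = contour_integral \<gamma> h)" ..
  have q: "polynomial_function (q \<gamma>)" "pathfinish (q \<gamma>) = pathstart (q \<gamma>)" "path_image (q \<gamma>) \<subseteq> D - ?K"
      "h holomorphic_on (D - ?K) \<Longrightarrow> contour_integral (q \<gamma>) h = contour_integral \<gamma> h"
    if "\<gamma> \<in> set \<Gamma>" for \<gamma> h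
    using q'[rule_format, OF that] by simp_all
  have vq: "valid_path (q \<gamma>)" "path (q \<gamma>)" if "\<gamma> \<in> set \<Gamma>" for \<gamma>
    using valid_path_polynomial_function[OF q(1)[OF that]] valid_path_imp_path by auto
  define P where "P = (\<Union>\<gamma>\<in>set \<Gamma>. path_image (q \<gamma>))"
  have PDK: "P \<subseteq> D - ?K" using q(3) by (auto simp: P_def)
  have "compact P" unfolding P_def by (intro compact_UN compact_path_image vq) auto
  then have openDP: "open (D - P)" using D(1) by (simp add: open_Diff compact_imp_closed)
  define N where "N z = (\<Sum>\<gamma>\<leftarrow>\<Gamma>. winding_number (q \<gamma>) z)" for z
  have contN: "continuous_on (D - P) N"
    unfolding N_def
    by (intro continuous_on_sum_list continuous_on_subset[OF continuous_on_winding_number] vq) (auto simp: P_def)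
  \<comment> \<open>The total winding number is continuous and integer-valued off the path images,
    so within distance 1/2 of 1 it equals 1; this yields an open set around the spectrum.\<close>
  define V where "V = (D - P) \<inter> N -` ball 1 (1/2)"
  have openV: "open V" unfolding V_def by (rule continuous_open_preimage[OF contN openDP]) simp
  have N1: "N z = 1" if "z \<in> V" for z
  proof -
    have "N z \<in> \<int>"
      unfolding N_def by (intro sum_list_Ints integer_winding_number vq q) (use that in \<open>auto simp: V_def P_def\<close>)
    then obtain n where n: "N z = of_int n" by (auto elim: Ints_cases)
    have "norm (complex_of_real (of_int (1 - n))) < 1/2" using that n by (simp add: V_def dist_norm)
    then have "\<bar>1 - n\<bar> < 1" unfolding norm_of_real by linarith
    then show ?thesis using n by simp
  qed
  have KV: "?K \<subseteq> V"
  proof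
    fix z assume z: "z \<in> ?K"
    have "winding_number (q \<gamma>) z = winding_number \<gamma> z" if g: "\<gamma> \<in> set \<Gamma>" for \<gamma>
    proof -
      have "(\<lambda>w. 1 / (w - z)) holomorphic_on D - ?K" using z by (intro holomorphic_intros) auto
      from q(4)[OF g this] show ?thesis
        using z G'[OF g] q(3)[OF g] vq[OF g]
        by (subst (1 2) winding_number_valid_path) auto
    qed
    then have "N z = (\<Sum>\<gamma>\<leftarrow>\<Gamma>. winding_number \<gamma> z)" unfolding N_def by (intro arg_cong[where f=sum_list] map_cong[OF refl])
    then have "N z = 1" using G z by (simp add: surrounding_cycle_def)
    then show "z \<in> V" using z K PDK by (auto simp: V_def)
  qed
  have ext: "\<exists>h. h holomorphic_on V \<and> (\<forall>z\<in>V - ?K.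
        h z = 2 * of_real pi * \<i> * f z * cinner (blinfun_apply (rsv X z) x) y -
          cinner (blinfun_apply (op_cycle_integral f X \<Gamma>) (blinfun_apply (rsv X z) x)) y)" for x y
  proof (intro exI conjI ballI)
    define g where "g x w = f w * cinner (blinfun_apply (rsv X w) x) y" for x w
    let ?h = "\<lambda>z. \<Sum>\<gamma>\<leftarrow>\<Gamma>. contour_integral (q \<gamma>) (\<lambda>w. g x w / (w - z))"
    have holg: "g x holomorphic_on D - ?K" for x unfolding g_def by (rule hol)
    show "?h holomorphic_on V"
      by (intro holomorphic_on_sum_list holomorphic_on_subset[OF cauchy_transform_holomorphic[OF q(1) DK q(3) holg]])
         (auto simp: V_def P_def)
    fix z assume z: "z \<in> V - ?K"
    define u where "u = blinfun_apply (rsv X z) x"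
    have "contour_integral (q \<gamma>) (\<lambda>w. g x w / (w - z)) =
       cinner u y * (2 * of_real pi * \<i> * winding_number (q \<gamma>) z * f z) - contour_integral \<gamma> (g u)"
      if ga: "\<gamma> \<in> set \<Gamma>" for \<gamma>
    proof -
      have zq: "z \<in> D" "z \<notin> path_image (q \<gamma>)" using z ga by (auto simp: V_def P_def)
      \<comment> \<open>Cauchy's formula is applied to each loop separately. A surrounding cycle
        only has total winding number 0 off \<open>D\<close>; that each single loop has it too is
        due to \<open>D\<close> being starlike.\<close>
      have C: "((\<lambda>w. f w / (w - z)) has_contour_integral
          complex_of_real (2 * pi) * \<i> * winding_number (q \<gamma>) z * f z) (q \<gamma>)"
      proof (rule Cauchy_integral_formula_global[OF D(1) f zq(1) vq(1)[OF ga] _ q(2)[OF ga]])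
        show "path_image (q \<gamma>) \<subseteq> D - {z}" using q(3)[OF ga] zq by auto
        show "winding_number (q \<gamma>) w = 0" if "w \<notin> D" for w
          using q(3)[OF ga] that
          by (intro simply_connected_imp_winding_number_zero[OF starlike_imp_simply_connected[OF D(2)] vq(2)[OF ga] _ q(2)[OF ga]]) auto
      qed
      have I: "g u contour_integrable_on q \<gamma>"
        by (rule contour_integrable_holomorphic_simple[OF holg DK vq(1)[OF ga] q(3)[OF ga]])
      have "contour_integral (q \<gamma>) (\<lambda>w. g x w / (w - z)) =
         contour_integral (q \<gamma>) (\<lambda>w. cinner u y * (f w / (w - z)) - g u w)"
      proof (rule contour_integral_eq)
        fix w assume w: "w \<in> path_image (q \<gamma>)"
        then have wz: "w \<noteq> z" "w \<notin> ?K" using zq q(3)[OF ga] by auto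
        have "rsv X w - rsv X z = op_scaleC (z - w) (rsv X w o\<^sub>L rsv X z)"
          by (rule resolvent_identity) (use wz z in auto)
        then have "blinfun_apply (rsv X w - rsv X z) x = blinfun_apply (op_scaleC (z - w) (rsv X w o\<^sub>L rsv X z)) x"
          by simp
        then have "blinfun_apply (rsv X w) x = u + scaleC (z - w) (blinfun_apply (rsv X w) u)"
          by (simp add: blinfun_simps u_def algebra_simps)
        then have "g x w = f w * (cinner u y + (z - w) * cinner (blinfun_apply (rsv X w) u) y)"
          unfolding g_def by (simp only: cinner_simps)
        then show "g x w / (w - z) = cinner u y * (f w / (w - z)) - g u w"
          using wz by (simp add: g_def field_simps)
      qed
      also have "\<dots> = cinner u y * contour_integral (q \<gamma>) (\<lambda>w. f w / (w - z)) - contour_integral (q \<gamma>) (g u)"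
      proof -
        have "(\<lambda>w. f w / (w - z)) contour_integrable_on q \<gamma>" using C contour_integrable_on_def by blast
        then show ?thesis
          by (simp only: contour_integral_diff[OF contour_integrable_lmul I] contour_integral_lmul)
      qed
      also have "contour_integral (q \<gamma>) (g u) = contour_integral \<gamma> (g u)" by (rule q(4)[OF ga holg])
      finally show ?thesis using contour_integral_unique[OF C] by simp
    qed
    then have "?h z = (\<Sum>\<gamma>\<leftarrow>\<Gamma>. cinner u y * (2 * of_real pi * \<i> * winding_number (q \<gamma>) z * f z) - contour_integral \<gamma> (g u))"
      by (intro arg_cong[where f=sum_list] map_cong[OF refl])
    also have "\<dots> = (\<Sum>\<gamma>\<leftarrow>\<Gamma>. (cinner u y * (2 * of_real pi * \<i> * f z)) * winding_number (q \<gamma>) z) - (\<Sum>\<gamma>\<leftarrow>\<Gamma>. contour_integral \<gamma> (g u))"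
      by (simp add: sum_list_subtractf mult_ac)
    also have "(\<Sum>\<gamma>\<leftarrow>\<Gamma>. (cinner u y * (2 * of_real pi * \<i> * f z)) * winding_number (q \<gamma>) z) = cinner u y * (2 * of_real pi * \<i> * f z)"
      using N1[of z] z by (simp only: sum_list_const_mult N_def[symmetric]) simp
    also have "(\<Sum>\<gamma>\<leftarrow>\<Gamma>. contour_integral \<gamma> (g u)) = cinner (blinfun_apply (op_cycle_integral f X \<Gamma>) u) y"
      unfolding op_cycle_integral_cinner[OF X D f K G] g_def ..
    finally show "?h z = 2 * of_real pi * \<i> * f z * cinner (blinfun_apply (rsv X z) x) y -
          cinner (blinfun_apply (op_cycle_integral f X \<Gamma>) (blinfun_apply (rsv X z) x)) y"
      by (simp add: u_def mult_ac)
  qed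
  show ?thesis using that[OF openV KV ext] .
qed

text \<open>In the difference of the two local extensions the term \<open>2 pi i f R\<close>
  cancels, so the matrix coefficients of \<open>E R(z)\<close> continue holomorphically across the
  spectrum. They tend to 0 at infinity, hence vanish, and \<open>R(z)\<close> is onto.\<close>

theorem cycle_integral_independent:
  assumes G1: "surrounding_cycle D (op_spectrum X) \<Gamma>1" and G2: "surrounding_cycle D (op_spectrum X) \<Gamma>2"
  shows "op_cycle_integral f X \<Gamma>1 = op_cycle_integral f X \<Gamma>2"
proof -
  let ?K = "op_spectrum X"
  define E where "E = op_cycle_integral f X \<Gamma>1 - op_cycle_integral f X \<Gamma>2"
  have EB: "E \<in> bounded_ops"
    unfolding E_def using op_cycle_integral_bounded_ops[OF X D f K] G1 G2 by simp
  obtain V1 where V1: "open V1" "?K \<subseteq> V1" "\<And>x y. \<exists>h. h holomorphic_on V1 \<and> (\<forall>z\<in>V1 - ?K.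
        h z = 2 * of_real pi * \<i> * f z * cinner (blinfun_apply (rsv X z) x) y -
          cinner (blinfun_apply (op_cycle_integral f X \<Gamma>1) (blinfun_apply (rsv X z) x)) y)"
    using cycle_integral_local_extension[OF G1] by blast
  obtain V2 where V2: "open V2" "?K \<subseteq> V2" "\<And>x y. \<exists>h. h holomorphic_on V2 \<and> (\<forall>z\<in>V2 - ?K.
        h z = 2 * of_real pi * \<i> * f z * cinner (blinfun_apply (rsv X z) x) y -
          cinner (blinfun_apply (op_cycle_integral f X \<Gamma>2) (blinfun_apply (rsv X z) x)) y)"
    using cycle_integral_local_extension[OF G2] by blast
  have zero: "cinner (blinfun_apply E (blinfun_apply (rsv X z) x)) y = 0" if z: "z \<notin> ?K" for x y z
  proof -
    define \<phi> where "\<phi> z = cinner (blinfun_apply E (blinfun_apply (rsv X z) x)) y" for z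
    obtain h1 h2 where h: "h1 holomorphic_on V1" "h2 holomorphic_on V2"
      "\<And>z. z \<in> V1 - ?K \<Longrightarrow> h1 z = 2 * of_real pi * \<i> * f z * cinner (blinfun_apply (rsv X z) x) y -
          cinner (blinfun_apply (op_cycle_integral f X \<Gamma>1) (blinfun_apply (rsv X z) x)) y"
      "\<And>z. z \<in> V2 - ?K \<Longrightarrow> h2 z = 2 * of_real pi * \<i> * f z * cinner (blinfun_apply (rsv X z) x) y -
          cinner (blinfun_apply (op_cycle_integral f X \<Gamma>2) (blinfun_apply (rsv X z) x)) y"
      using V1(3)[of x y] V2(3)[of x y] by blast
    define \<Phi> where "\<Phi> z = (if z \<in> ?K then h2 z - h1 z else \<phi> z)" for z
    have "\<phi> holomorphic_on - ?K"
      unfolding \<phi>_def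
    proof (rule holomorphic_rsv[OF X])
      show "bounded_linear (\<lambda>T. cinner (blinfun_apply E (blinfun_apply T x)) y)"
        by (intro bounded_linear_compose[OF bounded_linear_cinner_left]
            bounded_linear_compose[OF blinfun.bounded_linear_right] blinfun.bounded_linear_left)
    qed (simp add: blinfun_simps cinner_simps bounded_opsD[OF EB])
    then have "\<Phi> holomorphic_on - ?K" by (rule holomorphic_transform) (simp add: \<Phi>_def)
    moreover have "(\<lambda>z. h2 z - h1 z) holomorphic_on V1 \<inter> V2"
      by (intro holomorphic_intros holomorphic_on_subset[OF h(1)] holomorphic_on_subset[OF h(2)]) auto
    then have "\<Phi> holomorphic_on V1 \<inter> V2"
    proof (rule holomorphic_transform)
      fix z assume "z \<in> V1 \<inter> V2"
      then show "h2 z - h1 z = \<Phi> z"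
        using h(3)[of z] h(4)[of z] by (auto simp: \<Phi>_def \<phi>_def E_def blinfun_simps cinner_simps)
    qed
    ultimately have "\<Phi> holomorphic_on (- ?K) \<union> (V1 \<inter> V2)"
      using open_resolvent_set[OF X] V1(1) V2(1) by (intro holomorphic_on_Un open_Int) auto
    moreover have "(- ?K) \<union> (V1 \<inter> V2) = UNIV" using V1(2) V2(2) by auto
    ultimately have ent: "\<Phi> holomorphic_on UNIV" by simp
    have "(\<Phi> \<longlongrightarrow> 0) at_infinity"
      unfolding Lim_at_infinity
    proof (intro allI impI)
      fix e :: real assume e: "e > 0"
      define C where "C = norm E * norm x * norm y"
      have C: "C \<ge> 0" by (simp add: C_def)
      have "dist (\<Phi> w) 0 < e" if w: "norm X + C / e + 1 \<le> cmod w" for w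
      proof -
        have w': "norm X < cmod w" using w e C by (smt (verit) divide_nonneg_pos)
        then have "w \<notin> ?K" using op_spectrum_bound[OF X, of 0 w] by simp
        then have "cmod (\<Phi> w) \<le> norm (blinfun_apply E (blinfun_apply (rsv X w) x)) * norm y"
          using cinner_Cauchy_Schwarz by (simp add: \<Phi>_def \<phi>_def)
        also have "\<dots> \<le> norm E * (norm (rsv X w) * norm x) * norm y"
          by (intro mult_right_mono order_trans[OF norm_blinfun] mult_left_mono norm_blinfun norm_ge_zero)
        also have "\<dots> = C * norm (rsv X w)" by (simp add: C_def mult_ac)
        also have "\<dots> \<le> C * (1 / (cmod w - norm X))" by (intro mult_left_mono norm_rsv_le[OF X w'] C)
        also have "\<dots> < e"
        proof -
          have "C / e < cmod w - norm X" using w by linarith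
          then have "C < e * (cmod w - norm X)" using e by (simp add: divide_less_eq mult.commute)
          then show ?thesis using w' by (simp add: divide_less_eq)
        qed
        finally show ?thesis by simp
      qed
      then show "\<exists>b. \<forall>x. b \<le> norm x \<longrightarrow> dist (\<Phi> x) 0 < e" by blast
    qed
    from Liouville_weak_0[OF ent this, of z] show ?thesis using z by (simp add: \<Phi>_def \<phi>_def)
  qed
  define z where "z = complex_of_real (norm X + 1)"
  have "cmod z = norm X + 1" unfolding z_def norm_of_real by simp
  then have z: "z \<notin> ?K" using op_spectrum_bound[OF X, of 0 z] by simp
  have "E = 0"
  proof (rule op_eqI)
    fix x y
    show "cinner (blinfun_apply E x) y = cinner (blinfun_apply 0 x) y"
      using zero[OF z, of "blinfun_apply (op_const z - X) x" y] by (simp add: rsv(3)[OF z])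
  qed
  then show ?thesis by (simp add: E_def)
qed

end

section \<open>The holomorphic calculus as a Taylor series\<close>

definition taylor_coeff :: "(complex \<Rightarrow> complex) \<Rightarrow> complex \<Rightarrow> nat \<Rightarrow> complex" where
  "taylor_coeff f c m = (deriv ^^ m) f c / fact m"

lemma taylor_sums:
  assumes "f holomorphic_on ball c r" "cmod (w - c) < r"
  shows "(\<lambda>m. taylor_coeff f c m * (w - c) ^ m) sums f w"
  unfolding taylor_coeff_def
  by (rule holomorphic_power_series[OF assms(1)]) (use assms(2) in \<open>simp add: dist_norm norm_minus_commute\<close>)

lemma taylor_summable:
  assumes f: "f holomorphic_on ball c r" and s: "0 \<le> s" "s < r"
  shows "summable (\<lambda>m. cmod (taylor_coeff f c m) * s ^ m)"
proof -
  define t where "t = (s + r) / 2"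
  have t: "s < t" "t < r" "0 < t" using s by (auto simp: t_def)
  have "summable (\<lambda>m. taylor_coeff f c m * of_real t ^ m)"
    using taylor_sums[OF f, of "c + of_real t"] t by (auto simp: sums_iff)
  from powser_insidea[OF this, of "of_real s"] show ?thesis
    using s t by (simp add: norm_mult norm_power)
qed

text \<open>Makes the choice in \<open>op_hol_calc\<close> meaningful and supplies the cycle on
  which it is evaluated.\<close>

lemma surrounding_circlepath:
  assumes X: "X \<in> bounded_ops" and D: "ball c r \<subseteq> D" and s: "norm (X - op_const c) < s" "s < r"
  shows "surrounding_cycle D (op_spectrum X) [circlepath c s]"
proof -
  have s0: "s > 0" using s(1) norm_ge_zero[of "X - op_const c"] by linarith
  have K: "op_spectrum X \<subseteq> ball c s"
    using op_spectrum_subset_cball[OF X, of c] s by fastforce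
  have "winding_number (circlepath c s) z = 0" if "z \<notin> D" for z
    by (rule winding_number_zero_outside[where s = "cball c s"]) (use that D s s0 in \<open>auto simp: subset_iff\<close>)
  moreover have "winding_number (circlepath c s) z = 1" if "z \<in> op_spectrum X" for z
    by (rule winding_number_circlepath) (use K that in \<open>auto simp: dist_norm norm_minus_commute\<close>)
  moreover have "sphere c s \<subseteq> D - op_spectrum X" using K D s by (auto simp: subset_iff)
  ultimately show ?thesis using s0 by (simp add: surrounding_cycle_def)
qed

text \<open>On the circle the Neumann series of the resolvent about \<open>c\<close> converges
  uniformly, and Cauchy's formula for the \<open>m\<close>-th derivative integrates its
  \<open>m\<close>-th term against \<open>f\<close> to the Taylor coefficient.\<close>

theorem op_hol_calc_power_series:
  assumes X: "X \<in> bounded_ops" and D: "open D" "starlike D" and f: "f holomorphic_on D"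
    and r: "ball c r \<subseteq> D" "norm (X - op_const c) < r"
  shows "op_hol_calc D f X = op_ps (taylor_coeff f c) (X - op_const c)"
proof -
  let ?T = "X - op_const c"
  define s where "s = (norm ?T + r) / 2"
  have s: "norm ?T < s" "s < r" using r by (auto simp: s_def)
  have s0: "s > 0" using s(1) norm_ge_zero[of ?T] by linarith
  have TB: "?T \<in> bounded_ops" using X by simp
  have fr: "f holomorphic_on ball c r" by (rule holomorphic_on_subset[OF f r(1)])
  have K: "op_spectrum X \<subseteq> D" using op_spectrum_subset_cball[OF X, of c] r by fastforce
  have circ: "surrounding_cycle D (op_spectrum X) [circlepath c s]"
    by (rule surrounding_circlepath[OF X r(1) s])
  then have "surrounding_cycle D (op_spectrum X) (SOME \<Gamma>. surrounding_cycle D (op_spectrum X) \<Gamma>)"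
    by (rule someI)
  then have "op_hol_calc D f X = op_scaleC (1 / (2 * of_real pi * \<i>)) (op_cycle_integral f X [circlepath c s])"
    unfolding op_hol_calc_eq_cycle_integral using cycle_integral_independent[OF X D f K _ circ] by simp
  also have "\<dots> = op_ps (taylor_coeff f c) ?T"
  proof (rule op_eqI)
    fix x y
    let ?\<tau> = "\<lambda>m. cinner (blinfun_apply (op_pow ?T m) x) y"
    have cf: "continuous_on (cball c s) f"
      using fr s by (intro holomorphic_on_imp_continuous_on holomorphic_on_subset[OF fr]) auto
    then have "compact (f ` sphere c s)" by (intro compact_continuous_image) (auto intro: continuous_on_subset)
    then have "bounded (f ` sphere c s)" by (rule compact_imp_bounded)
    then obtain B where "\<forall>v\<in>f ` sphere c s. cmod v \<le> B" unfolding bounded_iff by blast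
    then have B: "cmod (f w) \<le> B" if "w \<in> sphere c s" for w using that by blast
    have "c + of_real s \<in> sphere c s" using s0 by (simp add: dist_norm)
    then have B0: "B \<ge> 0" using B order_trans[OF norm_ge_zero] by blast
    have \<tau>: "cmod (?\<tau> m) \<le> norm ?T ^ m * norm x * norm y" for m
      by (rule order_trans[OF cinner_Cauchy_Schwarz], intro mult_right_mono order_trans[OF norm_blinfun] norm_op_pow norm_ge_zero)
    define t where "t m w = f w / (w - c) ^ Suc m * ?\<tau> m" for m w
    have tB: "norm (t m w) \<le> B / s * norm x * norm y * (norm ?T / s) ^ m" if w: "w \<in> sphere c s" for m w
    proof -
      have ws: "cmod (w - c) = s" using w by (simp add: dist_norm norm_minus_commute)
      have "norm (t m w) = cmod (f w) / s ^ Suc m * cmod (?\<tau> m)"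
        unfolding t_def norm_mult norm_divide norm_power ws ..
      also have "\<dots> \<le> B / s ^ Suc m * (norm ?T ^ m * norm x * norm y)"
        using s0 B0 by (intro mult_mono divide_right_mono B w \<tau>) auto
      also have "\<dots> = B / s * norm x * norm y * (norm ?T / s) ^ m" by (simp add: power_divide)
      finally show ?thesis .
    qed
    have ul: "uniform_limit (sphere c s) (\<lambda>n w. \<Sum>m<n. t m w) (\<lambda>w. \<Sum>m. t m w) sequentially"
      by (rule Weierstrass_m_test[OF tB]) (use s s0 in \<open>auto intro!: summable_mult summable_geometric simp: divide_less_eq\<close>)
    have lim: "(\<Sum>m. t m w) = f w * cinner (blinfun_apply (rsv X w) x) y" if w: "w \<in> sphere c s" for w
    proof -
      have ws: "cmod (w - c) = s" using w by (simp add: dist_norm norm_minus_commute)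
      obtain S where S: "(\<lambda>m. op_scaleC (1 / (w - c) ^ Suc m) (op_pow ?T m)) sums S"
          "op_inverse_of (op_const (w - c) - ?T) S"
        using neumann_series[OF TB, of "w - c"] s ws by auto
      have "rsv X w = S" using S(2) by (intro rsv_eqI) (simp add: op_const_diff)
      moreover from bounded_linear.sums[OF bounded_linear_matrix_coeff[of x y] S(1)]
      have "(\<lambda>m. f w * (1 / (w - c) ^ Suc m * ?\<tau> m)) sums (f w * cinner (blinfun_apply S x) y)"
        by (intro sums_mult) (simp add: blinfun_simps cinner_simps)
      ultimately show ?thesis by (simp add: sums_iff t_def)
    qed
    have fs: "f holomorphic_on ball c s" using s by (intro holomorphic_on_subset[OF fr]) auto
    have ti: "(t m has_contour_integral 2 * of_real pi * \<i> * taylor_coeff f c m * ?\<tau> m) (circlepath c s)" for m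
      unfolding t_def
      using has_contour_integral_rmul[OF Cauchy_has_contour_integral_higher_derivative_circlepath[OF cf fs centre_in_ball[THEN iffD2, OF s0], of m], of "?\<tau> m"]
      by (simp add: taylor_coeff_def mult_ac)
    have si: "((\<lambda>w. \<Sum>m<n. t m w) has_contour_integral (\<Sum>m<n. 2 * of_real pi * \<i> * taylor_coeff f c m * ?\<tau> m)) (circlepath c s)" for n
      by (intro has_contour_integral_sum ti) auto
    have "(\<lambda>n. contour_integral (circlepath c s) (\<lambda>w. \<Sum>m<n. t m w)) \<longlonglongrightarrow>
        contour_integral (circlepath c s) (\<lambda>w. \<Sum>m. t m w)"
    proof (rule contour_integral_uniform_limit_circlepath(2)[OF _ ul _ s0])
      show "\<forall>\<^sub>F n in sequentially. (\<lambda>w. \<Sum>m<n. t m w) contour_integrable_on circlepath c s"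
        by (intro always_eventually allI has_contour_integral_integrable[OF si])
    qed simp
    also have "contour_integral (circlepath c s) (\<lambda>w. \<Sum>m. t m w) =
        contour_integral (circlepath c s) (\<lambda>w. f w * cinner (blinfun_apply (rsv X w) x) y)"
      by (rule contour_integral_eq) (use lim s0 in auto)
    also have "\<dots> = cinner (blinfun_apply (op_cycle_integral f X [circlepath c s]) x) y"
      using op_cycle_integral_cinner[OF X D f K circ] by simp
    finally have "(\<lambda>m. 2 * of_real pi * \<i> * taylor_coeff f c m * ?\<tau> m) sums
        cinner (blinfun_apply (op_cycle_integral f X [circlepath c s]) x) y"
      unfolding contour_integral_unique[OF si] sums_def .
    moreover have "(\<lambda>m. 2 * of_real pi * \<i> * (taylor_coeff f c m * ?\<tau> m)) sums
        (2 * of_real pi * \<i> * cinner (blinfun_apply (op_ps (taylor_coeff f c) ?T) x) y)"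
      by (intro sums_mult op_ps_cinner_sums[OF taylor_summable[OF fr, of s]]) (use s s0 in auto)
    ultimately have "cinner (blinfun_apply (op_cycle_integral f X [circlepath c s]) x) y =
        2 * of_real pi * \<i> * cinner (blinfun_apply (op_ps (taylor_coeff f c) ?T) x) y"
      by (simp add: sums_iff mult.assoc)
    then show "cinner (blinfun_apply (op_scaleC (1 / (2 * of_real pi * \<i>)) (op_cycle_integral f X [circlepath c s])) x) y
       = cinner (blinfun_apply (op_ps (taylor_coeff f c) ?T) x) y"
      by (simp add: blinfun_simps cinner_simps)
  qed
  finally show ?thesis .
qed

section \<open>The slit domain and the Poisson formula\<close>

lemma mem_slit_domain: "z \<in> slit_domain S \<longleftrightarrow> Im z \<noteq> 0 \<or> Re z \<in> S"
proof -
  have "z \<in> complex_of_real ` S \<longleftrightarrow> Im z = 0 \<and> Re z \<in> S" by (auto simp: image_iff complex_eq_iff)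
  then show ?thesis by (auto simp: slit_domain_def complex_is_Real_iff)
qed

lemma open_slit_domain: assumes "open S" shows "open (slit_domain S)"
proof -
  have "slit_domain S = - (Im -` {0}) \<union> Re -` S" by (auto simp: mem_slit_domain)
  moreover have "open (- (Im -` {0}))"
    by (intro open_Compl closed_vimage continuous_intros)
  moreover have "open (Re -` S)" by (intro open_vimage assms continuous_intros)
  ultimately show ?thesis by (simp only: open_Un)
qed

text \<open>The star centre is real: a segment from it to a non-real point leaves the axis at once,
  and one to a point of \<open>S\<close> stays in the interval.\<close>

lemma starlike_slit_domain:
  assumes S: "is_interval S" "c \<in> S" shows "starlike (slit_domain S)"
  unfolding starlike_def
proof (intro bexI ballI subsetI)
  show "complex_of_real c \<in> slit_domain S" using S by (simp add: mem_slit_domain)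
  fix x z assume x: "x \<in> slit_domain S" and z: "z \<in> closed_segment (complex_of_real c) x"
  obtain u where u: "0 \<le> u" "u \<le> 1" "z = (1 - u) *\<^sub>R complex_of_real c + u *\<^sub>R x"
    using z by (auto simp: closed_segment_def)
  show "z \<in> slit_domain S"
  proof (cases "Im x = 0 \<or> u = 0")
    case False
    then show ?thesis by (simp add: mem_slit_domain u(3))
  next
    case True
    have "convex S" using S(1) by (rule is_interval_convex)
    then have "u = 0 \<or> (1 - u) * c + u * Re x \<in> S"
      using True x S u convexD[of S c "Re x" "1 - u" u] by (auto simp: mem_slit_domain)
    then show ?thesis using S by (auto simp: mem_slit_domain u(3))
  qed
qed

lemma ball_subset_slit_domain:
  assumes "{c - r<..<c + r} \<subseteq> S" shows "ball (complex_of_real c) r \<subseteq> slit_domain S"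
proof
  fix z assume z: "z \<in> ball (complex_of_real c) r"
  have "\<bar>Re (z - of_real c)\<bar> < r"
    using z abs_Re_le_cmod[of "z - of_real c"] by (simp add: dist_norm norm_minus_commute)
  then have "Re z \<in> {c - r<..<c + r}" by (auto simp: abs_less_iff)
  then show "z \<in> slit_domain S" using assms by (auto simp: mem_slit_domain)
qed

lemma ball_subset_upper_half_plane: "ball (\<i> * complex_of_real R) R \<subseteq> upper_half_plane"
proof
  fix z assume z: "z \<in> ball (\<i> * complex_of_real R) R"
  have "\<bar>Im (z - \<i> * of_real R)\<bar> < R"
    using z abs_Im_le_cmod[of "z - \<i> * of_real R"] by (simp add: dist_norm norm_minus_commute)
  then show "z \<in> upper_half_plane" by (auto simp: upper_half_plane_def)
qed

lemma upper_half_plane_subset_slit_domain: "upper_half_plane \<subseteq> slit_domain S"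
  by (auto simp: upper_half_plane_def mem_slit_domain)

lemma reflect_ext_upper: "0 \<le> Im z \<Longrightarrow> reflect_ext F z = F z"
  by (simp add: reflect_ext_def)

lemma reflect_ext_holomorphic:
  assumes S: "open S" and F_cont: "continuous_on (upper_half_plane \<union> complex_of_real ` S) F"
    and F_hol: "F analytic_on upper_half_plane"
    and F_eq: "\<And>x. x \<in> S \<Longrightarrow> F (complex_of_real x) = complex_of_real (f x)"
  shows "reflect_ext F holomorphic_on slit_domain S"
proof -
  have "(\<lambda>z. if 0 \<le> Im z then F z else cnj (F (cnj z))) holomorphic_on slit_domain S"
  proof (rule Schwarz_reflection)
    show "open (slit_domain S)" by (rule open_slit_domain[OF S])
    show "cnj ` slit_domain S \<subseteq> slit_domain S" by (auto simp: mem_slit_domain)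
    show "F holomorphic_on (slit_domain S \<inter> {z. 0 < Im z})"
      by (rule holomorphic_on_subset[OF analytic_imp_holomorphic[OF F_hol]]) (auto simp: upper_half_plane_def)
    show "continuous_on (slit_domain S \<inter> {z. 0 \<le> Im z}) F"
    proof (rule continuous_on_subset[OF F_cont], rule subsetI)
      fix z assume z: "z \<in> slit_domain S \<inter> {z. 0 \<le> Im z}"
      then have "0 < Im z \<or> Im z = 0 \<and> Re z \<in> S" by (auto simp: mem_slit_domain)
      then show "z \<in> upper_half_plane \<union> complex_of_real ` S"
        by (auto simp: upper_half_plane_def image_iff complex_eq_iff)
    qed
    show "F z \<in> \<real>" if "z \<in> slit_domain S" "z \<in> \<real>" for z
    proof -
      have "Re z \<in> S" "z = of_real (Re z)" using that by (auto simp: mem_slit_domain complex_is_Real_iff complex_eq_iff)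
      then show ?thesis using F_eq by (metis Reals_of_real)
    qed
  qed
  then show ?thesis unfolding reflect_ext_def .
qed

text \<open>With \<open>T = X - c\<close> and \<open>w\<close> on the circle, \<open>k(w) = 2 Re \<langle>(w - c) R(w) x, x\<rangle> - \<parallel>x\<parallel>\<^sup>2\<close> is the
  operator-valued Poisson kernel. The term conjugate to the resolvent is on the circle a power series in
  \<open>w - c\<close>, so by Cauchy's formula it only contributes \<open>g(c) \<parallel>x\<parallel>\<^sup>2\<close>.\<close>

lemma poisson_lower_bound:
  assumes X: "X \<in> bounded_ops" and D: "open D" "starlike D" and g: "g holomorphic_on D"
    and r: "ball c r \<subseteq> D" and s: "norm (X - op_const c) < s" "s < r"
    and low: "\<And>w. w \<in> sphere c s \<Longrightarrow> \<kappa> \<le> Im (g w)" and \<kappa>: "\<kappa> \<ge> 0"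
  shows "\<kappa> * ((s - norm (X - op_const c)) / (s + norm (X - op_const c)) * (norm x)\<^sup>2) \<le>
    Im (cinner (blinfun_apply (op_hol_calc D g X) x) x)"
proof -
  define T where "T = X - op_const c"
  let ?N = "norm T"
  have TB: "T \<in> bounded_ops" using X by (simp add: T_def)
  have sN: "?N < s" using s by (simp add: T_def)
  have s0: "s > 0" using sN norm_ge_zero[of T] by linarith
  have K: "op_spectrum X \<subseteq> ball c s"
    using op_spectrum_subset_cball[OF X, of c] s by (auto simp: subset_iff)
  have KD: "op_spectrum X \<subseteq> D" using K r s by (auto simp: subset_iff)
  have circ: "surrounding_cycle D (op_spectrum X) [circlepath c s]"
    by (rule surrounding_circlepath[OF X r s])
  then have "surrounding_cycle D (op_spectrum X) (SOME \<Gamma>. surrounding_cycle D (op_spectrum X) \<Gamma>)"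
    by (rule someI)
  then have calc: "op_hol_calc D g X = op_scaleC (1 / (2 * of_real pi * \<i>)) (op_cycle_integral g X [circlepath c s])"
    unfolding op_hol_calc_eq_cycle_integral using cycle_integral_independent[OF X D g KD _ circ] by simp
  define \<tau> where "\<tau> m = cinner (blinfun_apply (op_pow T m) x) x" for m
  define p where "p w = (w - c) * cinner (blinfun_apply (rsv X w) x) x" for w
  define u where "u = (?N + s) / 2"
  have u: "?N < u" "u < s" "u > 0" using sN norm_ge_zero[of T] s0 by (auto simp: u_def add_nonneg_pos)
  \<comment> \<open>The series \<open>q\<close> below converges for
    \<open>|w - c| < s^2 / |T|\<close>; this radius lies between \<open>s\<close> and that bound,
    which makes \<open>q\<close> holomorphic on a neighbourhood of the closed disc.\<close>
  define r2 where "r2 = s^2 / u"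
  have r2: "s < r2" "?N * r2 < s^2"
  proof -
    show "s < r2" using u s0 by (simp add: r2_def less_divide_eq power2_eq_square)
    have "?N * s^2 < u * s^2" using u s0 by simp
    then show "?N * r2 < s^2" using u by (simp add: r2_def divide_less_eq mult.commute)
  qed
  have \<tau>: "cmod (\<tau> m) \<le> ?N ^ m * (norm x)^2" for m
  proof -
    have "cmod (\<tau> m) \<le> norm (blinfun_apply (op_pow T m) x) * norm x" unfolding \<tau>_def by (rule cinner_Cauchy_Schwarz)
    also have "\<dots> \<le> ?N ^ m * norm x * norm x"
      by (intro mult_right_mono order_trans[OF norm_blinfun] norm_op_pow norm_ge_zero)
    finally show ?thesis by (simp add: power2_eq_square mult.assoc)
  qed
  \<comment> \<open>On the circle \<open>cnj (w - c) = s^2 / (w - c)\<close>, which turns the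
    conjugate of \<open>\<tau> m / (w - c)^m\<close> into \<open>b m * (w - c)^m\<close>.\<close>
  define b where "b m = cnj (\<tau> m) / of_real (s ^ (2 * m))" for m
  define q where "q w = (\<Sum>m. b m * (w - c) ^ m)" for w
  have q: "(\<lambda>m. b m * (w - c) ^ m) sums q w" if w: "w \<in> ball c r2" for w
  proof -
    let ?\<rho> = "?N * cmod (w - c) / s^2"
    have wr: "cmod (w - c) \<le> r2" using w by (simp add: dist_norm norm_minus_commute)
    have "?N * cmod (w - c) \<le> ?N * r2" by (intro mult_left_mono wr) simp
    then have "norm ?\<rho> < 1" using r2 s0 by (simp add: divide_less_eq)
    then have sg: "summable (\<lambda>m. (norm x)^2 * ?\<rho> ^ m)" by (intro summable_mult summable_geometric)
    have "norm (b m * (w - c) ^ m) \<le> (norm x)^2 * ?\<rho> ^ m" for m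
    proof -
      have "norm (b m * (w - c) ^ m) = cmod (\<tau> m) * (cmod (w - c) ^ m / (s^2) ^ m)"
        using s0 by (simp add: b_def norm_mult norm_divide norm_power power_mult)
      also have "\<dots> \<le> ?N ^ m * (norm x)^2 * (cmod (w - c) ^ m / (s^2) ^ m)"
        by (intro mult_right_mono \<tau>) simp
      also have "\<dots> = (norm x)^2 * ?\<rho> ^ m" by (simp add: power_divide power_mult_distrib)
      finally show ?thesis .
    qed
    then have "summable (\<lambda>m. b m * (w - c) ^ m)"
      by (rule summable_comparison_test'[where N = 0, OF sg])
    then show ?thesis unfolding q_def by (rule summable_sums)
  qed
  have hq: "q holomorphic_on ball c r2" by (rule power_series_holomorphic[OF q])
  have q0: "q c = (norm x)^2"
  proof -
    have "q c = b 0" unfolding q_def by (simp only: diff_self powser_zero)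
    then show ?thesis by (simp add: b_def \<tau>_def cinner_self flip: of_real_power)
  qed
  define k where "k w = 2 * Re (p w) - (norm x)^2" for w
  have pq: "p w + q w - (norm x)^2 = of_real (k w)" and kb: "(s - ?N) / (s + ?N) * (norm x)^2 \<le> k w"
    if w: "w \<in> sphere c s" for w
  proof -
    have ws: "cmod (w - c) = s" using w by (simp add: dist_norm norm_minus_commute)
    then have wc: "w - c \<noteq> 0" using s0 by auto
    have wK: "w \<notin> op_spectrum X" using K w by auto
    obtain R where R: "(\<lambda>m. op_scaleC (1 / (w - c) ^ Suc m) (op_pow T m)) sums R"
          "op_inverse_of (op_const (w - c) - T) R"
      using neumann_series[OF TB, of "w - c"] sN ws by auto
    have "rsv X w = R" using R(2) by (intro rsv_eqI) (simp add: op_const_diff T_def)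
    from bounded_linear.sums[OF bounded_linear_matrix_coeff[of x x] R(1)] this
    have "(\<lambda>m. (w - c) * (1 / (w - c) ^ Suc m * \<tau> m)) sums p w"
      unfolding p_def by (intro sums_mult) (simp add: blinfun_simps cinner_simps \<tau>_def)
    then have "(\<lambda>m. cnj (\<tau> m / (w - c) ^ m)) sums cnj (p w)"
      using wc by (intro sums_cnj[THEN iffD2]) simp
    also have "(\<lambda>m. cnj (\<tau> m / (w - c) ^ m)) = (\<lambda>m. b m * (w - c) ^ m)"
    proof
      fix m
      have "(w - c) * cnj (w - c) = of_real (s^2)" using complex_norm_square[of "w - c"] unfolding ws by (rule sym)
      then have "((w - c) * cnj (w - c)) ^ m = of_real ((s ^ 2) ^ m)" by (simp only: of_real_power)
      then have "cnj (w - c) ^ m * (w - c) ^ m = of_real (s ^ (2 * m))"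
        by (simp only: power_mult_distrib power_mult mult.commute[of "(w - c) ^ m"])
      then show "cnj (\<tau> m / (w - c) ^ m) = b m * (w - c) ^ m"
        using wc s0 by (simp add: b_def field_simps)
    qed
    finally have "q w = cnj (p w)" using q[of w] w r2 sums_unique2 by (metis dist_commute mem_ball mem_sphere)
    then show "p w + q w - (norm x)^2 = of_real (k w)" by (simp add: k_def complex_eq_iff)
    \<comment> \<open>Here \<open>x = v - T y\<close> and \<open>k w = |v|^2 - |T y|^2\<close>. As
      \<open>|v| = s |y|\<close>, this is at least \<open>(s^2 - |T|^2) |y|^2\<close>, and
      \<open>|x| \<le> (s + |T|) |y|\<close> leaves the Harnack constant
      \<open>(s - |T|) / (s + |T|)\<close>.\<close>
    define y where "y = blinfun_apply (rsv X w) x"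
    define v where "v = scaleC (w - c) y"
    have xv: "x = v - blinfun_apply T y"
      using rsv(2)[OF wK, of x] by (simp add: v_def T_def y_def blinfun_simps complex_vector.scale_left_diff_distrib)
    have nv: "norm v = s * norm y" by (simp add: v_def norm_scaleC ws)
    have nT: "norm (blinfun_apply T y) \<le> ?N * norm y" by (rule norm_blinfun)
    have "k w = 2 * Re (cinner v x) - (norm x)^2" by (simp add: k_def p_def v_def y_def cinner_simps)
    also have "\<dots> = (norm v)^2 - (norm (blinfun_apply T y))^2"
      unfolding xv norm_diff_square cinner_diff by (simp add: cinner_self flip: of_real_power)
    also have "\<dots> \<ge> (s * norm y)^2 - (?N * norm y)^2"
      unfolding nv by (intro diff_left_mono power_mono nT) simp
    finally have k1: "(s^2 - ?N^2) * (norm y)^2 \<le> k w" by (simp add: power_mult_distrib algebra_simps)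
    have "norm x \<le> (s + ?N) * norm y"
      using norm_triangle_ineq4[of v "blinfun_apply T y"] nT unfolding xv[symmetric] nv by (simp add: algebra_simps)
    then have "(norm x)^2 \<le> ((s + ?N) * norm y)^2" by (intro power_mono) auto
    then have "(s - ?N) / (s + ?N) * (norm x)^2 \<le> (s - ?N) / (s + ?N) * ((s + ?N) * norm y)^2"
      using sN s0 by (intro mult_left_mono) auto
    also have "\<dots> = (s - ?N) * (s + ?N) * (norm y)^2"
    proof -
      have "s + ?N \<noteq> 0" using s0 norm_ge_zero[of T] by linarith
      then show ?thesis by (simp add: power2_eq_square)
    qed
    also have "\<dots> = (s^2 - ?N^2) * (norm y)^2" by (simp add: algebra_simps power2_eq_square)
    finally show "(s - ?N) / (s + ?N) * (norm x)^2 \<le> k w" using k1 by linarith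
  qed
  have gs: "g holomorphic_on ball c r" by (rule holomorphic_on_subset[OF g r])
  have gr: "g holomorphic_on cball c s" by (rule holomorphic_on_subset[OF gs]) (use s in auto)
  have gb: "g holomorphic_on ball c s" by (rule holomorphic_on_subset[OF gr]) auto
  have qr: "q holomorphic_on cball c s" by (rule holomorphic_on_subset[OF hq]) (use r2 in auto)
  have qb: "q holomorphic_on ball c s" by (rule holomorphic_on_subset[OF qr]) auto
  have I1: "((\<lambda>w. g w * cinner (blinfun_apply (rsv X w) x) x) has_contour_integral
      2 * of_real pi * \<i> * cinner (blinfun_apply (op_hol_calc D g X) x) x) (circlepath c s)"
  proof -
    have "(\<lambda>w. g w * cinner (blinfun_apply (rsv X w) x) x) contour_integrable_on circlepath c s"
      using circ contour_integrable_holomorphic_simple[OF hol_integrand[OF X D g KD] open_DK[OF X D g KD]]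
      by (auto simp: surrounding_cycle_def)
    moreover have "contour_integral (circlepath c s) (\<lambda>w. g w * cinner (blinfun_apply (rsv X w) x) x) =
        2 * of_real pi * \<i> * cinner (blinfun_apply (op_hol_calc D g X) x) x"
      using op_cycle_integral_cinner[OF X D g KD circ, of x x] by (simp add: calc blinfun_simps cinner_simps)
    ultimately show ?thesis using has_contour_integral_integral by fastforce
  qed
  have I2: "((\<lambda>w. g w * (q w - (norm x)^2) / (w - c)) has_contour_integral
      2 * of_real pi * \<i> * (g c * (q c - (norm x)^2))) (circlepath c s)"
  proof (rule Cauchy_integral_circlepath[where f = "\<lambda>w. g w * (q w - (norm x)^2)"])
    show "continuous_on (cball c s) (\<lambda>w. g w * (q w - (norm x)^2))"
      by (intro continuous_intros holomorphic_on_imp_continuous_on gr qr)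
    show "(\<lambda>w. g w * (q w - (norm x)^2)) holomorphic_on ball c s"
      by (intro holomorphic_intros gb qb)
  qed (use s0 in simp)
  have "((\<lambda>w. g w * of_real (k w) / (w - c)) has_contour_integral
      2 * of_real pi * \<i> * cinner (blinfun_apply (op_hol_calc D g X) x) x +
      2 * of_real pi * \<i> * (g c * (q c - (norm x)^2))) (circlepath c s)"
  proof (rule has_contour_integral_eq[OF has_contour_integral_add[OF I1 I2]])
    fix w assume "w \<in> path_image (circlepath c s)"
    then have w: "w \<in> sphere c s" using s0 by simp
    then have wc: "w - c \<noteq> 0" using s0 by auto
    show "g w * cinner (blinfun_apply (rsv X w) x) x + g w * (q w - (norm x)^2) / (w - c) = g w * of_real (k w) / (w - c)"
    proof -
      have "cinner (blinfun_apply (rsv X w) x) x = p w / (w - c)" using wc by (simp add: p_def)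
      then show ?thesis unfolding pq[OF w, symmetric] by (simp add: add_divide_distrib diff_divide_distrib algebra_simps)
    qed
  qed
  then have "((\<lambda>t. g (circlepath c s t) * of_real (k (circlepath c s t)) / (circlepath c s t - c) *
       vector_derivative (circlepath c s) (at t within {0..1})) has_integral
      2 * of_real pi * \<i> * cinner (blinfun_apply (op_hol_calc D g X) x) x) {0..1}"
    unfolding q0 by (simp add: has_contour_integral_def)
  then have "((\<lambda>t. 2 * of_real pi * \<i> * (g (circlepath c s t) * of_real (k (circlepath c s t)))) has_integral
      2 * of_real pi * \<i> * cinner (blinfun_apply (op_hol_calc D g X) x) x) {0..1}"
  proof (rule has_integral_eq[rotated])
    fix t :: real assume t: "t \<in> {0..1}"
    show "g (circlepath c s t) * of_real (k (circlepath c s t)) / (circlepath c s t - c) *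
       vector_derivative (circlepath c s) (at t within {0..1}) =
       2 * of_real pi * \<i> * (g (circlepath c s t) * of_real (k (circlepath c s t)))"
    proof -
      have e: "circlepath c s t - c = of_real s * exp (2 * of_real pi * \<i> * of_real t)" by (simp add: circlepath)
      then have "vector_derivative (circlepath c s) (at t within {0..1}) = 2 * of_real pi * \<i> * (circlepath c s t - c)"
        using t by (simp only: vector_derivative_circlepath01 atLeastAtMost_iff of_real_mult of_real_numeral mult_ac)
      moreover have "circlepath c s t - c \<noteq> 0" using e s0 by simp
      ultimately show ?thesis by simp
    qed
  qed
  from has_integral_mult_right[OF this, of "1 / (2 * of_real pi * \<i>)"]
  have "((\<lambda>t. g (circlepath c s t) * of_real (k (circlepath c s t))) has_integral
      cinner (blinfun_apply (op_hol_calc D g X) x) x) {0..1}" by simp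
  from has_integral_linear[OF this bounded_linear_Im]
  have I: "((\<lambda>t. Im (g (circlepath c s t)) * k (circlepath c s t)) has_integral
      Im (cinner (blinfun_apply (op_hol_calc D g X) x) x)) {0..1}" by (simp add: o_def)
  have "((\<lambda>t. \<kappa> * ((s - ?N) / (s + ?N) * (norm x)^2)) has_integral (\<kappa> * ((s - ?N) / (s + ?N) * (norm x)^2))) {0..1::real}"
    using has_integral_const_real[of "\<kappa> * ((s - ?N) / (s + ?N) * (norm x)^2)" 0 1] by simp
  then have "\<kappa> * ((s - ?N) / (s + ?N) * (norm x)^2) \<le> Im (cinner (blinfun_apply (op_hol_calc D g X) x) x)"
  proof (rule has_integral_le[OF _ I])
    fix t :: real assume t: "t \<in> {0..1}"
    have "circlepath c s t \<in> path_image (circlepath c s)" using t by (simp add: path_image_def)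
    then have w: "circlepath c s t \<in> sphere c s" using s0 by simp
    have "0 \<le> (s - ?N) / (s + ?N) * (norm x)^2" using sN s0 by simp
    then show "\<kappa> * ((s - ?N) / (s + ?N) * (norm x)^2) \<le> Im (g (circlepath c s t)) * k (circlepath c s t)"
      using low[OF w] kb[OF w] \<kappa> by (intro mult_mono) auto
  qed
  then show ?thesis by (simp add: T_def)
qed

section \<open>Consequences of the Pick property\<close>

locale half_plane_continuation =
  fixes S :: "real set" and f :: "real \<Rightarrow> real" and F :: "complex \<Rightarrow> complex"
  assumes S: "open S" "is_interval S" "S \<noteq> {}"
    and F_cont: "continuous_on (upper_half_plane \<union> complex_of_real ` S) F"
    and F_hol: "F analytic_on upper_half_plane"
    and F_eq: "\<And>x. x \<in> S \<Longrightarrow> F (complex_of_real x) = complex_of_real (f x)"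
begin

abbreviation "D \<equiv> slit_domain S"
abbreviation "g \<equiv> reflect_ext F"

lemma D: "open D" "starlike D"
  using open_slit_domain[OF S(1)] starlike_slit_domain[OF S(2)] S(3) by auto

lemma g_hol: "g holomorphic_on D"
  by (rule reflect_ext_holomorphic[OF S(1) F_cont F_hol F_eq])

lemma g_real: "x \<in> S \<Longrightarrow> g (of_real x) = of_real (f x)"
  by (simp add: reflect_ext_upper F_eq)

lemma ball_upper: "ball (\<i> * complex_of_real R) R \<subseteq> D"
  using ball_subset_upper_half_plane upper_half_plane_subset_slit_domain by blast

lemma calc_bounded_ops:
  assumes "X \<in> bounded_ops" "ball c r \<subseteq> D" "norm (X - op_const c) < r"
  shows "op_hol_calc D g X \<in> bounded_ops"
  unfolding op_hol_calc_power_series[OF assms(1) D g_hol assms(2,3)]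
  by (rule op_ps_bounded_ops[OF taylor_summable[OF holomorphic_on_subset[OF g_hol assms(2)] _ assms(3)]])
     (use assms in auto)

lemma calc_upper_bounded_ops:
  assumes "X \<in> bounded_ops" "op_pos (op_Im X)"
  shows "op_hol_calc D g X \<in> bounded_ops"
proof -
  obtain d where d: "d > 0" "\<And>x. d * (norm x)\<^sup>2 \<le> Im (cinner (blinfun_apply X x) x)"
    using assms op_pos_op_Im_iff by blast
  obtain R where "norm (X - op_const (\<i> * of_real R)) < R" using coercive_disc[OF assms(1) d] by blast
  from calc_bounded_ops[OF assms(1) ball_upper this] show ?thesis .
qed

text \<open>The circle of radius \<open>s\<close> lies strictly inside the ball of radius
  \<open>R\<close>, hence in the open half-plane, so that no boundary values of \<open>F\<close>
  enter. The two conclusions are the Poisson bound with \<open>\<kappa> = 0\<close> and with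
  \<open>\<kappa>\<close> the minimum of \<open>Im F\<close> on the circle, which is positive in the
  strict case.\<close>

lemma pick_imp_op_Im_bound:
  assumes pick: "\<And>z. 0 < Im z \<Longrightarrow> 0 \<le> Im (F z)"
    and X: "X \<in> bounded_ops" "op_pos (op_Im X)"
  obtains "\<And>x. 0 \<le> Im (cinner (blinfun_apply (op_hol_calc D g X) x) x)"
    "(\<And>z. 0 < Im z \<Longrightarrow> 0 < Im (F z)) \<Longrightarrow>
      \<exists>d>0. \<forall>x. d * (norm x)\<^sup>2 \<le> Im (cinner (blinfun_apply (op_hol_calc D g X) x) x)"
proof -
  obtain d where d: "d > 0" "\<And>x. d * (norm x)\<^sup>2 \<le> Im (cinner (blinfun_apply X x) x)"
    using X op_pos_op_Im_iff by blast
  obtain R where R: "R > 0" "norm (X - op_const (\<i> * of_real R)) < R" using coercive_disc[OF X(1) d] by blast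
  let ?c = "\<i> * complex_of_real R"
  let ?N = "norm (X - op_const ?c)"
  define s where "s = (?N + R) / 2"
  have s: "?N < s" "s < R" using R by (auto simp: s_def)
  have s0: "s > 0" using s(1) norm_ge_zero[of "X - op_const ?c"] by linarith
  have up: "0 < Im w \<and> g w = F w" if "w \<in> sphere ?c s" for w
  proof -
    have "w \<in> ball ?c R" using that s by auto
    then have "w \<in> upper_half_plane" using ball_subset_upper_half_plane by blast
    then have "0 < Im w" by (simp add: upper_half_plane_def)
    then show ?thesis by (simp add: reflect_ext_upper)
  qed
  note low = poisson_lower_bound[OF X(1) D g_hol ball_upper s]
  have "0 \<le> Im (cinner (blinfun_apply (op_hol_calc D g X) x) x)" for x
    using low[of 0 x] pick up by simp
  moreover have "\<exists>d>0. \<forall>x. d * (norm x)\<^sup>2 \<le> Im (cinner (blinfun_apply (op_hol_calc D g X) x) x)"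
    if strict: "\<And>z. 0 < Im z \<Longrightarrow> 0 < Im (F z)"
  proof -
    have "continuous_on (sphere ?c s) g"
      by (rule continuous_on_subset[OF holomorphic_on_imp_continuous_on[OF g_hol]])
         (use ball_upper[of R] s in \<open>auto simp: subset_iff\<close>)
    then have "continuous_on (sphere ?c s) (\<lambda>w. Im (g w))" by (intro continuous_intros)
    moreover have "?c + of_real s \<in> sphere ?c s" using s0 by (simp add: dist_norm)
    ultimately obtain w0 where w0: "w0 \<in> sphere ?c s" "\<And>w. w \<in> sphere ?c s \<Longrightarrow> Im (g w0) \<le> Im (g w)"
      using continuous_attains_inf[OF compact_sphere] by blast
    have pos: "Im (g w0) > 0" using up[OF w0(1)] strict by auto
    have q: "(s - ?N) / (s + ?N) > 0" using s s0 by (auto intro!: divide_pos_pos add_pos_nonneg)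
    show ?thesis
    proof (intro exI[of _ "Im (g w0) * ((s - ?N) / (s + ?N))"] conjI allI)
      show "Im (g w0) * ((s - ?N) / (s + ?N)) > 0" using pos q by (rule mult_pos_pos)
      show "Im (g w0) * ((s - ?N) / (s + ?N)) * (norm x)\<^sup>2 \<le> Im (cinner (blinfun_apply (op_hol_calc D g X) x) x)" for x
        using low[of "Im (g w0)" x, OF w0(2)] pos by (simp add: mult.assoc)
    qed
  qed
  ultimately show ?thesis using that by blast
qed

lemma op_psd_imp_pick:
  assumes psd: "\<And>X::'h::chilbert_space \<Rightarrow>\<^sub>L 'h. X \<in> bounded_ops \<Longrightarrow> op_pos (op_Im X) \<Longrightarrow> op_psd (op_Im (op_hol_calc D g X))"
    and nt: "\<exists>x::'h. x \<noteq> 0" and z: "0 < Im z"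
  shows "0 \<le> Im (F z)"
proof -
  define X :: "'h \<Rightarrow>\<^sub>L 'h" where "X = op_const z"
  have X: "X \<in> bounded_ops" by (simp add: X_def)
  have d: "Im z * (norm x)\<^sup>2 \<le> Im (cinner (blinfun_apply X x) x)" for x
    by (simp add: X_def blinfun_simps cinner_simps cinner_self flip: of_real_power)
  have pos: "op_pos (op_Im X)" using op_pos_op_Im_iff[OF X] d z by blast
  obtain R where R: "R > 0" "norm (X - op_const (\<i> * of_real R)) < R" using coercive_disc[OF X z d] by blast
  let ?c = "\<i> * complex_of_real R"
  obtain x :: 'h where x: "x \<noteq> 0" using nt by blast
  have T: "X - op_const ?c = op_const (z - ?c)" by (simp add: X_def op_const_diff)
  \<comment> \<open>The disc found for the operator also contains the number \<open>z\<close>,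
    because a scalar operator has norm at least the modulus of the scalar on a nonzero
    space.\<close>
  have "cmod (z - ?c) * norm x \<le> norm (op_const (z - ?c) :: 'h \<Rightarrow>\<^sub>L 'h) * norm x"
    using norm_blinfun[of "op_const (z - ?c)" x] by (simp add: blinfun_simps norm_scaleC)
  then have zR: "cmod (z - ?c) < R" using x R(2) unfolding T by (simp add: mult_le_cancel_right)
  have pow: "blinfun_apply (op_pow (op_const w) m) x = scaleC (w ^ m) x" for w m
    by (induction m) (auto simp: op_pow_Suc blinfun_simps scaleC_scaleC scaleC_one)
  have gb: "g holomorphic_on ball ?c R" by (rule holomorphic_on_subset[OF g_hol ball_upper])
  have sm: "summable (\<lambda>m. cmod (taylor_coeff g ?c m) * norm (X - op_const ?c) ^ m)"
    by (rule taylor_summable[OF gb norm_ge_zero R(2)])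
  have "(\<lambda>m. taylor_coeff g ?c m * cinner (blinfun_apply (op_pow (X - op_const ?c) m) x) x) sums
      cinner (blinfun_apply (op_hol_calc D g X) x) x"
    unfolding op_hol_calc_power_series[OF X D g_hol ball_upper R(2)]
    by (rule op_ps_cinner_sums[OF sm order_refl])
  moreover have "(\<lambda>m. taylor_coeff g ?c m * (z - ?c) ^ m * (norm x)\<^sup>2) sums (g z * (norm x)\<^sup>2)"
    by (rule sums_mult2[OF taylor_sums[OF gb zR]])
  ultimately have "cinner (blinfun_apply (op_hol_calc D g X) x) x = g z * (norm x)\<^sup>2"
    by (simp add: T pow cinner_simps cinner_self mult.assoc sums_iff)
  moreover have "0 \<le> Im (cinner (blinfun_apply (op_hol_calc D g X) x) x)"
    using psd[OF X pos] op_psd_op_Im_iff[OF calc_upper_bounded_ops[OF X pos]] by blast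
  ultimately have "0 \<le> Im (g z) * (norm x)\<^sup>2" by (simp flip: of_real_power)
  then show ?thesis using x z by (simp add: zero_le_mult_iff reflect_ext_upper)
qed

end

section \<open>Derivatives along lines of operators\<close>

lemma op_pow_line_derivative:
  assumes T: "T \<in> bounded_ops" and C: "C \<in> bounded_ops"
  shows "\<exists>d. \<forall>z. ((\<lambda>z. cinner (blinfun_apply (op_pow (T + op_scaleC z C) m) x) y) has_field_derivative d z) (at z) \<and>
     d 0 = (\<Sum>j<m. cinner (blinfun_apply (op_pow T j) (blinfun_apply C (blinfun_apply (op_pow T (m - 1 - j)) x))) y)"
proof (induction m arbitrary: x)
  case 0
  show ?case by (intro exI[of _ "\<lambda>_. 0"]) (simp add: blinfun_simps)
next
  case (Suc m)
  let ?h = "\<lambda>m x z. cinner (blinfun_apply (op_pow (T + op_scaleC z C) m) x) y"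
  obtain d1 where d1: "\<And>z. (?h m (blinfun_apply T x) has_field_derivative d1 z) (at z)"
    "d1 0 = (\<Sum>j<m. cinner (blinfun_apply (op_pow T j) (blinfun_apply C (blinfun_apply (op_pow T (m - 1 - j)) (blinfun_apply T x)))) y)"
    using Suc[of "blinfun_apply T x"] by blast
  obtain d2 where d2: "\<And>z. (?h m (blinfun_apply C x) has_field_derivative d2 z) (at z)"
    using Suc[of "blinfun_apply C x"] by blast
  \<comment> \<open>Splitting off the rightmost factor keeps the induction hypothesis applicable, at
    the vectors \<open>T x\<close> and \<open>C x\<close>. The derivative is wanted explicitly at 0
    only, but it must exist at every \<open>z\<close> for the termwise limit later.\<close>
  have eq: "?h (Suc m) x z = ?h m (blinfun_apply T x) z + z * ?h m (blinfun_apply C x) z" for z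
  proof -
    have "op_pow (T + op_scaleC z C) m \<in> bounded_ops" using T C by simp
    then show ?thesis by (simp add: op_pow_Suc_apply(1) blinfun_simps cinner_simps bounded_opsD)
  qed
  have "(?h (Suc m) x has_field_derivative (d1 z + (1 * ?h m (blinfun_apply C x) z + d2 z * z))) (at z)" for z
    unfolding eq by (intro DERIV_add DERIV_mult d1 d2 DERIV_ident)
  moreover have "d1 0 + (1 * ?h m (blinfun_apply C x) 0 + d2 0 * 0) =
     (\<Sum>j<Suc m. cinner (blinfun_apply (op_pow T j) (blinfun_apply C (blinfun_apply (op_pow T (Suc m - 1 - j)) x))) y)"
  proof -
    have "op_pow T (m - 1 - j) (blinfun_apply T x) = blinfun_apply (op_pow T (Suc m - 1 - j)) x" if "j < m" for j
      using that by (simp add: op_pow_Suc_apply(1)[symmetric] Suc_diff_Suc)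
    then show ?thesis unfolding d1(2) by (simp add: bounded_bilinear.zero_left[OF bounded_bilinear_op_scaleC])
  qed
  ultimately show ?case
    by (intro exI[of _ "\<lambda>z. d1 z + (1 * ?h m (blinfun_apply C x) z + d2 z * z)"]) blast
qed

text \<open>Termwise differentiation by locally uniform convergence of holomorphic functions. The
  series for \<open>d\<close> is kept because at a diagonal \<open>T\<close> and the rank-one
  \<open>ones_op\<close> it is the quadratic form of the Loewner matrix.\<close>

lemma op_ps_line_derivative:
  assumes T: "T \<in> bounded_ops" and C: "C \<in> bounded_ops"
    and s: "summable (\<lambda>m. cmod (a m) * r ^ m)" and r: "norm T < r"
  obtains d where
    "((\<lambda>z. cinner (blinfun_apply (op_ps a (T + op_scaleC z C)) x) y) has_field_derivative d) (at 0)"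
    "(\<lambda>m. a m * (\<Sum>j<m. cinner (blinfun_apply (op_pow T j) (blinfun_apply C (blinfun_apply (op_pow T (m - 1 - j)) x))) y)) sums d"
proof -
  define h where "h m z = cinner (blinfun_apply (op_pow (T + op_scaleC z C) m) x) y" for m z
  \<comment> \<open>Keeps \<open>T + z C\<close> within norm \<open>r\<close>; the summand 1 covers
    \<open>C = 0\<close>.\<close>
  define e where "e = (r - norm T) / (norm C + 1)"
  have e: "e > 0" using r by (simp add: e_def add_nonneg_pos)
  have nb: "norm (T + op_scaleC z C) \<le> r" if "z \<in> ball 0 e" for z
  proof -
    have "cmod z * norm C \<le> e * (norm C + 1)" using that e by (intro mult_mono) auto
    also have "\<dots> = r - norm T"
    proof -
      have "norm C + 1 \<noteq> 0" using norm_ge_zero[of C] by linarith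
      then show ?thesis by (simp add: e_def)
    qed
    finally show ?thesis using norm_triangle_ineq[of T "op_scaleC z C"] norm_op_scaleC[of z C] by linarith
  qed
  have hb: "norm (a m * h m z) \<le> cmod (a m) * r ^ m * (norm x * norm y)" if z: "z \<in> ball 0 e" for m z
  proof -
    have "cmod (h m z) \<le> norm (T + op_scaleC z C) ^ m * norm x * norm y"
      unfolding h_def
      by (rule order_trans[OF cinner_Cauchy_Schwarz], intro mult_right_mono order_trans[OF norm_blinfun] norm_op_pow norm_ge_zero)
    also have "\<dots> \<le> r ^ m * norm x * norm y" by (intro mult_right_mono power_mono nb z norm_ge_zero)
    finally have "cmod (h m z) \<le> r ^ m * norm x * norm y" .
    then have "cmod (a m) * cmod (h m z) \<le> cmod (a m) * (r ^ m * norm x * norm y)" by (rule mult_left_mono) simp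
    then show ?thesis by (simp add: norm_mult mult.assoc)
  qed
  have "\<forall>m. \<exists>d. \<forall>z. (h m has_field_derivative d z) (at z) \<and> d 0 =
     (\<Sum>j<m. cinner (blinfun_apply (op_pow T j) (blinfun_apply C (blinfun_apply (op_pow T (m - 1 - j)) x))) y)"
    unfolding h_def using op_pow_line_derivative[OF T C] by blast
  from choice[OF this] obtain h' where h'': "\<forall>m z. (h m has_field_derivative h' m z) (at z) \<and> h' m 0 =
     (\<Sum>j<m. cinner (blinfun_apply (op_pow T j) (blinfun_apply C (blinfun_apply (op_pow T (m - 1 - j)) x))) y)" by blast
  then have h': "(h m has_field_derivative h' m z) (at z)"
     "h' m 0 = (\<Sum>j<m. cinner (blinfun_apply (op_pow T j) (blinfun_apply C (blinfun_apply (op_pow T (m - 1 - j)) x))) y)" for m z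
    by blast+
  define H where "H z = (\<Sum>m. a m * h m z)" for z
  have ul: "uniform_limit (ball 0 e) (\<lambda>n z. \<Sum>m<n. a m * h m z) H sequentially"
    unfolding H_def by (rule Weierstrass_m_test[OF hb summable_mult2[OF s]])
  have "\<exists>g'. \<forall>z\<in>ball 0 e. (H has_field_derivative g' z) (at z) \<and> (\<lambda>n. \<Sum>m<n. a m * h' m z) \<longlonglongrightarrow> g' z"
  proof (rule has_complex_derivative_uniform_sequence[OF open_ball])
    show "((\<lambda>z. \<Sum>m<n. a m * h m z) has_field_derivative (\<Sum>m<n. a m * h' m z)) (at z)" for n z
      by (intro DERIV_sum DERIV_cmult h')
    fix z :: complex assume "z \<in> ball 0 e"
    then obtain d where "d > 0" "cball z d \<subseteq> ball 0 e"
      using open_ball[of "0::complex" e, unfolded open_contains_cball] by blast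
    then show "\<exists>d>0. cball z d \<subseteq> ball 0 e \<and> uniform_limit (cball z d) (\<lambda>n z. \<Sum>m<n. a m * h m z) H sequentially"
      using uniform_limit_on_subset[OF ul] by blast
  qed
  then obtain g' where g': "\<And>z. z \<in> ball 0 e \<Longrightarrow> (H has_field_derivative g' z) (at z)"
     "\<And>z. z \<in> ball 0 e \<Longrightarrow> (\<lambda>m. a m * h' m z) sums g' z" unfolding sums_def by blast
  have z0: "(0::complex) \<in> ball 0 e" using e by simp
  have HE: "H z = cinner (blinfun_apply (op_ps a (T + op_scaleC z C)) x) y" if "z \<in> ball 0 e" for z
    using op_ps_cinner_sums[OF s nb[OF that], of x y] by (simp add: H_def h_def sums_iff)
  have "((\<lambda>z. cinner (blinfun_apply (op_ps a (T + op_scaleC z C)) x) y) has_field_derivative g' 0) (at 0)"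
    by (rule has_field_derivative_transform_within_open[OF g'(1)[OF z0] open_ball z0]) (rule HE)
  moreover have "(\<lambda>m. a m * (\<Sum>j<m. cinner (blinfun_apply (op_pow T j) (blinfun_apply C (blinfun_apply (op_pow T (m - 1 - j)) x))) y)) sums g' 0"
    using g'(2)[OF z0] unfolding h' .
  ultimately show ?thesis using that by blast
qed

text \<open>\<open>(h (i t) - h 0) / (i t)\<close> has real part \<open>Im (h (i t)) / t\<close>. So
  non-negative imaginary parts in the imaginary direction give a non-negative derivative in the real
  direction: the bridge from the half-plane to monotonicity.\<close>

lemma Re_derivative_nonneg_of_Im_nonneg:
  fixes h :: "complex \<Rightarrow> complex"
  assumes h: "(h has_field_derivative d) (at 0)" and h0: "Im (h 0) = 0"
    and e: "e > 0" and im: "\<And>t. 0 < t \<Longrightarrow> t < e \<Longrightarrow> 0 \<le> Im (h (\<i> * of_real t))"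
  shows "0 \<le> Re d"
proof -
  have q: "((\<lambda>w. (h w - h 0) / w) \<longlongrightarrow> d) (at 0)" using h by (simp add: has_field_derivative_iff)
  have "filterlim (\<lambda>t. \<i> * complex_of_real t) (at 0) (at_right 0)"
  proof -
    have "((\<lambda>t. \<i> * complex_of_real t) \<longlongrightarrow> \<i> * of_real 0) (at_right 0)" by (intro tendsto_intros)
    moreover have "\<forall>\<^sub>F t in at_right (0::real). \<i> * complex_of_real t \<noteq> 0"
      by (auto simp: eventually_at_filter)
    ultimately show ?thesis by (simp add: filterlim_at)
  qed
  from filterlim_compose[OF q this]
  have "((\<lambda>t. Re ((h (\<i> * of_real t) - h 0) / (\<i> * of_real t))) \<longlongrightarrow> Re d) (at_right 0)"
    by (intro tendsto_intros)
  moreover have "\<forall>\<^sub>F t in at_right 0. 0 \<le> Re ((h (\<i> * of_real t) - h 0) / (\<i> * of_real t))"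
    using eventually_at_right_less[of "0::real"] eventually_at_right_real[OF e]
  proof eventually_elim
    case (elim t)
    have "(h (\<i> * of_real t) - h 0) / (\<i> * of_real t) = - \<i> * (h (\<i> * of_real t) - h 0) / of_real t"
      using elim by (simp add: field_simps)
    then have "Re ((h (\<i> * of_real t) - h 0) / (\<i> * of_real t)) = Im (h (\<i> * of_real t)) / t"
      using h0 by simp
    then show ?case using im[of t] elim by simp
  qed
  ultimately show ?thesis by (rule tendsto_lowerbound) simp
qed

lemma Re_derivative_nonneg_of_increasing:
  fixes h :: "complex \<Rightarrow> complex"
  assumes h: "(h has_field_derivative d) (at 0)"
    and e: "e > 0" and inc: "\<And>t. 0 < t \<Longrightarrow> t < e \<Longrightarrow> Re (h 0) \<le> Re (h (of_real t))"
  shows "0 \<le> Re d"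
proof -
  have q: "((\<lambda>w. (h w - h 0) / w) \<longlongrightarrow> d) (at 0)" using h by (simp add: has_field_derivative_iff)
  have "filterlim complex_of_real (at 0) (at_right 0)"
  proof -
    have "((\<lambda>t. complex_of_real t) \<longlongrightarrow> of_real 0) (at_right 0)" by (intro tendsto_intros)
    moreover have "\<forall>\<^sub>F t in at_right (0::real). complex_of_real t \<noteq> 0"
      by (auto simp: eventually_at_filter)
    ultimately show ?thesis by (simp add: filterlim_at)
  qed
  from filterlim_compose[OF q this]
  have "((\<lambda>t. Re ((h (of_real t) - h 0) / of_real t)) \<longlongrightarrow> Re d) (at_right 0)"
    by (intro tendsto_intros)
  moreover have "\<forall>\<^sub>F t in at_right 0. 0 \<le> Re ((h (of_real t) - h 0) / of_real t)"
    using eventually_at_right_less[of "0::real"] eventually_at_right_real[OF e]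
  proof eventually_elim
    case (elim t)
    then show ?case using inc[of t] by simp
  qed
  ultimately show ?thesis by (rule tendsto_lowerbound) simp
qed

lemma deriv_Reals:
  assumes h: "h holomorphic_on E" "open E" and S: "open S" "complex_of_real ` S \<subseteq> E"
    and re: "\<And>x. x \<in> S \<Longrightarrow> h (of_real x) \<in> \<real>" and x: "x \<in> S"
  shows "deriv h (of_real x) \<in> \<real>"
proof -
  have "(h has_field_derivative deriv h (of_real x)) (at (of_real x))"
    using h S x by (intro holomorphic_derivI[OF h]) auto
  then have v: "((\<lambda>t. h (of_real t)) has_vector_derivative deriv h (of_real x)) (at x)"
    by (rule has_vector_derivative_real_field)
  have "((\<lambda>t. Im (h (of_real t))) has_vector_derivative Im (deriv h (of_real x))) (at x)"
    by (rule bounded_linear.has_vector_derivative[OF bounded_linear_Im v])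
  moreover have "((\<lambda>t. Im (h (of_real t))) has_vector_derivative 0) (at x)"
    by (rule has_vector_derivative_transform_within_open[OF has_vector_derivative_const S(1) x])
       (use re in \<open>auto simp: complex_is_Real_iff\<close>)
  ultimately have "Im (deriv h (of_real x)) = 0" by (rule vector_derivative_unique_at)
  then show ?thesis by (simp add: complex_is_Real_iff)
qed

text \<open>Real coefficients make the series of a self-adjoint operator self-adjoint and fit the
  real polynomials in \<open>cont_calc\<close>.\<close>

lemma taylor_coeff_Reals:
  assumes h: "h holomorphic_on E" "open E" and S: "open S" "complex_of_real ` S \<subseteq> E"
    and re: "\<And>x. x \<in> S \<Longrightarrow> h (of_real x) \<in> \<real>" and x: "x \<in> S"
  shows "taylor_coeff h (of_real x) m \<in> \<real>"
proof -
  have "x \<in> S \<Longrightarrow> (deriv ^^ m) h (of_real x) \<in> \<real>" for x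
  proof (induction m arbitrary: x)
    case (Suc m)
    then show ?case
      using deriv_Reals[OF holomorphic_higher_deriv[OF h] h(2) S, of m x] by simp
  qed (use re in simp)
  moreover have "fact m \<in> (\<real> :: complex set)" by (metis Reals_of_nat of_nat_fact)
  ultimately show ?thesis using x by (auto simp: taylor_coeff_def intro!: Reals_divide)
qed

section \<open>From the Pick property to operator monotonicity\<close>

context half_plane_continuation
begin

lemma g_taylor_Reals: "x \<in> S \<Longrightarrow> taylor_coeff g (of_real x) m \<in> \<real>"
  by (rule taylor_coeff_Reals[OF g_hol D(1) S(1)]) (auto simp: mem_slit_domain g_real)

text \<open>Near a real centre \<open>c\<close> the continuous calculus, like the holomorphic one,
  is the Taylor series of \<open>g\<close>, which opens the operators of (i) to complex
  perturbation.\<close>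

lemma cont_calc_eq_op_ps:
  assumes A: "op_selfadjoint A" and n: "norm (A - op_const (of_real c)) < r" and r: "{c - r<..<c + r} \<subseteq> S"
  shows "cont_calc f A = op_ps (taylor_coeff g (of_real c)) (A - op_const (of_real c))"
proof -
  define s where "s = (norm (A - op_const (of_real c)) + r) / 2"
  have s: "norm (A - op_const (of_real c)) \<le> s" "s < r" using n by (auto simp: s_def)
  have s0: "0 \<le> s" using s norm_ge_zero order_trans by blast
  let ?a = "taylor_coeff g (of_real c)"
  have gb: "g holomorphic_on ball (of_real c) r"
    by (rule holomorphic_on_subset[OF g_hol ball_subset_slit_domain[OF r]])
  have cS: "c \<in> S" using r s s0 by auto
  have a: "of_real (Re (?a m)) = ?a m" for m
    using g_taylor_Reals[OF cS, of m] by (simp add: complex_is_Real_iff complex_eq_iff)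
  have abs: "\<bar>Re (?a m)\<bar> = cmod (?a m)" for m by (subst a[symmetric]) (simp only: norm_of_real)
  have "cont_calc f A = op_ps (\<lambda>m. of_real (Re (?a m))) (A - op_const (of_real c))"
  proof (rule cont_calc_power_series[OF A _ s(1)])
    show "summable (\<lambda>m. \<bar>Re (?a m)\<bar> * s ^ m)" unfolding abs by (rule taylor_summable[OF gb s0 s(2)])
    fix x assume x: "\<bar>x - c\<bar> \<le> s"
    have xS: "x \<in> S" using x s r by (auto simp: abs_le_iff subset_iff)
    have "cmod (of_real x - of_real c) < r" using x s by (simp flip: of_real_diff)
    from sums_Re[OF taylor_sums[OF gb this]]
    have "(\<lambda>m. Re (?a m * (of_real x - of_real c) ^ m)) sums f x" by (simp only: g_real[OF xS] Re_complex_of_real)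
    moreover have "Re (?a m * (of_real x - of_real c) ^ m) = Re (?a m) * (x - c) ^ m" for m
    proof -
      have "(complex_of_real x - of_real c) ^ m = of_real ((x - c) ^ m)" by simp
      then show ?thesis
        by (simp only: times_complex.sel Re_complex_of_real Im_complex_of_real mult_zero_right diff_zero)
    qed
    ultimately show "(\<lambda>m. Re (?a m) * (x - c) ^ m) sums f x" by simp
  qed
  then show ?thesis by (simp only: a)
qed

text \<open>The imaginary part is only assumed non-negative, so \<open>X + i t\<close> is used and
  \<open>t\<close> tends to 0; continuity in \<open>t\<close> comes from the line
  derivative.\<close>

lemma pick_imp_op_ps_Im_nonneg:
  assumes pick: "\<And>z. 0 < Im z \<Longrightarrow> 0 \<le> Im (F z)"
    and X: "X \<in> bounded_ops" and n: "norm (X - op_const (of_real c)) < r" and r: "{c - r<..<c + r} \<subseteq> S"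
    and im: "\<And>x. 0 \<le> Im (cinner (blinfun_apply X x) x)"
  shows "0 \<le> Im (cinner (blinfun_apply (op_ps (taylor_coeff g (of_real c)) (X - op_const (of_real c))) x) x)"
proof -
  let ?T = "X - op_const (of_real c)"
  let ?a = "taylor_coeff g (of_real c)"
  define s where "s = (norm ?T + r) / 2"
  have s: "norm ?T < s" "s < r" using n by (auto simp: s_def)
  have s0: "0 \<le> s" using s norm_ge_zero[of ?T] by linarith
  have gb: "g holomorphic_on ball (of_real c) r"
    by (rule holomorphic_on_subset[OF g_hol ball_subset_slit_domain[OF r]])
  have sm: "summable (\<lambda>m. cmod (?a m) * s ^ m)" by (rule taylor_summable[OF gb s0 s(2)])
  define C :: "'a \<Rightarrow>\<^sub>L 'a" where "C = op_const \<i>"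
  have TB: "?T \<in> bounded_ops" "C \<in> bounded_ops" using X by (auto simp: C_def)
  let ?h = "\<lambda>z. cinner (blinfun_apply (op_ps ?a (?T + op_scaleC z C)) x) x"
  obtain d where "(?h has_field_derivative d) (at 0)" using op_ps_line_derivative[OF TB sm s(1)] by blast
  then have "isCont ?h 0" by (rule DERIV_isCont)
  then have "(?h \<longlongrightarrow> ?h 0) (at 0)" by (simp add: isCont_def)
  moreover have "filterlim complex_of_real (at 0) (at_right 0)"
  proof -
    have "((\<lambda>t. complex_of_real t) \<longlongrightarrow> of_real 0) (at_right 0)" by (intro tendsto_intros)
    moreover have "\<forall>\<^sub>F t in at_right (0::real). complex_of_real t \<noteq> 0"
      by (auto simp: eventually_at_filter)
    ultimately show ?thesis by (simp add: filterlim_at)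
  qed
  ultimately have "((\<lambda>t. ?h (of_real t)) \<longlongrightarrow> ?h 0) (at_right 0)" by (rule filterlim_compose)
  then have "((\<lambda>t. Im (?h (of_real t))) \<longlongrightarrow> Im (?h 0)) (at_right 0)" by (rule tendsto_Im)
  moreover have "\<forall>\<^sub>F t in at_right 0. 0 \<le> Im (?h (of_real t))"
  proof -
    have "0 < r - norm ?T" using n by simp
    from eventually_at_right_real[OF this] show ?thesis
    proof eventually_elim
      case (elim t)
      define Y where "Y = X + op_scaleC (of_real t) C"
      have Y: "Y \<in> bounded_ops" using X TB by (simp add: Y_def)
      have "t * (norm x)\<^sup>2 \<le> Im (cinner (blinfun_apply Y x) x)" for x
        using im[of x] by (simp add: Y_def C_def blinfun_simps cinner_simps cinner_self flip: of_real_power)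
      then have pos: "op_pos (op_Im Y)" using op_pos_op_Im_iff[OF Y] elim by auto
      have eqY: "Y - op_const (of_real c) = ?T + op_scaleC (of_real t) C" by (simp add: Y_def)
      have "norm C \<le> 1"
        using norm_op_scaleC[of \<i> "id_blinfun :: 'a \<Rightarrow>\<^sub>L 'a"] norm_blinfun_id_le[where 'a='a] by (simp add: C_def)
      then have "t * norm C \<le> t * 1" using elim by (intro mult_left_mono) auto
      moreover have "norm (op_scaleC (of_real t) C) \<le> t * norm C"
        using norm_op_scaleC[of "of_real t" C] elim by simp
      ultimately have "norm (op_scaleC (of_real t) C) \<le> t" by linarith
      then have nY: "norm (Y - op_const (of_real c)) < r"
        unfolding eqY using norm_triangle_ineq[of ?T "op_scaleC (of_real t) C"] elim by simp
      \<comment> \<open>This bound comes from a disc in the upper half-plane, the expansion used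
        next from the disc about \<open>c\<close>; both describe the same
        \<open>op_hol_calc\<close>.\<close>
      have "0 \<le> Im (cinner (blinfun_apply (op_hol_calc D g Y) x) x)"
        by (rule pick_imp_op_Im_bound[OF pick Y pos])
      then show "0 \<le> Im (?h (of_real t))"
        unfolding op_hol_calc_power_series[OF Y D g_hol ball_subset_slit_domain[OF r] nY] eqY .
    qed
  qed
  ultimately have "0 \<le> Im (?h 0)" by (rule tendsto_lowerbound) simp
  then show ?thesis by (simp add: bounded_bilinear.zero_left[OF bounded_bilinear_op_scaleC])
qed

lemma op_selfadjoint_interval:
  assumes A: "op_selfadjoint A" "op_spectrum A \<subseteq> complex_of_real ` {m..M}" and mM: "m \<le> M"
  shows "norm (A - op_const (of_real ((m + M) / 2))) \<le> (M - m) / 2"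
proof -
  have AB: "A \<in> bounded_ops" using A by (simp add: op_selfadjoint_def)
  have "op_poly [:- ((m + M) / 2), 1:] A = A - op_const (of_real ((m + M) / 2))"
    using op_poly_linear_power[OF AB, of "(m + M) / 2" 1]
    by (simp add: op_pow_Suc) (auto intro!: blinfun_eqI simp: blinfun_simps)
  moreover have "norm (op_poly [:- ((m + M) / 2), 1:] A) \<le> (M - m) / 2"
  proof (rule norm_op_poly_le[OF A(1)])
    fix x assume "complex_of_real x \<in> op_spectrum A"
    then have "m \<le> x" "x \<le> M" using A(2) by auto
    then show "\<bar>poly [:- ((m + M) / 2), 1:] x\<bar> \<le> (M - m) / 2" by (simp add: abs_le_iff field_simps)
  qed (use mM in simp)
  ultimately show ?thesis by simp
qed

text \<open>\<open>h t\<close> is the form of \<open>f\<close> at \<open>A + t (B - A)\<close>.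
  Moving on by \<open>i u (B - A)\<close> gives the operator a non-negative imaginary part, so
  \<open>Im h\<close> is non-negative in that direction, and hence the real derivative of
  \<open>h\<close> is non-negative on \<open>[0, 1]\<close>.\<close>

theorem pick_imp_op_monotone:
  assumes pick: "\<And>z. 0 < Im z \<Longrightarrow> 0 \<le> Im (F z)" and nt: "\<exists>x::'h::chilbert_space. x \<noteq> 0"
  shows "op_monotone_on TYPE('h) S f"
  unfolding op_monotone_on_def
proof (intro allI impI, elim conjE)
  fix A B :: "'h \<Rightarrow>\<^sub>L 'h"
  assume A: "op_selfadjoint A" "op_spectrum A \<subseteq> complex_of_real ` S"
    and B: "op_selfadjoint B" "op_spectrum B \<subseteq> complex_of_real ` S" and psd: "op_psd (B - A)"
  have AB: "A \<in> bounded_ops" "B \<in> bounded_ops" using A B by (auto simp: op_selfadjoint_def)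
  define K where "K = Re ` (op_spectrum A \<union> op_spectrum B)"
  have "compact K" unfolding K_def
    by (intro compact_continuous_image compact_Un compact_op_spectrum AB continuous_intros)
  moreover have "K \<noteq> {}" using op_selfadjoint_norm_in_spectrum[OF A(1) nt] by (auto simp: K_def)
  ultimately obtain m M where m: "m \<in> K" "\<And>x. x \<in> K \<Longrightarrow> m \<le> x" and M: "M \<in> K" "\<And>x. x \<in> K \<Longrightarrow> x \<le> M"
    by (meson compact_attains_inf compact_attains_sup)
  have KS: "K \<subseteq> S" using A(2) B(2) by (auto simp: K_def)
  have mS: "m \<in> S" "M \<in> S" "m \<le> M" using m M KS by auto
  define c \<rho> where "c = (m + M) / 2" and "\<rho> = (M - m) / 2"
  obtain e where e: "e > 0" "ball m e \<subseteq> S" "ball M e \<subseteq> S"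
  proof -
    obtain e1 e2 where "e1 > 0" "ball m e1 \<subseteq> S" "e2 > 0" "ball M e2 \<subseteq> S" using S(1) mS by (meson openE)
    then have "ball m (min e1 e2) \<subseteq> S" "ball M (min e1 e2) \<subseteq> S" "0 < min e1 e2"
      by (auto simp: subset_iff)
    then show thesis using that by blast
  qed
  \<comment> \<open>Slightly larger than the half-width \<open>\<rho>\<close> of the common spectral
    hull \<open>[m, M]\<close>: room for the complex perturbation, while the interval about
    \<open>c\<close> stays in \<open>S\<close>.\<close>
  define r where "r = \<rho> + e / 2"
  have r: "{c - r<..<c + r} \<subseteq> S"
  proof
    fix x assume x: "x \<in> {c - r<..<c + r}"
    have "m - e/2 \<in> S" "M + e/2 \<in> S" using e by (auto simp: subset_iff dist_real_def)
    moreover have "c - r = m - e/2" "c + r = M + e/2" by (auto simp: r_def c_def \<rho>_def field_simps)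
    then have "m - e/2 \<le> x" "x \<le> M + e/2" using x by auto
    ultimately show "x \<in> S" using mem_is_interval_1_I[OF S(2)] by blast
  qed
  have "z \<in> complex_of_real ` {m..M}" if z: "z \<in> op_spectrum A \<union> op_spectrum B" for z
  proof (rule image_eqI)
    have "z \<in> \<real>" using z op_selfadjoint_spectrum_real[OF A(1)] op_selfadjoint_spectrum_real[OF B(1)] by blast
    then show "z = of_real (Re z)" by (simp add: complex_is_Real_iff complex_eq_iff)
    have "Re z \<in> K" unfolding K_def using z by (rule imageI)
    then show "Re z \<in> {m..M}" using m(2) M(2) by simp
  qed
  then have sub: "op_spectrum A \<subseteq> complex_of_real ` {m..M}" "op_spectrum B \<subseteq> complex_of_real ` {m..M}" by blast+
  let ?T = "A - op_const (of_real c)" and ?C = "B - A"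
  have nA: "norm ?T \<le> \<rho>" and nB: "norm (B - op_const (of_real c)) \<le> \<rho>"
    using op_selfadjoint_interval[OF A(1) sub(1) mS(3)] op_selfadjoint_interval[OF B(1) sub(2) mS(3)]
    by (auto simp: c_def \<rho>_def)
  have \<rho>r: "\<rho> < r" "0 \<le> \<rho>" using e mS by (auto simp: r_def \<rho>_def)
  let ?a = "taylor_coeff g (of_real c)"
  have gb: "g holomorphic_on ball (of_real c) r"
    by (rule holomorphic_on_subset[OF g_hol ball_subset_slit_domain[OF r]])
  define s where "s = (\<rho> + r) / 2"
  have s: "\<rho> < s" "s < r" "0 \<le> s" using \<rho>r by (auto simp: s_def)
  have sm: "summable (\<lambda>m. cmod (?a m) * s ^ m)" by (rule taylor_summable[OF gb s(3,2)])
  have cS: "c \<in> S" using r \<rho>r by auto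
  have TB: "?T \<in> bounded_ops" "?C \<in> bounded_ops" using AB by auto
  have Csa: "op_selfadjoint ?C" and Cpos: "\<And>x. 0 \<le> Re (cinner (blinfun_apply ?C x) x)"
    using psd by (auto simp: op_psd_def)
  have Tsa: "op_selfadjoint ?T"
    using A(1) by (auto simp: op_selfadjoint_iff blinfun_simps cinner_simps cinner_self simp flip: of_real_power)
  have Ct: "op_scaleC (of_real t) ?C = t *\<^sub>R ?C" for t by (rule op_scaleC_of_real)
  have nt: "norm (?T + op_scaleC (of_real t) ?C) \<le> \<rho>" if t: "0 \<le> t" "t \<le> 1" for t
  proof -
    have "?T + op_scaleC (of_real t) ?C = (1 - t) *\<^sub>R ?T + t *\<^sub>R (B - op_const (of_real c))"
      unfolding Ct by (simp add: algebra_simps)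
    also have "norm \<dots> \<le> (1 - t) * norm ?T + t * norm (B - op_const (of_real c))"
      using t norm_triangle_ineq[of "(1 - t) *\<^sub>R ?T" "t *\<^sub>R (B - op_const (of_real c))"] by simp
    also have "\<dots> \<le> (1 - t) * \<rho> + t * \<rho>" using t by (intro add_mono mult_left_mono nA nB) auto
    finally show ?thesis by (simp add: algebra_simps)
  qed
  have sa: "op_selfadjoint (?T + op_scaleC (of_real t) ?C)" for t
    using Tsa Csa TB unfolding op_selfadjoint_iff by (auto simp: blinfun_simps cinner_simps)
  have real: "Im (cinner (blinfun_apply (op_ps ?a T) x) x) = 0" if T: "op_selfadjoint T" "norm T \<le> s" for T x
  proof -
    have "Im (?a m * cinner (blinfun_apply (op_pow T m) x) x) = 0" for m
    proof -
      have "op_selfadjoint (op_pow T m)"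
        by (rule op_selfadjointI[OF op_pow_bounded_ops[OF op_selfadjointD(1)[OF T(1)]] op_pow_selfadjoint[OF T(1)]])
      then show ?thesis using g_taylor_Reals[OF cS, of m] by (simp add: op_selfadjoint_iff complex_is_Real_iff)
    qed
    with sums_Im[OF op_ps_cinner_sums[OF sm T(2), of x x]] show ?thesis by (simp add: sums_iff)
  qed
  have mono: "Re (cinner (blinfun_apply (cont_calc f A) x) x) \<le> Re (cinner (blinfun_apply (cont_calc f B) x) x)" for x
  proof -
    define h where "h z = cinner (blinfun_apply (op_ps ?a (?T + op_scaleC z ?C)) x) x" for z
    have "\<exists>d. ((\<lambda>t. Re (h (of_real t))) has_real_derivative d) (at t) \<and> 0 \<le> d" if t: "0 \<le> t" "t \<le> 1" for t
    proof -
      let ?Tt = "?T + op_scaleC (of_real t) ?C"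
      have TtB: "?Tt \<in> bounded_ops" using TB by auto
      have ns: "norm ?Tt < s" using nt[OF t] s by linarith
      obtain d where d: "((\<lambda>z. cinner (blinfun_apply (op_ps ?a (?Tt + op_scaleC z ?C)) x) x) has_field_derivative d) (at 0)"
        using op_ps_line_derivative[OF TtB TB(2) sm ns] by blast
      \<comment> \<open>The line through \<open>?Tt\<close> is the original line with shifted
        parameter, so the derivative at 0 of the lemma serves every \<open>t\<close>.\<close>
      have sh: "?Tt + op_scaleC z ?C = ?T + op_scaleC (of_real t + z) ?C" for z
        by (simp add: bounded_bilinear.add_left[OF bounded_bilinear_op_scaleC])
      have d': "((\<lambda>z. h (of_real t + z)) has_field_derivative d) (at 0)"
        using d unfolding sh h_def .
      then have dh: "(h has_field_derivative d) (at (of_real t))"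
        using DERIV_shift[of h d 0 "of_real t"] by (simp add: add.commute)
      have "0 \<le> Re d"
      proof (rule Re_derivative_nonneg_of_Im_nonneg[OF d'])
        show "Im (h (of_real t + 0)) = 0" using real[OF sa less_imp_le[OF ns]] by (simp add: h_def)
        define e' where "e' = (r - \<rho>) / (norm ?C + 1)"
        show "e' > 0" using \<rho>r by (simp add: e'_def add_nonneg_pos)
        fix u :: real assume u: "0 < u" "u < e'"
        \<comment> \<open>The point of the segment moved by \<open>i u ?C\<close> and translated
          back by \<open>c\<close>; its imaginary part is \<open>u ?C\<close>.\<close>
        let ?X = "?Tt + op_scaleC (\<i> * of_real u) ?C + op_const (of_real c)"
        have Xeq: "?X - op_const (of_real c) = ?Tt + op_scaleC (\<i> * of_real u) ?C" by (rule add_diff_cancel_right')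
        have "0 \<le> Im (cinner (blinfun_apply (op_ps ?a (?X - op_const (of_real c))) x) x)"
        proof (rule pick_imp_op_ps_Im_nonneg[OF pick _ _ r])
          show "?X \<in> bounded_ops" using AB by auto
          have "u * norm ?C \<le> u * (norm ?C + 1)" using u by (intro mult_left_mono) auto
          also have "\<dots> < e' * (norm ?C + 1)" using u by (intro mult_strict_right_mono) (auto simp: add_nonneg_pos)
          also have "\<dots> = r - \<rho>"
          proof -
            have "norm ?C + 1 \<noteq> 0" using norm_ge_zero[of ?C] by linarith
            then show ?thesis by (simp add: e'_def)
          qed
          finally have "u * norm ?C < r - \<rho>" .
          then show "norm (?X - op_const (of_real c)) < r" unfolding Xeq
            using norm_triangle_ineq[of ?Tt "op_scaleC (\<i> * of_real u) ?C"] norm_op_scaleC[of "\<i> * of_real u" ?C] nt[OF t] u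
            unfolding norm_mult norm_of_real norm_ii by linarith
          show "0 \<le> Im (cinner (blinfun_apply ?X y) y)" for y
          proof -
            have "Im (cinner (blinfun_apply ?Tt y) y) = 0" using sa[of t] unfolding op_selfadjoint_iff by blast
            moreover have "cinner (blinfun_apply ?X y) y = cinner (blinfun_apply ?Tt y) y +
                \<i> * of_real u * cinner (blinfun_apply ?C y) y + of_real c * of_real ((norm y)\<^sup>2)"
              unfolding blinfun.add_left op_scaleC.rep_eq cinner_add_left cinner_scaleC_left id_blinfun.rep_eq cinner_self by simp
            ultimately show ?thesis using Cpos[of y] u by simp
          qed
        qed (use pick in auto)
        then show "0 \<le> Im (h (of_real t + \<i> * of_real u))" unfolding Xeq unfolding h_def sh .
      qed
      moreover have "((\<lambda>t. Re (h (of_real t))) has_real_derivative Re d) (at t)"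
        using bounded_linear.has_vector_derivative[OF bounded_linear_Re has_vector_derivative_real_field[OF dh]]
        by (simp add: has_real_derivative_iff_has_vector_derivative)
      ultimately show ?thesis by blast
    qed
    then have "Re (h (of_real 0)) \<le> Re (h (of_real 1))"
      by (intro DERIV_nonneg_imp_nondecreasing[of 0 1 "\<lambda>t. Re (h (of_real t))"]) auto
    moreover have "cont_calc f A = op_ps ?a ?T" "cont_calc f B = op_ps ?a (B - op_const (of_real c))"
      using cont_calc_eq_op_ps[OF A(1) _ r] cont_calc_eq_op_ps[OF B(1) _ r] nA nB \<rho>r by auto
    moreover have "op_scaleC 1 ?C = ?C" using Ct[of 1] by simp
    ultimately show ?thesis
      by (simp add: h_def bounded_bilinear.zero_left[OF bounded_bilinear_op_scaleC])
  qed
  have saF: "op_selfadjoint (cont_calc f Y)" if Y: "op_selfadjoint Y" "norm (Y - op_const (of_real c)) \<le> \<rho>" for Y :: "'h \<Rightarrow>\<^sub>L 'h"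
  proof -
    have YB: "Y \<in> bounded_ops" using Y by (simp add: op_selfadjoint_def)
    have eq: "cont_calc f Y = op_ps ?a (Y - op_const (of_real c))"
      using cont_calc_eq_op_ps[OF Y(1) _ r] Y(2) \<rho>r by auto
    have saY: "op_selfadjoint (Y - op_const (of_real c))"
      using Y(1) by (auto simp: op_selfadjoint_iff blinfun_simps cinner_simps cinner_self simp flip: of_real_power)
    have nY: "norm (Y - op_const (of_real c)) \<le> s" using Y(2) s by linarith
    show ?thesis unfolding eq op_selfadjoint_iff
    proof (intro conjI allI)
      show "op_ps ?a (Y - op_const (of_real c)) \<in> bounded_ops"
        using YB by (intro op_ps_bounded_ops[OF sm nY]) auto
    qed (rule real[OF saY nY])
  qed
  have "op_selfadjoint (cont_calc f B - cont_calc f A)"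
    using saF[OF A(1) nA] saF[OF B(1) nB] by (auto simp: op_selfadjoint_iff blinfun_simps cinner_simps)
  then show "op_psd (cont_calc f B - cont_calc f A)"
    using mono by (auto simp: op_psd_def blinfun_simps cinner_simps)
qed

end

section \<open>Positive kernels on the unit disc\<close>

definition slope :: "(complex \<Rightarrow> complex) \<Rightarrow> complex \<Rightarrow> complex \<Rightarrow> complex" where
  "slope h x y = (if x = y then deriv h x else (h x - h y) / (x - y))"

text \<open>Off the diagonal \<open>x^(m+1) - y^(m+1)\<close> is divided by \<open>x - y\<close>,
  hence the shift to \<open>Suc m\<close>; on the diagonal termwise differentiation gives the same
  series.\<close>

lemma slope_sums:
  assumes h: "\<And>w. cmod w < K \<Longrightarrow> (\<lambda>m. b m * w ^ m) sums h w"
    and x: "cmod x < K" and y: "cmod y < K"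
  shows "(\<lambda>m. b (Suc m) * (\<Sum>j\<le>m. x ^ j * y ^ (m - j))) sums slope h x y"
proof (cases "x = y")
  case False
  have "(\<lambda>m. (b m * x ^ m - b m * y ^ m) / (x - y)) sums ((h x - h y) / (x - y))"
    by (intro sums_divide sums_diff h x y)
  then have "(\<lambda>m. (b (Suc m) * x ^ Suc m - b (Suc m) * y ^ Suc m) / (x - y)) sums ((h x - h y) / (x - y))"
    by (subst sums_Suc_iff) simp
  moreover have "(b (Suc m) * x ^ Suc m - b (Suc m) * y ^ Suc m) / (x - y) = b (Suc m) * (\<Sum>j\<le>m. x ^ j * y ^ (m - j))" for m
  proof -
    have "b (Suc m) * x ^ Suc m - b (Suc m) * y ^ Suc m = b (Suc m) * ((x - y) * (\<Sum>j\<le>m. x ^ j * y ^ (m - j)))"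
      unfolding right_diff_distrib[symmetric] diff_power_eq_sum lessThan_Suc_atMost ..
    then show ?thesis using False by simp
  qed
  ultimately show ?thesis using False by (simp only: slope_def if_False)
next
  case True
  have sm: "summable (\<lambda>m. b m * w ^ m)" if "norm w < K" for w using h[OF that] by (rule sums_summable)
  have "((\<lambda>z. \<Sum>n. b n * z ^ n) has_field_derivative (\<Sum>n. diffs b n * x ^ n)) (at x)"
    by (rule termdiffs_strong'[OF sm x])
  then have "(h has_field_derivative (\<Sum>n. diffs b n * x ^ n)) (at x)"
    by (rule has_field_derivative_transform_within_open[where S = "ball 0 K"])
       (use x in \<open>auto simp: sums_unique[OF h, symmetric]\<close>)
  then have "deriv h x = (\<Sum>n. diffs b n * x ^ n)" by (rule DERIV_imp_deriv)
  moreover have "summable (\<lambda>n. diffs b n * x ^ n)" by (rule termdiff_converges[OF x sm])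
  ultimately have "(\<lambda>n. diffs b n * x ^ n) sums deriv h x" by (simp add: summable_sums)
  moreover have "diffs b m * x ^ m = b (Suc m) * (\<Sum>j\<le>m. x ^ j * y ^ (m - j))" for m
    by (simp add: diffs_def True flip: power_add)
  ultimately show ?thesis by (simp add: slope_def True)
qed

text \<open>The kernel \<open>slope h x y / (1 - x y)\<close> for a power series \<open>h\<close> with coefficients \<open>b\<close> on the unit
  disc, as a bilinear form \<open>kform\<close> in the sequences of powers of \<open>x\<close> and \<open>y\<close>.\<close>

locale disc_coeffs =
  fixes b :: "nat \<Rightarrow> complex" and \<rho> :: real
  assumes b: "\<And>\<kappa>. 0 \<le> \<kappa> \<Longrightarrow> \<kappa> < 1 \<Longrightarrow> summable (\<lambda>m. cmod (b m) * \<kappa> ^ m)"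
    and \<rho>: "0 < \<rho>" "\<rho> < 1"
begin

text \<open>The ball of radius \<open>B\<close> in the sup norm with weight \<open>\<rho>^i\<close>.
  Powers of \<open>x\<close> with \<open>|x| \<le> \<rho>\<close> lie in the unit ball, and the
  forms below are bounded in this norm.\<close>

definition bdd :: "real \<Rightarrow> (nat \<Rightarrow> complex) \<Rightarrow> bool" where
  "bdd B s \<longleftrightarrow> (\<forall>i. cmod (s i) \<le> B * \<rho> ^ i)"

definition qterm :: "(nat \<Rightarrow> complex) \<Rightarrow> (nat \<Rightarrow> complex) \<Rightarrow> nat \<Rightarrow> complex" where
  "qterm s s' m = b (Suc m) * (\<Sum>j\<le>m. s j * s' (m - j))"

definition qform :: "(nat \<Rightarrow> complex) \<Rightarrow> (nat \<Rightarrow> complex) \<Rightarrow> complex" where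
  "qform s s' = (\<Sum>m. qterm s s' m)"

definition shift :: "nat \<Rightarrow> (nat \<Rightarrow> complex) \<Rightarrow> nat \<Rightarrow> complex" where
  "shift l s i = s (i + l)"

text \<open>On the powers of \<open>x\<close> and \<open>y\<close>, \<open>qform\<close> takes the
  value \<open>slope h x y\<close>, and shifting both sequences by \<open>l\<close> multiplies it by
  \<open>(x y)^l\<close>; summing over \<open>l\<close> supplies the factor
  \<open>1 / (1 - x y)\<close>. The form is bilinear, so conjugates are put in by hand.\<close>

definition kform :: "(nat \<Rightarrow> complex) \<Rightarrow> (nat \<Rightarrow> complex) \<Rightarrow> complex" where
  "kform s s' = (\<Sum>l. qform (shift l s) (shift l s'))"

definition M :: real where "M = (\<Sum>m. cmod (b (Suc m)) * (real (Suc m) * \<rho> ^ m))"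

text \<open>The convolution in \<open>qterm\<close> has \<open>Suc m\<close> summands, so the bound
  is the termwise differentiated series of the \<open>|b m|\<close>.\<close>

lemma M_summable: "summable (\<lambda>m. cmod (b (Suc m)) * (real (Suc m) * \<rho> ^ m))"
proof -
  have "summable (\<lambda>m. diffs (\<lambda>n. cmod (b n)) m * \<rho> ^ m)"
  proof (rule termdiff_converges[where K = 1])
    fix x :: real assume x: "norm x < 1"
    show "summable (\<lambda>n. cmod (b n) * x ^ n)"
      by (rule summable_comparison_test'[OF b[of "\<bar>x\<bar>"], where N = 0]) (use x in \<open>auto simp: abs_mult power_abs\<close>)
  qed (use \<rho> in simp)
  then show ?thesis by (simp add: diffs_def mult_ac)
qed

lemma M_nonneg: "0 \<le> M"
  unfolding M_def by (rule suminf_nonneg[OF M_summable]) (use \<rho> in simp)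

lemma bdd_nonneg: "bdd B s \<Longrightarrow> 0 \<le> B"
  unfolding bdd_def by (metis mult.right_neutral norm_ge_zero order_trans power_0)

lemma qterm_bound:
  assumes s: "bdd B s" and s': "bdd B' s'"
  shows "cmod (qterm s s' m) \<le> cmod (b (Suc m)) * (real (Suc m) * \<rho> ^ m) * (B * B')"
proof -
  have "cmod (\<Sum>j\<le>m. s j * s' (m - j)) \<le> (\<Sum>j\<le>m. B * B' * \<rho> ^ m)"
  proof (rule sum_norm_le)
    fix j assume j: "j \<in> {..m}"
    have "cmod (s j * s' (m - j)) \<le> (B * \<rho> ^ j) * (B' * \<rho> ^ (m - j))"
      unfolding norm_mult using s s' bdd_nonneg[OF s] \<rho> by (intro mult_mono) (auto simp: bdd_def)
    also have "\<dots> = B * B' * (\<rho> ^ j * \<rho> ^ (m - j))" by (simp only: mult_ac)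
    also have "\<rho> ^ j * \<rho> ^ (m - j) = \<rho> ^ m" using j by (simp flip: power_add)
    finally show "cmod (s j * s' (m - j)) \<le> B * B' * \<rho> ^ m" .
  qed
  also have "\<dots> = real (Suc m) * \<rho> ^ m * (B * B')" by simp
  finally have "cmod (b (Suc m)) * cmod (\<Sum>j\<le>m. s j * s' (m - j)) \<le> cmod (b (Suc m)) * (real (Suc m) * \<rho> ^ m * (B * B'))"
    by (rule mult_left_mono) simp
  then show ?thesis unfolding qterm_def norm_mult by (simp only: mult.assoc)
qed

lemma qform_sums: "bdd B s \<Longrightarrow> bdd B' s' \<Longrightarrow> qterm s s' sums qform s s'"
  unfolding qform_def
  by (intro summable_sums summable_comparison_test'[OF summable_mult2[OF M_summable, of "B * B'"], where N = 0] qterm_bound)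

lemma qform_bound:
  assumes "bdd B s" "bdd B' s'" shows "cmod (qform s s') \<le> M * (B * B')"
proof -
  have sm: "summable (\<lambda>m. cmod (b (Suc m)) * (real (Suc m) * \<rho> ^ m) * (B * B'))" by (rule summable_mult2[OF M_summable])
  have "cmod (qform s s') \<le> (\<Sum>m. cmod (b (Suc m)) * (real (Suc m) * \<rho> ^ m) * (B * B'))"
    unfolding qform_def by (rule norm_suminf_le[OF qterm_bound[OF assms] sm])
  also have "\<dots> = M * (B * B')" unfolding M_def by (rule suminf_mult2[symmetric, OF M_summable])
  finally show ?thesis .
qed

lemma bdd_shift: assumes "bdd B s" shows "bdd (B * \<rho> ^ l) (shift l s)"
  unfolding bdd_def shift_def
proof
  fix i
  have "cmod (s (i + l)) \<le> B * \<rho> ^ (i + l)" using assms by (simp add: bdd_def)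
  then show "cmod (s (i + l)) \<le> B * \<rho> ^ l * \<rho> ^ i" by (simp add: power_add mult_ac)
qed

lemma kterm_bound:
  assumes "bdd B s" "bdd B' s'"
  shows "cmod (qform (shift l s) (shift l s')) \<le> M * (B * B') * (\<rho>\<^sup>2) ^ l"
proof -
  have "cmod (qform (shift l s) (shift l s')) \<le> M * (B * \<rho> ^ l * (B' * \<rho> ^ l))"
    by (intro qform_bound bdd_shift assms)
  also have "\<dots> = M * (B * B') * (\<rho>\<^sup>2) ^ l" by (simp add: power2_eq_square power_mult_distrib mult_ac)
  finally show ?thesis .
qed

lemma geom: "summable (\<lambda>l. (\<rho>\<^sup>2) ^ l)"
proof (rule summable_geometric)
  have "\<rho> * \<rho> < 1 * 1" using \<rho> by (intro mult_strict_mono) auto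
  then show "norm (\<rho>\<^sup>2) < 1" by (simp add: power2_eq_square)
qed

lemma kform_sums: "bdd B s \<Longrightarrow> bdd B' s' \<Longrightarrow> (\<lambda>l. qform (shift l s) (shift l s')) sums kform s s'"
  unfolding kform_def
  by (intro summable_sums summable_comparison_test'[OF summable_mult[OF geom, of "M * (B * B')"], where N = 0] kterm_bound)

definition N :: real where "N = M * (\<Sum>l. (\<rho>\<^sup>2) ^ l)"

lemma N_nonneg: "0 \<le> N"
  unfolding N_def by (intro mult_nonneg_nonneg M_nonneg suminf_nonneg geom) simp

lemma kform_bound:
  assumes "bdd B s" "bdd B' s'" shows "cmod (kform s s') \<le> N * (B * B')"
proof -
  have "cmod (kform s s') \<le> (\<Sum>l. M * (B * B') * (\<rho>\<^sup>2) ^ l)"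
    unfolding kform_def by (rule norm_suminf_le[OF kterm_bound[OF assms] summable_mult[OF geom]])
  also have "\<dots> = M * (B * B') * (\<Sum>l. (\<rho>\<^sup>2) ^ l)" by (rule suminf_mult[OF geom])
  finally show ?thesis by (simp add: N_def mult_ac)
qed

lemma bdd_add: "bdd B s \<Longrightarrow> bdd B' s' \<Longrightarrow> bdd (B + B') (\<lambda>i. s i + s' i)"
  unfolding bdd_def by (metis (no_types, lifting) add_mono distrib_right norm_triangle_le)

lemma bdd_cmult: assumes "bdd B s" shows "bdd (cmod c * B) (\<lambda>i. c * s i)"
  unfolding bdd_def
proof
  fix i
  have "cmod (s i) \<le> B * \<rho> ^ i" using assms by (simp add: bdd_def)
  then have "cmod c * cmod (s i) \<le> cmod c * (B * \<rho> ^ i)" by (rule mult_left_mono) simp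
  then show "cmod (c * s i) \<le> cmod c * B * \<rho> ^ i" by (simp add: norm_mult mult.assoc)
qed

lemma bdd_cnj: "bdd B s \<Longrightarrow> bdd B (\<lambda>i. cnj (s i))"
  by (simp add: bdd_def)

lemma bdd_power: "cmod x \<le> \<rho> \<Longrightarrow> bdd 1 (\<lambda>i. x ^ i)"
  by (simp add: bdd_def norm_power power_mono)

lemma kform_lincomb_left:
  assumes s: "bdd B s" and t: "bdd C t" and s': "bdd B' s'"
  shows "kform (\<lambda>i. s i + c * t i) s' = kform s s' + c * kform t s'"
proof -
  have q: "qform (\<lambda>i. s i + c * t i) s' = qform s s' + c * qform t s'"
    if s: "bdd B s" and t: "bdd C t" and s': "bdd B' s'" for s t s' B B' C
  proof -
    have "(\<lambda>m. qterm s s' m + c * qterm t s' m) sums (qform s s' + c * qform t s')"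
      by (intro sums_add sums_mult qform_sums[OF s s'] qform_sums[OF t s'])
    moreover have "qterm s s' m + c * qterm t s' m = qterm (\<lambda>i. s i + c * t i) s' m" for m
      by (simp add: qterm_def distrib_left distrib_right sum.distrib sum_distrib_left mult_ac)
    ultimately show ?thesis by (simp add: qform_def sums_iff)
  qed
  have "(\<lambda>l. qform (shift l s) (shift l s') + c * qform (shift l t) (shift l s')) sums (kform s s' + c * kform t s')"
    by (intro sums_add sums_mult kform_sums[OF s s'] kform_sums[OF t s'])
  moreover have "qform (shift l s) (shift l s') + c * qform (shift l t) (shift l s') =
      qform (shift l (\<lambda>i. s i + c * t i)) (shift l s')" for l
    using q[OF bdd_shift[OF s] bdd_shift[OF t] bdd_shift[OF s'], of l l l] by (simp add: shift_def[abs_def])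
  ultimately show ?thesis by (simp add: kform_def sums_iff)
qed

text \<open>Carries linearity and bounds from the first argument over to the second.\<close>

lemma kform_commute: "kform s s' = kform s' s"
proof -
  have "qterm s s' m = qterm s' s m" for s s' m
  proof -
    have "(\<Sum>j\<le>m. s j * s' (m - j)) = (\<Sum>j\<le>m. s (m - j) * s' (m - (m - j)))"
      by (rule sum.reindex_bij_witness[where i = "\<lambda>j. m - j" and j = "\<lambda>j. m - j"]) auto
    also have "\<dots> = (\<Sum>j\<le>m. s' j * s (m - j))" by (rule sum.cong) (auto simp: mult.commute)
    finally show ?thesis by (simp add: qterm_def)
  qed
  then show ?thesis by (simp add: kform_def qform_def)
qed

lemma kform_power:
  assumes h: "\<And>w. cmod w < 1 \<Longrightarrow> (\<lambda>m. b m * w ^ m) sums h w"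
    and x: "cmod x \<le> \<rho>" and y: "cmod y \<le> \<rho>"
  shows "kform (\<lambda>i. x ^ i) (\<lambda>i. y ^ i) = slope h x y / (1 - x * y)"
proof -
  have x1: "cmod x < 1" "cmod y < 1" using x y \<rho> by auto
  have "qform (shift l (\<lambda>i. x ^ i)) (shift l (\<lambda>i. y ^ i)) = (x * y) ^ l * slope h x y" for l
  proof -
    have "(\<lambda>m. (x * y) ^ l * (b (Suc m) * (\<Sum>j\<le>m. x ^ j * y ^ (m - j)))) sums ((x * y) ^ l * slope h x y)"
      by (intro sums_mult slope_sums[OF h x1])
    moreover have "(x * y) ^ l * (b (Suc m) * (\<Sum>j\<le>m. x ^ j * y ^ (m - j))) = qterm (shift l (\<lambda>i. x ^ i)) (shift l (\<lambda>i. y ^ i)) m" for m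
      by (simp only: qterm_def shift_def power_add power_mult_distrib sum_distrib_left mult_ac)
    ultimately show ?thesis by (simp add: qform_def sums_iff)
  qed
  moreover have "cmod (x * y) < 1"
    using x1 mult_strict_mono'[of "cmod x" 1 "cmod y" 1] by (simp add: norm_mult)
  then have "(\<lambda>l. (x * y) ^ l * slope h x y) sums (1 / (1 - x * y) * slope h x y)"
    by (intro sums_mult2 geometric_sums)
  ultimately show ?thesis by (simp add: kform_def sums_iff)
qed

text \<open>Finite combinations of power sequences of real nodes, built one term at a time so that
  closure properties follow by induction; \<open>power_comb_sum\<close> returns to indexed
  sums.\<close>

inductive power_comb :: "real \<Rightarrow> (nat \<Rightarrow> complex) \<Rightarrow> bool" for \<tau> where
  zero: "power_comb \<tau> (\<lambda>_. 0)"
| step: "power_comb \<tau> v \<Longrightarrow> \<bar>t\<bar> < \<tau> \<Longrightarrow> power_comb \<tau> (\<lambda>i. v i + c * of_real t ^ i)"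

lemma power_comb_add: "power_comb \<tau> w \<Longrightarrow> power_comb \<tau> v \<Longrightarrow> power_comb \<tau> (\<lambda>i. v i + w i)"
  by (induction rule: power_comb.induct) (auto simp: add.assoc[symmetric] intro: power_comb.step)

lemma power_comb_cmult: "power_comb \<tau> w \<Longrightarrow> power_comb \<tau> (\<lambda>i. d * w i)"
proof (induction rule: power_comb.induct)
  case (step v t c)
  then have "power_comb \<tau> (\<lambda>i. d * v i + (d * c) * of_real t ^ i)" by (intro power_comb.step)
  then show ?case by (simp add: distrib_left mult.assoc)
qed (simp add: power_comb.zero)

lemma power_comb_sum:
  assumes "power_comb \<tau> w"
  shows "\<exists>(n::nat) c t. (\<forall>k<n. \<bar>t k\<bar> < \<tau>) \<and> w = (\<lambda>i. \<Sum>k<n. c k * of_real (t k) ^ i)"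
  using assms
proof induction
  case zero
  show ?case by (rule exI[of _ "0::nat"]) simp
next
  case (step v t c)
  then obtain n :: nat and c' t' where *: "\<forall>k<n. \<bar>t' k\<bar> < \<tau>" "v = (\<lambda>i. \<Sum>k<n. c' k * of_real (t' k) ^ i)" by blast
  show ?case
    by (intro exI[of _ "Suc n"] exI[of _ "c'(n := c)"] exI[of _ "t'(n := t)"])
       (use * step(2) in \<open>auto simp: less_Suc_eq\<close>)
qed

lemma power_comb_bdd: assumes "power_comb \<tau> w" "\<tau> \<le> \<rho>" shows "\<exists>B. bdd B w"
  using assms
proof induction
  case zero
  show ?case by (rule exI[of _ 0]) (simp add: bdd_def)
next
  case (step v t c)
  then obtain B where "bdd B v" by blast
  moreover have "bdd (cmod c * 1) (\<lambda>i. c * of_real t ^ i)" using step by (intro bdd_cmult bdd_power) simp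
  ultimately show ?case using bdd_add by blast
qed

text \<open>Membership in the closure of these combinations in the weighted norm. The difference is
  written with the scalar \<open>-1\<close> to match the shape of
  \<open>kform_lincomb_left\<close>.\<close>

definition approx :: "real \<Rightarrow> (nat \<Rightarrow> complex) \<Rightarrow> bool" where
  "approx \<tau> s \<longleftrightarrow> (\<forall>e>0. \<exists>v. power_comb \<tau> v \<and> bdd e (\<lambda>i. s i + (-1) * v i))"

lemma approx_power_comb: "power_comb \<tau> v \<Longrightarrow> approx \<tau> v"
  using \<rho> by (auto simp: approx_def bdd_def intro!: exI[of _ v])

lemma approx_lincomb:
  assumes s: "approx \<tau> s" and t: "approx \<tau> t" shows "approx \<tau> (\<lambda>i. s i + c * t i)"
  unfolding approx_def
proof (intro allI impI)
  fix e :: real assume e: "e > 0"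
  obtain v where v: "power_comb \<tau> v" "bdd (e/2) (\<lambda>i. s i + (-1) * v i)" using s e unfolding approx_def by (meson half_gt_zero)
  define q where "q = cmod c + 1"
  define e' where "e' = e / 2 / q"
  have e': "e' > 0" "cmod c * e' \<le> e / 2"
  proof -
    have p: "q > 0" by (simp add: q_def add_nonneg_pos)
    then show "e' > 0" using e by (simp add: e'_def)
    have "cmod c * e' \<le> q * e'" using \<open>e' > 0\<close> by (intro mult_right_mono) (auto simp: q_def)
    also have "\<dots> = e / 2" using p by (simp add: e'_def)
    finally show "cmod c * e' \<le> e / 2" .
  qed
  obtain w where w: "power_comb \<tau> w" "bdd e' (\<lambda>i. t i + (-1) * w i)" using t e'(1) unfolding approx_def by blast
  have bd: "bdd (e / 2 + cmod c * e') (\<lambda>i. (s i + (-1) * v i) + c * (t i + (-1) * w i))"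
    by (intro bdd_add bdd_cmult v w)
  have eq: "(s i + (-1) * v i) + c * (t i + (-1) * w i) = s i + c * t i + (-1) * (v i + c * w i)" for i
    by (simp add: algebra_simps)
  from bd have "bdd (e / 2 + cmod c * e') (\<lambda>i. s i + c * t i + (-1) * (v i + c * w i))" by (simp only: eq)
  then have le: "cmod (s i + c * t i + (-1) * (v i + c * w i)) \<le> (e / 2 + cmod c * e') * \<rho> ^ i" for i
    unfolding bdd_def by blast
  have "(e / 2 + cmod c * e') * \<rho> ^ i \<le> e * \<rho> ^ i" for i
    using e'(2) \<rho> by (intro mult_right_mono) auto
  with le have "bdd e (\<lambda>i. s i + c * t i + (-1) * (v i + c * w i))"
    unfolding bdd_def using order_trans by blast
  moreover have "power_comb \<tau> (\<lambda>i. v i + c * w i)"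
    by (rule power_comb_add[OF power_comb_cmult[OF w(1)] v(1)])
  ultimately show "\<exists>v. power_comb \<tau> v \<and> bdd e (\<lambda>i. s i + c * t i + - 1 * v i)" by blast
qed

lemma approx_limit:
  assumes "\<And>e. e > 0 \<Longrightarrow> \<exists>w. approx \<tau> w \<and> bdd e (\<lambda>i. s i + (-1) * w i)"
  shows "approx \<tau> s"
  unfolding approx_def
proof (intro allI impI)
  fix e :: real assume e: "e > 0"
  obtain w where w: "approx \<tau> w" "bdd (e/2) (\<lambda>i. s i + (-1) * w i)" using assms[of "e/2"] e by auto
  obtain v where v: "power_comb \<tau> v" "bdd (e/2) (\<lambda>i. w i + (-1) * v i)" using w(1) e unfolding approx_def by (meson half_gt_zero)
  have "bdd (e/2 + e/2) (\<lambda>i. (s i + (-1) * w i) + (w i + (-1) * v i))" by (intro bdd_add v w)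
  then have "bdd e (\<lambda>i. s i + (-1) * v i)" by simp
  then show "\<exists>v. power_comb \<tau> v \<and> bdd e (\<lambda>i. s i + - 1 * v i)" using v(1) by blast
qed

lemma approx_zero: "approx \<tau> (\<lambda>_. 0)"
  by (rule approx_power_comb[OF power_comb.zero])

lemma approx_sum:
  "finite I \<Longrightarrow> (\<And>j. j \<in> I \<Longrightarrow> approx \<tau> (s j)) \<Longrightarrow> approx \<tau> (\<lambda>i. \<Sum>j\<in>I. c j * s j i)"
proof (induction rule: finite_induct)
  case (insert x F)
  then have "approx \<tau> (\<lambda>i. (\<Sum>j\<in>F. c j * s j i) + c x * s x i)" by (intro approx_lincomb) auto
  then show ?case using insert by (simp add: add.commute)
qed (simp add: approx_zero)

text \<open>Removing the first \<open>j\<close> terms from the powers of \<open>t\<close>, dividing by \<open>t\<^sup>j\<close> and letting \<open>t\<close> tend to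
  \<open>0\<close> leaves the \<open>j\<close>-th unit sequence.\<close>

lemma approx_unit:
  assumes \<tau>: "0 < \<tau>" "\<tau> \<le> \<rho>"
  shows "approx \<tau> (\<lambda>i. if i = j then 1 else 0)"
proof (induction j rule: less_induct)
  case (less j)
  show ?case
  proof (rule approx_limit)
    fix e :: real assume e: "e > 0"
    \<comment> \<open>The error at an index \<open>i > j\<close> is \<open>t^(i - j)\<close>: one
      factor \<open>t \<le> e \<rho>^(j + 1)\<close> and \<open>t < \<rho>\<close> for the others
      bring it below \<open>e \<rho>^i\<close>. Smaller indices cancel exactly.\<close>
    define t where "t = min (\<tau> / 2) (e * \<rho> ^ Suc j)"
    have "0 < e * \<rho> ^ Suc j" using e \<rho> by simp
    then have "0 < t" unfolding t_def min_less_iff_conj using \<tau> by simp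
    moreover have "t \<le> \<tau> / 2" "t \<le> e * \<rho> ^ Suc j" unfolding t_def by (rule min.cobounded1, rule min.cobounded2)
    ultimately have t: "0 < t" "t < \<tau>" "t \<le> e * \<rho> ^ Suc j" "t < \<rho>" using \<tau> by linarith+
    let ?p = "\<lambda>i. complex_of_real t ^ i"
    let ?w = "\<lambda>i. (1 / of_real t ^ j) * (?p i + (-1) * (\<Sum>l<j. ?p l * (if i = l then 1 else 0)))"
    have "power_comb \<tau> (\<lambda>i. 0 + 1 * of_real t ^ i)" using t by (intro power_comb.intros) auto
    then have p: "approx \<tau> ?p" using approx_power_comb by simp
    have "approx \<tau> (\<lambda>i. ?p i + (-1) * (\<Sum>l<j. ?p l * (if i = l then 1 else 0)))"
      by (intro approx_lincomb p approx_sum less) auto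
    from approx_lincomb[OF approx_zero this, of "1 / of_real t ^ j"] have "approx \<tau> ?w" by simp
    moreover have "bdd e (\<lambda>i. (if i = j then 1 else 0) + (-1) * ?w i)"
      unfolding bdd_def
    proof
      fix i
      have sm: "(\<Sum>l<j. ?p l * (if i = l then 1 else 0)) = (if i < j then ?p i else 0)"
        by (simp add: if_distrib[of "\<lambda>x. _ * x"] sum.delta cong: if_cong)
      consider "i < j" | "i = j" | "i > j" by linarith
      then show "cmod ((if i = j then 1 else 0) + (-1) * ?w i) \<le> e * \<rho> ^ i"
      proof cases
        case 1
        then show ?thesis unfolding sm using e \<rho> by simp
      next
        case 2
        then show ?thesis unfolding sm using e \<rho> t by simp
      next
        case 3
        have "cmod ((if i = j then 1 else 0) + (-1) * ?w i) = t ^ i / t ^ j"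
          unfolding sm using 3 t by (simp add: norm_mult norm_divide norm_power)
        also have "\<dots> = t * t ^ (i - Suc j)"
        proof -
          have "t ^ i = t ^ j * (t * t ^ (i - Suc j))"
            using 3 by (metis Suc_leI le_add_diff_inverse power_Suc power_add mult.assoc mult.commute)
          then show ?thesis using t by simp
        qed
        also have "\<dots> \<le> (e * \<rho> ^ Suc j) * \<rho> ^ (i - Suc j)" using t e \<rho> by (intro mult_mono power_mono) auto
        also have "\<dots> = e * \<rho> ^ i" using 3 by (metis Suc_leI le_add_diff_inverse mult.assoc power_add)
        finally show ?thesis .
      qed
    qed
    ultimately show "\<exists>w. approx \<tau> w \<and> bdd e (\<lambda>i. (if i = j then 1 else 0) + (-1) * w i)" by blast
  qed
qed

text \<open>Here the real axis is left: the powers of a complex \<open>u\<close>, cut off at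
  \<open>n\<close>, are a combination of unit sequences, and the tail has weighted norm at most
  \<open>(|u| / \<rho>)^n\<close>, which is small because \<open>|u| < \<rho>\<close>.\<close>

lemma approx_power:
  assumes \<tau>: "0 < \<tau>" "\<tau> \<le> \<rho>" and u: "cmod u < \<rho>"
  shows "approx \<tau> (\<lambda>i. u ^ i)"
proof (rule approx_limit)
  fix e :: real assume e: "e > 0"
  define q where "q = cmod u / \<rho>"
  have q: "0 \<le> q" "q < 1" using u \<rho> by (auto simp: q_def)
  obtain n where n: "q ^ n < e" using real_arch_pow_inv[OF e q(2)] by blast
  let ?w = "\<lambda>i. \<Sum>j<n. u ^ j * (if i = j then 1 else 0)"
  have "approx \<tau> ?w" by (intro approx_sum approx_unit \<tau>) auto
  moreover have "bdd e (\<lambda>i. u ^ i + (-1) * ?w i)"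
    unfolding bdd_def
  proof
    fix i
    have sm: "?w i = (if i < n then u ^ i else 0)"
      by (simp add: if_distrib[of "\<lambda>x. _ * x"] sum.delta cong: if_cong)
    show "cmod (u ^ i + (-1) * ?w i) \<le> e * \<rho> ^ i"
    proof (cases "i < n")
      case True
      then show ?thesis unfolding sm using e \<rho> by simp
    next
      case False
      have "cmod (u ^ i + (-1) * ?w i) = q ^ i * \<rho> ^ i"
        unfolding sm using False \<rho> by (simp add: norm_power q_def power_divide)
      also have "\<dots> \<le> e * \<rho> ^ i"
      proof (rule mult_right_mono)
        have "q ^ i \<le> q ^ n" using False q by (intro power_decreasing) auto
        then show "q ^ i \<le> e" using n by linarith
      qed (use \<rho> in simp)
      finally show ?thesis .
    qed
  qed
  ultimately show "\<exists>w. approx \<tau> w \<and> bdd e (\<lambda>i. u ^ i + (-1) * w i)" by blast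
qed

lemma kform_approx_nonneg:
  assumes \<tau>: "0 < \<tau>" "\<tau> \<le> \<rho>"
    and pos: "\<And>v. power_comb \<tau> v \<Longrightarrow> 0 \<le> Re (kform v (\<lambda>i. cnj (v i)))"
    and s: "approx \<tau> s" and sb: "bdd B s"
  shows "0 \<le> Re (kform s (\<lambda>i. cnj (s i)))"
proof (rule ccontr)
  assume neg: "\<not> ?thesis"
  define x where "x = - Re (kform s (\<lambda>i. cnj (s i)))"
  have x: "x > 0" using neg by (simp add: x_def)
  have B: "0 \<le> B" by (rule bdd_nonneg[OF sb])
  \<comment> \<open>Exchanging \<open>s\<close> for \<open>v\<close> changes the form by at most
    \<open>N e (2 B + 1)\<close>, which this choice makes smaller than the supposed defect
    \<open>x\<close>; \<open>e \<le> 1\<close> gives \<open>bdd (B + 1) v\<close>.\<close>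
  define e where "e = min 1 (x / (2 * (N * (2 * B + 1) + 1)))"
  have den: "N * (2 * B + 1) + 1 > 0" using N_nonneg B by (simp add: add_nonneg_pos)
  have e: "e > 0" "e \<le> 1" using x den by (auto simp: e_def)
  have "e \<le> x / (2 * (N * (2 * B + 1) + 1))" by (simp add: e_def)
  then have ex: "2 * (e * (N * (2 * B + 1) + 1)) \<le> x" using den by (simp add: pos_le_divide_eq mult_ac)
  obtain v where v: "power_comb \<tau> v" "bdd e (\<lambda>i. s i + (-1) * v i)" using s e unfolding approx_def by blast
  obtain Bv' where Bv': "bdd Bv' v" using power_comb_bdd[OF v(1) \<tau>(2)] by blast
  let ?d = "\<lambda>i. s i + (-1) * v i"
  have vb: "bdd (B + cmod (-1) * e) v"
  proof -
    have "bdd (B + cmod (-1) * e) (\<lambda>i. s i + (-1) * ?d i)" by (intro bdd_add sb bdd_cmult v)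
    then show ?thesis by simp
  qed
  have vb: "bdd (B + 1) v"
    unfolding bdd_def
  proof
    fix i
    have "cmod (v i) \<le> (B + cmod (-1) * e) * \<rho> ^ i" using vb by (simp add: bdd_def)
    also have "\<dots> \<le> (B + 1) * \<rho> ^ i" using e \<rho> by (intro mult_right_mono) auto
    finally show "cmod (v i) \<le> (B + 1) * \<rho> ^ i" .
  qed
  have 1: "kform ?d (\<lambda>i. cnj (s i)) = kform s (\<lambda>i. cnj (s i)) + (-1) * kform v (\<lambda>i. cnj (s i))"
    by (rule kform_lincomb_left[OF sb vb bdd_cnj[OF sb]])
  have 2: "kform (\<lambda>i. cnj (?d i)) v = kform (\<lambda>i. cnj (s i)) v + (-1) * kform (\<lambda>i. cnj (v i)) v"
    using kform_lincomb_left[OF bdd_cnj[OF sb] bdd_cnj[OF vb] vb, of "-1"] by simp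
  \<comment> \<open>The form at \<open>s\<close> passes to the form at \<open>v\<close> in one
    argument at a time.\<close>
  have "kform s (\<lambda>i. cnj (s i)) = kform v (\<lambda>i. cnj (v i)) + (kform ?d (\<lambda>i. cnj (s i)) + kform (\<lambda>i. cnj (?d i)) v)"
    unfolding 1 2 kform_commute[of "\<lambda>i. cnj (s i)" v] kform_commute[of "\<lambda>i. cnj (v i)" v] by simp
  then have "Re (kform s (\<lambda>i. cnj (s i))) = Re (kform v (\<lambda>i. cnj (v i))) + Re (kform ?d (\<lambda>i. cnj (s i)) + kform (\<lambda>i. cnj (?d i)) v)"
    by (simp only: plus_complex.sel)
  moreover have "cmod (kform ?d (\<lambda>i. cnj (s i)) + kform (\<lambda>i. cnj (?d i)) v) \<le> N * (e * B) + N * (e * (B + 1))"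
    by (rule order_trans[OF norm_triangle_ineq])
       (intro add_mono kform_bound v bdd_cnj[OF sb] bdd_cnj[OF v(2)] vb)
  moreover have "\<bar>Re (kform ?d (\<lambda>i. cnj (s i)) + kform (\<lambda>i. cnj (?d i)) v)\<bar> \<le> cmod (kform ?d (\<lambda>i. cnj (s i)) + kform (\<lambda>i. cnj (?d i)) v)"
    by (rule abs_Re_le_cmod)
  moreover have "N * (e * B) + N * (e * (B + 1)) = e * (N * (2 * B + 1) + 1) - e" by (simp add: algebra_simps)
  ultimately have "x \<le> e * (N * (2 * B + 1) + 1) - e" using pos[OF v(1)] unfolding x_def by linarith
  then show False using ex e x by linarith
qed

text \<open>The radius \<open>\<tau>\<close> of the real nodes may be far smaller than
  \<open>\<rho>\<close>: positivity on a short interval about 0 reaches the whole disc of radius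
  \<open>\<rho>\<close>. For the sequence \<open>u^i\<close> the conjugate is
  \<open>(cnj u)^i\<close>, which places the kernel at \<open>(u, cnj u)\<close>.\<close>

theorem kernel_nonneg:
  assumes h: "\<And>w. cmod w < 1 \<Longrightarrow> (\<lambda>m. b m * w ^ m) sums h w"
    and \<tau>: "0 < \<tau>" "\<tau> \<le> \<rho>"
    and pos: "\<And>n c t. (\<forall>k<n. \<bar>t k\<bar> < \<tau>) \<Longrightarrow> 0 \<le> Re (\<Sum>k<n::nat. \<Sum>l<n. c k * cnj (c l) *
        (slope h (of_real (t k)) (of_real (t l)) / (1 - of_real (t k) * of_real (t l))))"
    and u: "cmod u < \<rho>"
  shows "0 \<le> Re (slope h u (cnj u) / (1 - u * cnj u))"
proof -
  have lin: "kform (\<lambda>i. \<Sum>k<n. c k * of_real (t k) ^ i) s' = (\<Sum>k<n. c k * kform (\<lambda>i. of_real (t k) ^ i) s')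
      \<and> (\<exists>B. bdd B (\<lambda>i. \<Sum>k<n. c k * of_real (t k) ^ i))"
    if s': "bdd B' s'" and t: "\<forall>k<n. \<bar>t k\<bar> < \<tau>" for n :: nat and c t s' B'
    using t
  proof (induction n)
    case 0
    have z: "bdd 0 (\<lambda>_. 0)" by (simp add: bdd_def)
    have "kform (\<lambda>_. 0 + (-1) * 0) s' = kform (\<lambda>_. 0) s' + (-1) * kform (\<lambda>_. 0) s'"
      by (rule kform_lincomb_left[OF z z s'])
    then show ?case using z by auto
  next
    case (Suc n)
    then obtain B where B: "bdd B (\<lambda>i. \<Sum>k<n. c k * of_real (t k) ^ i)" by auto
    have p: "bdd 1 (\<lambda>i. complex_of_real (t n) ^ i)" using Suc.prems \<tau> by (intro bdd_power) auto
    show ?case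
      using kform_lincomb_left[OF B p s', of "c n"] bdd_add[OF B bdd_cmult[OF p, of "c n"]] Suc by auto
  qed
  have "0 \<le> Re (kform v (\<lambda>i. cnj (v i)))" if pc: "power_comb \<tau> v" for v
  proof -
    obtain n :: nat and c t where t: "\<forall>k<n. \<bar>t k\<bar> < \<tau>" and v: "v = (\<lambda>i. \<Sum>k<n. c k * of_real (t k) ^ i)"
      using power_comb_sum[OF pc] by blast
    obtain B where B: "bdd B v" using power_comb_bdd[OF pc \<tau>(2)] by blast
    have cv: "(\<lambda>i. cnj (v i)) = (\<lambda>i. \<Sum>k<n. cnj (c k) * of_real (t k) ^ i)" by (simp add: v)
    have tk: "cmod (of_real (t k)) \<le> \<rho>" if "k < n" for k using t that \<tau> by auto
    have "kform v (\<lambda>i. cnj (v i)) = (\<Sum>k<n. c k * kform (\<lambda>i. of_real (t k) ^ i) (\<lambda>i. cnj (v i)))"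
      using lin[OF bdd_cnj[OF B] t, of c] by (simp only: v)
    also have "\<dots> = (\<Sum>k<n. c k * (\<Sum>l<n. cnj (c l) * kform (\<lambda>i. of_real (t l) ^ i) (\<lambda>i. of_real (t k) ^ i)))"
    proof (rule sum.cong[OF refl])
      fix k assume "k \<in> {..<n}"
      then have "bdd 1 (\<lambda>i. complex_of_real (t k) ^ i)" using tk by (intro bdd_power) auto
      from lin[OF this t, of "\<lambda>l. cnj (c l)"]
      show "c k * kform (\<lambda>i. of_real (t k) ^ i) (\<lambda>i. cnj (v i)) =
          c k * (\<Sum>l<n. cnj (c l) * kform (\<lambda>i. of_real (t l) ^ i) (\<lambda>i. of_real (t k) ^ i))"
        unfolding cv kform_commute[of "\<lambda>i. complex_of_real (t k) ^ i"] by simp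
    qed
    also have "\<dots> = (\<Sum>k<n. \<Sum>l<n. c k * cnj (c l) * (slope h (of_real (t k)) (of_real (t l)) / (1 - of_real (t k) * of_real (t l))))"
    proof (unfold sum_distrib_left, intro sum.cong[OF refl])
      fix k l assume kl: "k \<in> {..<n}" "l \<in> {..<n}"
      have "kform (\<lambda>i. complex_of_real (t l) ^ i) (\<lambda>i. of_real (t k) ^ i) = slope h (of_real (t k)) (of_real (t l)) / (1 - of_real (t k) * of_real (t l))"
        unfolding kform_commute[of "\<lambda>i. complex_of_real (t l) ^ i"] by (rule kform_power[OF h]) (use tk kl in auto)
      then show "c k * (cnj (c l) * kform (\<lambda>i. complex_of_real (t l) ^ i) (\<lambda>i. of_real (t k) ^ i)) =
         c k * cnj (c l) * (slope h (of_real (t k)) (of_real (t l)) / (1 - of_real (t k) * of_real (t l)))"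
        by (simp only: mult.assoc)
    qed
    finally show ?thesis using pos[OF t, of c] by simp
  qed
  from kform_approx_nonneg[OF \<tau> this approx_power[OF \<tau> u] bdd_power[OF less_imp_le[OF u]]]
  have "0 \<le> Re (kform (\<lambda>i. u ^ i) (\<lambda>i. cnj (u ^ i)))" .
  also have "kform (\<lambda>i. u ^ i) (\<lambda>i. cnj (u ^ i)) = slope h u (cnj u) / (1 - u * cnj u)"
    unfolding complex_cnj_power by (rule kform_power[OF h]) (use u in auto)
  finally show ?thesis .
qed

end

section \<open>Loewner matrices of operator monotone functions\<close>

definition ortho :: "(nat \<Rightarrow> 'a::chilbert_space) \<Rightarrow> nat \<Rightarrow> bool" where
  "ortho e n \<longleftrightarrow> (\<forall>i<n. \<forall>j<n. cinner (e i) (e j) = (if i = j then 1 else 0))"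

lemma orthoD: "ortho e n \<Longrightarrow> i < n \<Longrightarrow> j < n \<Longrightarrow> cinner (e i) (e j) = (if i = j then 1 else 0)"
  by (simp add: ortho_def)

lemma ortho_coeff:
  assumes "ortho e n" "i < n" shows "cinner (\<Sum>j<n. scaleC (c j) (e j)) (e i) = c i"
proof -
  have "cinner (\<Sum>j<n. scaleC (c j) (e j)) (e i) = (\<Sum>j<n. if j = i then c j else 0)"
    unfolding cinner_sum_left by (intro sum.cong) (auto simp: cinner_simps orthoD[OF assms(1) _ assms(2)])
  then show ?thesis using assms(2) by simp
qed

lemma ortho_coeff_right:
  assumes "ortho e n" "i < n" shows "cinner (e i) (\<Sum>j<n. scaleC (c j) (e j)) = cnj (c i)"
  by (subst cinner_commute) (simp add: ortho_coeff[OF assms])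

lemma ortho_norm:
  assumes "ortho e n" shows "(norm (\<Sum>j<n. scaleC (c j) (e j)))\<^sup>2 = (\<Sum>j<n. (cmod (c j))\<^sup>2)"
proof -
  let ?v = "\<Sum>j<n. scaleC (c j) (e j)"
  have "complex_of_real ((norm ?v)\<^sup>2) = cinner ?v ?v" by (simp only: cinner_self)
  also have "\<dots> = (\<Sum>j<n. c j * cinner (e j) ?v)" by (subst cinner_sum_left) (simp only: cinner_scaleC_left)
  also have "\<dots> = (\<Sum>j<n. of_real ((cmod (c j))\<^sup>2))"
    by (intro sum.cong refl) (simp only: lessThan_iff ortho_coeff_right[OF assms] complex_norm_square)
  finally have "complex_of_real ((norm ?v)\<^sup>2) = complex_of_real (\<Sum>j<n. (cmod (c j))\<^sup>2)" by (simp only: of_real_sum)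
  then show ?thesis by (simp only: of_real_eq_iff)
qed

lemma bessel:
  assumes "ortho e n" shows "(\<Sum>j<n. (cmod (cinner h (e j)))\<^sup>2) \<le> (norm h)\<^sup>2"
proof -
  let ?p = "\<Sum>j<n. scaleC (cinner h (e j)) (e j)"
  have "cinner h ?p = (\<Sum>j<n. of_real ((cmod (cinner h (e j)))\<^sup>2))"
    unfolding cinner_sum_right by (intro sum.cong refl) (simp only: cinner_scaleC_right complex_norm_square mult.commute)
  then have "Re (cinner h ?p) = (\<Sum>j<n. (cmod (cinner h (e j)))\<^sup>2)" by (simp only: of_real_sum[symmetric] Re_complex_of_real)
  moreover have "0 \<le> (norm (h - ?p))\<^sup>2" by simp
  ultimately show ?thesis unfolding norm_diff_square ortho_norm[OF assms] by simp
qed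

text \<open>A Gram-Schmidt step. Infinite dimension is used in this form: orthonormal systems of
  every finite length, in which matrices of every size can be realised.\<close>

lemma ortho_ex:
  assumes "\<not> (\<exists>S. finite S \<and> complex_vector.span S = (UNIV :: 'a::chilbert_space set))"
  shows "\<exists>e :: nat \<Rightarrow> 'a. ortho e n"
proof (induction n)
  case 0
  show ?case by (simp add: ortho_def)
next
  case (Suc n)
  then obtain e :: "nat \<Rightarrow> 'a" where e: "ortho e n" by blast
  have "complex_vector.span (e ` {..<n}) \<noteq> UNIV" using assms by blast
  then obtain x where x: "x \<notin> complex_vector.span (e ` {..<n})" by blast
  define p where "p = (\<Sum>j<n. scaleC (cinner x (e j)) (e j))"
  define w where "w = x - p"
  have "p \<in> complex_vector.span (e ` {..<n})"
    unfolding p_def by (intro complex_vector.span_sum complex_vector.span_scale complex_vector.span_base) auto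
  then have w0: "w \<noteq> 0" using x by (auto simp: w_def)
  have we: "cinner w (e i) = 0" if "i < n" for i
    using ortho_coeff[OF e that, of "\<lambda>j. cinner x (e j)"] by (simp add: w_def p_def cinner_simps)
  have ew: "cinner (e i) w = 0" if "i < n" for i
    by (subst cinner_commute) (simp add: we[OF that])
  define u where "u = (1 / norm w) *\<^sub>R w"
  have uu: "cinner u u = 1" using w0 by (simp add: cinner_self u_def)
  have "ortho (e(n := u)) (Suc n)"
    unfolding ortho_def
  proof (intro allI impI)
    fix i j assume "i < Suc n" "j < Suc n"
    then consider "i < n" "j < n" | "i = n" "j < n" | "i < n" "j = n" | "i = n" "j = n" by linarith
    then show "cinner ((e(n := u)) i) ((e(n := u)) j) = (if i = j then 1 else 0)"
      by cases (auto simp: orthoD[OF e] uu, auto simp: u_def cinner_simps we ew)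
  qed
  then show ?case by blast
qed

section \<open>Finite-rank operators in an orthonormal system\<close>

lift_definition rank_one :: "'a::chilbert_space \<Rightarrow> 'a \<Rightarrow> ('a \<Rightarrow>\<^sub>L 'a)" is "\<lambda>u v h. scaleC (cinner h v) u"
  by (rule bounded_linear_compose[OF bounded_bilinear.bounded_linear_left[OF bounded_bilinear_scaleC] bounded_linear_cinner_left])

definition mat_op :: "(nat \<Rightarrow> 'a::chilbert_space) \<Rightarrow> nat \<Rightarrow> (nat \<Rightarrow> nat \<Rightarrow> complex) \<Rightarrow> ('a \<Rightarrow>\<^sub>L 'a)" where
  "mat_op e n M = (\<Sum>i<n. \<Sum>j<n. op_scaleC (M i j) (rank_one (e i) (e j)))"

lemma mat_op_apply: "blinfun_apply (mat_op e n M) h = (\<Sum>i<n. scaleC (\<Sum>j<n. M i j * cinner h (e j)) (e i))"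
  by (simp add: mat_op_def blinfun.sum_left blinfun_simps rank_one.rep_eq scaleC_scaleC complex_vector.scale_sum_left)

lemma mat_op_bounded_ops [intro, simp]: "mat_op e n M \<in> bounded_ops"
proof -
  have "rank_one (e i) (e j) \<in> bounded_ops" for i j
    by (simp add: bounded_ops_def rank_one.rep_eq cinner_simps scaleC_scaleC)
  then show ?thesis unfolding mat_op_def by (intro bounded_ops_sum bounded_ops_intros)
qed

lemma mat_op_form: "cinner (blinfun_apply (mat_op e n M) x) y = (\<Sum>i<n. \<Sum>j<n. M i j * cinner x (e j) * cinner (e i) y)"
  by (simp add: mat_op_apply cinner_sum_left cinner_simps sum_distrib_right)

lemma mat_op_selfadjoint:
  assumes "\<And>i j. i < n \<Longrightarrow> j < n \<Longrightarrow> M i j = cnj (M j i)"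
  shows "op_selfadjoint (mat_op e n M)"
proof (rule op_selfadjointI)
  fix x y
  have "cinner x (blinfun_apply (mat_op e n M) y) = cnj (cinner (blinfun_apply (mat_op e n M) y) x)"
    by (rule cinner_commute)
  also have "\<dots> = (\<Sum>i<n. \<Sum>j<n. cnj (M i j) * cnj (cinner y (e j)) * cnj (cinner (e i) x))"
    by (simp add: mat_op_form)
  also have "\<dots> = (\<Sum>i<n. \<Sum>j<n. cnj (M i j) * cinner (e j) y * cinner x (e i))"
    by (simp only: cinner_commute[symmetric])
  also have "\<dots> = (\<Sum>j<n. \<Sum>i<n. cnj (M i j) * cinner (e j) y * cinner x (e i))" by (rule sum.swap)
  also have "\<dots> = (\<Sum>j<n. \<Sum>i<n. M j i * cinner x (e i) * cinner (e j) y)"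
  proof (intro sum.cong refl)
    fix i j assume "j \<in> {..<n}" "i \<in> {..<n}"
    then have "cnj (M i j) = M j i" using assms[of j i] by simp
    then show "cnj (M i j) * cinner (e j) y * cinner x (e i) = M j i * cinner x (e i) * cinner (e j) y"
      by (simp only: mult_ac)
  qed
  also have "\<dots> = cinner (blinfun_apply (mat_op e n M) x) y" by (rule mat_op_form[symmetric])
  finally show "cinner (blinfun_apply (mat_op e n M) x) y = cinner x (blinfun_apply (mat_op e n M) y)" ..
qed simp

definition diag_op :: "(nat \<Rightarrow> 'a::chilbert_space) \<Rightarrow> nat \<Rightarrow> (nat \<Rightarrow> real) \<Rightarrow> ('a \<Rightarrow>\<^sub>L 'a)" where
  "diag_op e n y = mat_op e n (\<lambda>i j. if i = j then of_real (y i) else 0)"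

lemma diag_op_apply: "blinfun_apply (diag_op e n y) h = (\<Sum>i<n. scaleC (of_real (y i) * cinner h (e i)) (e i))"
proof -
  have "(\<Sum>j<n. (if i = j then of_real (y i) else 0) * cinner h (e j)) = of_real (y i) * cinner h (e i)" if "i < n" for i
  proof -
    have "(\<Sum>j<n. (if i = j then of_real (y i) else 0) * cinner h (e j)) = (\<Sum>j<n. if i = j then of_real (y i) * cinner h (e j) else 0)"
      by (intro sum.cong) auto
    then show ?thesis using that by simp
  qed
  then show ?thesis unfolding diag_op_def mat_op_apply by (intro sum.cong refl) simp
qed

lemma diag_op_selfadjoint: "op_selfadjoint (diag_op e n y)"
  unfolding diag_op_def by (rule mat_op_selfadjoint) auto

lemma diag_op_norm:
  assumes e: "ortho e n" and y: "\<And>k. k < n \<Longrightarrow> \<bar>y k\<bar> \<le> r" and r: "0 \<le> r"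
  shows "norm (diag_op e n y) \<le> r"
proof (rule norm_blinfun_bound[OF r])
  fix h
  have "(norm (blinfun_apply (diag_op e n y) h))\<^sup>2 = (\<Sum>i<n. (cmod (of_real (y i) * cinner h (e i)))\<^sup>2)"
    unfolding diag_op_apply by (rule ortho_norm[OF e])
  also have "\<dots> \<le> (\<Sum>i<n. r\<^sup>2 * (cmod (cinner h (e i)))\<^sup>2)"
  proof (rule sum_mono)
    fix i assume "i \<in> {..<n}"
    then have "\<bar>y i\<bar>\<^sup>2 \<le> r\<^sup>2" using y by (intro power_mono) auto
    then show "(cmod (of_real (y i) * cinner h (e i)))\<^sup>2 \<le> r\<^sup>2 * (cmod (cinner h (e i)))\<^sup>2"
      by (simp add: norm_mult power_mult_distrib mult_right_mono)
  qed
  also have "\<dots> = r\<^sup>2 * (\<Sum>i<n. (cmod (cinner h (e i)))\<^sup>2)" by (simp only: sum_distrib_left)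
  also have "\<dots> \<le> r\<^sup>2 * (norm h)\<^sup>2" by (intro mult_left_mono bessel[OF e]) simp
  finally have "(norm (blinfun_apply (diag_op e n y) h))\<^sup>2 \<le> (r * norm h)\<^sup>2" by (simp add: power_mult_distrib)
  then show "norm (blinfun_apply (diag_op e n y) h) \<le> r * norm h" by (rule power2_le_imp_le) (use r in simp)
qed

lemma diag_op_pow:
  assumes e: "ortho e n"
  shows "blinfun_apply (op_pow (diag_op e n y) k) (\<Sum>i<n. scaleC (d i) (e i)) = (\<Sum>i<n. scaleC (of_real (y i) ^ k * d i) (e i))"
proof (induction k)
  case (Suc k)
  show ?case unfolding op_pow_Suc_apply(2) Suc diag_op_apply
    by (intro sum.cong refl) (simp add: ortho_coeff[OF e] mult.assoc)
qed simp

text \<open>The rank-one operator \<open>h \<mapsto> <h, w> w\<close> with \<open>w\<close> the sum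
  of the \<open>e i\<close>; as a perturbation direction it makes every entry of the Loewner matrix
  appear with weight 1.\<close>

definition ones_op :: "(nat \<Rightarrow> 'a::chilbert_space) \<Rightarrow> nat \<Rightarrow> ('a \<Rightarrow>\<^sub>L 'a)" where
  "ones_op e n = mat_op e n (\<lambda>_ _. 1)"

lemma ones_op_form: "cinner (blinfun_apply (ones_op e n) x) y = (\<Sum>j<n. cinner x (e j)) * (\<Sum>i<n. cinner (e i) y)"
  unfolding ones_op_def mat_op_form by (subst sum.swap) (simp add: sum_product)

lemma ones_op_psd: "op_psd (ones_op e n)"
  unfolding op_psd_def
proof (intro conjI allI)
  show "op_selfadjoint (ones_op e n)" unfolding ones_op_def by (rule mat_op_selfadjoint) simp
  fix x
  have "(\<Sum>i<n. cinner (e i) x) = cnj (\<Sum>j<n. cinner x (e j))"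
    by (simp only: cnj_sum cinner_commute[symmetric])
  then have "cinner (blinfun_apply (ones_op e n) x) x = of_real ((cmod (\<Sum>j<n. cinner x (e j)))\<^sup>2)"
    unfolding ones_op_form complex_norm_square by simp
  then show "0 \<le> Re (cinner (blinfun_apply (ones_op e n) x) x)" by (simp only: Re_complex_of_real) simp
qed

text \<open>The coefficients of \<open>\<eta>\<close> are conjugated so that the outcome has the
  form of the products in \<open>loewner_at\<close>.\<close>

lemma diag_ones_form:
  assumes e: "ortho e n" and \<eta>: "\<eta> = (\<Sum>k<n. scaleC (cnj (d k)) (e k))"
  shows "cinner (blinfun_apply (op_pow (diag_op e n y) j) (blinfun_apply (ones_op e n) (blinfun_apply (op_pow (diag_op e n y) k) \<eta>))) \<eta>
     = (\<Sum>i<n. d i * of_real (y i) ^ j) * cnj (\<Sum>i<n. d i * of_real (y i) ^ k)"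
proof -
  let ?T = "diag_op e n y"
  have "cinner (blinfun_apply (op_pow ?T j) (blinfun_apply (ones_op e n) (blinfun_apply (op_pow ?T k) \<eta>))) \<eta>
      = cinner (blinfun_apply (ones_op e n) (blinfun_apply (op_pow ?T k) \<eta>)) (blinfun_apply (op_pow ?T j) \<eta>)"
    by (rule op_pow_selfadjoint[OF diag_op_selfadjoint])
  also have "\<dots> = (\<Sum>l<n. of_real (y l) ^ k * cnj (d l)) * (\<Sum>i<n. cnj (of_real (y i) ^ j * cnj (d i)))"
    unfolding ones_op_form \<eta> diag_op_pow[OF e]
    by (intro arg_cong2[where f=times] sum.cong refl) (simp_all add: ortho_coeff[OF e] ortho_coeff_right[OF e])
  also have "\<dots> = (\<Sum>i<n. d i * of_real (y i) ^ j) * cnj (\<Sum>i<n. d i * of_real (y i) ^ k)"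
    by (simp add: mult.commute)
  finally show ?thesis .
qed

context half_plane_continuation
begin

text \<open>The quadratic form with coefficients \<open>d\<close> of the divided differences of
  \<open>g\<close> at the nodes \<open>c + y k\<close>, expanded in powers of the
  \<open>y k\<close>. In this shape it is the derivative series of
  \<open>op_ps_line_derivative\<close>, and coinciding nodes are no special case; convergence is
  part of the claim.\<close>

definition loewner_at :: "real \<Rightarrow> real \<Rightarrow> bool" where
  "loewner_at c \<rho> \<longleftrightarrow> (\<forall>n (y :: nat \<Rightarrow> real) d. (\<forall>k<n. \<bar>y k\<bar> < \<rho>) \<longrightarrow>
     (\<exists>s. (\<lambda>m. taylor_coeff g (of_real c) (Suc m) * (\<Sum>j\<le>m. (\<Sum>i<n. d i * of_real (y i) ^ j) *
        cnj (\<Sum>i<n. d i * of_real (y i) ^ (m - j)))) sums s \<and> 0 \<le> Re s))"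

text \<open>At a diagonal operator with eigenvalues \<open>c + y k\<close>, the derivative of
  \<open>f\<close> in a direction is the Schur product of the direction with the Loewner matrix. For
  \<open>ones_op\<close> this is the Loewner matrix itself, and monotonicity makes its form
  non-negative.\<close>

lemma op_monotone_imp_loewner:
  assumes mono: "op_monotone_on TYPE('h::chilbert_space) S f"
    and inf: "\<And>n. \<exists>e :: nat \<Rightarrow> 'h. ortho e n"
    and r: "{c - r<..<c + r} \<subseteq> S" "r > 0"
  shows "loewner_at c (r / 2)"
  unfolding loewner_at_def
proof (intro allI impI)
  fix n and y :: "nat \<Rightarrow> real" and d :: "nat \<Rightarrow> complex"
  assume y: "\<forall>k<n. \<bar>y k\<bar> < r / 2"
  obtain e :: "nat \<Rightarrow> 'h" where e: "ortho e n" using inf by blast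
  let ?T = "diag_op e n y" and ?C = "ones_op e n" and ?a = "taylor_coeff g (of_real c)"
  define \<eta> where "\<eta> = (\<Sum>k<n. scaleC (cnj (d k)) (e k))"
  have gb: "g holomorphic_on ball (of_real c) r"
    by (rule holomorphic_on_subset[OF g_hol ball_subset_slit_domain[OF r(1)]])
  have nT: "norm ?T \<le> r / 2" by (rule diag_op_norm[OF e]) (use y r in \<open>auto simp: less_imp_le\<close>)
  \<comment> \<open>The nodes use up \<open>r / 2\<close> and \<open>s\<close> lies halfway to
    \<open>r\<close>; below, \<open>t * norm ?C \<le> r / 4\<close> keeps \<open>B\<close> in the
    disc as well.\<close>
  define s where "s = 3 / 4 * r"
  have s: "norm ?T < s" "s < r" "0 \<le> s" using nT r by (auto simp: s_def)
  have sm: "summable (\<lambda>m. cmod (?a m) * s ^ m)" by (rule taylor_summable[OF gb s(3,2)])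
  have TB: "?T \<in> bounded_ops" "?C \<in> bounded_ops" by (auto simp: diag_op_def ones_op_def)
  let ?h = "\<lambda>z. cinner (blinfun_apply (op_ps ?a (?T + op_scaleC z ?C)) \<eta>) \<eta>"
  obtain \<delta> where \<delta>: "(?h has_field_derivative \<delta>) (at 0)"
    "(\<lambda>m. ?a m * (\<Sum>j<m. cinner (blinfun_apply (op_pow ?T j) (blinfun_apply ?C (blinfun_apply (op_pow ?T (m - 1 - j)) \<eta>))) \<eta>)) sums \<delta>"
    using op_ps_line_derivative[OF TB sm s(1)] by blast
  have "0 \<le> Re \<delta>"
  proof (rule Re_derivative_nonneg_of_increasing[OF \<delta>(1)])
    define q where "q = norm ?C + 1"
    define \<epsilon> where "\<epsilon> = r / 4 / q"
    have p: "q > 0" by (simp add: q_def add_nonneg_pos)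
    show "\<epsilon> > 0" using p r by (simp add: \<epsilon>_def)
    fix t :: real assume t: "0 < t" "t < \<epsilon>"
    define A where "A = op_const (of_real c) + ?T"
    define B where "B = A + t *\<^sub>R ?C"
    have "t * norm ?C \<le> \<epsilon> * q" using t by (intro mult_mono) (auto simp: q_def)
    also have "\<dots> = r / 4" using p by (simp add: \<epsilon>_def)
    finally have tC: "t * norm ?C \<le> r / 4" .
    have Ac: "A - op_const (of_real c) = ?T" and Bc: "B - op_const (of_real c) = ?T + op_scaleC (of_real t) ?C"
      by (auto simp: A_def B_def op_scaleC_of_real)
    have nA: "norm (A - op_const (of_real c)) < r" using s unfolding Ac by linarith
    have "norm (?T + t *\<^sub>R ?C) \<le> norm ?T + t * norm ?C" using norm_triangle_ineq[of ?T "t *\<^sub>R ?C"] t by simp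
    moreover have TC: "?T + op_scaleC (of_real t) ?C = ?T + t *\<^sub>R ?C" by (simp only: op_scaleC_of_real)
    ultimately have nB: "norm (B - op_const (of_real c)) < r" using tC nT r(2) unfolding Bc TC by linarith
    have saC: "op_selfadjoint ?C" using ones_op_psd by (auto simp: op_psd_def)
    have saA: "op_selfadjoint A"
      using diag_op_selfadjoint[of e n y]
      by (auto simp: A_def op_selfadjoint_iff blinfun_simps cinner_simps cinner_self simp flip: of_real_power)
    have saB: "op_selfadjoint B"
      using saA saC by (auto simp: B_def op_selfadjoint_iff blinfun_simps cinner_simps)
    have spec: "op_spectrum Y \<subseteq> complex_of_real ` S" if Y: "op_selfadjoint Y" "norm (Y - op_const (of_real c)) < r" for Y :: "'h \<Rightarrow>\<^sub>L 'h"
    proof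
      fix z assume z: "z \<in> op_spectrum Y"
      have "z \<in> \<real>" using op_selfadjoint_spectrum_real[OF Y(1)] z by blast
      moreover have "z \<in> ball (of_real c) r"
        using op_spectrum_subset_cball[OF op_selfadjointD(1)[OF Y(1)], of "of_real c"] z Y(2) by (auto simp: subset_iff)
      then have "z \<in> slit_domain S" using ball_subset_slit_domain[OF r(1)] by blast
      ultimately show "z \<in> complex_of_real ` S" by (auto simp: slit_domain_def)
    qed
    have "op_psd (B - A)"
      using ones_op_psd[of e n] t by (auto simp: B_def op_psd_def op_selfadjoint_iff blinfun_simps cinner_simps)
    then have "op_psd (cont_calc f B - cont_calc f A)"
      using mono spec[OF saA nA] spec[OF saB nB] saA saB unfolding op_monotone_on_def by blast
    then have "0 \<le> Re (cinner (blinfun_apply (cont_calc f B - cont_calc f A) \<eta>) \<eta>)" by (simp add: op_psd_def)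
    then have "Re (cinner (blinfun_apply (cont_calc f A) \<eta>) \<eta>) \<le> Re (cinner (blinfun_apply (cont_calc f B) \<eta>) \<eta>)"
      by (simp add: blinfun_simps cinner_simps)
    then show "Re (?h 0) \<le> Re (?h (of_real t))"
      unfolding cont_calc_eq_op_ps[OF saA nA r(1)] cont_calc_eq_op_ps[OF saB nB r(1)] Ac Bc
      by (simp add: bounded_bilinear.zero_left[OF bounded_bilinear_op_scaleC])
  qed
  moreover have "(\<lambda>m. ?a (Suc m) * (\<Sum>j\<le>m. (\<Sum>i<n. d i * of_real (y i) ^ j) * cnj (\<Sum>i<n. d i * of_real (y i) ^ (m - j)))) sums \<delta>"
  proof -
    \<comment> \<open>In the derivative series the exponents add up to \<open>m - 1\<close>, and the
      term at \<open>m = 0\<close> is an empty sum; dropping it yields the index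
      \<open>Suc m\<close> of \<open>loewner_at\<close>.\<close>
    define q where "q m = ?a m * (\<Sum>j<m. (\<Sum>i<n. d i * of_real (y i) ^ j) * cnj (\<Sum>i<n. d i * of_real (y i) ^ (m - 1 - j)))" for m
    have "q sums \<delta>" using \<delta>(2) unfolding diag_ones_form[OF e \<eta>_def] q_def .
    moreover have "q 0 = 0" by (simp add: q_def)
    ultimately have "(\<lambda>m. q (Suc m)) sums \<delta>" by (simp only: sums_Suc_iff add_0_right)
    then show ?thesis by (simp only: q_def lessThan_Suc_atMost diff_Suc_1)
  qed
  ultimately show "\<exists>s. (\<lambda>m. ?a (Suc m) * (\<Sum>j\<le>m. (\<Sum>i<n. d i * of_real (y i) ^ j) *
        cnj (\<Sum>i<n. d i * of_real (y i) ^ (m - j)))) sums s \<and> 0 \<le> Re s" by blast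
qed

end

section \<open>From Loewner matrices to the Pick property\<close>

text \<open>The reciprocal of the Joukowski map \<open>(u + 1/u) / 2\<close>; it maps the interval
  \<open>(-1, 1)\<close> into itself and the upper half disc onto the upper half-plane.\<close>

definition joukowski :: "complex \<Rightarrow> complex" where
  "joukowski u = 2 * u / (1 + u\<^sup>2)"

lemma one_plus_square_neq_0: "cmod u < 1 \<Longrightarrow> 1 + u\<^sup>2 \<noteq> 0"
proof
  assume u: "cmod u < 1" and "1 + u\<^sup>2 = 0"
  then have "u\<^sup>2 = - 1" by (simp add: eq_neg_iff_add_eq_0 add.commute)
  then have "(cmod u)\<^sup>2 = 1" by (metis norm_power norm_minus_cancel norm_one)
  then show False using u abs_square_less_1[of "cmod u"] by simp
qed

lemma joukowski_Im:
  assumes u: "cmod u < 1"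
  shows "Im (joukowski u) * (cmod (1 + u\<^sup>2))\<^sup>2 = 2 * Im u * (1 - (cmod u)\<^sup>2)"
proof -
  have "(cmod (1 + u\<^sup>2))\<^sup>2 \<noteq> 0" using one_plus_square_neq_0[OF u] by simp
  moreover have "joukowski u = (2 * u * cnj (1 + u\<^sup>2)) / of_real ((cmod (1 + u\<^sup>2))\<^sup>2)"
    unfolding joukowski_def by (subst complex_div_cnj) simp
  ultimately have "Im (joukowski u) * (cmod (1 + u\<^sup>2))\<^sup>2 = Im (2 * u * cnj (1 + u\<^sup>2))"
    by (simp only: Im_divide_of_real) simp
  also have "\<dots> = 2 * Im u * (1 - (cmod u)\<^sup>2)"
    unfolding cmod_power2 by (simp add: power2_eq_square algebra_simps)
  finally show ?thesis .
qed

lemma joukowski_of_real: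
  fixes t :: real
  assumes t: "\<bar>t\<bar> < 1"
  shows "joukowski (of_real t) = of_real (2 * t / (1 + t\<^sup>2))" "\<bar>2 * t / (1 + t\<^sup>2)\<bar> < 1" "\<bar>2 * t / (1 + t\<^sup>2)\<bar> \<le> 2 * \<bar>t\<bar>"
proof -
  show "joukowski (of_real t) = of_real (2 * t / (1 + t\<^sup>2))" by (simp add: joukowski_def)
  have p: "1 + t\<^sup>2 > 0" by (simp add: add_pos_nonneg)
  have "(1 - \<bar>t\<bar>)\<^sup>2 > 0" using t by simp
  then have "2 * \<bar>t\<bar> < 1 + t\<^sup>2" by (simp add: power2_diff)
  then show "\<bar>2 * t / (1 + t\<^sup>2)\<bar> < 1" using p by (simp add: abs_mult)
  show "\<bar>2 * t / (1 + t\<^sup>2)\<bar> \<le> 2 * \<bar>t\<bar>"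
    using p mult_left_mono[of 1 "1 + t\<^sup>2" "\<bar>t\<bar>"] by (simp add: abs_mult divide_le_eq)
qed

text \<open>Source of the kernel \<open>1 / (1 - u v)\<close>: the factors \<open>1 + u^2\<close>
  and \<open>1 + v^2\<close> depend on one variable each and can be absorbed into the coefficients
  of a quadratic form.\<close>

lemma joukowski_diff:
  assumes "1 + u\<^sup>2 \<noteq> 0" "1 + v\<^sup>2 \<noteq> 0"
  shows "joukowski u - joukowski v = 2 * (u - v) * (1 - u * v) / ((1 + u\<^sup>2) * (1 + v\<^sup>2))"
  using assms by (simp add: joukowski_def diff_frac_eq) (simp add: algebra_simps power2_eq_square)

lemma joukowski_deriv:
  assumes "1 + u\<^sup>2 \<noteq> 0"
  shows "(joukowski has_field_derivative 2 * (1 - u * u) / ((1 + u\<^sup>2) * (1 + u\<^sup>2))) (at u)"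
  unfolding joukowski_def[abs_def]
  by (rule derivative_eq_intros refl assms)+ (use assms in \<open>simp add: field_simps power2_eq_square\<close>)

text \<open>\<open>joukowski u = w\<close> means \<open>u^2 - 2 u / w + 1 = 0\<close>, whose roots
  \<open>1 / w + v\<close> and \<open>1 / w - v\<close> have product 1. On the unit circle they
  would be conjugate and \<open>2 / w\<close> real, so one of them lies inside; the sign of
  \<open>Im u\<close> follows from \<open>joukowski_Im\<close>.\<close>

lemma joukowski_surj:
  assumes w: "0 < Im w"
  obtains u where "cmod u < 1" "0 < Im u" "joukowski u = w"
proof -
  have w0: "w \<noteq> 0" using w by auto
  define v where "v = csqrt (1 / w\<^sup>2 - 1)"
  have v2: "v\<^sup>2 = 1 / w\<^sup>2 - 1" by (simp add: v_def)
  have root: "u\<^sup>2 + 1 = 2 * u / w" if "u = 1 / w + v \<or> u = 1 / w - v" for u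
  proof -
    have "(u - 1 / w)\<^sup>2 = v\<^sup>2" using that by auto
    then have "u\<^sup>2 - 2 * u / w + 1 / w\<^sup>2 = 1 / w\<^sup>2 - 1" unfolding v2 by (simp add: power2_diff power_divide)
    then show ?thesis by (simp add: algebra_simps)
  qed
  have prod: "(1 / w + v) * (1 / w - v) = 1"
  proof -
    have "(1 / w + v) * (1 / w - v) = (1 / w)\<^sup>2 - v\<^sup>2" by (simp add: algebra_simps power2_eq_square)
    then show ?thesis by (simp add: v2 power_divide)
  qed
  have nprod: "cmod (1 / w + v) * cmod (1 / w - v) = 1" using arg_cong[OF prod, of cmod] by (simp add: norm_mult)
  have n1: "cmod (1 / w + v) \<noteq> 1"
  proof
    assume n: "cmod (1 / w + v) = 1"
    have "(1 / w + v) * cnj (1 / w + v) = 1" using complex_norm_square[of "1 / w + v"] n by simp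
    with prod have "(1 / w + v) * (1 / w - v) = (1 / w + v) * cnj (1 / w + v)" by simp
    moreover have "1 / w + v \<noteq> 0" using n by auto
    ultimately have "1 / w - v = cnj (1 / w + v)" by simp
    moreover have "2 / w = (1 / w + v) + (1 / w - v)" by (simp add: add_divide_distrib[symmetric])
    ultimately have "2 / w = (1 / w + v) + cnj (1 / w + v)" by (simp only:)
    then have "Im (2 / w) = 0" by (simp only: complex_add_cnj Im_complex_of_real)
    moreover have "Im (2 / w) = - 2 * Im w / ((Re w)\<^sup>2 + (Im w)\<^sup>2)" by (simp add: Im_divide)
    moreover have "(Re w)\<^sup>2 + (Im w)\<^sup>2 > 0" using w by (simp add: add_nonneg_pos)
    then have "- 2 * Im w / ((Re w)\<^sup>2 + (Im w)\<^sup>2) < 0" using w by (intro divide_neg_pos) auto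
    ultimately show False by linarith
  qed
  obtain u where u: "u = 1 / w + v \<or> u = 1 / w - v" "cmod u < 1"
  proof (cases "cmod (1 / w + v) < 1")
    case False
    then have "cmod (1 / w + v) > 1" using n1 by linarith
    have "cmod (1 / w - v) < 1"
    proof (rule ccontr)
      assume "\<not> ?thesis"
      then have "1 * 1 < cmod (1 / w + v) * cmod (1 / w - v)" using \<open>cmod (1 / w + v) > 1\<close> by (intro mult_less_le_imp_less) auto
      then show False using nprod by simp
    qed
    then show thesis using that by blast
  qed (use that in blast)
  have u0: "u \<noteq> 0" using u(1) prod by auto
  have "joukowski u = w" unfolding joukowski_def using root[OF u(1)] u0 w0 by (simp add: add.commute)
  moreover have "0 < Im u"
  proof -
    have "0 < Im (joukowski u) * (cmod (1 + u\<^sup>2))\<^sup>2" using calculation w one_plus_square_neq_0[OF u(2)] by simp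
    then have "0 < Im u * (1 - (cmod u)\<^sup>2)" unfolding joukowski_Im[OF u(2)] by simp
    moreover have "0 < 1 - (cmod u)\<^sup>2" using u(2) abs_square_less_1[of "cmod u"] by simp
    ultimately show ?thesis by (simp add: zero_less_mult_iff)
  qed
  ultimately show thesis using that u(2) by blast
qed

text \<open>\<open>\<lambda>u. c + r * joukowski u\<close> maps the unit disc into the slit domain and the unit interval into
  \<open>(c - r, c + r)\<close>. It turns the Loewner kernel of \<open>h\<close> into the kernel of the locale above.\<close>

lemma slope_joukowski:
  fixes h :: "complex \<Rightarrow> complex" and r :: real
  assumes h: "h holomorphic_on ball 0 r" and r: "r > 0"
    and t: "\<bar>t\<bar> < 1" "\<bar>t'\<bar> < 1"
  defines "G \<equiv> \<lambda>u. h (of_real r * joukowski u)"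
  defines "X \<equiv> complex_of_real t" and "Y \<equiv> complex_of_real t'"
  shows "slope h (of_real r * joukowski X) (of_real r * joukowski Y) / ((1 + X\<^sup>2) * (1 + Y\<^sup>2)) =
    slope G X Y / (1 - X * Y) / of_real (2 * r)"
proof -
  have nX: "1 + X\<^sup>2 \<noteq> 0" and nY: "1 + Y\<^sup>2 \<noteq> 0" using t by (auto simp: X_def Y_def intro!: one_plus_square_neq_0)
  \<comment> \<open>The cancellations off and on the diagonal, as identities in independent
    variables.\<close>
  have frac: "g / (\<rho> * (2 * d * q / (p * p'))) / (p * p') = g / d / q / (2 * \<rho>)"
    if "d \<noteq> 0" "q \<noteq> 0" "p \<noteq> 0" "p' \<noteq> 0" "\<rho> \<noteq> 0" for g d q p p' \<rho> :: complex
    using that by (simp add: field_simps)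
  have frac': "g / (p * p) = g * (\<rho> * (2 * q / (p * p))) / q / (2 * \<rho>)"
    if "q \<noteq> 0" "p \<noteq> 0" "\<rho> \<noteq> 0" for g q p \<rho> :: complex
    using that by (simp add: field_simps)
  have nXY: "1 - X * Y \<noteq> 0"
  proof -
    have "\<bar>t\<bar> * \<bar>t'\<bar> < 1 * 1" using t by (intro mult_strict_mono') auto
    then have "t * t' \<noteq> 1" by (auto simp flip: abs_mult)
    then show ?thesis unfolding X_def Y_def by (metis eq_iff_diff_eq_0 of_real_1 of_real_eq_iff of_real_mult)
  qed
  show ?thesis
  proof (cases "X = Y")
    case False
    then have d: "joukowski X - joukowski Y = 2 * (X - Y) * (1 - X * Y) / ((1 + X\<^sup>2) * (1 + Y\<^sup>2))"
      using joukowski_diff[OF nX nY] by simp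
    then have ne: "joukowski X \<noteq> joukowski Y" using False nX nY nXY by auto
    have "slope h (of_real r * joukowski X) (of_real r * joukowski Y) = (G X - G Y) / (of_real r * (joukowski X - joukowski Y))"
      using ne r by (simp add: slope_def G_def right_diff_distrib)
    also have "\<dots> / ((1 + X\<^sup>2) * (1 + Y\<^sup>2)) = (G X - G Y) / (X - Y) / (1 - X * Y) / of_real (2 * r)"
      unfolding d of_real_mult of_real_numeral using False nX nY nXY r by (intro frac) auto
    finally show ?thesis using False by (simp add: slope_def)
  next
    case True
    have "of_real r * joukowski X \<in> ball 0 r"
    proof -
      let ?p = "2 * t / (1 + t\<^sup>2)"
      have "of_real r * joukowski X = of_real (r * ?p)"
        unfolding X_def by (simp only: joukowski_of_real(1)[OF t(1)] of_real_mult)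
      moreover have "\<bar>r * ?p\<bar> < r"
        using joukowski_of_real(2)[OF t(1)] r mult_strict_left_mono[of "\<bar>?p\<bar>" 1 r] unfolding abs_mult[of r] by simp
      ultimately show ?thesis by (simp only: mem_ball_0 norm_of_real)
    qed
    then have "(h has_field_derivative deriv h (of_real r * joukowski X)) (at (of_real r * joukowski X))"
      by (intro holomorphic_derivI[OF h open_ball])
    from DERIV_chain2[OF this DERIV_cmult[OF joukowski_deriv[OF nX], of "of_real r"]]
    have "(G has_field_derivative deriv h (of_real r * joukowski X) * (of_real r * (2 * (1 - X * X) / ((1 + X\<^sup>2) * (1 + X\<^sup>2))))) (at X)"
      by (simp add: G_def)
    then have dG: "deriv G X = deriv h (of_real r * joukowski X) * (of_real r * (2 * (1 - X * X) / ((1 + X\<^sup>2) * (1 + X\<^sup>2))))"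
      by (rule DERIV_imp_deriv)
    have q: "1 - X * X \<noteq> 0" using nXY True by simp
    have r0: "complex_of_real r \<noteq> 0" using r by simp
    have s: "slope k a a = deriv k a" for k a by (simp add: slope_def)
    show ?thesis unfolding True[symmetric] s dG of_real_mult of_real_numeral by (rule frac'[OF q nX r0])
  qed
qed

context half_plane_continuation
begin

lemma g_cnj: "Im z \<noteq> 0 \<Longrightarrow> g (cnj z) = cnj (g z)"
  by (auto simp: reflect_ext_def)

text \<open>Positivity near the single point \<open>c\<close> reaches every \<open>z\<close> of the
  half-plane, because \<open>z = c + r joukowski u\<close> for some \<open>u\<close> in the upper
  half disc, and the kernel at \<open>(u, cnj u)\<close> is controlled by its values at real nodes
  near 0.\<close>

theorem loewner_imp_pick:
  assumes r: "{c - r<..<c + r} \<subseteq> S" "r > 0" and \<rho>0: "\<rho>0 > 0" and L: "loewner_at c \<rho>0" and z: "0 < Im z"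
  shows "0 \<le> Im (F z)"
proof -
  define \<phi> where "\<phi> u = of_real c + of_real r * joukowski u" for u
  have \<phi>D: "\<phi> u \<in> D" if u: "cmod u < 1" for u
  proof (cases "Im u = 0")
    case False
    have "1 - (cmod u)\<^sup>2 \<noteq> 0" using u abs_square_less_1[of "cmod u"] by simp
    then have "Im (joukowski u) \<noteq> 0" using joukowski_Im[OF u] False by auto
    then show ?thesis using r by (simp add: \<phi>_def mem_slit_domain)
  next
    case True
    then have uR: "u = of_real (Re u)" by (simp add: complex_eq_iff)
    have ab: "\<bar>Re u\<bar> < 1" using u abs_Re_le_cmod[of u] by linarith
    let ?p = "2 * Re u / (1 + (Re u)\<^sup>2)"
    have "\<phi> u = of_real (c + r * ?p)" unfolding \<phi>_def by (subst uR) (simp add: joukowski_of_real(1)[OF ab])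
    moreover have "\<bar>r * ?p\<bar> < r" using joukowski_of_real(2)[OF ab] r mult_strict_left_mono[of "\<bar>?p\<bar>" 1 r] by (simp add: abs_mult)
    then have "c + r * ?p \<in> {c - r<..<c + r}" unfolding abs_less_iff greaterThanLessThan_iff by linarith
    then have "c + r * ?p \<in> S" using r(1) by blast
    ultimately show ?thesis by (simp only: mem_slit_domain Re_complex_of_real) simp
  qed
  have jh: "joukowski holomorphic_on ball 0 1"
    unfolding joukowski_def[abs_def] using one_plus_square_neq_0 by (intro holomorphic_intros) auto
  have \<phi>h: "\<phi> holomorphic_on ball 0 1" unfolding \<phi>_def by (intro holomorphic_intros jh)
  define G where "G u = g (\<phi> u)" for u
  have Gh: "G holomorphic_on ball 0 1"
  proof -
    have "\<phi> ` ball 0 1 \<subseteq> D" using \<phi>D by auto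
    from holomorphic_on_compose_gen[OF \<phi>h g_hol this] show ?thesis unfolding G_def o_def .
  qed
  define b where "b = taylor_coeff G 0"
  have bs: "(\<lambda>m. b m * w ^ m) sums G w" if "cmod w < 1" for w
    using taylor_sums[OF Gh, of w] that by (simp add: b_def)
  obtain u where u: "cmod u < 1" "0 < Im u" "joukowski u = (z - of_real c) / of_real r"
    using joukowski_surj[of "(z - of_real c) / of_real r"] z r by auto
  have \<phi>u: "\<phi> u = z" using r by (simp add: \<phi>_def u(3))
  define \<rho> where "\<rho> = (cmod u + 1) / 2"
  have \<rho>: "cmod u < \<rho>" "\<rho> < 1" "0 < \<rho>" using u by (auto simp: \<rho>_def add_nonneg_pos)
  note u\<rho> = \<rho>(1)
  interpret disc_coeffs b \<rho>
    by standard (use taylor_summable[OF Gh] \<rho> in \<open>auto simp: b_def\<close>)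
  \<comment> \<open>A node \<open>t\<close> corresponds to \<open>y = r joukowski t\<close> with
    \<open>|y| \<le> 2 r |t|\<close>, which has to stay below \<open>\<rho>0\<close>.\<close>
  define \<tau> where "\<tau> = min \<rho> (\<rho>0 / (2 * r))"
  have \<tau>: "0 < \<tau>" "\<tau> \<le> \<rho>" "\<tau> \<le> \<rho>0 / (2 * r)" using \<rho> \<rho>0 r by (auto simp: \<tau>_def)
  define h where "h w = g (of_real c + w)" for w
  let ?a = "taylor_coeff g (of_real c)"
  have gb: "g holomorphic_on ball (of_real c) r"
    by (rule holomorphic_on_subset[OF g_hol ball_subset_slit_domain[OF r(1)]])
  have hs: "(\<lambda>m. ?a m * w ^ m) sums h w" if "cmod w < r" for w
    using taylor_sums[OF gb, of "of_real c + w"] that by (simp add: h_def)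
  have hh: "h holomorphic_on ball 0 r"
    by (rule power_series_holomorphic[where a = ?a]) (use hs in simp)
  have Gj: "G = (\<lambda>u. h (of_real r * joukowski u))" by (simp add: G_def h_def \<phi>_def fun_eq_iff)
  have pos: "0 \<le> Re (\<Sum>k<n. \<Sum>l<n. k' k * cnj (k' l) *
        (slope G (of_real (t k)) (of_real (t l)) / (1 - of_real (t k) * of_real (t l))))"
    if tt: "\<forall>k<n. \<bar>t k\<bar> < \<tau>" for n :: nat and k' t
  proof -
    define y where "y k = r * (2 * t k / (1 + (t k)\<^sup>2))" for k
    \<comment> \<open>Absorbs the one-variable factors of \<open>slope_joukowski\<close>; the nodes
      are real, so conjugating \<open>d l\<close> leaves its denominator unchanged.\<close>
    define d where "d k = k' k / (1 + (of_real (t k))\<^sup>2)" for k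
    have t1: "\<bar>t k\<bar> < 1" if "k < n" for k using tt that \<tau> \<rho> by (meson less_le_trans less_trans)
    have yj: "of_real (y k) = of_real r * joukowski (of_real (t k))" if "k < n" for k
      by (simp only: joukowski_of_real(1)[OF t1[OF that]] y_def of_real_mult)
    have yr: "cmod (of_real (y k)) < r" if "k < n" for k
      using joukowski_of_real(2)[OF t1[OF that]] r mult_strict_left_mono[of "\<bar>2 * t k / (1 + (t k)\<^sup>2)\<bar>" 1 r]
      unfolding norm_of_real y_def abs_mult[of r] by simp
    have "\<bar>y k\<bar> < \<rho>0" if k: "k < n" for k
    proof -
      have "\<bar>y k\<bar> \<le> r * (2 * \<bar>t k\<bar>)"
        using joukowski_of_real(3)[OF t1[OF k]] r unfolding y_def abs_mult[of r] by (intro mult_mono) auto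
      also have "\<dots> < r * (2 * (\<rho>0 / (2 * r)))" using tt k \<tau>(3) r by (intro mult_strict_left_mono) auto
      also have "\<dots> = \<rho>0" using r by simp
      finally show ?thesis .
    qed
    then obtain s where s: "(\<lambda>m. ?a (Suc m) * (\<Sum>j\<le>m. (\<Sum>i<n. d i * of_real (y i) ^ j) *
        cnj (\<Sum>i<n. d i * of_real (y i) ^ (m - j)))) sums s" "0 \<le> Re s"
      using L unfolding loewner_at_def by blast
    have "(\<lambda>m. \<Sum>k<n. \<Sum>l<n. d k * cnj (d l) * (?a (Suc m) * (\<Sum>j\<le>m. of_real (y k) ^ j * of_real (y l) ^ (m - j)))) sums
       (\<Sum>k<n. \<Sum>l<n. d k * cnj (d l) * slope h (of_real (y k)) (of_real (y l)))"
      using yr by (intro sums_sum sums_mult slope_sums[OF hs]) auto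
    moreover have "(\<Sum>k<n. \<Sum>l<n. d k * cnj (d l) * (?a (Suc m) * (\<Sum>j\<le>m. of_real (y k) ^ j * of_real (y l) ^ (m - j)))) =
        ?a (Suc m) * (\<Sum>j\<le>m. (\<Sum>i<n. d i * of_real (y i) ^ j) * cnj (\<Sum>i<n. d i * of_real (y i) ^ (m - j)))" for m
    proof -
      have "(\<Sum>j\<le>m. (\<Sum>i<n. d i * of_real (y i) ^ j) * cnj (\<Sum>i<n. d i * of_real (y i) ^ (m - j)))
          = (\<Sum>j\<le>m. \<Sum>k<n. \<Sum>l<n. d k * cnj (d l) * (of_real (y k) ^ j * of_real (y l) ^ (m - j)))"
        by (simp add: sum_product mult_ac)
      also have "\<dots> = (\<Sum>k<n. \<Sum>j\<le>m. \<Sum>l<n. d k * cnj (d l) * (of_real (y k) ^ j * of_real (y l) ^ (m - j)))"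
        by (rule sum.swap)
      also have "\<dots> = (\<Sum>k<n. \<Sum>l<n. \<Sum>j\<le>m. d k * cnj (d l) * (of_real (y k) ^ j * of_real (y l) ^ (m - j)))"
        by (rule sum.cong[OF refl]) (rule sum.swap)
      finally show ?thesis by (simp only: sum_distrib_left mult_ac)
    qed
    ultimately have sE: "s = (\<Sum>k<n. \<Sum>l<n. d k * cnj (d l) * slope h (of_real (y k)) (of_real (y l)))"
      using s(1) by (simp only: sums_unique2)
    also have "\<dots> = (\<Sum>k<n. \<Sum>l<n. (k' k * cnj (k' l) *
        (slope G (of_real (t k)) (of_real (t l)) / (1 - of_real (t k) * of_real (t l)))) / of_real (2 * r))"
    proof (intro sum.cong refl)
      fix k l assume kl: "k \<in> {..<n}" "l \<in> {..<n}"
      have "d k * cnj (d l) * slope h (of_real (y k)) (of_real (y l)) =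
         k' k * cnj (k' l) * (slope h (of_real (y k)) (of_real (y l)) / ((1 + (of_real (t k))\<^sup>2) * (1 + (of_real (t l))\<^sup>2)))"
        by (simp add: d_def)
      also have "slope h (of_real (y k)) (of_real (y l)) / ((1 + (of_real (t k))\<^sup>2) * (1 + (of_real (t l))\<^sup>2)) =
          slope G (of_real (t k)) (of_real (t l)) / (1 - of_real (t k) * of_real (t l)) / of_real (2 * r)"
        using slope_joukowski[OF hh r(2) t1 t1, of k l] kl unfolding Gj by (simp only: yj lessThan_iff)
      finally show "d k * cnj (d l) * slope h (of_real (y k)) (of_real (y l)) = (k' k * cnj (k' l) *
        (slope G (of_real (t k)) (of_real (t l)) / (1 - of_real (t k) * of_real (t l)))) / of_real (2 * r)"
        by (simp only: times_divide_eq_right)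
    qed
    also have "\<dots> = (\<Sum>k<n. \<Sum>l<n. k' k * cnj (k' l) *
        (slope G (of_real (t k)) (of_real (t l)) / (1 - of_real (t k) * of_real (t l)))) / of_real (2 * r)"
      by (simp only: sum_divide_distrib)
    finally show ?thesis using s(2) r by (simp add: Re_divide_of_real zero_le_divide_iff del: of_real_mult)
  qed
  have "0 \<le> Re (slope G u (cnj u) / (1 - u * cnj u))"
    by (rule kernel_nonneg[OF bs \<tau>(1,2) pos u\<rho>])
  \<comment> \<open>As \<open>\<phi>\<close> commutes with conjugation, the difference quotient at
    \<open>u\<close> and \<open>cnj u\<close> is \<open>2 i Im F(z)\<close> over
    \<open>2 i Im u\<close>.\<close>
  moreover have "slope G u (cnj u) / (1 - u * cnj u) = of_real (Im (F z) / Im u / (1 - (cmod u)\<^sup>2))"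
  proof -
    have "\<phi> (cnj u) = cnj (\<phi> u)" by (simp add: \<phi>_def joukowski_def)
    then have Gc: "G (cnj u) = cnj (F z)" "G u = F z"
      using g_cnj[of z] z by (simp_all add: G_def \<phi>u reflect_ext_upper)
    have ne: "u \<noteq> cnj u" using u(2) by (auto simp: complex_eq_iff)
    have "slope G u (cnj u) = (F z - cnj (F z)) / (u - cnj u)" using ne by (simp add: slope_def Gc)
    also have "\<dots> = of_real (Im (F z) / Im u)"
      unfolding complex_diff_cnj using u(2) by simp
    moreover have "1 - u * cnj u = of_real (1 - (cmod u)\<^sup>2)" by (simp only: complex_norm_square[symmetric] of_real_diff of_real_1)
    ultimately show ?thesis by (simp only: of_real_divide)
  qed
  ultimately have "0 \<le> Im (F z) / Im u / (1 - (cmod u)\<^sup>2)" by (simp only: Re_complex_of_real)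
  moreover define w where "w = Im u * (1 - (cmod u)\<^sup>2)"
  ultimately have "0 \<le> Im (F z) / w" by (simp only: divide_divide_eq_left)
  moreover have "0 < w" unfolding w_def using u(1,2) abs_square_less_1[of "cmod u"] by (intro mult_pos_pos) auto
  ultimately show ?thesis by (simp add: zero_le_divide_iff)
qed

end

section \<open>The matrix calculus\<close>

abbreviation proj_op :: "(nat \<Rightarrow> 'a::chilbert_space) \<Rightarrow> nat \<Rightarrow> ('a \<Rightarrow>\<^sub>L 'a)" where
  "proj_op e n \<equiv> diag_op e n (\<lambda>_. 1)"

abbreviation mop :: "(nat \<Rightarrow> 'a::chilbert_space) \<Rightarrow> complex Matrix.mat \<Rightarrow> ('a \<Rightarrow>\<^sub>L 'a)" where
  "mop e A \<equiv> mat_op e (dim_row A) (\<lambda>i j. A $$ (i, j))"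

text \<open>Acts as \<open>A\<close> on the span of an orthonormal system and as
  \<open>\<alpha>\<close> on its complement. Extension by 0 would put 0 into the spectrum, a point
  that may lie outside the domain.\<close>

definition full_op :: "(nat \<Rightarrow> 'a::chilbert_space) \<Rightarrow> complex Matrix.mat \<Rightarrow> complex \<Rightarrow> ('a \<Rightarrow>\<^sub>L 'a)" where
  "full_op e A \<alpha> = mop e A + op_scaleC \<alpha> (id_blinfun - proj_op e (dim_row A))"

definition lin :: "(nat \<Rightarrow> 'a::chilbert_space) \<Rightarrow> complex Matrix.vec \<Rightarrow> 'a" where
  "lin e v = (\<Sum>i<dim_vec v. scaleC (v $ i) (e i))"

definition coords :: "(nat \<Rightarrow> 'a::chilbert_space) \<Rightarrow> nat \<Rightarrow> 'a \<Rightarrow> complex Matrix.vec" where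
  "coords e n h = Matrix.vec n (\<lambda>i. cinner h (e i))"

lemma coords_carrier [simp]: "coords e n h \<in> carrier_vec n" "dim_vec (coords e n h) = n"
  by (simp_all add: coords_def)

lemma lin_add: "dim_vec v = dim_vec w \<Longrightarrow> lin e (v + w) = lin e v + lin e w"
  by (simp add: lin_def scaleC_add_left sum.distrib)

lemma lin_smult: "lin e (c \<cdot>\<^sub>v v) = scaleC c (lin e v)"
  by (simp add: lin_def complex_vector.scale_sum_right scaleC_scaleC)

lemma mop_apply:
  assumes "A \<in> carrier_mat n n" shows "blinfun_apply (mop e A) h = lin e (A *\<^sub>v coords e n h)"
proof -
  have "(\<Sum>j<n. A $$ (i, j) * cinner h (e j)) = (A *\<^sub>v coords e n h) $ i" if "i < n" for i
    using assms that by (simp add: coords_def scalar_prod_def lessThan_atLeast0)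
  then show ?thesis using assms unfolding mat_op_apply lin_def by (intro sum.cong) auto
qed

lemma proj_op_apply: "blinfun_apply (proj_op e n) h = lin e (coords e n h)"
  by (simp add: diag_op_apply lin_def coords_def)

lemma coords_lin: "ortho e n \<Longrightarrow> v \<in> carrier_vec n \<Longrightarrow> coords e n (lin e v) = v"
  by (intro eq_vecI) (auto simp: coords_def lin_def ortho_coeff)

lemma coords_add: "coords e n (h + k) = coords e n h + coords e n k"
  by (intro eq_vecI) (auto simp: coords_def cinner_simps)

lemma coords_diff: "coords e n (h - k) = coords e n h - coords e n k"
  by (intro eq_vecI) (auto simp: coords_def cinner_simps)

lemma coords_scaleC: "coords e n (scaleC c h) = c \<cdot>\<^sub>v coords e n h"
  by (intro eq_vecI) (auto simp: coords_def cinner_simps)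

lemma full_op_apply:
  assumes "A \<in> carrier_mat n n"
  shows "blinfun_apply (full_op e A \<alpha>) h = lin e (A *\<^sub>v coords e n h) + scaleC \<alpha> (h - lin e (coords e n h))"
  using assms mop_apply[OF assms, of e h] by (simp add: full_op_def blinfun_simps proj_op_apply)

lemma full_op_bounded_ops [simp]: "full_op e A \<alpha> \<in> bounded_ops"
  by (simp add: full_op_def diag_op_def)

lemma full_op_lin:
  assumes "ortho e n" "A \<in> carrier_mat n n" "v \<in> carrier_vec n"
  shows "blinfun_apply (full_op e A \<alpha>) (lin e v) = lin e (A *\<^sub>v v)"
  using assms by (simp add: full_op_apply coords_lin)

lemma full_op_mult:
  assumes e: "ortho e n" and A: "A \<in> carrier_mat n n" and B: "B \<in> carrier_mat n n"
  shows "blinfun_apply (full_op e A \<alpha>) (blinfun_apply (full_op e B \<beta>) h) = blinfun_apply (full_op e (A * B) (\<alpha> * \<beta>)) h"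
proof -
  let ?v = "coords e n h" and ?q = "h - lin e (coords e n h)"
  have c0: "coords e n ?q = 0\<^sub>v n"
    using coords_lin[OF e, of ?v] by (simp add: coords_diff)
  have c: "coords e n (blinfun_apply (full_op e B \<beta>) h) = B *\<^sub>v ?v"
  proof -
    have "\<beta> \<cdot>\<^sub>v 0\<^sub>v n = (0\<^sub>v n :: complex Matrix.vec)" by (intro eq_vecI) auto
    moreover have "B *\<^sub>v ?v \<in> carrier_vec n" using B by (rule mult_mat_vec_carrier) simp
    ultimately show ?thesis
      unfolding full_op_apply[OF B] coords_add coords_scaleC c0 by (simp add: coords_lin[OF e])
  qed
  have "blinfun_apply (full_op e A \<alpha>) (blinfun_apply (full_op e B \<beta>) h)
      = lin e (A *\<^sub>v (B *\<^sub>v ?v)) + scaleC \<alpha> (blinfun_apply (full_op e B \<beta>) h - lin e (B *\<^sub>v ?v))"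
    unfolding full_op_apply[OF A] c ..
  also have "\<dots> = lin e ((A * B) *\<^sub>v ?v) + scaleC (\<alpha> * \<beta>) ?q"
    unfolding full_op_apply[OF B] using A B by (simp add: scaleC_scaleC assoc_mult_mat_vec[OF A B])
  finally show ?thesis unfolding full_op_apply[OF mult_carrier_mat[OF A B]] .
qed

lemma full_op_one: "blinfun_apply (full_op e (1\<^sub>m n) 1) h = h"
  using full_op_apply[of "1\<^sub>m n" n e 1 h] by (simp add: scaleC_one)

lemma full_op_inverse:
  assumes e: "ortho e n" and A: "A \<in> carrier_mat n n" and B: "B \<in> carrier_mat n n"
    and AB: "A * B = 1\<^sub>m n" "B * A = 1\<^sub>m n" and \<alpha>: "\<alpha> \<noteq> 0"
  shows "op_inverse_of (full_op e A \<alpha>) (full_op e B (1 / \<alpha>))"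
  by (rule op_inverse_ofI) (use \<alpha> in \<open>simp_all add: full_op_mult[OF e A B] full_op_mult[OF e B A] AB full_op_one\<close>)

lemma resolvent_mult_vec:
  fixes A :: "complex Matrix.mat"
  assumes A: "A \<in> carrier_mat n n" and v: "v \<in> carrier_vec n" and i: "i < n"
  shows "((z \<cdot>\<^sub>m 1\<^sub>m n - A) *\<^sub>v v) $ i = z * v $ i - (A *\<^sub>v v) $ i"
proof -
  have "((z \<cdot>\<^sub>m 1\<^sub>m n - A) *\<^sub>v v) $ i = (\<Sum>j=0..<n. (z * (if i = j then 1 else 0) - A $$ (i, j)) * v $ j)"
    using i A v by (auto simp: scalar_prod_def intro!: sum.cong)
  also have "\<dots> = (\<Sum>j=0..<n. (if i = j then z * v $ j else 0) - A $$ (i, j) * v $ j)"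
    by (intro sum.cong) (auto simp: algebra_simps)
  also have "\<dots> = z * v $ i - (\<Sum>j=0..<n. A $$ (i, j) * v $ j)"
    using i by (simp add: sum_subtractf)
  also have "(\<Sum>j=0..<n. A $$ (i, j) * v $ j) = (A *\<^sub>v v) $ i"
    using i A v by (auto simp: scalar_prod_def)
  finally show ?thesis .
qed

lemma full_op_resolvent:
  assumes A: "A \<in> carrier_mat n n"
  shows "op_const z - full_op e A \<alpha> = full_op e (z \<cdot>\<^sub>m 1\<^sub>m n - A) (z - \<alpha>)"
proof (rule blinfun_eqI)
  fix h
  let ?v = "coords e n h"
  have zA: "z \<cdot>\<^sub>m 1\<^sub>m n - A \<in> carrier_mat n n" using A by (auto intro: minus_carrier_mat)
  have "(z \<cdot>\<^sub>m 1\<^sub>m n - A) *\<^sub>v ?v = z \<cdot>\<^sub>v ?v + (-1) \<cdot>\<^sub>v (A *\<^sub>v ?v)"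
  proof (rule eq_vecI)
    show "dim_vec ((z \<cdot>\<^sub>m 1\<^sub>m n - A) *\<^sub>v ?v) = dim_vec (z \<cdot>\<^sub>v ?v + (-1) \<cdot>\<^sub>v (A *\<^sub>v ?v))" using A by simp
    fix i assume "i < dim_vec (z \<cdot>\<^sub>v ?v + (-1) \<cdot>\<^sub>v (A *\<^sub>v ?v))"
    then have i: "i < n" using A by simp
    then show "((z \<cdot>\<^sub>m 1\<^sub>m n - A) *\<^sub>v ?v) $ i = (z \<cdot>\<^sub>v ?v + (-1) \<cdot>\<^sub>v (A *\<^sub>v ?v)) $ i"
      unfolding resolvent_mult_vec[OF A coords_carrier(1) i] using A by (simp del: index_mult_mat_vec)
  qed
  then have "lin e ((z \<cdot>\<^sub>m 1\<^sub>m n - A) *\<^sub>v ?v) = scaleC z (lin e ?v) - lin e (A *\<^sub>v ?v)"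
    using A by (simp add: lin_add lin_smult)
  then show "blinfun_apply (op_const z - full_op e A \<alpha>) h = blinfun_apply (full_op e (z \<cdot>\<^sub>m 1\<^sub>m n - A) (z - \<alpha>)) h"
    unfolding full_op_apply[OF zA]
    by (simp add: blinfun_simps full_op_apply[OF A] complex_vector.scale_left_diff_distrib scaleC_diff_right algebra_simps)
qed

lemma lin_eq_0:
  assumes "ortho e n" "v \<in> carrier_vec n" "lin e v = 0" shows "v = 0\<^sub>v n"
proof -
  have "v = coords e n (lin e v)" using coords_lin[OF assms(1,2)] by simp
  also have "\<dots> = 0\<^sub>v n" unfolding assms(3) by (intro eq_vecI) (auto simp: coords_def)
  finally show ?thesis .
qed

lemma mat_resolvent:
  fixes A :: "complex Matrix.mat"
  assumes A: "A \<in> carrier_mat n n" and z: "z \<notin> spectrum A"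
  obtains B where "mat_inverse (z \<cdot>\<^sub>m 1\<^sub>m n - A) = Some B" "B \<in> carrier_mat n n"
    "(z \<cdot>\<^sub>m 1\<^sub>m n - A) * B = 1\<^sub>m n" "B * (z \<cdot>\<^sub>m 1\<^sub>m n - A) = 1\<^sub>m n"
proof -
  let ?Z = "z \<cdot>\<^sub>m 1\<^sub>m n - A"
  have zA: "?Z \<in> carrier_mat n n" using A by (auto intro: minus_carrier_mat)
  have "Determinant.det ?Z \<noteq> 0"
  proof
    assume "Determinant.det ?Z = 0"
    then obtain v where v: "v \<in> carrier_vec n" "v \<noteq> 0\<^sub>v n" "?Z *\<^sub>v v = 0\<^sub>v n"
      using det_0_iff_vec_prod_zero[OF zA] by blast
    have "A *\<^sub>v v = z \<cdot>\<^sub>v v"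
    proof (rule eq_vecI)
      fix i assume "i < dim_vec (z \<cdot>\<^sub>v v)"
      then have i: "i < n" using v by simp
      have "(?Z *\<^sub>v v) $ i = z * v $ i - (A *\<^sub>v v) $ i"
        by (rule resolvent_mult_vec[OF A v(1) i])
      then show "(A *\<^sub>v v) $ i = (z \<cdot>\<^sub>v v) $ i" using v i by (simp del: index_mult_mat_vec)
    qed (use A v in auto)
    then have "eigenvector A v z" using A v by (auto simp: eigenvector_def)
    then show False using z by (auto simp: spectrum_def eigenvalue_def)
  qed
  then have "?Z \<in> Units (ring_mat TYPE(complex) n ())" by (rule det_non_zero_imp_unit[OF zA])
  then obtain B where B: "mat_inverse ?Z = Some B" using mat_inverse(1)[OF zA, of "()"] by (cases "mat_inverse ?Z") auto
  then show ?thesis using mat_inverse(2)[OF zA B] that by blast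
qed

text \<open>An eigenvalue of \<open>A\<close> on the complement adds nothing to the spectrum. Exact
  equality matters: both calculi choose their cycle from the spectrum, and so choose the same
  one.\<close>

lemma op_spectrum_full_op:
  assumes e: "ortho e n" and A: "A \<in> carrier_mat n n" and l: "\<mu> \<in> spectrum A"
  shows "op_spectrum (full_op e A \<mu>) = spectrum A"
    and "z \<notin> spectrum A \<Longrightarrow> i < n \<Longrightarrow> j < n \<Longrightarrow>
      cinner (blinfun_apply (rsv (full_op e A \<mu>) z) (e j)) (e i) = the (mat_inverse (z \<cdot>\<^sub>m 1\<^sub>m n - A)) $$ (i, j)"
proof -
  have zA: "z \<cdot>\<^sub>m 1\<^sub>m n - A \<in> carrier_mat n n" for z using A by (auto intro: minus_carrier_mat)
  have inv: "op_inverse_of (op_const z - full_op e A \<mu>) (full_op e B (1 / (z - \<mu>)))"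
    if z: "z \<notin> spectrum A" and B: "B \<in> carrier_mat n n"
      "(z \<cdot>\<^sub>m 1\<^sub>m n - A) * B = 1\<^sub>m n" "B * (z \<cdot>\<^sub>m 1\<^sub>m n - A) = 1\<^sub>m n" for z B
    unfolding full_op_resolvent[OF A] by (rule full_op_inverse[OF e zA B]) (use z l in auto)
  show "op_spectrum (full_op e A \<mu>) = spectrum A"
  proof (intro equalityI subsetI)
    fix z assume "z \<in> op_spectrum (full_op e A \<mu>)"
    then have ninv: "\<not> op_invertible (op_const z - full_op e A \<mu>)" by (simp add: op_spectrum_def)
    show "z \<in> spectrum A"
    proof (rule ccontr)
      assume z: "z \<notin> spectrum A"
      obtain B where "B \<in> carrier_mat n n" "(z \<cdot>\<^sub>m 1\<^sub>m n - A) * B = 1\<^sub>m n" "B * (z \<cdot>\<^sub>m 1\<^sub>m n - A) = 1\<^sub>m n"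
        by (rule mat_resolvent[OF A z])
      from inv[OF z this] ninv show False by (auto simp: op_invertible_def)
    qed
  next
    fix z assume "z \<in> spectrum A"
    then obtain v where v: "v \<in> carrier_vec n" "v \<noteq> 0\<^sub>v n" "A *\<^sub>v v = z \<cdot>\<^sub>v v"
      using A by (auto simp: spectrum_def eigenvalue_def eigenvector_def)
    have "blinfun_apply (op_const z - full_op e A \<mu>) (lin e v) = 0"
      by (simp add: blinfun_simps full_op_lin[OF e A v(1)] v(3) lin_smult)
    moreover have "lin e v \<noteq> 0" using lin_eq_0[OF e v(1)] v(2) by blast
    ultimately show "z \<in> op_spectrum (full_op e A \<mu>)"
      using rsv(3)[of z "full_op e A \<mu>" "lin e v"] by (auto simp: blinfun.zero_right)
  qed
  assume z: "z \<notin> spectrum A" and ij: "i < n" "j < n"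
  obtain B where B: "mat_inverse (z \<cdot>\<^sub>m 1\<^sub>m n - A) = Some B" "B \<in> carrier_mat n n"
    "(z \<cdot>\<^sub>m 1\<^sub>m n - A) * B = 1\<^sub>m n" "B * (z \<cdot>\<^sub>m 1\<^sub>m n - A) = 1\<^sub>m n"
    by (rule mat_resolvent[OF A z])
  have "rsv (full_op e A \<mu>) z = full_op e B (1 / (z - \<mu>))" by (rule rsv_eqI[OF inv[OF z B(2-4)]])
  moreover have ej: "e j = lin e (unit_vec n j)"
  proof -
    have "lin e (unit_vec n j) = (\<Sum>i<n. if i = j then e i else 0)"
      unfolding lin_def by (intro sum.cong) (auto simp: ij scaleC_one)
    then show ?thesis using ij by simp
  qed
  have "cinner (blinfun_apply (full_op e B (1 / (z - \<mu>))) (e j)) (e i) = (B *\<^sub>v unit_vec n j) $ i"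
    unfolding ej full_op_lin[OF e B(2) unit_vec_carrier] using B(2) ij by (simp add: lin_def ortho_coeff[OF e] del: index_mult_mat_vec)
  also have "\<dots> = B $$ (i, j)" using B(2) ij by simp
  ultimately show "cinner (blinfun_apply (rsv (full_op e A \<mu>) z) (e j)) (e i) = the (mat_inverse (z \<cdot>\<^sub>m 1\<^sub>m n - A)) $$ (i, j)"
    using B(1) by simp
qed

section \<open>Quadratic forms of matrices\<close>

definition qf :: "complex Matrix.mat \<Rightarrow> complex Matrix.vec \<Rightarrow> complex" where
  "qf A v = (\<Sum>i<dim_vec v. \<Sum>j<dim_vec v. A $$ (i, j) * v $ j * cnj (v $ i))"

lemma qf_eq_inner:
  assumes "A \<in> carrier_mat n n" "v \<in> carrier_vec n" shows "(A *\<^sub>v v) \<bullet>c v = qf A v"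
  using assms by (auto simp: qf_def scalar_prod_def sum_distrib_right lessThan_atLeast0)

lemma mat_adjoint_index:
  assumes "A \<in> carrier_mat n n" "i < n" "j < n" shows "mat_adjoint A $$ (i, j) = cnj (A $$ (j, i))"
  using assms by (simp add: mat_adjoint_def mat_of_rows_def)

lemma mat_adjoint_carrier: "A \<in> carrier_mat n n \<Longrightarrow> mat_adjoint A \<in> carrier_mat n n"
  by (auto simp: mat_adjoint_def)

lemma herm_matsI:
  assumes "A \<in> carrier_mat n n" "\<And>i j. i < n \<Longrightarrow> j < n \<Longrightarrow> A $$ (i, j) = cnj (A $$ (j, i))"
  shows "A \<in> herm_mats n"
proof -
  note C = mat_adjoint_carrier[OF assms(1)]
  have "mat_adjoint A = A"
  proof (rule eq_matI)
    fix i j assume "i < dim_row A" "j < dim_col A"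
    then have ij: "i < n" "j < n" using assms(1) by (simp_all only: carrier_matD)
    show "mat_adjoint A $$ (i, j) = A $$ (i, j)"
      unfolding mat_adjoint_index[OF assms(1) ij] by (rule assms(2)[OF ij, symmetric])
  qed (simp_all only: carrier_matD[OF C] carrier_matD[OF assms(1)])
  then show ?thesis using assms(1) by (simp add: herm_mats_def)
qed

lemma herm_matsD:
  assumes "A \<in> herm_mats n"
  shows "A \<in> carrier_mat n n" "i < n \<Longrightarrow> j < n \<Longrightarrow> A $$ (i, j) = cnj (A $$ (j, i))"
proof -
  show A: "A \<in> carrier_mat n n" using assms by (simp add: herm_mats_def)
  assume "i < n" "j < n"
  from mat_adjoint_index[OF A this] show "A $$ (i, j) = cnj (A $$ (j, i))" using assms by (simp add: herm_mats_def)
qed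

lemma mop_form:
  assumes "A \<in> carrier_mat n n"
  shows "cinner (blinfun_apply (mop e A) h) h = qf A (coords e n h)"
proof -
  have "cinner (e i) h = cnj (cinner h (e i))" for i by (rule cinner_commute)
  then show ?thesis using assms by (simp add: mat_op_form qf_def coords_def)
qed

lemma mat_psd_iff:
  assumes "A \<in> herm_mats n" shows "mat_psd A \<longleftrightarrow> (\<forall>v\<in>carrier_vec n. 0 \<le> Re (qf A v))"
  using assms herm_matsD(1)[OF assms] by (auto simp: mat_psd_def qf_eq_inner)

lemma mat_Im_props:
  assumes A: "A \<in> carrier_mat n n"
  shows "mat_Im A \<in> herm_mats n" "v \<in> carrier_vec n \<Longrightarrow> qf (mat_Im A) v = of_real (Im (qf A v))"
proof -
  have C: "mat_Im A \<in> carrier_mat n n"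
    using A mat_adjoint_carrier[OF A] by (auto simp: mat_Im_def intro: minus_carrier_mat)
  have ix: "mat_Im A $$ (i, j) = (A $$ (i, j) - cnj (A $$ (j, i))) / (2 * \<i>)" if "i < n" "j < n" for i j
    using that A mat_adjoint_carrier[OF A] by (simp add: mat_Im_def mat_adjoint_index[OF A that])
  show "mat_Im A \<in> herm_mats n"
  proof (rule herm_matsI[OF C])
    fix i j assume ij: "i < n" "j < n"
    show "mat_Im A $$ (i, j) = cnj (mat_Im A $$ (j, i))"
      unfolding ix[OF ij] ix[OF ij(2) ij(1)] by (simp, simp add: algebra_simps)
  qed
  assume v: "v \<in> carrier_vec n"
  have "(\<Sum>i<n. \<Sum>j<n. cnj (A $$ (j, i)) * v $ j * cnj (v $ i)) = (\<Sum>j<n. \<Sum>i<n. cnj (A $$ (j, i)) * v $ j * cnj (v $ i))"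
    by (rule sum.swap)
  also have "\<dots> = cnj (qf A v)" using v by (simp add: qf_def mult_ac)
  finally have adj: "(\<Sum>i<n. \<Sum>j<n. cnj (A $$ (j, i)) * v $ j * cnj (v $ i)) = cnj (qf A v)" .
  have "qf (mat_Im A) v = (\<Sum>i<n. \<Sum>j<n. (A $$ (i, j) * v $ j * cnj (v $ i) - cnj (A $$ (j, i)) * v $ j * cnj (v $ i)) / (2 * \<i>))"
    using v unfolding qf_def by (intro sum.cong) (auto simp: ix diff_divide_distrib left_diff_distrib)
  also have "\<dots> = (qf A v - cnj (qf A v)) / (2 * \<i>)"
    unfolding sum_divide_distrib[symmetric] sum_subtractf adj using v by (simp only: qf_def carrier_vecD)
  also have "\<dots> = of_real (Im (qf A v))" unfolding complex_diff_cnj by (simp add: mult.commute[of "complex_of_real _" \<i>])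
  finally show "qf (mat_Im A) v = of_real (Im (qf A v))" .
qed

lemma proj_complement_form:
  assumes e: "ortho e n"
  shows "cinner (blinfun_apply (id_blinfun - proj_op e n) h) h = of_real ((norm h)\<^sup>2 - (\<Sum>j<n. (cmod (cinner h (e j)))\<^sup>2))"
proof -
  have "cinner (blinfun_apply (proj_op e n) h) h = (\<Sum>j<n. cinner h (e j) * cinner (e j) h)"
    by (simp add: diag_op_apply cinner_sum_left cinner_simps)
  also have "\<dots> = (\<Sum>j<n. of_real ((cmod (cinner h (e j)))\<^sup>2))"
    by (intro sum.cong refl) (simp only: complex_norm_square cinner_commute[of "e _" h])
  finally show ?thesis by (simp add: blinfun_simps cinner_simps cinner_self)
qed

text \<open>Extending \<open>B\<close> by the identity on the complement keeps it positive and
  invertible, so the lower bound for operators applies.\<close>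

lemma mat_pos_bound:
  assumes e: "ortho e n" and B: "B \<in> herm_mats n" "mat_pos B"
  obtains d where "d > 0" "\<And>h. d * (norm h)\<^sup>2 \<le> Re (qf B (coords e n h)) + ((norm h)\<^sup>2 - (\<Sum>j<n. (cmod (cinner h (e j)))\<^sup>2))"
proof -
  have BC: "B \<in> carrier_mat n n" by (rule herm_matsD(1)[OF B(1)])
  have form: "cinner (blinfun_apply (full_op e B 1) h) h = qf B (coords e n h) + of_real ((norm h)\<^sup>2 - (\<Sum>j<n. (cmod (cinner h (e j)))\<^sup>2))" for h
  proof -
    have "cinner (blinfun_apply (full_op e B 1) h) h = cinner (blinfun_apply (mop e B) h) h + cinner (blinfun_apply (id_blinfun - proj_op e n) h) h"
      using BC by (simp add: full_op_def blinfun_simps cinner_simps scaleC_one)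
    then show ?thesis unfolding mop_form[OF BC] proj_complement_form[OF e] .
  qed
  have imB: "Im (qf B v) = 0" if v: "v \<in> carrier_vec n" for v
  proof -
    have "op_selfadjoint (mop e B)" by (rule mat_op_selfadjoint) (simp only: carrier_matD[OF BC], rule herm_matsD(2)[OF B(1)])
    then have "Im (cinner (blinfun_apply (mop e B) (lin e v)) (lin e v)) = 0" unfolding op_selfadjoint_iff by blast
    then show ?thesis unfolding mop_form[OF BC] coords_lin[OF e v] .
  qed
  have psdB: "0 \<le> Re (qf B v)" if "v \<in> carrier_vec n" for v using B that mat_psd_iff[OF B(1)] by (auto simp: mat_pos_def)
  have "op_psd (full_op e B 1)"
    unfolding op_psd_def op_selfadjoint_iff
    by (auto simp: form imB psdB bessel[OF e] simp del: of_real_diff of_real_power of_real_sum)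
  moreover obtain B' where B': "B * B' = 1\<^sub>m n" "B' * B = 1\<^sub>m (dim_row B')"
    using B(2) BC by (auto simp: mat_pos_def invertible_mat_def inverts_mat_def)
  have "B' \<in> carrier_mat n n"
  proof -
    have "dim_col B' = n" using arg_cong[OF B'(1), of dim_col] by simp
    moreover have "dim_row B' = n" using arg_cong[OF B'(2), of dim_col] BC by simp
    ultimately show ?thesis by auto
  qed
  then have "op_inverse_of (full_op e B 1) (full_op e B' (1 / 1))"
    using B' by (intro full_op_inverse[OF e BC]) auto
  then have "op_invertible (full_op e B 1)" by (auto simp: op_invertible_def)
  ultimately obtain d where "d > 0" "\<And>h. d * (norm h)\<^sup>2 \<le> Re (cinner (blinfun_apply (full_op e B 1) h) h)"
    using op_psd_invertible_bound by blast
  then show ?thesis using that unfolding form by (simp del: of_real_diff of_real_power of_real_sum)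
qed

text \<open>At an eigenvector \<open>v\<close> of \<open>X\<close> with embedded vector
  \<open>u\<close>, \<open>Im \<mu> |u|^2\<close> is the form of \<open>B\<close>, hence
  \<open>Im \<mu> > 0\<close>, and the scalar \<open>\<mu>\<close> on the complement is coercive as
  well. \<open>n \<ge> 1\<close> provides the eigenvalue.\<close>

lemma full_op_coercive:
  assumes e: "ortho e n" and n: "n \<ge> 1" and A: "A \<in> herm_mats n" and B: "B \<in> herm_mats n" "mat_pos B"
  defines "X \<equiv> A + \<i> \<cdot>\<^sub>m B"
  obtains \<mu> d where "\<mu> \<in> spectrum X" "d > 0" "\<And>h. d * (norm h)\<^sup>2 \<le> Im (cinner (blinfun_apply (full_op e X \<mu>) h) h)"
proof -
  have AC: "A \<in> carrier_mat n n" and BC: "B \<in> carrier_mat n n" using herm_matsD(1) A B by auto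
  have XC: "X \<in> carrier_mat n n" using AC BC by (simp add: X_def)
  obtain d where d: "d > 0" "\<And>h. d * (norm h)\<^sup>2 \<le> Re (qf B (coords e n h)) + ((norm h)\<^sup>2 - (\<Sum>j<n. (cmod (cinner h (e j)))\<^sup>2))"
    using mat_pos_bound[OF e B] by blast
  have qX: "qf X v = qf A v + \<i> * qf B v" if "v \<in> carrier_vec n" for v
    unfolding qf_def sum_distrib_left sum.distrib[symmetric]
  proof (intro sum.cong refl)
    fix i j assume "i \<in> {..<dim_vec v}" "j \<in> {..<dim_vec v}"
    then have "i < n" "j < n" using that by simp_all
    then have "X $$ (i, j) = A $$ (i, j) + \<i> * B $$ (i, j)" using AC BC by (simp add: X_def)
    then show "X $$ (i, j) * v $ j * cnj (v $ i) = A $$ (i, j) * v $ j * cnj (v $ i) + \<i> * (B $$ (i, j) * v $ j * cnj (v $ i))"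
      by (simp only: distrib_right mult.assoc)
  qed
  have imA: "Im (qf A v) = 0" if v: "v \<in> carrier_vec n" for v
  proof -
    have "op_selfadjoint (mop e A)" by (rule mat_op_selfadjoint) (simp only: carrier_matD[OF AC], rule herm_matsD(2)[OF A])
    then have "Im (cinner (blinfun_apply (mop e A) (lin e v)) (lin e v)) = 0" unfolding op_selfadjoint_iff by blast
    then show ?thesis unfolding mop_form[OF AC] coords_lin[OF e v] .
  qed
  obtain \<mu> where l: "\<mu> \<in> spectrum X" using spectrum_non_empty[OF XC] n by auto
  then obtain v where v: "v \<in> carrier_vec n" "v \<noteq> 0\<^sub>v n" "X *\<^sub>v v = \<mu> \<cdot>\<^sub>v v"
    using XC by (auto simp: spectrum_def eigenvalue_def eigenvector_def)
  let ?u = "lin e v"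
  have u0: "?u \<noteq> 0" using lin_eq_0[OF e v(1)] v(2) by blast
  have cu: "coords e n ?u = v" by (rule coords_lin[OF e v(1)])
  have nu: "(norm ?u)\<^sup>2 = (\<Sum>j<n. (cmod (cinner ?u (e j)))\<^sup>2)"
    using ortho_norm[OF e, of "\<lambda>i. v $ i"] v(1) by (auto simp: lin_def ortho_coeff[OF e])
  have "\<mu> * of_real ((norm ?u)\<^sup>2) = cinner (blinfun_apply (mop e X) ?u) ?u"
    by (simp add: mop_apply[OF XC] cu v(3) lin_smult cinner_simps cinner_self)
  then have "\<mu> * of_real ((norm ?u)\<^sup>2) = qf A v + \<i> * qf B v" unfolding mop_form[OF XC] cu qX[OF v(1)] .
  then have "Im (\<mu> * of_real ((norm ?u)\<^sup>2)) = Im (qf A v + \<i> * qf B v)" by (rule arg_cong)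
  then have "Im \<mu> * (norm ?u)\<^sup>2 = Re (qf B v)" using imA[OF v(1)] by (simp del: of_real_power)
  moreover have "d * (norm ?u)\<^sup>2 \<le> Re (qf B v)" using d(2)[of ?u] unfolding cu nu by simp
  moreover have "0 < d * (norm ?u)\<^sup>2" using d(1) u0 by simp
  ultimately have "0 < Im \<mu> * (norm ?u)\<^sup>2" by linarith
  then have iml: "0 < Im \<mu>" using u0 by (simp add: zero_less_mult_iff)
  have psdB: "0 \<le> Re (qf B v)" if "v \<in> carrier_vec n" for v using B that mat_psd_iff[OF B(1)] by (auto simp: mat_pos_def)
  \<comment> \<open>In the bound \<open>d\<close> the complement enters with factor 1, in
    \<open>full_op e X \<mu>\<close> with factor \<open>Im \<mu>\<close>; this weight is below both
    and below the factor 1 of \<open>B\<close>.\<close>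
  define m where "m = min 1 (Im \<mu>)"
  have m: "0 < m" "m \<le> 1" "m \<le> Im \<mu>" using iml by (auto simp: m_def)
  have "m * d * (norm h)\<^sup>2 \<le> Im (cinner (blinfun_apply (full_op e X \<mu>) h) h)" for h
  proof -
    let ?b = "Re (qf B (coords e n h))" and ?q = "(norm h)\<^sup>2 - (\<Sum>j<n. (cmod (cinner h (e j)))\<^sup>2)"
    have b: "0 \<le> ?b" "0 \<le> ?q" using psdB bessel[OF e, of h] by auto
    have "m * (d * (norm h)\<^sup>2) \<le> m * (?b + ?q)" using m by (intro mult_left_mono d) auto
    also have "\<dots> \<le> 1 * ?b + Im \<mu> * ?q" unfolding distrib_left using m b by (intro add_mono mult_right_mono) auto
    also have "\<dots> = Im (cinner (blinfun_apply (full_op e X \<mu>) h) h)"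
    proof -
      have "cinner (blinfun_apply (full_op e X \<mu>) h) h = cinner (blinfun_apply (mop e X) h) h + \<mu> * cinner (blinfun_apply (id_blinfun - proj_op e n) h) h"
        using XC unfolding full_op_def blinfun.add_left op_scaleC.rep_eq cinner_add_left cinner_scaleC_left by simp
      also have "\<dots> = qf A (coords e n h) + \<i> * qf B (coords e n h) + \<mu> * of_real ?q"
        unfolding mop_form[OF XC] proj_complement_form[OF e] qX[OF coords_carrier(1)] ..
      finally show ?thesis using imA[of "coords e n h"] by (simp del: of_real_diff of_real_power of_real_sum)
    qed
    finally show ?thesis by (simp add: mult.assoc)
  qed
  moreover have "m * d > 0" using m d by simp
  ultimately show ?thesis using that l by blast
qed

context half_plane_continuation
begin

text \<open>An entrywise comparison on the common cycle, where the entries of the inverse matrix are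
  matrix coefficients of the resolvent.\<close>

lemma mat_hol_calc_form:
  assumes e: "ortho e n" and X: "X \<in> carrier_mat n n" and l: "\<mu> \<in> spectrum X"
    and d: "d > 0" "\<And>h. d * (norm h)\<^sup>2 \<le> Im (cinner (blinfun_apply (full_op e X \<mu>) h) h)"
  shows "mat_hol_calc D g X \<in> carrier_mat n n"
    "v \<in> carrier_vec n \<Longrightarrow> qf (mat_hol_calc D g X) v = cinner (blinfun_apply (op_hol_calc D g (full_op e X \<mu>)) (lin e v)) (lin e v)"
proof -
  let ?Y = "full_op e X \<mu>" and ?K = "spectrum X"
  let ?\<Gamma> = "SOME \<Gamma>. surrounding_cycle D ?K \<Gamma>"
  have spec: "op_spectrum ?Y = ?K" by (rule op_spectrum_full_op(1)[OF e X l])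
  obtain R where R: "norm (?Y - op_const (\<i> * of_real R)) < R" using coercive_disc[OF full_op_bounded_ops d] by blast
  define s where "s = (norm (?Y - op_const (\<i> * of_real R)) + R) / 2"
  have s: "norm (?Y - op_const (\<i> * of_real R)) < s" "s < R" using R by (auto simp: s_def)
  have "surrounding_cycle D (op_spectrum ?Y) [circlepath (\<i> * of_real R) s]"
    by (rule surrounding_circlepath[OF full_op_bounded_ops ball_upper s])
  then have cyc: "surrounding_cycle D (op_spectrum ?Y) ?\<Gamma>" unfolding spec by (rule someI)
  have KD: "op_spectrum ?Y \<subseteq> D"
    using op_spectrum_subset_cball[OF full_op_bounded_ops, of e X \<mu> "\<i> * of_real R"] R ball_upper[of R]
    by (auto simp: subset_iff)
  show "mat_hol_calc D g X \<in> carrier_mat n n" using X by (simp add: mat_hol_calc_def Let_def)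
  have entry: "mat_hol_calc D g X $$ (i, j) = cinner (blinfun_apply (op_hol_calc D g ?Y) (e j)) (e i)" if ij: "i < n" "j < n" for i j
  proof -
    have "contour_integral \<gamma> (\<lambda>\<zeta>. g \<zeta> * the (mat_inverse (\<zeta> \<cdot>\<^sub>m 1\<^sub>m n - X)) $$ (i, j)) =
        contour_integral \<gamma> (\<lambda>\<zeta>. g \<zeta> * cinner (blinfun_apply (rsv ?Y \<zeta>) (e j)) (e i))" if ga: "\<gamma> \<in> set ?\<Gamma>" for \<gamma>
    proof (rule contour_integral_eq)
      fix \<zeta> assume "\<zeta> \<in> path_image \<gamma>"
      then have nK: "\<zeta> \<notin> ?K" using cyc ga unfolding surrounding_cycle_def spec by blast
      show "g \<zeta> * the (mat_inverse (\<zeta> \<cdot>\<^sub>m 1\<^sub>m n - X)) $$ (i, j) = g \<zeta> * cinner (blinfun_apply (rsv ?Y \<zeta>) (e j)) (e i)"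
        by (simp only: op_spectrum_full_op(2)[OF e X l nK ij])
    qed
    then have "(\<Sum>\<gamma>\<leftarrow>?\<Gamma>. contour_integral \<gamma> (\<lambda>\<zeta>. g \<zeta> * the (mat_inverse (\<zeta> \<cdot>\<^sub>m 1\<^sub>m n - X)) $$ (i, j))) =
        cinner (blinfun_apply (op_cycle_integral g ?Y ?\<Gamma>) (e j)) (e i)"
      unfolding op_cycle_integral_cinner[OF full_op_bounded_ops D g_hol KD cyc]
      by (intro arg_cong[where f=sum_list] map_cong[OF refl])
    then show ?thesis
      using X ij by (simp add: mat_hol_calc_def Let_def op_hol_calc_eq_cycle_integral spec blinfun_simps cinner_simps)
  qed
  assume v: "v \<in> carrier_vec n"
  have YB: "op_hol_calc D g ?Y \<in> bounded_ops" by (rule calc_bounded_ops[OF full_op_bounded_ops ball_upper R])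
  have "cinner (blinfun_apply (op_hol_calc D g ?Y) (lin e v)) (lin e v) =
      (\<Sum>i<n. \<Sum>j<n. cnj (v $ i) * (v $ j * cinner (blinfun_apply (op_hol_calc D g ?Y) (e j)) (e i)))"
    using v by (simp add: lin_def blinfun.sum_right bounded_opsD[OF YB] cinner_sum_left cinner_sum_right cinner_simps sum_distrib_left)
  also have "\<dots> = qf (mat_hol_calc D g X) v" using v by (auto simp: qf_def entry mult_ac intro!: sum.cong)
  finally show "qf (mat_hol_calc D g X) v = cinner (blinfun_apply (op_hol_calc D g ?Y) (lin e v)) (lin e v)" ..
qed

lemma pick_imp_matrix:
  assumes pick: "\<And>z. 0 < Im z \<Longrightarrow> 0 \<le> Im (F z)" and inf: "\<And>n. \<exists>e :: nat \<Rightarrow> 'h::chilbert_space. ortho e n"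
    and n: "n \<ge> 1" and A: "A \<in> herm_mats n" and B: "B \<in> herm_mats n" "mat_pos B"
  shows "mat_psd (mat_Im (mat_hol_calc D g (A + \<i> \<cdot>\<^sub>m B)))"
proof -
  obtain e :: "nat \<Rightarrow> 'h" where e: "ortho e n" using inf by blast
  let ?X = "A + \<i> \<cdot>\<^sub>m B"
  have XC: "?X \<in> carrier_mat n n" using herm_matsD(1)[OF A] herm_matsD(1)[OF B(1)] by simp
  obtain \<mu> d where l: "\<mu> \<in> spectrum ?X" and d: "d > 0" "\<And>h. d * (norm h)\<^sup>2 \<le> Im (cinner (blinfun_apply (full_op e ?X \<mu>) h) h)"
    using full_op_coercive[OF e n A B] by blast
  note M = mat_hol_calc_form[OF e XC l d]
  have pos: "op_pos (op_Im (full_op e ?X \<mu>))" using op_pos_op_Im_iff[OF full_op_bounded_ops] d by blast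
  have "0 \<le> Re (qf (mat_Im (mat_hol_calc D g ?X)) v)" if v: "v \<in> carrier_vec n" for v
  proof -
    have "0 \<le> Im (cinner (blinfun_apply (op_hol_calc D g (full_op e ?X \<mu>)) (lin e v)) (lin e v))"
      by (rule pick_imp_op_Im_bound[OF pick full_op_bounded_ops pos])
    then show ?thesis unfolding mat_Im_props(2)[OF M(1) v] M(2)[OF v] by simp
  qed
  then show ?thesis using mat_psd_iff[OF mat_Im_props(1)[OF M(1)]] by blast
qed

end

section \<open>Loewner matrices from the matrix condition\<close>

lemma mop_eq_form:
  assumes "X \<in> carrier_mat n n"
  shows "cinner (blinfun_apply (mop e X) x) y = (\<Sum>i<n. \<Sum>j<n. X $$ (i, j) * cinner x (e j) * cinner (e i) y)"
  using assms mat_op_form[of e n "\<lambda>i j. X $$ (i, j)" x y] by simp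

lemma diag_mat_herm_in:
  assumes S: "\<And>k. k < n \<Longrightarrow> x k \<in> S"
  shows "Matrix.mat n n (\<lambda>(i, j). if i = j then complex_of_real (x i) else 0) \<in> herm_mats_in n S" (is "?A \<in> _")
proof -
  have A: "?A \<in> carrier_mat n n" by simp
  have "?A \<in> herm_mats n" by (rule herm_matsI[OF A]) auto
  moreover have "spectrum ?A \<subseteq> complex_of_real ` S"
  proof
    fix k assume "k \<in> spectrum ?A"
    then obtain v where v: "v \<in> carrier_vec n" "v \<noteq> 0\<^sub>v n" "?A *\<^sub>v v = k \<cdot>\<^sub>v v"
      by (auto simp: spectrum_def eigenvalue_def eigenvector_def)
    obtain i where i: "i < n" "v $ i \<noteq> 0"
    proof (rule ccontr)
      assume "\<not> thesis"
      then have "v $ i = 0" if "i < n" for i using that \<open>\<And>i. i < n \<Longrightarrow> v $ i \<noteq> 0 \<Longrightarrow> thesis\<close> by blast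
      then have "v = 0\<^sub>v n" using v(1) by (intro eq_vecI) auto
      then show False using v(2) by simp
    qed
    have "(?A *\<^sub>v v) $ i = (\<Sum>j=0..<n. (if i = j then of_real (x i) else 0) * v $ j)"
      using i(1) v(1) by (simp add: scalar_prod_def)
    also have "\<dots> = (\<Sum>j=0..<n. if i = j then of_real (x i) * v $ j else 0)" by (intro sum.cong refl) simp
    also have "\<dots> = of_real (x i) * v $ i" using i(1) by simp
    finally have "(?A *\<^sub>v v) $ i = of_real (x i) * v $ i" .
    moreover have "(k \<cdot>\<^sub>v v) $ i = k * v $ i" using i(1) v(1) by simp
    ultimately have "k = of_real (x i)" using i(2) v(3) by simp
    then show "k \<in> complex_of_real ` S" using S[OF i(1)] by simp
  qed
  ultimately show ?thesis by (simp add: herm_mats_in_def)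
qed

text \<open>Coercivity excludes a kernel, and for a square matrix this provides the inverse.\<close>

lemma mat_posI:
  assumes e: "ortho e n" and B: "B \<in> herm_mats n"
    and d: "d > 0" "\<And>h. d * (norm (lin e (coords e n h)))\<^sup>2 \<le> Re (qf B (coords e n h))"
  shows "mat_pos B"
proof -
  have BC: "B \<in> carrier_mat n n" by (rule herm_matsD(1)[OF B])
  have low: "d * (norm (lin e v))\<^sup>2 \<le> Re (qf B v)" if "v \<in> carrier_vec n" for v
    using d(2)[of "lin e v"] coords_lin[OF e that] by simp
  have "0 \<le> Re (qf B v)" if "v \<in> carrier_vec n" for v
    using low[OF that] d(1) by (meson order_trans mult_nonneg_nonneg less_imp_le zero_le_power2)
  then have "mat_psd B" using mat_psd_iff[OF B] by blast
  moreover have "Determinant.det B \<noteq> 0"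
  proof
    assume "Determinant.det B = 0"
    then obtain v where v: "v \<in> carrier_vec n" "v \<noteq> 0\<^sub>v n" "B *\<^sub>v v = 0\<^sub>v n"
      using det_0_iff_vec_prod_zero[OF BC] by blast
    have "qf B v = 0" using qf_eq_inner[OF BC v(1)] v by (simp add: scalar_prod_def)
    moreover have "lin e v \<noteq> 0" using lin_eq_0[OF e v(1)] v(2) by blast
    then have "0 < d * (norm (lin e v))\<^sup>2" using d(1) by simp
    ultimately show False using low[OF v(1)] by simp
  qed
  then have "B \<in> Units (ring_mat TYPE(complex) n ())" by (rule det_non_zero_imp_unit[OF BC])
  then obtain B' where "mat_inverse B = Some B'" using mat_inverse(1)[OF BC, of "()"] by (cases "mat_inverse B") auto
  then have "B * B' = 1\<^sub>m n" "B' * B = 1\<^sub>m n" "B' \<in> carrier_mat n n" using mat_inverse(2)[OF BC] by auto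
  then have "invertible_mat B" using BC unfolding invertible_mat_def inverts_mat_def by (auto intro!: exI[of _ B'])
  ultimately show ?thesis by (simp add: mat_pos_def)
qed

context half_plane_continuation
begin

text \<open>The complement of the range of the embedding contributes the eigenvalue \<open>\<mu>\<close> only, so that the
  embedded operator and \<open>W\<close> have the same powers on that range.\<close>

lemma matrix_imp_loewner_step:
  fixes e :: "nat \<Rightarrow> 'h::chilbert_space"
  assumes iii: "\<And>n A B. n \<ge> 1 \<Longrightarrow> A \<in> herm_mats_in n S \<Longrightarrow> B \<in> herm_mats n \<Longrightarrow> mat_pos B \<Longrightarrow>
      mat_psd (mat_Im (mat_hol_calc D g (A + \<i> \<cdot>\<^sub>m B)))"
    and e: "ortho e n" and n: "n \<ge> 1" and r: "{c - r<..<c + r} \<subseteq> S" "r > 0"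
    and y: "\<And>k. k < n \<Longrightarrow> \<bar>y k\<bar> < r / 8"
    and \<delta>: "\<delta> > 0" and t: "t > 0" and v: "v \<in> carrier_vec n"
  defines "W \<equiv> diag_op e n y + op_scaleC (\<i> * of_real t) (ones_op e n + \<delta> *\<^sub>R proj_op e n)"
  assumes W: "norm W \<le> r / 4"
  shows "0 \<le> Im (cinner (blinfun_apply (op_ps (taylor_coeff g (of_real c)) W) (lin e v)) (lin e v))"
proof -
  let ?a = "taylor_coeff g (of_real c)"
  define A where "A = Matrix.mat n n (\<lambda>(i, j). if i = j then complex_of_real (c + y i) else 0)"
  define B where "B = Matrix.mat n n (\<lambda>(i, j). complex_of_real t * (1 + (if i = j then of_real \<delta> else 0)))"
  define X where "X = A + \<i> \<cdot>\<^sub>m B"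
  have AC: "A \<in> carrier_mat n n" and BC: "B \<in> carrier_mat n n" and XC: "X \<in> carrier_mat n n"
    by (auto simp: A_def B_def X_def)
  have "c + y k \<in> S" if "k < n" for k
  proof -
    have "c + y k \<in> {c - r<..<c + r}" using y[OF that] r(2) unfolding abs_less_iff greaterThanLessThan_iff by linarith
    then show ?thesis using r(1) by blast
  qed
  then have AS: "A \<in> herm_mats_in n S" unfolding A_def by (rule diag_mat_herm_in)
  have Ah: "A \<in> herm_mats n" using AS by (simp add: herm_mats_in_def)
  have Bh: "B \<in> herm_mats n" by (rule herm_matsI[OF BC]) (auto simp: B_def)
  have Bform: "cinner (blinfun_apply (mop e B) x) z = of_real t * (cinner (blinfun_apply (ones_op e n) x) z
      + of_real \<delta> * cinner (blinfun_apply (proj_op e n) x) z)" for x z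
    unfolding mop_eq_form[OF BC]
    unfolding ones_op_def diag_op_def mat_op_form sum_distrib_left sum.distrib[symmetric]
    by (intro sum.cong refl) (auto simp: B_def algebra_simps)
  have Xform: "mop e X = op_scaleC (of_real c) (proj_op e n) + W"
  proof (rule op_eqI)
    fix x z
    have "cinner (blinfun_apply (mop e X) x) z = of_real c * cinner (blinfun_apply (proj_op e n) x) z
        + cinner (blinfun_apply (diag_op e n y) x) z + \<i> * cinner (blinfun_apply (mop e B) x) z"
      unfolding mop_eq_form[OF BC] mop_eq_form[OF XC]
      unfolding diag_op_def mat_op_form sum_distrib_left sum.distrib[symmetric]
      by (intro sum.cong refl) (use BC in \<open>auto simp: X_def A_def algebra_simps\<close>)
    then show "cinner (blinfun_apply (mop e X) x) z = cinner (blinfun_apply (op_scaleC (of_real c) (proj_op e n) + W) x) z"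
      unfolding Bform by (simp add: W_def blinfun_simps cinner_simps algebra_simps)
  qed
  have P: "blinfun_apply (proj_op e n) (lin e u) = lin e u" if "u \<in> carrier_vec n" for u
    unfolding proj_op_apply coords_lin[OF e that] ..
  have Bpos: "mat_pos B"
  proof (rule mat_posI[OF e Bh])
    show "t * \<delta> > 0" using t \<delta> by simp
    fix h
    let ?u = "lin e (coords e n h)"
    have cu: "coords e n ?u = coords e n h" by (rule coords_lin[OF e]) simp
    have "qf B (coords e n h) = cinner (blinfun_apply (mop e B) ?u) ?u" unfolding mop_form[OF BC] cu ..
    also have "\<dots> = of_real t * (cinner (blinfun_apply (ones_op e n) ?u) ?u + of_real \<delta> * of_real ((norm ?u)\<^sup>2))"
      unfolding Bform P[OF coords_carrier(1)] cinner_self ..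
    finally have "Re (qf B (coords e n h)) = t * (Re (cinner (blinfun_apply (ones_op e n) ?u) ?u) + \<delta> * (norm ?u)\<^sup>2)"
      by (simp del: of_real_power)
    moreover have "0 \<le> Re (cinner (blinfun_apply (ones_op e n) ?u) ?u)" using ones_op_psd[of e n] by (simp add: op_psd_def)
    then have "t * (\<delta> * (norm ?u)\<^sup>2) \<le> t * (Re (cinner (blinfun_apply (ones_op e n) ?u) ?u) + \<delta> * (norm ?u)\<^sup>2)"
      using t by (intro mult_left_mono) auto
    ultimately show "t * \<delta> * (norm ?u)\<^sup>2 \<le> Re (qf B (coords e n h))" by (simp add: mult.assoc)
  qed
  obtain \<mu> d where l: "\<mu> \<in> spectrum X" and d: "d > 0" "\<And>h. d * (norm h)\<^sup>2 \<le> Im (cinner (blinfun_apply (full_op e X \<mu>) h) h)"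
    using full_op_coercive[OF e n Ah Bh Bpos] unfolding X_def[symmetric] by blast
  note M = mat_hol_calc_form[OF e XC l d]
  have "mat_psd (mat_Im (mat_hol_calc D g X))" unfolding X_def by (rule iii[OF n AS Bh Bpos])
  then have "0 \<le> Re (qf (mat_Im (mat_hol_calc D g X)) v)" using mat_psd_iff[OF mat_Im_props(1)[OF M(1)]] v by blast
  then have im: "0 \<le> Im (cinner (blinfun_apply (op_hol_calc D g (full_op e X \<mu>)) (lin e v)) (lin e v))"
    unfolding mat_Im_props(2)[OF M(1) v] M(2)[OF v] by simp
  define Z where "Z = full_op e X \<mu> - op_const (of_real c)"
  have ZW: "Z = W + op_scaleC (\<mu> - of_real c) (id_blinfun - proj_op e n)"
    unfolding Z_def full_op_def Xform using XC
    by (intro blinfun_eqI) (simp add: blinfun_simps complex_vector.scale_left_diff_distrib scaleC_diff_right algebra_simps)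
  have Wlin: "blinfun_apply W (lin e u) = lin e (X *\<^sub>v u) - scaleC (of_real c) (lin e u)" if u: "u \<in> carrier_vec n" for u
  proof -
    have "lin e (X *\<^sub>v u) = scaleC (of_real c) (lin e u) + blinfun_apply W (lin e u)"
      using mop_apply[OF XC, of e "lin e u"] coords_lin[OF e u] P[OF u] unfolding Xform by (simp add: blinfun_simps)
    then show ?thesis by simp
  qed
  \<comment> \<open>\<open>\<mu> - c\<close> is an eigenvalue of \<open>W\<close> on the embedded
    space.\<close>
  have nl: "cmod (\<mu> - of_real c) \<le> norm W"
  proof -
    obtain u where u: "u \<in> carrier_vec n" "u \<noteq> 0\<^sub>v n" "X *\<^sub>v u = \<mu> \<cdot>\<^sub>v u"
      using l XC by (auto simp: spectrum_def eigenvalue_def eigenvector_def)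
    have u0: "lin e u \<noteq> 0" using lin_eq_0[OF e u(1)] u(2) by blast
    have "blinfun_apply W (lin e u) = scaleC (\<mu> - of_real c) (lin e u)"
      unfolding Wlin[OF u(1)] u(3) lin_smult complex_vector.scale_left_diff_distrib ..
    then have "cmod (\<mu> - of_real c) * norm (lin e u) \<le> norm W * norm (lin e u)"
      using norm_blinfun[of W "lin e u"] by (simp add: norm_scaleC)
    then show ?thesis using u0 by (simp add: mult_le_cancel_right)
  qed
  \<comment> \<open>\<open>|Z| \<le> |W| + |\<mu> - c| |1 - P| \<le> 3 |W|\<close>, so
    \<open>|W| \<le> r / 4\<close> keeps \<open>Z\<close> inside the disc about
    \<open>c\<close>.\<close>
  have nZ: "norm Z < r"
  proof -
    have "norm (id_blinfun - proj_op e n) \<le> 1 + 1"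
      by (rule order_trans[OF norm_triangle_ineq4]) (intro add_mono norm_blinfun_id_le diag_op_norm[OF e], auto)
    then have "cmod (\<mu> - of_real c) * norm (id_blinfun - proj_op e n) \<le> norm W * (1 + 1)"
      by (intro mult_mono nl) auto
    then have p: "cmod (\<mu> - of_real c) * norm (id_blinfun - proj_op e n) \<le> 2 * norm W" by (simp add: mult.commute)
    have key: "u < r" if "u \<le> w + q" "q \<le> p" "p \<le> 2 * w" "w \<le> r / 4" for u w p q using that r(2) by linarith
    show ?thesis unfolding ZW by (rule key[OF norm_triangle_ineq norm_op_scaleC p W])
  qed
  have pow: "blinfun_apply (op_pow Z m) (lin e u) = blinfun_apply (op_pow W m) (lin e u)" if "u \<in> carrier_vec n" for m u
    using that
  proof (induction m arbitrary: u)
    case (Suc m)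
    have Zu: "blinfun_apply Z (lin e u) = blinfun_apply W (lin e u)" unfolding ZW by (simp add: blinfun_simps P[OF Suc.prems])
    have Xu: "X *\<^sub>v u \<in> carrier_vec n" using XC Suc.prems by (rule mult_mat_vec_carrier)
    have "blinfun_apply W (lin e u) = lin e (X *\<^sub>v u + (- of_real c) \<cdot>\<^sub>v u)"
      using Xu Suc.prems XC unfolding Wlin[OF Suc.prems] by (simp add: lin_add lin_smult complex_vector.scale_minus_left)
    moreover have "X *\<^sub>v u + (- of_real c) \<cdot>\<^sub>v u \<in> carrier_vec n" using Xu Suc.prems by simp
    ultimately show ?case unfolding op_pow_Suc_apply(1) Zu using Suc.IH by simp
  qed simp
  have gb: "g holomorphic_on ball (of_real c) r"
    by (rule holomorphic_on_subset[OF g_hol ball_subset_slit_domain[OF r(1)]])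
  have sm: "summable (\<lambda>m. cmod (?a m) * norm Z ^ m)" by (rule taylor_summable[OF gb norm_ge_zero nZ])
  have smW: "summable (\<lambda>m. cmod (?a m) * norm W ^ m)" by (rule taylor_summable[OF gb norm_ge_zero]) (use W r in linarith)
  have "cinner (blinfun_apply (op_ps ?a Z) (lin e v)) (lin e v) = cinner (blinfun_apply (op_ps ?a W) (lin e v)) (lin e v)"
    using op_ps_cinner_sums[OF sm order_refl, of "lin e v" "lin e v"] op_ps_cinner_sums[OF smW order_refl, of "lin e v" "lin e v"]
    unfolding pow[OF v] by (rule sums_unique2)
  then show ?thesis
    using im op_hol_calc_power_series[OF full_op_bounded_ops D g_hol ball_subset_slit_domain[OF r(1)] nZ[unfolded Z_def]]
    by (simp add: Z_def)
qed

text \<open>Condition (iii) asks for \<open>B > 0\<close>, but \<open>ones_op\<close> is only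
  positive semidefinite. Hence the direction \<open>ones_op + \<delta> proj_op\<close>: the
  derivative is linear in the direction, and \<open>\<delta>\<close> tends to 0. The radius
  \<open>r / 8\<close> comes from the bound \<open>r / 4\<close> on \<open>W\<close>, half of which
  goes to the imaginary part.\<close>

theorem matrix_imp_loewner:
  assumes iii: "\<And>n A B. n \<ge> 1 \<Longrightarrow> A \<in> herm_mats_in n S \<Longrightarrow> B \<in> herm_mats n \<Longrightarrow> mat_pos B \<Longrightarrow>
      mat_psd (mat_Im (mat_hol_calc D g (A + \<i> \<cdot>\<^sub>m B)))"
    and inf: "\<And>n. \<exists>e :: nat \<Rightarrow> 'h::chilbert_space. ortho e n"
    and r: "{c - r<..<c + r} \<subseteq> S" "r > 0"
  shows "loewner_at c (r / 8)"
  unfolding loewner_at_def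
proof (intro allI impI)
  fix n and y :: "nat \<Rightarrow> real" and d :: "nat \<Rightarrow> complex"
  assume y: "\<forall>k<n. \<bar>y k\<bar> < r / 8"
  let ?a = "taylor_coeff g (of_real c)"
  show "\<exists>s. (\<lambda>m. ?a (Suc m) * (\<Sum>j\<le>m. (\<Sum>i<n. d i * of_real (y i) ^ j) *
        cnj (\<Sum>i<n. d i * of_real (y i) ^ (m - j)))) sums s \<and> 0 \<le> Re s"
  proof (cases "n = 0")
    \<comment> \<open>The matrix condition starts at \<open>n = 1\<close>; the empty form is
      0.\<close>
    case True
    then show ?thesis by (intro exI[of _ 0]) simp
  next
    case False
    then have n: "n \<ge> 1" by simp
    obtain e :: "nat \<Rightarrow> 'h" where e: "ortho e n" using inf by blast
    define v where "v = Matrix.vec n (\<lambda>k. cnj (d k))"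
    have v: "v \<in> carrier_vec n" by (simp add: v_def)
    define \<eta> where "\<eta> = lin e v"
    have \<eta>: "\<eta> = (\<Sum>k<n. scaleC (cnj (d k)) (e k))" by (simp add: \<eta>_def lin_def v_def)
    let ?T = "diag_op e n y" and ?C = "ones_op e n" and ?P = "proj_op e n"
    have gb: "g holomorphic_on ball (of_real c) r"
      by (rule holomorphic_on_subset[OF g_hol ball_subset_slit_domain[OF r(1)]])
    have nT: "norm ?T \<le> r / 8" by (rule diag_op_norm[OF e]) (use y r in \<open>auto simp: less_imp_le\<close>)
    define s where "s = r / 2"
    have s: "norm ?T < s" "s < r" "0 \<le> s" using nT r by (auto simp: s_def)
    have sm: "summable (\<lambda>m. cmod (?a m) * s ^ m)" by (rule taylor_summable[OF gb s(3,2)])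
    have TB: "?T \<in> bounded_ops" "?C \<in> bounded_ops" "?P \<in> bounded_ops" by (auto simp: diag_op_def ones_op_def)
    let ?D = "\<lambda>C m. \<Sum>j<m. cinner (blinfun_apply (op_pow ?T j) (blinfun_apply C (blinfun_apply (op_pow ?T (m - 1 - j)) \<eta>))) \<eta>"
    obtain d1 where "((\<lambda>z. cinner (blinfun_apply (op_ps ?a (?T + op_scaleC z ?C)) \<eta>) \<eta>) has_field_derivative d1) (at 0)"
      and d1: "(\<lambda>m. ?a m * ?D ?C m) sums d1"
      using op_ps_line_derivative[OF TB(1,2) sm s(1)] by blast
    obtain d2 where "((\<lambda>z. cinner (blinfun_apply (op_ps ?a (?T + op_scaleC z ?P)) \<eta>) \<eta>) has_field_derivative d2) (at 0)"
      and d2: "(\<lambda>m. ?a m * ?D ?P m) sums d2"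
      using op_ps_line_derivative[OF TB(1,3) sm s(1)] by blast
    have nonneg: "0 \<le> Re d1 + \<delta> * Re d2" if \<delta>: "\<delta> > 0" for \<delta>
    proof -
      define C where "C = ?C + \<delta> *\<^sub>R ?P"
      have CB: "C \<in> bounded_ops" using TB by (simp add: C_def)
      let ?h = "\<lambda>z. cinner (blinfun_apply (op_ps ?a (?T + op_scaleC z C)) \<eta>) \<eta>"
      obtain d3 where d3: "(?h has_field_derivative d3) (at 0)" "(\<lambda>m. ?a m * ?D C m) sums d3"
        using op_ps_line_derivative[OF TB(1) CB sm s(1)] by blast
      have "?D C m = ?D ?C m + of_real \<delta> * ?D ?P m" for m
        by (simp add: C_def blinfun_simps cinner_simps sum.distrib sum_distrib_left)
      then have "(\<lambda>m. ?a m * ?D C m) = (\<lambda>m. ?a m * ?D ?C m + of_real \<delta> * (?a m * ?D ?P m))"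
        by (simp add: fun_eq_iff distrib_left mult.left_commute)
      then have "d3 = d1 + of_real \<delta> * d2"
        using sums_unique2[OF d3(2)] sums_add[OF d1 sums_mult[OF d2, of "of_real \<delta>"]] by simp
      moreover have "0 \<le> Re d3"
      proof (rule Re_derivative_nonneg_of_Im_nonneg[OF d3(1)])
        have cS: "c \<in> S" using r by auto
        have "Im (?a m * cinner (blinfun_apply (op_pow ?T m) \<eta>) \<eta>) = 0" for m
        proof -
          have "op_selfadjoint (op_pow ?T m)"
            by (rule op_selfadjointI[OF op_pow_bounded_ops[OF TB(1)] op_pow_selfadjoint[OF diag_op_selfadjoint]])
          then show ?thesis using g_taylor_Reals[OF cS, of m] by (simp add: op_selfadjoint_iff complex_is_Real_iff)
        qed
        with sums_Im[OF op_ps_cinner_sums[OF sm less_imp_le[OF s(1)], of \<eta> \<eta>]]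
        have "Im (cinner (blinfun_apply (op_ps ?a ?T) \<eta>) \<eta>) = 0" by (simp add: sums_iff)
        then show "Im (?h 0) = 0" by (simp add: bounded_bilinear.zero_left[OF bounded_bilinear_op_scaleC])
        define q where "q = norm C + 1"
        have q: "q > 0" by (simp add: q_def add_nonneg_pos)
        show "r / 8 / q > 0" using q r by simp
        fix t :: real assume t: "0 < t" "t < r / 8 / q"
        have "t * norm C \<le> r / 8 / q * q" using t by (intro mult_mono) (auto simp: q_def)
        then have tC: "t * norm C \<le> r / 8" using q by simp
        have "norm (?T + op_scaleC (\<i> * of_real t) C) \<le> norm ?T + t * norm C"
          using norm_triangle_ineq[of ?T "op_scaleC (\<i> * of_real t) C"] norm_op_scaleC[of "\<i> * of_real t" C] t
          unfolding norm_mult norm_of_real norm_ii by simp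
        then have "norm (?T + op_scaleC (\<i> * of_real t) C) \<le> r / 4" using nT tC by linarith
        then show "0 \<le> Im (?h (\<i> * of_real t))"
          unfolding C_def \<eta>_def
          by (intro matrix_imp_loewner_step[OF iii e n r _ \<delta> t(1) v]) (use y in auto)
      qed
      ultimately show ?thesis by simp
    qed
    have "((\<lambda>\<delta>. Re d1 + \<delta> * Re d2) \<longlongrightarrow> Re d1 + 0 * Re d2) (at_right 0)" by (intro tendsto_intros)
    moreover have "\<forall>\<^sub>F \<delta> in at_right (0::real). 0 \<le> Re d1 + \<delta> * Re d2"
      using eventually_at_right_less[of "0::real"] by eventually_elim (rule nonneg)
    ultimately have "0 \<le> Re d1 + 0 * Re d2" by (rule tendsto_lowerbound) simp
    then have "0 \<le> Re d1" by simp
    moreover have "(\<lambda>m. ?a (Suc m) * (\<Sum>j\<le>m. (\<Sum>i<n. d i * of_real (y i) ^ j) * cnj (\<Sum>i<n. d i * of_real (y i) ^ (m - j)))) sums d1"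
    proof -
      define q where "q m = ?a m * (\<Sum>j<m. (\<Sum>i<n. d i * of_real (y i) ^ j) * cnj (\<Sum>i<n. d i * of_real (y i) ^ (m - 1 - j)))" for m
      have "q sums d1" using d1 unfolding diag_ones_form[OF e \<eta>] q_def .
      moreover have "q 0 = 0" by (simp add: q_def)
      ultimately have "(\<lambda>m. q (Suc m)) sums d1" by (simp only: sums_Suc_iff add_0_right)
      then show ?thesis by (simp only: q_def lessThan_Suc_atMost diff_Suc_1)
    qed
    ultimately show ?thesis by blast
  qed
qed

text \<open>If \<open>Im F\<close> vanished somewhere, the image of the half-plane could not be open
  at that value, so \<open>F\<close> would be constant; the boundary values along vertical lines
  would then make \<open>f\<close> constant as well.\<close>

lemma pick_strict:
  assumes pick: "\<And>z. 0 < Im z \<Longrightarrow> 0 \<le> Im (F z)" and nc: "\<not> f constant_on S" and z: "0 < Im z"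
  shows "0 < Im (F z)"
proof (rule ccontr)
  assume "\<not> ?thesis"
  then have z0: "Im (F z) = 0" using pick[OF z] by simp
  have up: "upper_half_plane = {z. Im z > 0}" by (simp add: upper_half_plane_def)
  have op: "open upper_half_plane" unfolding up by (rule open_halfspace_Im_gt)
  have co: "connected upper_half_plane" unfolding up by (intro convex_connected convex_halfspace_Im_gt)
  have "F constant_on upper_half_plane"
  proof (rule ccontr)
    assume "\<not> ?thesis"
    then have "open (F ` upper_half_plane)"
      by (intro open_mapping_thm[OF analytic_imp_holomorphic[OF F_hol] op co op]) auto
    moreover have "F z \<in> F ` upper_half_plane" using z by (simp add: up)
    ultimately obtain e where e: "e > 0" "ball (F z) e \<subseteq> F ` upper_half_plane" by (meson openE)
    have "F z - \<i> * of_real (e / 2) \<in> ball (F z) e" using e(1) by (simp add: dist_norm norm_mult)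
    then obtain w where "w \<in> upper_half_plane" "F w = F z - \<i> * of_real (e / 2)" using e(2) by (metis imageE subsetD)
    then have "Im (F w) = - (e / 2)" "0 < Im w" using z0 by (simp_all add: up)
    then show False using pick[of w] e(1) by simp
  qed
  then obtain k where k: "\<And>w. 0 < Im w \<Longrightarrow> F w = k" unfolding constant_on_def up by auto
  have "f x = Re k" if x: "x \<in> S" for x
  proof -
    let ?U = "upper_half_plane \<union> complex_of_real ` S"
    have "(F \<longlongrightarrow> F (of_real x)) (at (of_real x) within ?U)"
      using F_cont x unfolding continuous_on_def by blast
    moreover have "filterlim (\<lambda>t. of_real x + \<i> * complex_of_real t) (at (of_real x) within ?U) (at_right 0)"
      unfolding filterlim_at
    proof
      have ev: "\<forall>\<^sub>F t in at_right (0::real). 0 < t" by (rule eventually_at_right_less)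
      show "\<forall>\<^sub>F t in at_right 0. of_real x + \<i> * complex_of_real t \<in> ?U \<and> of_real x + \<i> * complex_of_real t \<noteq> of_real x"
        using ev by eventually_elim (auto simp: up)
      have "((\<lambda>t. of_real x + \<i> * complex_of_real t) \<longlongrightarrow> of_real x + \<i> * of_real 0) (at_right 0)" by (intro tendsto_intros)
      then show "((\<lambda>t. of_real x + \<i> * complex_of_real t) \<longlongrightarrow> of_real x) (at_right 0)" by simp
    qed
    ultimately have "((\<lambda>t. F (of_real x + \<i> * complex_of_real t)) \<longlongrightarrow> F (of_real x)) (at_right 0)" by (rule filterlim_compose)
    moreover have "((\<lambda>t. F (of_real x + \<i> * complex_of_real t)) \<longlongrightarrow> k) (at_right 0)"
    proof (rule tendsto_eventually)
      show "\<forall>\<^sub>F t in at_right 0. F (of_real x + \<i> * complex_of_real t) = k"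
        using eventually_at_right_less[of "0::real"] by eventually_elim (simp add: k)
    qed
    ultimately have "F (of_real x) = k" by (intro tendsto_unique[of "at_right (0::real)"]) auto
    then show ?thesis using F_eq[OF x] by (metis Re_complex_of_real)
  qed
  then show False using nc unfolding constant_on_def by blast
qed

end

section \<open>The equivalence\<close>

theorem theorem4p2:
  fixes a b :: ereal
    and f :: "real \<Rightarrow> real"
    and F :: "complex \<Rightarrow> complex"
  assumes H: "separable_infinite_dim TYPE('h::chilbert_space)"
    and ab: "a < b"
    and f_cont: "continuous_on (einterval a b) f"
    and F_cont: "continuous_on (upper_half_plane \<union> complex_of_real ` einterval a b) F"
    and F_hol: "F analytic_on upper_half_plane"
    and F_eq: "\<And>x. x \<in> einterval a b \<Longrightarrow> F (complex_of_real x) = complex_of_real (f x)"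
  defines "fX \<equiv> op_hol_calc (slit_domain (einterval a b)) (reflect_ext F) ::
                   ('h \<Rightarrow>\<^sub>L 'h) \<Rightarrow> ('h \<Rightarrow>\<^sub>L 'h)"
    and "fM \<equiv> mat_hol_calc (slit_domain (einterval a b)) (reflect_ext F)"
  defines "cond_i \<equiv> op_monotone_on TYPE('h) (einterval a b) f"
    and "cond_ii \<equiv> (\<forall>X\<in>bounded_ops. op_pos (op_Im X) \<longrightarrow> op_psd (op_Im (fX X)))"
    and "cond_iii \<equiv> (\<forall>n\<ge>1. \<forall>A\<in>herm_mats_in n (einterval a b). \<forall>B\<in>herm_mats n.
                       mat_pos B \<longrightarrow> mat_psd (mat_Im (fM (A + \<i> \<cdot>\<^sub>m B))))"
    and "cond_iv \<equiv> (\<forall>z. 0 < Im z \<longrightarrow> 0 \<le> Im (F z))"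
  shows "((cond_i \<longleftrightarrow> cond_ii) \<and> (cond_i \<longleftrightarrow> cond_iii) \<and> (cond_i \<longleftrightarrow> cond_iv)) \<and>
         (\<not> f constant_on einterval a b \<and> op_monotone_on TYPE('h) (einterval a b) f \<longrightarrow>
            (\<forall>X\<in>bounded_ops. op_pos (op_Im X) \<longrightarrow> op_pos (op_Im (fX X))))"
proof -
  let ?S = "einterval a b"
  obtain c where c: "c \<in> ?S" using einterval_nonempty[OF ab] by blast
  have "is_interval ?S"
    unfolding is_interval_1
  proof (intro ballI allI impI)
    fix u v x assume "u \<in> ?S" "v \<in> ?S" "u \<le> x \<and> x \<le> v"
    then have x: "a < ereal u" "ereal u \<le> ereal x" "ereal x \<le> ereal v" "ereal v < b" by (simp_all add: einterval_iff)
    show "x \<in> ?S" unfolding einterval_iff using less_le_trans[OF x(1,2)] le_less_trans[OF x(3,4)] by blast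
  qed
  then interpret half_plane_continuation ?S f F
    using c F_cont F_hol F_eq by unfold_locales (auto simp: open_einterval)
  have inf: "\<exists>e :: nat \<Rightarrow> 'h. ortho e n" for n
    using H ortho_ex unfolding separable_infinite_dim_def by blast
  have nt: "\<exists>x::'h. x \<noteq> 0"
  proof -
    obtain e :: "nat \<Rightarrow> 'h" where "ortho e 1" using inf by blast
    then have "cinner (e 0) (e 0) = 1" by (simp add: ortho_def)
    then show ?thesis by (intro exI[of _ "e 0"]) auto
  qed
  \<comment> \<open>One interval about a single point \<open>c\<close> suffices for the implications
    from (i) and from (iii) to (iv).\<close>
  obtain r where r: "r > 0" "ball c r \<subseteq> ?S" using c open_einterval by (meson openE)
  have r': "{c - r<..<c + r} \<subseteq> ?S" using r(2) by (auto simp: subset_iff dist_real_def abs_less_iff)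
  have i_iv: "cond_iv" if cond_i
    unfolding cond_iv_def
    using loewner_imp_pick[OF r' r(1) _ op_monotone_imp_loewner[OF that[unfolded cond_i_def] inf r' r(1)]] r(1) by simp
  have iii_iv: "cond_iv" if iii: cond_iii
  proof -
    have L: "loewner_at c (r / 8)"
      by (rule matrix_imp_loewner[OF _ inf r' r(1)]) (use iii in \<open>auto simp: cond_iii_def fM_def\<close>)
    show ?thesis unfolding cond_iv_def using loewner_imp_pick[OF r' r(1) _ L] r(1) by simp
  qed
  have ii_iv: "cond_iv" if ii: cond_ii
    unfolding cond_iv_def using op_psd_imp_pick[OF _ nt] ii unfolding cond_ii_def fX_def by blast
  have iv_i: "cond_i" if cond_iv
    unfolding cond_i_def using pick_imp_op_monotone[OF _ nt] that unfolding cond_iv_def by blast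
  have iv_ii: "cond_ii" if iv: cond_iv
    unfolding cond_ii_def fX_def
  proof (intro ballI impI)
    fix X :: "'h \<Rightarrow>\<^sub>L 'h" assume X: "X \<in> bounded_ops" "op_pos (op_Im X)"
    have "0 \<le> Im (cinner (blinfun_apply (op_hol_calc D g X) x) x)" for x
      by (rule pick_imp_op_Im_bound[OF _ X]) (use iv in \<open>auto simp: cond_iv_def\<close>)
    then show "op_psd (op_Im (op_hol_calc D g X))"
      using op_psd_op_Im_iff[OF calc_upper_bounded_ops[OF X]] by blast
  qed
  have iv_iii: "cond_iii" if iv: cond_iv
    unfolding cond_iii_def fM_def
  proof (intro allI impI ballI)
    fix n A B assume n: "1 \<le> (n::nat)" and A: "A \<in> herm_mats_in n ?S" and B: "B \<in> herm_mats n" "mat_pos B"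
    show "mat_psd (mat_Im (mat_hol_calc D g (A + \<i> \<cdot>\<^sub>m B)))"
      by (rule pick_imp_matrix[OF _ inf n _ B]) (use iv A in \<open>auto simp: cond_iv_def herm_mats_in_def\<close>)
  qed
  have "op_pos (op_Im (fX X))"
    if nc: "\<not> f constant_on ?S" and mono: "op_monotone_on TYPE('h) ?S f" and X: "X \<in> bounded_ops" "op_pos (op_Im X)" for X
  proof -
    have pick: "0 \<le> Im (F z)" if "0 < Im z" for z using i_iv mono that unfolding cond_i_def cond_iv_def by blast
    have strict: "0 < Im (F z)" if "0 < Im z" for z by (rule pick_strict[OF pick nc that])
    have "\<exists>d>0. \<forall>x. d * (norm x)\<^sup>2 \<le> Im (cinner (blinfun_apply (op_hol_calc D g X) x) x)"
      using pick_imp_op_Im_bound[OF pick X] strict by blast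
    then show ?thesis unfolding fX_def using op_pos_op_Im_iff[OF calc_upper_bounded_ops[OF X]] by blast
  qed
  then show ?thesis using i_iv iii_iv ii_iv iv_i iv_ii iv_iii by blast
qed

end
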